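(* Let $Y$ be an affine $\mathrm{GL}$-variety, let $\lambda$ be a non-empty partition, and let $X$ be a closed $\mathrm{GL}$-subvariety of $Y\times\mathbf{A}^{\lambda}$. Then one of the following two cases holds: (a) There exists a closed $\mathrm{GL}$-subvariety $Y_0\subset Y$ such that $X=Y_0\times\mathbf{A}^{\lambda}$. (b) There exist an integer $n\ge 0$ and, writing $\underline{\mu}=\mathrm{sh}_{n,0}(\lambda)$, a $\mathrm{GL}$-invariant function $h$ on $\mathrm{Sh}_n(Y)\times\mathbf{A}^{\underline{\mu}}$ that does not vanish identically on $\mathrm{Sh}_n(X)$, such that the projection map $\pi\colon \mathrm{Sh}_n(Y\times\mathbf{A}^{\lambda})=\mathrm{Sh}_n(Y)\times\mathbf{A}^{\lambda}\times\mathbf{A}^{\underline{\mu}}\to\mathrm{Sh}_n(Y)\times\mathbf{A}^{\underline{\mu}}$ restricts to a closed immersion $$\pi\colon \mathrm{Sh}_n(X)[1/h]\to(\mathrm{Sh}_n(Y)\times\mathbf{A}^{\underline{\mu}})[1/h].$$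
   Context: Fix a field $K$ of characteristic $0$. $\mathrm{GL}=\bigcup_{n\ge1}\mathrm{GL}_n(K)$ is the infinite general linear group (a discrete group) and $\mathbf{V}=\bigcup_{n\ge1}K^n$ its standard representation. A polynomial representation of $\mathrm{GL}$ is a subquotient of a (possibly infinite) direct sum of tensor powers of $\mathbf{V}$. For a partition $\lambda$, $\mathbf{V}_\lambda=\mathbf{S}_\lambda(\mathbf{V})$ with $\mathbf{S}_\lambda$ the Schur functor; it is irreducible, and every polynomial representation is a direct sum of such. A tuple is a finite tuple $\underline{\lambda}=[\lambda_1,\dots,\lambda_r]$ of partitions; $\mathbf{V}_{\underline{\lambda}}=\bigoplus_i\mathbf{V}_{\lambda_i}$ and $\mathbf{A}^{\underline{\lambda}}=\mathrm{Spec}(\mathrm{Sym}(\mathbf{V}_{\underline{\lambda}}))$; write $\mathbf{A}^{\lambda}$ for $\mathbf{A}^{[\lambda]}$. A $\mathrm{GL}$-algebra is a (commutative) $K$-algebra with an action of $\mathrm{GL}$ by algebra automorphisms that is a polynomial representation; it is finitely $\mathrm{GL}$-generated if it is generated as a $K$-algebra by the $\mathrm{GL}$-orbits of finitely many elements. An affine $\mathrm{GL}$-variety is a reduced affine scheme $X$ with $\mathrm{GL}$-action such that $\Gamma(X,\mathcal{O}_X)$ is a finitely $\mathrm{GL}$-generated $\mathrm{GL}$-algebra. Equivalently, it is a closed $\mathrm{GL}$-stable reduced subscheme of some $\mathbf{A}^{\underline{\lambda}}$. Morphisms are $\mathrm{GL}$-equivariant. Shift: $\mathrm{Sh}_n(\mathbf{V}_\lambda)=\mathbf{S}_\lambda(K^n\oplus\mathbf{V})$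 with $\mathrm{GL}$ acting trivially on $K^n$; this extends additively to a tensor functor $\mathrm{Sh}_n$ on polynomial representations, hence to $\mathrm{GL}$-algebras, and $\mathrm{Sh}_n(\mathrm{Spec}\,R)=\mathrm{Spec}(\mathrm{Sh}_n(R))$. $\mathrm{Sh}_n$ commutes with products of affine $\mathrm{GL}$-schemes. One has $\mathrm{Sh}_n(\mathbf{A}^{\lambda})\cong\mathbf{A}^{\lambda}\times\mathbf{A}^{\mathrm{sh}_{n,0}(\lambda)}$ for a tuple $\mathrm{sh}_{n,0}(\lambda)$ all of whose partitions have size strictly smaller than that of $\lambda$; explicitly $\mathbf{S}_\lambda(K^n\oplus\mathbf{V})\cong\mathbf{V}_\lambda\oplus\mathbf{V}_{\mathrm{sh}_{n,0}(\lambda)}$. $Z[1/h]$ denotes the open locus $h\ne0$ in $Z$; the function $h$ in (b) is regarded as a function on $\mathrm{Sh}_n(Y\times\mathbf{A}^\lambda)$, and on its closed subvariety $\mathrm{Sh}_n(X)$, by pullback along $\pi$. *)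

theory Defs
  imports
    "HOL-Algebra.QuotRing"
    "HOL-Algebra.Generated_Rings"
    "HOL-Algebra.Module"
    "HOL-Combinatorics.Permutations"
    "HOL-Library.Poly_Mapping"
begin

text \<open>
  Affine schemes over the field are represented contravariantly by their coordinate rings: a closed
  subscheme is an ideal, a product is a tensor product, a principal open subset is a localization,
  and a morphism \<open>Spec S \<rightarrow> Spec R\<close> is a ring homomorphism \<open>R \<rightarrow> S\<close>.  The ground field of
  characteristic 0 is a type \<open>'k\<close> of class \<^class>\<open>field_char_0\<close>.
\<close>

section \<open>The infinite general linear group\<close>

type_synonym 'k mat = "nat \<Rightarrow> nat \<Rightarrow> 'k"

definition mat_one :: "'k::field_char_0 mat" where
  "mat_one i j = (if i = j then 1 else 0)"

text \<open>The sum is finite for the matrices in question, whose rows have finite support.\<close>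

definition mat_mult :: "'k::field_char_0 mat \<Rightarrow> 'k mat \<Rightarrow> 'k mat" where
  "mat_mult g h i j = (\<Sum>k | g i k \<noteq> 0. g i k * h k j)"

definition mat_block :: "nat \<Rightarrow> 'k::field_char_0 mat set" where
  "mat_block n = {g. \<forall>i j. n \<le> i \<or> n \<le> j \<longrightarrow> g i j = mat_one i j}"

text \<open>\<open>GL\<^sub>n(K)\<close>, embedded in the upper left corner.\<close>

definition GLn :: "nat \<Rightarrow> 'k::field_char_0 mat set" where
  "GLn n = {g \<in> mat_block n.
     \<exists>h \<in> mat_block n. mat_mult g h = mat_one \<and> mat_mult h g = mat_one}"

definition GL :: "'k::field_char_0 mat set" where
  "GL = (\<Union>n\<in>{1..}. GLn n)"


section \<open>Representations of GL and GL-algebras\<close>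

text \<open>
  As in the library's \<^const>\<open>module\<close>, one record type serves for vector spaces and for algebras;
  for a bare representation the fields \<open>mult\<close> and \<open>one\<close> carry no meaning.
\<close>

record ('k, 'a) gl_module = "('k, 'a) module" +
  act :: "'k mat \<Rightarrow> 'a \<Rightarrow> 'a"

definition KK :: "'k::field_char_0 ring" where
  "KK = \<lparr>carrier = UNIV, monoid.mult = (*), one = 1, ring.zero = 0, add = (+)\<rparr>"

definition gl_rep :: "('k::field_char_0, 'a) gl_module \<Rightarrow> bool" where
  "gl_rep M \<longleftrightarrow> module KK M \<and>
     (\<forall>g\<in>GL. \<forall>x\<in>carrier M. act M g x \<in> carrier M) \<and>
     (\<forall>g\<in>GL. \<forall>x\<in>carrier M. \<forall>y\<in>carrier M.
        act M g (x \<oplus>\<^bsub>M\<^esub> y) = act M g x \<oplus>\<^bsub>M\<^esub> act M g y) \<and>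
     (\<forall>g\<in>GL. \<forall>c. \<forall>x\<in>carrier M. act M g (c \<odot>\<^bsub>M\<^esub> x) = c \<odot>\<^bsub>M\<^esub> act M g x) \<and>
     (\<forall>x\<in>carrier M. act M mat_one x = x) \<and>
     (\<forall>g\<in>GL. \<forall>h\<in>GL. \<forall>x\<in>carrier M. act M (mat_mult g h) x = act M g (act M h x))"

definition gl_hom :: "('k::field_char_0, 'a) gl_module \<Rightarrow> ('k, 'b) gl_module \<Rightarrow> ('a \<Rightarrow> 'b) set" where
  "gl_hom M N = {f. f \<in> carrier M \<rightarrow> carrier N \<and>
     (\<forall>x\<in>carrier M. \<forall>y\<in>carrier M. f (x \<oplus>\<^bsub>M\<^esub> y) = f x \<oplus>\<^bsub>N\<^esub> f y) \<and>
     (\<forall>c. \<forall>x\<in>carrier M. f (c \<odot>\<^bsub>M\<^esub> x) = c \<odot>\<^bsub>N\<^esub> f x) \<and>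
     (\<forall>g\<in>GL. \<forall>x\<in>carrier M. f (act M g x) = act N g (f x))}"

definition gl_iso :: "('k::field_char_0, 'a) gl_module \<Rightarrow> ('k, 'b) gl_module \<Rightarrow> ('a \<Rightarrow> 'b) set" where
  "gl_iso M N = {f \<in> gl_hom M N. bij_betw f (carrier M) (carrier N)}"

definition gl_stable :: "('k::field_char_0, 'a) gl_module \<Rightarrow> 'a set \<Rightarrow> bool" where
  "gl_stable M N \<longleftrightarrow> (\<forall>g\<in>GL. \<forall>x\<in>N. act M g x \<in> N)"

definition gl_dsum :: "'i set \<Rightarrow> ('i \<Rightarrow> ('k::field_char_0, 'a) gl_module) \<Rightarrow> ('k, 'i \<Rightarrow> 'a) gl_module" where
  "gl_dsum I M = \<lparr>
     carrier = {f. (\<forall>i\<in>I. f i \<in> carrier (M i)) \<and> (\<forall>i. i \<notin> I \<longrightarrow> f i = \<zero>\<^bsub>M i\<^esub>) \<and>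
                   finite {i\<in>I. f i \<noteq> \<zero>\<^bsub>M i\<^esub>}},
     monoid.mult = undefined, one = undefined,
     ring.zero = (\<lambda>i. \<zero>\<^bsub>M i\<^esub>),
     add = (\<lambda>x y i. x i \<oplus>\<^bsub>M i\<^esub> y i),
     module.smult = (\<lambda>c x i. c \<odot>\<^bsub>M i\<^esub> x i),
     act = (\<lambda>g x i. act (M i) g (x i))\<rparr>"


section \<open>Tensor powers and Schur functors\<close>

text \<open>
  \<open>push f\<close> is the linear map between free modules that extends the map \<open>f\<close> of bases.
\<close>

definition push :: "('x \<Rightarrow> 'y) \<Rightarrow> ('x \<Rightarrow>\<^sub>0 'c::comm_monoid_add) \<Rightarrow> ('y \<Rightarrow>\<^sub>0 'c)" where
  "push f t = (\<Sum>x\<in>Poly_Mapping.keys t. Poly_Mapping.single (f x) (Poly_Mapping.lookup t x))"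

definition scale :: "'k::field_char_0 \<Rightarrow> ('x \<Rightarrow>\<^sub>0 'k) \<Rightarrow> ('x \<Rightarrow>\<^sub>0 'k)" where
  "scale c t = Poly_Mapping.map ((*) c) t"

text \<open>
  Let \<open>W\<close> be a representation with basis \<open>(e\<^sub>i)\<close>, \<open>i \<in> I\<close>, on which \<open>g\<close> acts through the matrix
  \<open>\<rho> g\<close>, that is, \<open>g e\<^sub>j = \<Sum>\<^sub>i \<rho> g i j e\<^sub>i\<close>.  The basis of the \<open>d\<close>-th tensor power is
  indexed by the words of length \<open>d\<close> over \<open>I\<close>, and \<open>tensor_coeff (\<rho> g) v w\<close> is the coefficient
  of \<open>e\<^sub>v\<close> in \<open>g e\<^sub>w\<close>.
\<close>

definition tensor_coeff :: "('i \<Rightarrow> 'i \<Rightarrow> 'k::field_char_0) \<Rightarrow> 'i list \<Rightarrow> 'i list \<Rightarrow> 'k" where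
  "tensor_coeff m v w =
     (if length v = length w then \<Prod>k<length w. m (v ! k) (w ! k) else 0)"

definition tensor_act ::
    "('i \<Rightarrow> 'i \<Rightarrow> 'k::field_char_0) \<Rightarrow> ('i list \<Rightarrow>\<^sub>0 'k) \<Rightarrow> ('i list \<Rightarrow>\<^sub>0 'k)" where
  "tensor_act m t = Abs_poly_mapping
     (\<lambda>v. \<Sum>w\<in>Poly_Mapping.keys t. tensor_coeff m v w * Poly_Mapping.lookup t w)"

definition tensor_power ::
    "'i set \<Rightarrow> ('k mat \<Rightarrow> 'i \<Rightarrow> 'i \<Rightarrow> 'k::field_char_0) \<Rightarrow> nat \<Rightarrow> ('k, 'i list \<Rightarrow>\<^sub>0 'k) gl_module" where
  "tensor_power I \<rho> d = \<lparr>
     carrier = {t. \<forall>w\<in>Poly_Mapping.keys t. length w = d \<and> set w \<subseteq> I},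
     monoid.mult = undefined, one = undefined, ring.zero = 0, add = (+), module.smult = scale,
     act = (\<lambda>g. tensor_act (\<rho> g))\<rparr>"

definition partition :: "nat list \<Rightarrow> bool" where
  "partition lam \<longleftrightarrow> sorted_wrt (\<ge>) lam \<and> 0 \<notin> set lam"

definition cells :: "nat list \<Rightarrow> (nat \<times> nat) list" where
  "cells lam = concat (map (\<lambda>i. map (Pair i) [0..<lam ! i]) [0..<length lam])"

text \<open>
  The row and column groups of the tableau whose boxes are numbered row by row.
\<close>

definition row_group :: "nat list \<Rightarrow> (nat \<Rightarrow> nat) set" where
  "row_group lam = {p. p permutes {..<sum_list lam} \<and>
     (\<forall>k<sum_list lam. fst (cells lam ! p k) = fst (cells lam ! k))}"

definition col_group :: "nat list \<Rightarrow> (nat \<Rightarrow> nat) set" where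
  "col_group lam = {q. q permutes {..<sum_list lam} \<and>
     (\<forall>k<sum_list lam. snd (cells lam ! q k) = snd (cells lam ! k))}"

text \<open>
  The right action of the Young symmetrizer \<open>\<Sum>\<^sub>p \<Sum>\<^sub>q sgn(q) p q\<close>, permutations acting on
  tensors by place permutation.  The Schur functor is its image on the tensor power.
\<close>

definition young_symmetrizer ::
    "nat list \<Rightarrow> ('i list \<Rightarrow>\<^sub>0 'k::field_char_0) \<Rightarrow> ('i list \<Rightarrow>\<^sub>0 'k)" where
  "young_symmetrizer lam t = (\<Sum>p\<in>row_group lam. \<Sum>q\<in>col_group lam.
     scale (of_int (sign q)) (push (permute_list (p \<circ> q)) t))"

definition schur ::
    "'i set \<Rightarrow> ('k mat \<Rightarrow> 'i \<Rightarrow> 'i \<Rightarrow> 'k::field_char_0) \<Rightarrow> nat list \<Rightarrow> ('k, 'i list \<Rightarrow>\<^sub>0 'k) gl_module" where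
  "schur I \<rho> lam = (tensor_power I \<rho> (sum_list lam))
     \<lparr>carrier := young_symmetrizer lam ` carrier (tensor_power I \<rho> (sum_list lam))\<rparr>"

definition V_part :: "nat list \<Rightarrow> ('k::field_char_0, nat list \<Rightarrow>\<^sub>0 'k) gl_module" where
  "V_part lam = schur UNIV (\<lambda>g. g) lam"

definition V_tuple :: "nat list list \<Rightarrow> ('k::field_char_0, nat \<Rightarrow> nat list \<Rightarrow>\<^sub>0 'k) gl_module" where
  "V_tuple mu = gl_dsum {..<length mu} (\<lambda>i. V_part (mu ! i))"

text \<open>
  A polynomial representation is a subquotient of a direct sum of tensor powers of the standard
  representation, i.e. the image of a homomorphism \<open>\<theta>\<close> on a subrepresentation \<open>N\<close>.  Each element of \<open>M\<close>
  lifts to an element involving finitely many summands, so that allowing countably many summands for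
  each element of \<open>M\<close> (index type \<open>'a \<times> nat\<close>) is no restriction.
\<close>

definition polynomial_rep :: "('k::field_char_0, 'a) gl_module \<Rightarrow> bool" where
  "polynomial_rep M \<longleftrightarrow> gl_rep M \<and>
     (\<exists>(d :: 'a \<times> nat \<Rightarrow> nat) N \<theta>.
        let T = gl_dsum UNIV (\<lambda>i. tensor_power UNIV (\<lambda>g. g) (d i)) in
        submodule N KK T \<and> gl_stable T N \<and>
        \<theta> \<in> gl_hom (T\<lparr>carrier := N\<rparr>) M \<and> \<theta> ` N = carrier M)"


section \<open>Affine GL-varieties\<close>

definition gl_algebra :: "('k::field_char_0, 'a) gl_module \<Rightarrow> bool" where
  "gl_algebra A \<longleftrightarrow> algebra KK A \<and> polynomial_rep A \<and> (\<forall>g\<in>GL. act A g \<in> ring_hom A A)"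

definition gl_generated :: "('k::field_char_0, 'a) gl_module \<Rightarrow> 'a set \<Rightarrow> 'a set" where
  "gl_generated A S =
     generate_ring A ({c \<odot>\<^bsub>A\<^esub> \<one>\<^bsub>A\<^esub> |c. True} \<union> {act A g s |g s. g \<in> GL \<and> s \<in> S})"

definition finitely_gl_generated :: "('k::field_char_0, 'a) gl_module \<Rightarrow> bool" where
  "finitely_gl_generated A \<longleftrightarrow>
     (\<exists>S \<subseteq> carrier A. finite S \<and> gl_generated A S = carrier A)"

definition reduced :: "('a, 'm) ring_scheme \<Rightarrow> bool" where
  "reduced R \<longleftrightarrow> (\<forall>x\<in>carrier R. \<forall>n::nat. x [^]\<^bsub>R\<^esub> n = \<zero>\<^bsub>R\<^esub> \<longrightarrow> x = \<zero>\<^bsub>R\<^esub>)"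

definition affine_gl_variety :: "('k::field_char_0, 'a) gl_module \<Rightarrow> bool" where
  "affine_gl_variety A \<longleftrightarrow> gl_algebra A \<and> finitely_gl_generated A \<and> reduced A"

text \<open>The quotient by a GL-stable ideal: the library's quotient ring with the induced structure.\<close>

definition gl_quot :: "('k::field_char_0, 'a) gl_module \<Rightarrow> 'a set \<Rightarrow> ('k, 'a set) gl_module" where
  "gl_quot A I = \<lparr>
     carrier = carrier (A Quot I),
     monoid.mult = (\<otimes>\<^bsub>A Quot I\<^esub>), one = \<one>\<^bsub>A Quot I\<^esub>,
     ring.zero = \<zero>\<^bsub>A Quot I\<^esub>, add = (\<oplus>\<^bsub>A Quot I\<^esub>),
     module.smult = (\<lambda>c X. \<Union>x\<in>X. I +>\<^bsub>A\<^esub> (c \<odot>\<^bsub>A\<^esub> x)),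
     act = (\<lambda>g X. \<Union>x\<in>X. I +>\<^bsub>A\<^esub> act A g x)\<rparr>"

text \<open>The map that \<open>f\<close> induces from a quotient to \<open>gl_quot A I\<close>.\<close>

definition quot_map :: "('k::field_char_0, 'a) gl_module \<Rightarrow> 'a set \<Rightarrow> ('b \<Rightarrow> 'a) \<Rightarrow> 'b set \<Rightarrow> 'a set" where
  "quot_map A I f X = (\<Union>x\<in>X. I +>\<^bsub>A\<^esub> f x)"

text \<open>Closed GL-subvarieties of \<open>Spec A\<close>, given by their ideals.\<close>

definition closed_gl_subvariety :: "('k::field_char_0, 'a) gl_module \<Rightarrow> 'a set \<Rightarrow> bool" where
  "closed_gl_subvariety A I \<longleftrightarrow> ideal I A \<and> gl_stable A I \<and> reduced (gl_quot A I)"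


section \<open>Symmetric algebras\<close>

text \<open>
  The polynomial algebra with one variable for each vector of \<open>M\<close>; the symmetric algebra is
  its quotient by the linear relations.
\<close>

definition vec_var :: "'a \<Rightarrow> ('a \<Rightarrow>\<^sub>0 nat) \<Rightarrow>\<^sub>0 'k::field_char_0" where
  "vec_var x = Poly_Mapping.single (Poly_Mapping.single x 1) 1"

definition free_sym ::
    "('k::field_char_0, 'a) gl_module \<Rightarrow> ('k, ('a \<Rightarrow>\<^sub>0 nat) \<Rightarrow>\<^sub>0 'k) gl_module" where
  "free_sym M = \<lparr>
     carrier = {p. \<forall>m\<in>Poly_Mapping.keys p. Poly_Mapping.keys m \<subseteq> carrier M},
     monoid.mult = (*), one = 1, ring.zero = 0, add = (+), module.smult = scale,
     act = (\<lambda>g. push (push (act M g)))\<rparr>"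

definition sym_rels :: "('k::field_char_0, 'a) gl_module \<Rightarrow> (('a \<Rightarrow>\<^sub>0 nat) \<Rightarrow>\<^sub>0 'k) set" where
  "sym_rels M =
     {vec_var (x \<oplus>\<^bsub>M\<^esub> y) - vec_var x - vec_var y |x y. x \<in> carrier M \<and> y \<in> carrier M} \<union>
     {vec_var (c \<odot>\<^bsub>M\<^esub> x) - scale c (vec_var x) |c x. x \<in> carrier M}"

definition sym_ideal :: "('k::field_char_0, 'a) gl_module \<Rightarrow> (('a \<Rightarrow>\<^sub>0 nat) \<Rightarrow>\<^sub>0 'k) set" where
  "sym_ideal M = Idl\<^bsub>free_sym M\<^esub> (sym_rels M)"

definition Sym ::
    "('k::field_char_0, 'a) gl_module \<Rightarrow> ('k, (('a \<Rightarrow>\<^sub>0 nat) \<Rightarrow>\<^sub>0 'k) set) gl_module" where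
  "Sym M = gl_quot (free_sym M) (sym_ideal M)"

definition sym_map :: "('k::field_char_0, 'b) gl_module \<Rightarrow> ('a \<Rightarrow> 'b) \<Rightarrow>
    (('a \<Rightarrow>\<^sub>0 nat) \<Rightarrow>\<^sub>0 'k) set \<Rightarrow> (('b \<Rightarrow>\<^sub>0 nat) \<Rightarrow>\<^sub>0 'k) set" where
  "sym_map N f = quot_map (free_sym N) (sym_ideal N) (push (push f))"


section \<open>Tensor products\<close>

text \<open>
  \<open>A \<otimes> C\<close> is the quotient of the vector space with basis \<open>A \<times> C\<close>, made into a ring as the monoid
  algebra of the multiplicative monoid \<open>A \<times> C\<close>, by the bilinearity relations (whose linear span is
  an ideal).
\<close>

definition free_pairs :: "('k::field_char_0, 'a) gl_module \<Rightarrow> ('k, 'b) gl_module \<Rightarrow>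
    ('k, ('a \<times> 'b) \<Rightarrow>\<^sub>0 'k) gl_module" where
  "free_pairs A C = \<lparr>
     carrier = {t. Poly_Mapping.keys t \<subseteq> carrier A \<times> carrier C},
     monoid.mult = (\<lambda>s t. \<Sum>p\<in>Poly_Mapping.keys s. \<Sum>q\<in>Poly_Mapping.keys t.
        Poly_Mapping.single (fst p \<otimes>\<^bsub>A\<^esub> fst q, snd p \<otimes>\<^bsub>C\<^esub> snd q)
          (Poly_Mapping.lookup s p * Poly_Mapping.lookup t q)),
     one = Poly_Mapping.single (\<one>\<^bsub>A\<^esub>, \<one>\<^bsub>C\<^esub>) 1,
     ring.zero = 0, add = (+), module.smult = scale,
     act = (\<lambda>g. push (map_prod (act A g) (act C g)))\<rparr>"

definition pair_var :: "'a \<Rightarrow> 'b \<Rightarrow> ('a \<times> 'b) \<Rightarrow>\<^sub>0 'k::field_char_0" where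
  "pair_var a b = Poly_Mapping.single (a, b) 1"

definition bilinear_rels :: "('k::field_char_0, 'a) gl_module \<Rightarrow> ('k, 'b) gl_module \<Rightarrow>
    (('a \<times> 'b) \<Rightarrow>\<^sub>0 'k) set" where
  "bilinear_rels A C =
     {pair_var (x \<oplus>\<^bsub>A\<^esub> y) z - pair_var x z - pair_var y z |x y z.
        x \<in> carrier A \<and> y \<in> carrier A \<and> z \<in> carrier C} \<union>
     {pair_var x (y \<oplus>\<^bsub>C\<^esub> z) - pair_var x y - pair_var x z |x y z.
        x \<in> carrier A \<and> y \<in> carrier C \<and> z \<in> carrier C} \<union>
     {pair_var (c \<odot>\<^bsub>A\<^esub> x) z - scale c (pair_var x z) |c x z. x \<in> carrier A \<and> z \<in> carrier C} \<union>
     {pair_var x (c \<odot>\<^bsub>C\<^esub> z) - scale c (pair_var x z) |c x z. x \<in> carrier A \<and> z \<in> carrier C}"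

definition tensor_ideal :: "('k::field_char_0, 'a) gl_module \<Rightarrow> ('k, 'b) gl_module \<Rightarrow>
    (('a \<times> 'b) \<Rightarrow>\<^sub>0 'k) set" where
  "tensor_ideal A C = Idl\<^bsub>free_pairs A C\<^esub> (bilinear_rels A C)"

definition tensor :: "('k::field_char_0, 'a) gl_module \<Rightarrow> ('k, 'b) gl_module \<Rightarrow>
    ('k, (('a \<times> 'b) \<Rightarrow>\<^sub>0 'k) set) gl_module" where
  "tensor A C = gl_quot (free_pairs A C) (tensor_ideal A C)"

definition tensor_map :: "('k::field_char_0, 'c) gl_module \<Rightarrow> ('k, 'd) gl_module \<Rightarrow>
    ('a \<Rightarrow> 'c) \<Rightarrow> ('b \<Rightarrow> 'd) \<Rightarrow> (('a \<times> 'b) \<Rightarrow>\<^sub>0 'k) set \<Rightarrow> (('c \<times> 'd) \<Rightarrow>\<^sub>0 'k) set" where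
  "tensor_map A C f f' = quot_map (free_pairs A C) (tensor_ideal A C) (push (map_prod f f'))"

text \<open>The ideal of \<open>Y\<^sub>0 \<times> Spec C\<close> in \<open>Y \<times> Spec C\<close>, where \<open>Y = Spec A\<close> and \<open>I\<close> is the ideal of \<open>Y\<^sub>0\<close>.\<close>

definition product_ideal ::
    "('k::field_char_0, 'a) gl_module \<Rightarrow> ('k, 'b) gl_module \<Rightarrow> 'a set \<Rightarrow> (('a \<times> 'b) \<Rightarrow>\<^sub>0 'k) set set" where
  "product_ideal A C I = a_kernel (tensor A C) (tensor (gl_quot A I) C)
     (tensor_map (gl_quot A I) C (\<lambda>x. I +>\<^bsub>A\<^esub> x) (\<lambda>z. z))"


section \<open>The shift functor\<close>

text \<open>
  The space \<open>K\<^sup>n \<oplus> V\<close> is identified with \<open>V\<close> by letting \<open>K\<^sup>n\<close> be spanned by the first \<open>n\<close>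
  basis vectors and sending the \<open>j\<close>-th basis vector of \<open>V\<close> to the \<open>(n + j)\<close>-th.  Letting \<open>g\<close> act as the identity
  on \<open>K\<^sup>n\<close> and as usual on \<open>V\<close> means letting the block matrix \<open>diag(1\<^sub>n, g)\<close> act on \<open>V\<close>.
  Evaluating a polynomial functor at \<open>K\<^sup>n \<oplus> V\<close> thus amounts to restricting the action along
  \<open>g \<mapsto> diag(1\<^sub>n, g)\<close>, which is visibly additive and compatible with tensor products.  The lemma
  \<open>Sh_schur\<close> below checks the agreement with \<open>S\<^sub>\<lambda>(K\<^sup>n \<oplus> V)\<close>.
\<close>

definition shift_mat :: "nat \<Rightarrow> 'k::field_char_0 mat \<Rightarrow> 'k mat" where
  "shift_mat n g i j = (if i < n \<or> j < n then mat_one i j else g (i - n) (j - n))"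

definition Sh :: "nat \<Rightarrow> ('k::field_char_0, 'a) gl_module \<Rightarrow> ('k, 'a) gl_module" where
  "Sh n M = M\<lparr>act := (\<lambda>g. act M (shift_mat n g))\<rparr>"

lemma Sh_simps [simp]:
  "carrier (Sh n M) = carrier M" "monoid.mult (Sh n M) = monoid.mult M" "one (Sh n M) = one M"
  "ring.zero (Sh n M) = ring.zero M" "add (Sh n M) = add M" "module.smult (Sh n M) = module.smult M"
  "act (Sh n M) g = act M (shift_mat n g)"
  by (simp_all add: Sh_def)

lemma ideal_cong:
  fixes R :: "('a, 'm) ring_scheme" and S :: "('a, 'm) ring_scheme"
  assumes "carrier R = carrier S" "monoid.mult R = monoid.mult S" "one R = one S"
    "ring.zero R = ring.zero S" "add R = add S"
  shows "ideal I R = ideal I S"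
  using assms
  unfolding ideal_def additive_subgroup_def subgroup_def ideal_axioms_def ring_def ring_axioms_def
    abelian_group_def abelian_group_axioms_def abelian_monoid_def monoid_def
  by simp

lemma gl_quot_Sh:
  fixes A A' :: "('k::field_char_0, 'a) gl_module"
  assumes "A' = Sh n A"
  shows "gl_quot A' I = Sh n (gl_quot A I)"
  by (simp add: assms gl_quot_def Sh_def FactRing_def A_RCOSETS_def RCOSETS_def
      a_r_coset_def r_coset_def set_add_def set_mult_def rcoset_mult_def fun_eq_iff)

text \<open>\<open>Sh\<^sub>n\<close> commutes with symmetric algebras and with tensor products on the nose.\<close>

lemma Sh_Sym: "Sym (Sh n M) = Sh n (Sym M)"
proof -
  have 1: "free_sym (Sh n M) = Sh n (free_sym M)"
    by (simp add: free_sym_def Sh_def fun_eq_iff)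
  have 2: "sym_ideal (Sh n M) = sym_ideal M"
    unfolding sym_ideal_def genideal_def 1 sym_rels_def
    by (simp add: ideal_cong[of "Sh n (free_sym M)" "free_sym M"])
  show ?thesis
    unfolding Sym_def 2 by (rule gl_quot_Sh[OF 1])
qed

lemma Sh_tensor: "tensor (Sh n A) (Sh n C) = Sh n (tensor A C)"
proof -
  have 1: "free_pairs (Sh n A) (Sh n C) = Sh n (free_pairs A C)"
    by (simp add: free_pairs_def Sh_def fun_eq_iff)
  have 2: "tensor_ideal (Sh n A) (Sh n C) = tensor_ideal A C"
    unfolding tensor_ideal_def genideal_def 1 bilinear_rels_def
    by (simp add: ideal_cong[of "Sh n (free_pairs A C)" "free_pairs A C"])
  show ?thesis
    unfolding tensor_def 2 by (rule gl_quot_Sh[OF 1])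
qed

text \<open>
  The space \<open>K\<^sup>n \<oplus> V\<close> itself, with basis \<open>shift_basis n\<close>, the action of \<open>g\<close> on it, and the
  identification of its basis with that of \<open>V\<close>.
\<close>

definition block_mat :: "'k::field_char_0 mat \<Rightarrow> nat + nat \<Rightarrow> nat + nat \<Rightarrow> 'k" where
  "block_mat g i j = (case (i, j) of
      (Inl a, Inl b) \<Rightarrow> mat_one a b | (Inr a, Inr b) \<Rightarrow> g a b | _ \<Rightarrow> 0)"

definition shift_basis :: "nat \<Rightarrow> (nat + nat) set" where
  "shift_basis n = Inl ` {..<n} \<union> range Inr"

definition shift_index :: "nat \<Rightarrow> nat + nat \<Rightarrow> nat" where
  "shift_index n = case_sum (\<lambda>i. i) ((+) n)"

lemma lookup_scale: "Poly_Mapping.lookup (scale c t) x = c * Poly_Mapping.lookup t x"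
  unfolding scale_def by (simp add: Poly_Mapping.map.rep_eq when_def)

lemma lookup_push:
  "Poly_Mapping.lookup (push f t) y =
    (\<Sum>x\<in>Poly_Mapping.keys t. Poly_Mapping.lookup t x when f x = y)"
  by (simp add: push_def lookup_sum lookup_single)

lemma lookup_push_sup:
  assumes "finite S" "Poly_Mapping.keys t \<subseteq> S"
  shows "Poly_Mapping.lookup (push f t) y = (\<Sum>x\<in>S. Poly_Mapping.lookup t x when f x = y)"
  unfolding lookup_push
  by (rule sum.mono_neutral_left) (use assms in \<open>auto simp: when_def in_keys_iff\<close>)

lemma push_add: "push f (s + t) = push f s + push f t"
proof (rule poly_mapping_eqI)
  fix y
  let ?S = "Poly_Mapping.keys s \<union> Poly_Mapping.keys t"
  have S: "finite ?S" "Poly_Mapping.keys s \<subseteq> ?S" "Poly_Mapping.keys t \<subseteq> ?S"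
    "Poly_Mapping.keys (s + t) \<subseteq> ?S" by (auto simp: keys_add)
  show "Poly_Mapping.lookup (push f (s + t)) y = Poly_Mapping.lookup (push f s + push f t) y"
    unfolding lookup_add lookup_push_sup[OF S(1,2)] lookup_push_sup[OF S(1,3)] lookup_push_sup[OF S(1,4)]
    by (auto simp: lookup_add when_def simp flip: sum.distrib intro!: sum.cong)
qed

lemma push_zero [simp]: "push f 0 = 0"
  by (simp add: push_def)

lemma push_sum: "push f (\<Sum>i\<in>A. t i) = (\<Sum>i\<in>A. push f (t i))"
  by (induction A rule: infinite_finite_induct) (auto simp: push_add)

lemma keys_scale: "Poly_Mapping.keys (scale c t) \<subseteq> Poly_Mapping.keys t"
  by (auto simp: in_keys_iff lookup_scale)

lemma push_scale: "push f (scale c t) = scale c (push f t)"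
proof (rule poly_mapping_eqI)
  fix y
  have "Poly_Mapping.lookup (push f (scale c t)) y =
      (\<Sum>x\<in>Poly_Mapping.keys t. Poly_Mapping.lookup (scale c t) x when f x = y)"
    by (rule lookup_push_sup) (simp_all add: keys_scale)
  also have "\<dots> = Poly_Mapping.lookup (scale c (push f t)) y"
    by (simp add: lookup_scale lookup_push sum_distrib_left mult_when)
  finally show "Poly_Mapping.lookup (push f (scale c t)) y = \<dots>" .
qed

lemma push_single: "push f (Poly_Mapping.single x c) = Poly_Mapping.single (f x) c"
  by (simp add: push_def)

lemma push_push: "push f (push g t) = push (\<lambda>x. f (g x)) t"
  unfolding push_def[of g] push_sum push_single by (simp add: push_def)

lemma push_cong: "(\<And>x. x \<in> Poly_Mapping.keys t \<Longrightarrow> f x = g x) \<Longrightarrow> push f t = push g t"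
  unfolding push_def by (rule sum.cong) auto

lemma keys_push: "Poly_Mapping.keys (push f t) \<subseteq> f ` Poly_Mapping.keys t"
proof
  fix y assume "y \<in> Poly_Mapping.keys (push f t)"
  then have "(\<Sum>x\<in>Poly_Mapping.keys t. Poly_Mapping.lookup t x when f x = y) \<noteq> 0"
    by (simp add: in_keys_iff lookup_push)
  then obtain x where "x \<in> Poly_Mapping.keys t" "f x = y"
    by (metis (mono_tags, lifting) sum.neutral when_def)
  then show "y \<in> f ` Poly_Mapping.keys t" by auto
qed

lemma lookup_push_inj:
  assumes "inj_on f S" "Poly_Mapping.keys t \<subseteq> S" "x \<in> S"
  shows "Poly_Mapping.lookup (push f t) (f x) = Poly_Mapping.lookup t x"
proof -
  have "Poly_Mapping.lookup (push f t) (f x) =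
      (\<Sum>y\<in>Poly_Mapping.keys t. Poly_Mapping.lookup t y when y = x)"
    unfolding lookup_push
    by (rule sum.cong) (use assms in \<open>auto simp: when_def inj_on_eq_iff\<close>)
  also have "\<dots> = Poly_Mapping.lookup t x"
    by (simp add: when_def in_keys_iff)
  finally show ?thesis .
qed

lemma sum_keys_push_inj:
  fixes F :: "'b \<Rightarrow> 'k::field_char_0"
  assumes "inj_on f S" "Poly_Mapping.keys t \<subseteq> S"
  shows "(\<Sum>y\<in>Poly_Mapping.keys (push f t). F y * Poly_Mapping.lookup (push f t) y) =
    (\<Sum>x\<in>Poly_Mapping.keys t. F (f x) * Poly_Mapping.lookup t x)"
proof -
  have "(\<Sum>y\<in>Poly_Mapping.keys (push f t). F y * Poly_Mapping.lookup (push f t) y) =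
      (\<Sum>y\<in>f ` Poly_Mapping.keys t. F y * Poly_Mapping.lookup (push f t) y)"
    by (rule sum.mono_neutral_left) (auto simp: in_keys_iff keys_push[THEN subsetD])
  also have "\<dots> = (\<Sum>x\<in>Poly_Mapping.keys t. F (f x) * Poly_Mapping.lookup (push f t) (f x))"
    by (subst sum.reindex) (use assms in \<open>auto intro: inj_on_subset\<close>)
  also have "\<dots> = (\<Sum>x\<in>Poly_Mapping.keys t. F (f x) * Poly_Mapping.lookup t x)"
    by (rule sum.cong) (use assms in \<open>auto simp: lookup_push_inj[OF assms(1,2)] subset_iff\<close>)
  finally show ?thesis .
qed

lemma lookup_tensor_act:
  assumes "\<And>j. finite {i. m i j \<noteq> 0}"
  shows "Poly_Mapping.lookup (tensor_act m t) v =
    (\<Sum>w\<in>Poly_Mapping.keys t. tensor_coeff m v w * Poly_Mapping.lookup t w)"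
proof -
  have fin: "finite {v. tensor_coeff m v w \<noteq> 0}" for w
  proof (rule finite_subset)
    show "{v. tensor_coeff m v w \<noteq> 0} \<subseteq>
        {v. set v \<subseteq> (\<Union>j\<in>set w. {i. m i j \<noteq> 0}) \<and> length v = length w}"
    proof
      fix v assume "v \<in> {v. tensor_coeff m v w \<noteq> 0}"
      then have v: "length v = length w" "\<And>k. k < length w \<Longrightarrow> m (v ! k) (w ! k) \<noteq> 0"
        by (auto simp: tensor_coeff_def split: if_splits)
      have "i \<in> (\<Union>j\<in>set w. {i. m i j \<noteq> 0})" if "i \<in> set v" for i
      proof -
        from that obtain k where "k < length w" "i = v ! k" using v(1) by (auto simp: in_set_conv_nth)
        then have "w ! k \<in> set w" "m i (w ! k) \<noteq> 0" using v(2) by auto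
        then show ?thesis by blast
      qed
      then show "v \<in> {v. set v \<subseteq> (\<Union>j\<in>set w. {i. m i j \<noteq> 0}) \<and> length v = length w}"
        using v(1) by auto
    qed
    show "finite {v. set v \<subseteq> (\<Union>j\<in>set w. {i. m i j \<noteq> 0}) \<and> length v = length w}"
      by (rule finite_lists_length_eq) (use assms in auto)
  qed
  have "finite {v. (\<Sum>w\<in>Poly_Mapping.keys t. tensor_coeff m v w * Poly_Mapping.lookup t w) \<noteq> 0}"
  proof (rule finite_subset)
    show "{v. (\<Sum>w\<in>Poly_Mapping.keys t. tensor_coeff m v w * Poly_Mapping.lookup t w) \<noteq> 0} \<subseteq>
        (\<Union>w\<in>Poly_Mapping.keys t. {v. tensor_coeff m v w \<noteq> 0})"
      by (auto elim!: sum.not_neutral_contains_not_neutral)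
  qed (use fin in auto)
  then show ?thesis by (simp add: tensor_act_def)
qed

lemma GL_finite_column:
  assumes "g \<in> GL" shows "finite {i. g i j \<noteq> 0}"
proof -
  from assms obtain n where "g \<in> mat_block n" by (auto simp: GL_def GLn_def)
  then have "{i. g i j \<noteq> 0} \<subseteq> {..<n} \<union> {j}"
    by (auto simp: mat_block_def mat_one_def) (metis not_le)
  then show ?thesis by (rule finite_subset) auto
qed

lemma shift_mat_index:
  assumes "i \<in> shift_basis n" "j \<in> shift_basis n"
  shows "shift_mat n g (shift_index n i) (shift_index n j) = block_mat g i j"
  using assms
  by (auto simp: shift_basis_def shift_index_def shift_mat_def block_mat_def mat_one_def)

lemma bij_shift_index: "bij_betw (shift_index n) (shift_basis n) UNIV"
proof (rule bij_betw_imageI)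
  show "inj_on (shift_index n) (shift_basis n)"
    by (auto simp: inj_on_def shift_index_def shift_basis_def)
  have "k \<in> shift_index n ` shift_basis n" for k
  proof (cases "k < n")
    case True
    then have "shift_index n (Inl k) = k" "Inl k \<in> shift_basis n"
      by (auto simp: shift_index_def shift_basis_def)
    then show ?thesis by force
  next
    case False
    then have "shift_index n (Inr (k - n)) = k" "Inr (k - n) \<in> shift_basis n"
      by (auto simp: shift_index_def shift_basis_def)
    then show ?thesis by force
  qed
  then show "shift_index n ` shift_basis n = UNIV" by auto
qed

lemma shift_mat_finite_column:
  assumes "g \<in> GL" shows "finite {i. shift_mat n g i j \<noteq> 0}"
proof (rule finite_subset)
  show "{i. shift_mat n g i j \<noteq> 0} \<subseteq> {..<n} \<union> {j} \<union> (+) n ` {i. g i (j - n) \<noteq> 0}"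
  proof
    fix i assume "i \<in> {i. shift_mat n g i j \<noteq> 0}"
    then show "i \<in> {..<n} \<union> {j} \<union> (+) n ` {i. g i (j - n) \<noteq> 0}"
      by (cases "i < n"; cases "j < n")
        (auto simp: shift_mat_def mat_one_def image_iff split: if_splits intro!: exI[of _ "i - n"])
  qed
qed (use GL_finite_column[OF assms] in auto)

lemma block_mat_finite_column:
  assumes "g \<in> GL" shows "finite {i. block_mat g i j \<noteq> 0}"
proof (cases j)
  case (Inl b)
  have "{i. block_mat g i j \<noteq> 0} \<subseteq> {Inl b}"
    unfolding Inl by (rule subsetI, rename_tac i, case_tac i)
      (auto simp: block_mat_def mat_one_def split: if_splits)
  then show ?thesis by (rule finite_subset) auto
next
  case (Inr b)
  have "{i. block_mat g i j \<noteq> 0} \<subseteq> Inr ` {i. g i b \<noteq> 0}"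
    unfolding Inr by (rule subsetI, rename_tac i, case_tac i) (auto simp: block_mat_def)
  then show ?thesis by (rule finite_subset) (use GL_finite_column[OF assms] in auto)
qed

lemma block_mat_support:
  assumes "j \<in> shift_basis n" "block_mat g i j \<noteq> 0" shows "i \<in> shift_basis n"
  using assms by (auto simp: block_mat_def shift_basis_def mat_one_def split: sum.splits if_splits)

lemma bij_map_shift_index:
  "bij_betw (map (shift_index n)) (lists (shift_basis n)) UNIV"
  using bij_lists[OF bij_shift_index] by simp

lemma push_inj_on:
  assumes "inj_on f S" "Poly_Mapping.keys s \<subseteq> S" "Poly_Mapping.keys t \<subseteq> S" "push f s = push f t"
  shows "s = t"
proof (rule poly_mapping_eqI)
  fix x
  show "Poly_Mapping.lookup s x = Poly_Mapping.lookup t x"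
  proof (cases "x \<in> S")
    case True
    then show ?thesis using assms lookup_push_inj by metis
  next
    case False
    then have "x \<notin> Poly_Mapping.keys s" "x \<notin> Poly_Mapping.keys t" using assms(2,3) by auto
    then show ?thesis by (simp add: in_keys_iff)
  qed
qed

lemma tensor_coeff_map:
  assumes "v \<in> lists (shift_basis n)" "w \<in> lists (shift_basis n)"
  shows "tensor_coeff (shift_mat n g) (map (shift_index n) v) (map (shift_index n) w) =
    tensor_coeff (block_mat g) v w"
  using assms by (auto simp: tensor_coeff_def in_lists_conv_set intro!: prod.cong shift_mat_index)

lemma tensor_act_keys:
  assumes "g \<in> GL" "Poly_Mapping.keys t \<subseteq> lists (shift_basis n)"
  shows "Poly_Mapping.keys (tensor_act (block_mat g) t) \<subseteq> lists (shift_basis n)"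
proof
  fix v assume "v \<in> Poly_Mapping.keys (tensor_act (block_mat g) t)"
  then have "(\<Sum>w\<in>Poly_Mapping.keys t. tensor_coeff (block_mat g) v w * Poly_Mapping.lookup t w) \<noteq> 0"
    by (simp add: in_keys_iff lookup_tensor_act block_mat_finite_column[OF assms(1)])
  then obtain w where w: "w \<in> Poly_Mapping.keys t" "tensor_coeff (block_mat g) v w \<noteq> 0"
    by (metis (no_types, lifting) mult_zero_left sum.neutral)
  have "v ! k \<in> shift_basis n" if "k < length v" for k
  proof (rule block_mat_support)
    show "w ! k \<in> shift_basis n"
      using w assms(2) that by (auto simp: tensor_coeff_def in_lists_conv_set split: if_splits)
    show "block_mat g (v ! k) (w ! k) \<noteq> 0"
      using w(2) that by (auto simp: tensor_coeff_def split: if_splits)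
  qed
  then show "v \<in> lists (shift_basis n)" by (auto simp: in_lists_conv_set in_set_conv_nth)
qed

lemma push_tensor_act:
  assumes "g \<in> GL" "Poly_Mapping.keys t \<subseteq> lists (shift_basis n)"
  shows "push (map (shift_index n)) (tensor_act (block_mat g) t) =
    tensor_act (shift_mat n g) (push (map (shift_index n)) t)"
proof (rule poly_mapping_eqI)
  fix u
  note inj = bij_betw_imp_inj_on[OF bij_map_shift_index[of n]]
  obtain v where v: "u = map (shift_index n) v" "v \<in> lists (shift_basis n)"
    using bij_map_shift_index[of n] by (metis UNIV_I bij_betw_imp_surj_on imageE)
  have "Poly_Mapping.lookup (push (map (shift_index n)) (tensor_act (block_mat g) t)) u =
      (\<Sum>w\<in>Poly_Mapping.keys t. tensor_coeff (block_mat g) v w * Poly_Mapping.lookup t w)"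
    unfolding v(1) lookup_push_inj[OF inj tensor_act_keys[OF assms] v(2)]
    by (simp add: lookup_tensor_act block_mat_finite_column[OF assms(1)])
  also have "\<dots> = (\<Sum>w\<in>Poly_Mapping.keys t.
      tensor_coeff (shift_mat n g) u (map (shift_index n) w) * Poly_Mapping.lookup t w)"
    unfolding v(1) by (rule sum.cong) (use v(2) assms(2) in \<open>auto simp only: tensor_coeff_map subset_iff\<close>)
  also have "\<dots> = Poly_Mapping.lookup (tensor_act (shift_mat n g) (push (map (shift_index n)) t)) u"
    by (simp add: lookup_tensor_act shift_mat_finite_column[OF assms(1)] sum_keys_push_inj[OF inj assms(2)])
  finally show "Poly_Mapping.lookup (push (map (shift_index n)) (tensor_act (block_mat g) t)) u = \<dots>" .
qed

lemma push_young:
  assumes "\<And>w. w \<in> Poly_Mapping.keys t \<Longrightarrow> length w = sum_list lam"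
  shows "push (map f) (young_symmetrizer lam t) = young_symmetrizer lam (push (map f) t)"
proof -
  have "push (\<lambda>w. map f (permute_list (p \<circ> q) w)) t = push (\<lambda>w. permute_list (p \<circ> q) (map f w)) t"
    if "p \<in> row_group lam" "q \<in> col_group lam" for p q
  proof (rule push_cong)
    fix w assume "w \<in> Poly_Mapping.keys t"
    then have "p \<circ> q permutes {..<length w}"
      using that assms by (auto simp: row_group_def col_group_def intro: permutes_compose)
    then show "map f (permute_list (p \<circ> q) w) = permute_list (p \<circ> q) (map f w)"
      by (simp add: permute_list_map)
  qed
  then show ?thesis
    by (simp add: young_symmetrizer_def push_sum push_scale push_push)
qed

lemma keys_young:
  assumes "\<And>w. w \<in> Poly_Mapping.keys t \<Longrightarrow> length w = sum_list lam \<and> set w \<subseteq> I"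
    and "w \<in> Poly_Mapping.keys (young_symmetrizer lam t)"
  shows "length w = sum_list lam \<and> set w \<subseteq> I"
proof -
  have *: "u \<in> Poly_Mapping.keys (\<Sum>i\<in>A. s i) \<Longrightarrow> \<exists>i\<in>A. u \<in> Poly_Mapping.keys (s i)"
    for u :: "'a list" and A :: "(nat \<Rightarrow> nat) set" and s :: "(nat \<Rightarrow> nat) \<Rightarrow> 'a list \<Rightarrow>\<^sub>0 'b"
    by (auto simp: in_keys_iff lookup_sum elim!: sum.not_neutral_contains_not_neutral)
  obtain p where p: "p \<in> row_group lam"
    "w \<in> Poly_Mapping.keys (\<Sum>q\<in>col_group lam. scale (of_int (sign q)) (push (permute_list (p \<circ> q)) t))"
    using *[OF assms(2)[unfolded young_symmetrizer_def]] by blast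
  obtain q where q: "q \<in> col_group lam"
    "w \<in> Poly_Mapping.keys (scale (of_int (sign q)) (push (permute_list (p \<circ> q)) t))"
    using *[OF p(2)] by blast
  note pq = p(1) q(1)
  have "w \<in> permute_list (p \<circ> q) ` Poly_Mapping.keys t"
    by (rule subsetD[OF keys_push subsetD[OF keys_scale q(2)]])
  then obtain u where u: "u \<in> Poly_Mapping.keys t" "w = permute_list (p \<circ> q) u"
    by blast
  have "p \<circ> q permutes {..<length u}"
    using pq u(1) assms(1) by (auto simp: row_group_def col_group_def intro: permutes_compose)
  then show ?thesis using u assms(1)[OF u(1)] by simp
qed

lemma Sh_schur:
  "push (map (shift_index n)) \<in>
     gl_iso (schur (shift_basis n) block_mat lam) (Sh n (V_part lam) :: ('k::field_char_0, _) gl_module)"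
proof -
  let ?f = "map (shift_index n)" and ?L = "lists (shift_basis n)"
  let ?T = "tensor_power (shift_basis n) block_mat (sum_list lam) :: ('k, _) gl_module"
  let ?T' = "tensor_power UNIV (\<lambda>g. g) (sum_list lam) :: ('k, _) gl_module"
  let ?S = "schur (shift_basis n) block_mat lam :: ('k, _) gl_module"
  let ?S' = "Sh n (V_part lam) :: ('k, _) gl_module"
  note bij = bij_map_shift_index[of n] note inj = bij_betw_imp_inj_on[OF bij]
  have surj: "?f ` ?L = UNIV" by (rule bij_betw_imp_surj_on[OF bij])
  have cT: "carrier ?T = {t. \<forall>w\<in>Poly_Mapping.keys t. length w = sum_list lam \<and> set w \<subseteq> shift_basis n}"
    by (simp add: tensor_power_def)
  have cT': "carrier ?T' = {t. \<forall>w\<in>Poly_Mapping.keys t. length w = sum_list lam}"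
    by (simp add: tensor_power_def)
  have c: "carrier ?S = young_symmetrizer lam ` carrier ?T"
    by (simp add: schur_def)
  have c': "carrier ?S' = young_symmetrizer lam ` carrier ?T'"
    by (simp add: schur_def V_part_def)
  have keysL: "Poly_Mapping.keys t \<subseteq> ?L" if "t \<in> young_symmetrizer lam ` carrier ?T" for t
  proof
    fix w assume w: "w \<in> Poly_Mapping.keys t"
    from that obtain s where s: "s \<in> carrier ?T" "t = young_symmetrizer lam s" by blast
    have "length w = sum_list lam \<and> set w \<subseteq> shift_basis n"
      by (rule keys_young[of s]) (use s w in \<open>simp_all add: cT\<close>)
    then show "w \<in> ?L" by (simp add: in_lists_conv_set subset_iff)
  qed
  have im: "push ?f ` carrier ?T = carrier ?T'"
  proof (intro equalityI subsetI)
    fix s assume "s \<in> push ?f ` carrier ?T"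
    then obtain t where t: "t \<in> carrier ?T" "s = push ?f t" by blast
    have "length w = sum_list lam" if "w \<in> Poly_Mapping.keys s" for w
    proof -
      from that obtain u where "u \<in> Poly_Mapping.keys t" "w = ?f u"
        using keys_push[of ?f t] t(2) by blast
      then show ?thesis using t(1) by (simp add: cT)
    qed
    then show "s \<in> carrier ?T'" by (simp add: cT')
  next
    fix s assume s: "s \<in> carrier ?T'"
    let ?g = "inv_into ?L ?f"
    have "push ?f (push ?g s) = push (\<lambda>x. x) s"
      unfolding push_push
      by (rule push_cong) (rule f_inv_into_f, simp only: surj UNIV_I)
    also have "\<dots> = s"
      by (rule poly_mapping_eqI) (simp add: lookup_push when_def in_keys_iff)
    finally have 1: "push ?f (push ?g s) = s" .
    have gw: "length (?g w) = length w \<and> set (?g w) \<subseteq> shift_basis n" for w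
    proof -
      have "?g w \<in> ?L" "?f (?g w) = w"
        by (rule inv_into_into f_inv_into_f, simp only: surj UNIV_I)+
      then show ?thesis by (metis in_listsD length_map subsetI)
    qed
    have "length w = sum_list lam \<and> set w \<subseteq> shift_basis n"
      if "w \<in> Poly_Mapping.keys (push ?g s)" for w
    proof -
      from that obtain u where "u \<in> Poly_Mapping.keys s" "w = ?g u"
        using keys_push[of ?g s] by blast
      then show ?thesis using s gw[of u] by (simp add: cT')
    qed
    then have "push ?g s \<in> carrier ?T" by (simp add: cT)
    with 1 show "s \<in> push ?f ` carrier ?T" by (metis image_eqI)
  qed
  have young: "push ?f (young_symmetrizer lam t) = young_symmetrizer lam (push ?f t)"
    if "t \<in> carrier ?T" for t
    by (rule push_young) (use that in \<open>auto simp: cT\<close>)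
  have im2: "push ?f ` carrier ?S = carrier ?S'"
    unfolding c c' im[symmetric] image_image by (rule image_cong) (use young in auto)
  have inj2: "inj_on (push ?f) (carrier ?S)"
    unfolding c by (rule inj_onI, rule push_inj_on[OF inj]) (rule keysL keysL, assumption)+
  have eq: "push ?f (act ?S g t) = act ?S' g (push ?f t)"
    if "g \<in> GL" "t \<in> carrier ?S" for g t
    using push_tensor_act[OF that(1) keysL[OF that(2)[unfolded c]]]
    by (simp add: schur_def V_part_def tensor_power_def)
  have S: "x \<oplus>\<^bsub>?S\<^esub> y = x + y" "c \<odot>\<^bsub>?S\<^esub> x = scale c x" for c x y
    by (simp_all add: schur_def tensor_power_def)
  have S': "x \<oplus>\<^bsub>?S'\<^esub> y = x + y" "c \<odot>\<^bsub>?S'\<^esub> x = scale c x" for c x y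
    by (simp_all add: schur_def V_part_def tensor_power_def)
  have "push ?f \<in> gl_hom ?S ?S'"
    unfolding gl_hom_def mem_Collect_eq S S' push_add push_scale
  proof (intro conjI ballI allI)
    show "push ?f \<in> carrier ?S \<rightarrow> carrier ?S'" unfolding im2[symmetric] by (rule funcsetI) (rule imageI)
  qed (simp_all only: eq)
  moreover have "bij_betw (push ?f) (carrier ?S) (carrier ?S')"
    using im2 inj2 by (simp only: bij_betw_def)
  ultimately show ?thesis by (simp only: gl_iso_def mem_Collect_eq)
qed

text \<open>
  A tuple \<open>\<mu>\<close> is \<open>sh\<^sub>n\<^sub>,\<^sub>0(\<lambda>)\<close> (which is determined up to order), with \<open>\<phi>\<close> the
  identification \<open>V\<^sub>\<lambda> \<oplus> V\<^sub>\<mu> \<cong> S\<^sub>\<lambda>(K\<^sup>n \<oplus> V)\<close>.  As \<open>\<lambda>\<close> does not occur among the partitions in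
  \<open>\<mu>\<close>, two choices of \<open>\<phi>\<close> differ by an automorphism of \<open>V\<^sub>\<lambda>\<close> and one of \<open>V\<^sub>\<mu>\<close>.
\<close>

definition shift_splitting :: "nat \<Rightarrow> nat list \<Rightarrow> nat list list \<Rightarrow>
    ((nat \<Rightarrow> nat list \<Rightarrow>\<^sub>0 'k::field_char_0) \<Rightarrow> (nat list \<Rightarrow>\<^sub>0 'k)) \<Rightarrow> bool" where
  "shift_splitting n lam mu \<phi> \<longleftrightarrow>
     (\<forall>p\<in>set mu. partition p \<and> sum_list p < sum_list lam) \<and>
     \<phi> \<in> gl_iso (V_tuple (lam # mu)) (Sh n (V_part lam))"

text \<open>
  With \<open>Y = Spec A\<close>, the pullback along the projection
  \<open>\<pi>: Sh\<^sub>n(Y \<times> A\<^sup>\<lambda>) = Sh\<^sub>n(Y) \<times> A\<^sup>\<lambda> \<times> A\<^sup>\<mu> \<rightarrow> Sh\<^sub>n(Y) \<times> A\<^sup>\<mu>\<close>: it is induced by the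
  inclusion of \<open>V\<^sub>\<mu>\<close> in \<open>V\<^sub>\<lambda> \<oplus> V\<^sub>\<mu> \<cong> Sh\<^sub>n(V\<^sub>\<lambda>)\<close>.  Its target is the coordinate ring of
  \<open>Sh\<^sub>n(Y) \<times> Sh\<^sub>n(A\<^sup>\<lambda>)\<close>, which equals that of \<open>Sh\<^sub>n(Y \<times> A\<^sup>\<lambda>)\<close> by \<open>Sh_Sym\<close> and \<open>Sh_tensor\<close>.
\<close>

definition shift_proj where
  "shift_proj n A lam \<phi> =
     tensor_map (Sh n A) (Sym (Sh n (V_part lam))) (\<lambda>b. b)
       (sym_map (Sh n (V_part lam)) (\<lambda>x. \<phi> (case_nat 0 x)))"


section \<open>Principal open subsets and closed immersions\<close>

text \<open>
  The localization \<open>R[1/h]\<close>; the fraction \<open>r / h\<^sup>k\<close> is the class of \<open>(r, k)\<close>.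
\<close>

definition loc_rel :: "('a, 'm) ring_scheme \<Rightarrow> 'a \<Rightarrow> (('a \<times> nat) \<times> ('a \<times> nat)) set" where
  "loc_rel R h = {((r, k), (s, l)). r \<in> carrier R \<and> s \<in> carrier R \<and>
     (\<exists>m::nat. h [^]\<^bsub>R\<^esub> m \<otimes>\<^bsub>R\<^esub> (h [^]\<^bsub>R\<^esub> l \<otimes>\<^bsub>R\<^esub> r) = h [^]\<^bsub>R\<^esub> m \<otimes>\<^bsub>R\<^esub> (h [^]\<^bsub>R\<^esub> k \<otimes>\<^bsub>R\<^esub> s))}"

definition loc_frac :: "('a, 'm) ring_scheme \<Rightarrow> 'a \<Rightarrow> 'a \<Rightarrow> nat \<Rightarrow> ('a \<times> nat) set" where
  "loc_frac R h r k = loc_rel R h `` {(r, k)}"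

definition localization :: "('a, 'm) ring_scheme \<Rightarrow> 'a \<Rightarrow> ('a \<times> nat) set ring" where
  "localization R h = \<lparr>
     carrier = {loc_frac R h r k |r k. r \<in> carrier R},
     monoid.mult = (\<lambda>Z W. \<Union>(r, k)\<in>Z. \<Union>(s, l)\<in>W. loc_frac R h (r \<otimes>\<^bsub>R\<^esub> s) (k + l)),
     one = loc_frac R h \<one>\<^bsub>R\<^esub> 0,
     ring.zero = loc_frac R h \<zero>\<^bsub>R\<^esub> 0,
     add = (\<lambda>Z W. \<Union>(r, k)\<in>Z. \<Union>(s, l)\<in>W.
       loc_frac R h (h [^]\<^bsub>R\<^esub> l \<otimes>\<^bsub>R\<^esub> r \<oplus>\<^bsub>R\<^esub> h [^]\<^bsub>R\<^esub> k \<otimes>\<^bsub>R\<^esub> s) (k + l))\<rparr>"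

text \<open>
  The map \<open>R[1/h] \<rightarrow> S[1/f(h)]\<close> induced by a ring homomorphism \<open>f: R \<rightarrow> S\<close>.
\<close>

definition loc_map :: "('b, 'm) ring_scheme \<Rightarrow> 'b \<Rightarrow> ('a \<Rightarrow> 'b) \<Rightarrow> ('a \<times> nat) set \<Rightarrow> ('b \<times> nat) set" where
  "loc_map S h' f Z = (\<Union>(r, k)\<in>Z. loc_frac S h' (f r) k)"

text \<open>A morphism \<open>Spec S \<rightarrow> Spec R\<close> is a closed immersion iff \<open>R \<rightarrow> S\<close> is surjective.\<close>

definition closed_immersion :: "('a, 'm) ring_scheme \<Rightarrow> ('b, 'n) ring_scheme \<Rightarrow> ('a \<Rightarrow> 'b) \<Rightarrow> bool" where
  "closed_immersion R S f \<longleftrightarrow> f \<in> ring_hom R S \<and> f ` carrier R = carrier S"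

end

theory Submission
  imports Defs
begin

text \<open>
  Write \<open>R = K[Y \<times> A\<^sup>\<lambda>] = K[Y] \<otimes> Sym(V\<^sub>\<lambda>)\<close> and let \<open>d = |\<lambda>|\<close>.  Elements of \<open>V\<^sub>\<lambda>\<close> are tensors, linear combinations of words
  of length \<open>d\<close> in the letters \<open>0, 1, 2, \<dots>\<close> (the basis of \<open>V\<close>), in the image of the Young symmetrizer.  The dichotomy is decided by
  the formal partial derivatives of the elements of \<open>J\<close> with respect to the coordinates on \<open>A\<^sup>\<lambda>\<close>.

  If all of them lie in \<open>J\<close>, then \<open>J\<close> is generated by its intersection with \<open>K[Y]\<close>, which is case (a): the Euler operator
  \<open>\<Sum> (\<partial>f / \<partial>x\<^sub>w) x\<^sub>w\<close> multiplies the top degree part of \<open>f\<close> by the degree, and characteristic zero allows induction on the degree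
  (\<open>derivative_stable\<close>).

  Otherwise \<open>h = \<partial>f / \<partial>x\<^sub>u\<close> is not in \<open>J\<close> for some \<open>f \<in> J\<close> and some word \<open>u\<close>.  Choose \<open>n\<close> so large that \<open>f\<close> involves only the first
  \<open>n\<close> basis vectors; then \<open>f\<close> and \<open>h\<close> are invariant under the copy of \<open>GL\<close> that acts on the remaining ones, and \<open>h\<close> is a function
  on \<open>Sh\<^sub>n(Y) \<times> A\<^sup>\<mu>\<close>, whose ring is generated by \<open>K[Y]\<close> and the tensors all of whose words contain a letter below \<open>n\<close>
  (\<open>shift_splitting_exists\<close>, \<open>grad_lift\<close>).  Unipotent elements of \<open>GL\<close> act polynomially, so that \<open>J\<close> is stable under the derivations
  that replace a letter \<open>i\<close> by a letter \<open>p\<close>.  Apply to \<open>f\<close> the \<open>d\<close> derivations that replace the letters of \<open>u\<close> by \<open>d\<close> distinct new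
  letters, and combine the orders in which this can be done by means of the Young symmetrizer.  A product of fewer than \<open>d\<close> such
  derivations keeps a letter below \<open>n\<close> in each word, so that modulo the functions on \<open>Sh\<^sub>n(Y) \<times> A\<^sup>\<mu>\<close> the composite is a derivation; by
  \<open>probe_coefficient\<close> its value on \<open>f\<close> is a nonzero multiple of \<open>h\<close> times the coordinate of one nonzero vector of the pure
  part \<open>V\<^sub>\<lambda>\<close> of \<open>Sh\<^sub>n(V\<^sub>\<lambda>)\<close> (\<open>Theta_grad\<close>).  As the value lies in \<open>J\<close>, this coordinate becomes on \<open>Sh\<^sub>n(X)[1/h]\<close> a function on
  \<open>Sh\<^sub>n(Y) \<times> A\<^sup>\<mu>\<close>.  The vectors with this property form a subrepresentation, because \<open>h\<close> is invariant, and \<open>V\<^sub>\<lambda>\<close> is irreducible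
  (\<open>V_part_simple\<close>), so that all pure coordinates can be solved for (\<open>solved_pure\<close>): the restriction map is surjective
  after inverting \<open>h\<close>, which is case (b).

  The representation theory that enters is proved from the group algebra of the symmetric groups: the square of the Young
  symmetrizer is a nonzero multiple of it (\<open>young_sq\<close>), and the left ideals generated by the right translates of all Young
  symmetrizers exhaust the group algebra (\<open>young_exhaustive\<close>), from which the decomposition of \<open>Sh\<^sub>n(V\<^sub>\<lambda>)\<close> follows.
\<close>

section \<open>The group algebra of the symmetric groups\<close>

text \<open>
  Finitary permutations of the natural numbers, written additively: with this convention
  \<open>sperm \<Rightarrow>\<^sub>0 'k\<close> carries the convolution product of the library and is the group algebra.
\<close>

typedef sperm = "{p::nat \<Rightarrow> nat. \<exists>n. p permutes {..<n}}"
  morphisms papp Sperm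
  by (rule exI[of _ id]) (auto simp: permutes_id)

lemma permutes_max:
  assumes "p permutes {..<m}" "q permutes {..<n::nat}"
  shows "p permutes {..<max m n}" "q permutes {..<max m n}"
  using assms by (auto elim!: permutes_subset)

lemma permutes_comp_ex:
  assumes "\<exists>n. p permutes {..<n::nat}" "\<exists>n. q permutes {..<n}"
  shows "\<exists>n. (p \<circ> q) permutes {..<n}"
  using assms permutes_max permutes_compose by meson

instantiation sperm :: group_add
begin

definition "0 = Sperm id"
definition "s + t = Sperm (papp s \<circ> papp t)"
definition "- s = Sperm (inv_into UNIV (papp s))"
definition "s - t = s + - (t::sperm)"

lemma papp_zero: "papp 0 = id"
  unfolding zero_sperm_def by (rule Sperm_inverse) (auto intro: permutes_id)

lemma papp_add: "papp (s + t) = papp s \<circ> papp t"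
  unfolding plus_sperm_def by (rule Sperm_inverse) (use papp[of s] papp[of t] permutes_comp_ex in auto)

lemma papp_uminus: "papp (- s) = inv_into UNIV (papp s)"
  unfolding uminus_sperm_def by (rule Sperm_inverse) (use papp[of s] permutes_inv in auto)

lemma papp_bij: "bij (papp s)"
  using papp[of s] by (auto dest: permutes_bij)

instance
proof
  fix a b c :: sperm
  show "a + b + c = a + (b + c)"
    by (simp add: papp_inject[symmetric] papp_add comp_assoc)
  show "0 + a = a" "a + 0 = a"
    by (simp_all add: papp_inject[symmetric] papp_add papp_zero)
  show "- a + a = 0"
    using papp_bij[of a] by (simp add: papp_inject[symmetric] papp_add papp_zero papp_uminus bij_is_inj)
  show "a + - b = a - b" by (simp add: minus_sperm_def)
qed

end

lemmas papp_simps [simp] = papp_zero papp_add papp_uminus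

definition SS :: "nat \<Rightarrow> sperm set" where
  "SS e = {s. papp s permutes {..<e}}"

lemma SS_closed [intro]:
  "0 \<in> SS e" "s \<in> SS e \<Longrightarrow> t \<in> SS e \<Longrightarrow> s + t \<in> SS e" "s \<in> SS e \<Longrightarrow> - s \<in> SS e"
  by (auto simp: SS_def permutes_id permutes_compose permutes_inv)

lemma papp_image_SS: "papp ` SS e = {p. p permutes {..<e}}"
proof (intro equalityI subsetI)
  fix p assume "p \<in> {p. p permutes {..<e}}"
  then have "papp (Sperm p) = p" by (intro Sperm_inverse) auto
  with \<open>p \<in> _\<close> show "p \<in> papp ` SS e" by (metis SS_def image_eqI mem_Collect_eq)
qed (auto simp: SS_def)

lemma inj_papp: "inj papp" by (meson injI papp_inject)

lemma finite_SS [simp]: "finite (SS e)"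
  by (rule finite_imageD[of papp]) (auto simp: papp_image_SS finite_permutations intro: inj_on_subset[OF inj_papp])

lemma SS_less: "s \<in> SS e \<Longrightarrow> k < e \<Longrightarrow> papp s k < e"
  unfolding SS_def using permutes_in_image by fastforce

lemma SS_less_iff: "s \<in> SS e \<Longrightarrow> papp s k < e \<longleftrightarrow> k < e"
  unfolding SS_def using permutes_in_image by fastforce

lemma papp_eq_iff [simp]: "papp s x = papp s y \<longleftrightarrow> x = y"
  using papp_bij[of s] by (metis bij_is_inj inj_eq)

lemma papp_inv [simp]: "papp s (inv_into UNIV (papp s) x) = x" "inv_into UNIV (papp s) (papp s x) = x"
  using papp_bij[of s] by (simp_all add: bij_is_inj bij_is_surj surj_f_inv_f)

definition tr :: "nat \<Rightarrow> nat \<Rightarrow> sperm" where "tr x y = Sperm (transpose x y)"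

lemma papp_tr [simp]: "papp (tr x y) = transpose x y"
  unfolding tr_def by (rule Sperm_inverse) (auto intro!: exI[of _ "Suc (max x y)"] permutes_swap_id)

lemma tr_SS [intro]: "x < e \<Longrightarrow> y < e \<Longrightarrow> tr x y \<in> SS e"
  by (auto simp: SS_def intro: permutes_swap_id)

lemma add_tr: "s + tr x y = tr (papp s x) (papp s y) + s"
  by (simp add: papp_inject[symmetric]) (auto simp: fun_eq_iff transpose_def)

type_synonym 'k galg = "sperm \<Rightarrow>\<^sub>0 'k"

definition gs :: "sperm \<Rightarrow> 'k::field_char_0 galg" where "gs s = Poly_Mapping.single s 1"

lemma gs_mult: "gs s * gs t = gs (s + t)" by (simp add: gs_def mult_single)

lemma gs_zero [simp]: "gs 0 = 1" by (simp add: gs_def)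

lemma scale_conv: "scale c (x :: 'k::field_char_0 galg) = Poly_Mapping.single 0 c * x"
  unfolding scale_def by (rule mult_map_scale_conv_mult)

lemma scale_simps:
  fixes x y :: "'x \<Rightarrow>\<^sub>0 'k::field_char_0"
  shows scale_add: "scale c (x + y) = scale c x + scale c y"
    and scale_diff: "scale c (x - y) = scale c x - scale c y"
    and scale_uminus: "scale c (- x) = - scale c x"
    and scale_zero: "scale c (0 :: 'x \<Rightarrow>\<^sub>0 'k) = 0"
    and scale_0: "scale 0 x = 0"
    and scale_1: "scale 1 x = x"
    and scale_scale: "scale c (scale d x) = scale (c * d) x"
    and scale_add_left: "scale (c + d) x = scale c x + scale d x"
    and scale_minus_left: "scale (- c) x = - scale c x"
    and scale_diff_left: "scale (c - d) x = scale c x - scale d x"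
  by (auto intro!: poly_mapping_eqI simp: lookup_scale lookup_add lookup_minus algebra_simps)

lemma scale_sum: "scale c (\<Sum>i\<in>A. f i) = (\<Sum>i\<in>A. scale c (f i :: 'x \<Rightarrow>\<^sub>0 'k::field_char_0))"
  by (induction A rule: infinite_finite_induct) (auto simp: scale_simps)

lemma scale_sum_left: "scale (\<Sum>i\<in>A. f i) (x :: 'x \<Rightarrow>\<^sub>0 'k::field_char_0) = (\<Sum>i\<in>A. scale (f i) x)"
  by (induction A rule: infinite_finite_induct) (auto simp: scale_simps)

lemma scale_single: "scale c (Poly_Mapping.single x d) = Poly_Mapping.single x (c * d)"
  by (rule poly_mapping_eqI) (simp add: lookup_scale lookup_single mult_when)

lemma sum_singles: "t = (\<Sum>x\<in>Poly_Mapping.keys t. Poly_Mapping.single x (Poly_Mapping.lookup t x))"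
  by (rule poly_mapping_eqI) (simp add: lookup_sum lookup_single when_def in_keys_iff)

lemma galg_sum_gs: "x = (\<Sum>s\<in>Poly_Mapping.keys x. scale (Poly_Mapping.lookup x s) (gs s))"
  by (subst sum_singles) (simp add: gs_def scale_single)

lemma single_central:
  "Poly_Mapping.single 0 c * x = x * Poly_Mapping.single 0 c" for x :: "'k::field_char_0 galg"
proof -
  have "Poly_Mapping.single 0 c * (\<Sum>s\<in>K. Poly_Mapping.single s (f s)) =
      (\<Sum>s\<in>K. Poly_Mapping.single s (f s)) * Poly_Mapping.single 0 c" for K and f :: "sperm \<Rightarrow> 'k"
    by (simp add: sum_distrib_left sum_distrib_right mult_single mult.commute)
  from this[of "Poly_Mapping.lookup x" "Poly_Mapping.keys x"] show ?thesis
    by (simp only: sum_singles[symmetric])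
qed

lemma scale_mult: "scale c x * y = scale c (x * y)" "x * scale c y = scale c (x * y :: 'k::field_char_0 galg)"
  by (simp add: scale_conv mult.assoc) (simp add: scale_conv single_central mult.assoc)

lemma of_nat_scale: "of_nat n * x = scale (of_nat n) (x :: 'k::field_char_0 galg)"
  by (simp add: scale_conv)

lemma galg_mult_sum_left:
  "(x :: 'k::field_char_0 galg) * y = (\<Sum>s\<in>Poly_Mapping.keys x. scale (Poly_Mapping.lookup x s) (gs s * y))"
  by (subst galg_sum_gs[of x]) (simp add: sum_distrib_right scale_mult)

text \<open>The coefficient of the identity is a trace form.\<close>

definition tau :: "'k::field_char_0 galg \<Rightarrow> 'k" where "tau x = Poly_Mapping.lookup x 0"

lemma tau_linear: "tau (x + y) = tau x + tau y" "tau (scale c x) = c * tau x"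
  by (simp_all add: tau_def lookup_add lookup_scale)

lemma tau_sum: "tau (\<Sum>i\<in>A. f i) = (\<Sum>i\<in>A. tau (f i))"
  by (simp add: tau_def lookup_sum)

lemma lookup_mult_gs: "Poly_Mapping.lookup (gs s * x) t = Poly_Mapping.lookup x (- s + t)"
proof -
  have eq: "s + u = t \<longleftrightarrow> u = - s + t" for u
    by (metis add.assoc add.left_neutral left_minus right_minus)
  have "Poly_Mapping.lookup (gs s * (\<Sum>u\<in>K. Poly_Mapping.single u (f u))) t =
      Poly_Mapping.lookup (\<Sum>u\<in>K. Poly_Mapping.single u (f u)) (- s + t)" for K and f :: "sperm \<Rightarrow> 'a"
    by (simp add: sum_distrib_left gs_def mult_single lookup_sum lookup_single when_def eq)
  from this[of "Poly_Mapping.lookup x" "Poly_Mapping.keys x"] show ?thesis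
    by (simp only: sum_singles[symmetric])
qed

lemma tau_commute: "tau (x * y) = tau (y * x :: 'k::field_char_0 galg)"
proof -
  have 1: "tau (gs s * gs t) = tau (gs t * gs s :: 'k galg)" for s t
    by (simp add: gs_mult) (auto simp: tau_def gs_def lookup_single when_def eq_neg_iff_add_eq_0 neg_eq_iff_add_eq_0 dest: minus_unique)
  have 2: "tau (gs s * y) = tau (y * gs s)" for s
    by (subst galg_sum_gs[of y], subst (2) galg_sum_gs[of y])
      (simp add: sum_distrib_left sum_distrib_right scale_mult tau_sum tau_linear 1)
  show ?thesis
    by (subst galg_sum_gs[of x], subst (2) galg_sum_gs[of x])
      (simp add: sum_distrib_left sum_distrib_right scale_mult tau_sum tau_linear 2)
qed


section \<open>Young symmetrizers\<close>

definition young_grp :: "nat \<Rightarrow> (nat \<Rightarrow> nat) \<Rightarrow> sperm set" where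
  "young_grp e r = {s \<in> SS e. \<forall>k<e. r (papp s k) = r k}"

definition rsym :: "nat \<Rightarrow> (nat \<Rightarrow> nat) \<Rightarrow> 'k::field_char_0 galg" where
  "rsym e r = (\<Sum>s\<in>young_grp e r. gs s)"

definition csym :: "nat \<Rightarrow> (nat \<Rightarrow> nat) \<Rightarrow> 'k::field_char_0 galg" where
  "csym e r = (\<Sum>s\<in>young_grp e r. scale (of_int (sign (papp s))) (gs s))"

lemma finite_young_grp [simp]: "finite (young_grp e r)"
  by (rule finite_subset[of _ "SS e"]) (auto simp: young_grp_def)

lemma young_grp_SS: "s \<in> young_grp e r \<Longrightarrow> s \<in> SS e" by (simp add: young_grp_def)

lemma young_grp_closed:
  "0 \<in> young_grp e r" "s \<in> young_grp e r \<Longrightarrow> t \<in> young_grp e r \<Longrightarrow> s + t \<in> young_grp e r"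
  "s \<in> young_grp e r \<Longrightarrow> - s \<in> young_grp e r"
  "s \<in> young_grp e r \<Longrightarrow> t \<in> young_grp e r \<Longrightarrow> s - t \<in> young_grp e r"
proof -
  show "0 \<in> young_grp e r" by (auto simp: young_grp_def)
  show a: "s + t \<in> young_grp e r" if "s \<in> young_grp e r" "t \<in> young_grp e r" for s t
    using that by (auto simp: young_grp_def SS_less)
  show m: "- s \<in> young_grp e r" if s: "s \<in> young_grp e r" for s
  proof -
    have s': "s \<in> SS e" "\<And>k. k < e \<Longrightarrow> r (papp s k) = r k" using s by (auto simp: young_grp_def)
    have "r (inv_into UNIV (papp s) k) = r k" if "k < e" for k
      using s'(2)[of "inv_into UNIV (papp s) k"] SS_less[OF SS_closed(3)[OF s'(1)] that] by simp
    then show ?thesis using s' by (auto simp: young_grp_def)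
  qed
  show "s - t \<in> young_grp e r" if "s \<in> young_grp e r" "t \<in> young_grp e r"
    unfolding diff_conv_add_uminus by (intro a m that)
qed

lemma young_grp_card: "card (young_grp e r) > 0"
  using young_grp_closed(1)[of e r] by (auto simp: card_gt_0_iff)

lemma tr_young_grp: "x < e \<Longrightarrow> y < e \<Longrightarrow> r x = r y \<Longrightarrow> tr x y \<in> young_grp e r"
  by (auto simp: young_grp_def transpose_def)

lemma sum_young_grp_right:
  assumes "t \<in> young_grp e r"
  shows "(\<Sum>s\<in>young_grp e r. f (s + t)) = (\<Sum>s\<in>young_grp e r. f s)"
  by (rule sum.reindex_bij_witness[of _ "\<lambda>s. s + - t" "\<lambda>s. s + t"])
    (auto intro!: young_grp_closed assms simp: add.assoc)

lemma sum_young_grp_left: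
  assumes "t \<in> young_grp e r"
  shows "(\<Sum>s\<in>young_grp e r. f (t + s)) = (\<Sum>s\<in>young_grp e r. f s)"
  by (rule sum.reindex_bij_witness[of _ "\<lambda>s. - t + s" "\<lambda>s. t + s"])
    (auto intro!: young_grp_closed assms simp: add.assoc[symmetric])

lemma rsym_gs: "t \<in> young_grp e r \<Longrightarrow> rsym e r * gs t = rsym e r"
  using sum_young_grp_right[of t e r gs] by (simp add: rsym_def sum_distrib_right gs_mult)

lemma gs_rsym: "t \<in> young_grp e r \<Longrightarrow> gs t * rsym e r = rsym e r"
  using sum_young_grp_left[of t e r gs] by (simp add: rsym_def sum_distrib_left gs_mult)

lemma sign_papp_add: "sign (papp (s + t)) = sign (papp s) * sign (papp t)"
proof -
  have "permutation (papp s)" for s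
    using papp[of s] by (auto intro: permutes_imp_permutation[of "{..<_}"])
  then show ?thesis by (simp add: sign_compose)
qed

lemma sign_papp_uminus: "sign (papp (- s)) = sign (papp s)"
  using papp[of s] by (auto simp: sign_inverse intro!: sign_inverse permutes_imp_permutation[of "{..<_}"])

lemma gs_csym:
  assumes "t \<in> young_grp e r"
  shows "gs t * csym e r = scale (of_int (sign (papp t))) (csym e r)"
proof -
  let ?f = "\<lambda>s. scale (of_int (sign (papp t) * sign (papp s))) (gs s)"
  have "of_int (sign (papp t)) * of_int (sign (papp t)) = (1::'k::field_char_0)"
    by (simp flip: of_int_mult)
  then have "gs t * csym e r = (\<Sum>s\<in>young_grp e r. ?f (t + s))"
    by (simp add: csym_def sum_distrib_left scale_mult gs_mult sign_papp_add mult.assoc[symmetric] del: papp_simps)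
  also have "\<dots> = (\<Sum>s\<in>young_grp e r. ?f s)" by (rule sum_young_grp_left[OF assms])
  also have "\<dots> = scale (of_int (sign (papp t))) (csym e r)"
    by (simp add: csym_def scale_sum scale_scale)
  finally show ?thesis .
qed

text \<open>Subspaces of the group algebra that are stable under left multiplication by \<open>S\<^sub>e\<close>.\<close>

definition left_ideal :: "nat \<Rightarrow> 'k::field_char_0 galg set \<Rightarrow> bool" where
  "left_ideal e I \<longleftrightarrow> 0 \<in> I \<and> (\<forall>x\<in>I. \<forall>y\<in>I. x + y \<in> I) \<and> (\<forall>c. \<forall>x\<in>I. scale c x \<in> I) \<and>
     (\<forall>s\<in>SS e. \<forall>x\<in>I. gs s * x \<in> I)"

lemma left_idealD:
  assumes "left_ideal e I"
  shows "0 \<in> I" "x \<in> I \<Longrightarrow> y \<in> I \<Longrightarrow> x + y \<in> I" "x \<in> I \<Longrightarrow> scale c x \<in> I"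
    "s \<in> SS e \<Longrightarrow> x \<in> I \<Longrightarrow> gs s * x \<in> I" "x \<in> I \<Longrightarrow> - x \<in> I"
    "x \<in> I \<Longrightarrow> y \<in> I \<Longrightarrow> x - y \<in> I" "(\<And>i. i \<in> A \<Longrightarrow> f i \<in> I) \<Longrightarrow> (\<Sum>i\<in>A. f i) \<in> I"
proof -
  show 1: "0 \<in> I" "x \<in> I \<Longrightarrow> y \<in> I \<Longrightarrow> x + y \<in> I" "x \<in> I \<Longrightarrow> scale c x \<in> I"
    "s \<in> SS e \<Longrightarrow> x \<in> I \<Longrightarrow> gs s * x \<in> I" for x y c s
    using assms by (auto simp: left_ideal_def)
  show m: "x \<in> I \<Longrightarrow> - x \<in> I" for x using 1(3)[of x "- 1"] by (simp add: scale_minus_left scale_1)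
  show "x \<in> I \<Longrightarrow> y \<in> I \<Longrightarrow> x - y \<in> I" using 1(2)[of x "- y"] m by simp
  show "(\<And>i. i \<in> A \<Longrightarrow> f i \<in> I) \<Longrightarrow> (\<Sum>i\<in>A. f i) \<in> I"
    by (induction A rule: infinite_finite_induct) (auto intro: 1)
qed

lemma left_ideal_mult:
  assumes I: "left_ideal e I" and x: "Poly_Mapping.keys x \<subseteq> SS e" and y: "y \<in> I"
  shows "x * y \<in> I"
  unfolding galg_mult_sum_left[of x y]
  by (intro left_idealD[OF I]) (use x y in auto)

text \<open>
  The relations satisfied, modulo a left ideal, by a highest weight vector \<open>m\<close> with rows \<open>r\<close>: it is
  invariant under permutations within the rows, and symmetrizing it further over the boxes of a row and a
  box \<open>y\<close> in a lower row gives zero.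
\<close>

definition highest :: "nat \<Rightarrow> (nat \<Rightarrow> nat) \<Rightarrow> 'k::field_char_0 galg set \<Rightarrow> 'k galg \<Rightarrow> bool" where
  "highest e r I m \<longleftrightarrow> (\<forall>s\<in>young_grp e r. gs s * m = m) \<and>
     (\<forall>y<e. \<forall>i<r y. m + (\<Sum>x | x < e \<and> r x = i. gs (tr x y) * m) \<in> I)"

text \<open>
  A highest weight vector spans the image of the row symmetrizer on the module that it generates, and the
  scalar by which \<open>rsym * gs s\<close> acts on it depends on \<open>s\<close> only.  Rows are made to agree with their images
  under \<open>s\<close> one after the other: if \<open>s\<close> moves a box out of row \<open>i\<close>, the relation for a box \<open>y\<close> that it
  moves into row \<open>i\<close> expresses \<open>gs s * m\<close>, up to the row symmetrizer, by permutations that move fewer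
  boxes out of row \<open>i\<close>.
\<close>

lemma highest_weight_scalar:
  assumes "s \<in> SS e"
  shows "\<exists>\<kappa>. \<forall>I (m :: 'k::field_char_0 galg). left_ideal e I \<longrightarrow> highest e r I m \<longrightarrow>
    rsym e r * gs s * m - scale \<kappa> m \<in> I"
proof -
  define L where "L = Suc (Max (r ` {..<Suc e}))"
  have L: "r k < L" if "k < e" for k
    unfolding L_def using that by (auto intro!: le_imp_less_Suc Max_ge)
  define Q where "Q s \<longleftrightarrow> (\<exists>\<kappa>. \<forall>I (m :: 'k galg). left_ideal e I \<longrightarrow> highest e r I m \<longrightarrow>
    rsym e r * gs s * m - scale \<kappa> m \<in> I)" for s
  define pres where "pres i s \<longleftrightarrow> (\<forall>k<e. r k < i \<longrightarrow> r (papp s k) = r k)" for i s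
  define D where "D i s = {k. k < e \<and> r k = i \<and> r (papp s k) \<noteq> i}" for i s
  have finD: "finite (D i s)" for i s by (simp add: D_def)
  have "Q s" if "s \<in> SS e" "i \<le> L" "pres i s" for i s
    using that(2,1,3)
  proof (induction i arbitrary: s rule: inc_induct)
    case base
    then have "s \<in> young_grp e r" using L by (auto simp: young_grp_def pres_def)
    then have "rsym e r * gs s * m - scale (of_nat (card (young_grp e r))) m = 0"
      if "highest e r I m" for I and m :: "'k galg"
      using that
      by (simp add: rsym_gs highest_def) (simp add: rsym_def sum_distrib_right of_nat_scale)
    then show ?case unfolding Q_def by (metis left_idealD(1))
  next
    case (step i)
    from step.prems step.hyps show ?case
    proof (induction "card (D i s)" arbitrary: s rule: less_induct)
      case less
      show ?case
      proof (cases "D i s = {}")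
        case True
        then have "pres (Suc i) s"
          using less.prems by (auto simp: pres_def D_def less_Suc_eq)
        then show ?thesis using step.IH less.prems by blast
      next
        case False
        define X where "X = {x. x < e \<and> r x = i}"
        have finX: "finite X" by (simp add: X_def)
        from False obtain k0 where k0: "k0 \<in> X" "r (papp s k0) \<noteq> i" by (auto simp: D_def X_def)
        have "\<not> X \<subseteq> papp s ` X"
        proof
          assume "X \<subseteq> papp s ` X"
          then have "papp s ` X = X"
            by (intro card_subset_eq[symmetric]) (auto simp: finX card_image inj_on_def)
          then show False using k0 by (auto simp: X_def)
        qed
        then obtain y' where y': "y' \<in> X" "y' \<notin> papp s ` X" by blast
        define y where "y = inv_into UNIV (papp s) y'"
        have sy: "papp s y = y'" by (simp add: y_def)
        have y: "y < e" using y'(1) SS_less_iff[OF less.prems(1), of y] by (simp add: sy X_def)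
        have ryi: "r y' = i" using y'(1) by (simp add: X_def)
        have "r y \<noteq> i" using y' sy y by (auto simp: X_def)
        moreover have "\<not> r y < i" using less.prems(2) y ryi sy by (auto simp: pres_def)
        ultimately have iy: "i < r y" by simp
        define X1 where "X1 = {x\<in>X. r (papp s x) = i}"
        define X2 where "X2 = X - X1"
        have X12: "X = X1 \<union> X2" "X1 \<inter> X2 = {}" by (auto simp: X1_def X2_def)
        have X1: "rsym e r * gs (s + tr x y) = (rsym e r * gs s :: 'k galg)" if "x \<in> X1" for x
        proof -
          have "papp s x < e" "papp s y < e" "r (papp s x) = r (papp s y)"
            using that less.prems(1) y SS_less sy ryi by (auto simp: X1_def X_def)
          then have "tr (papp s x) (papp s y) \<in> young_grp e r" by (rule tr_young_grp)
          then show ?thesis by (simp add: add_tr rsym_gs flip: gs_mult mult.assoc)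
        qed
        have "Q (s + tr x y)" if x: "x \<in> X2" for x
        proof (rule less.hyps)
          have x': "x < e" "r x = i" "x \<noteq> y" "r (papp s x) \<noteq> i"
            using x iy by (auto simp: X2_def X1_def X_def)
          show "s + tr x y \<in> SS e" using less.prems(1) x' y by blast
          show "pres i (s + tr x y)"
            using less.prems(2) x' iy by (auto simp: pres_def transpose_def)
          have "D i (s + tr x y) \<subseteq> D i s - {x}"
            using x' iy ryi sy by (auto simp: D_def transpose_def split: if_splits)
          moreover have "x \<in> D i s" using x' by (simp add: D_def)
          ultimately have "D i (s + tr x y) \<subset> D i s" by blast
          then show "card (D i (s + tr x y)) < card (D i s)" by (rule psubset_card_mono[OF finD])
        qed (use less.prems in auto)
        then obtain \<kappa> where \<kappa>: "\<And>x I (m :: 'k galg). x \<in> X2 \<Longrightarrow> left_ideal e I \<Longrightarrow> highest e r I m \<Longrightarrow>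
            rsym e r * gs (s + tr x y) * m - scale (\<kappa> x) m \<in> I"
          unfolding Q_def by metis
        define N where "N = (1 + of_nat (card X1) :: 'k)"
        have N: "N \<noteq> 0" unfolding N_def by (metis of_nat_Suc of_nat_neq_0)
        have "rsym e r * gs s * m - scale (- (\<Sum>x\<in>X2. \<kappa> x) / N) m \<in> I"
          if I: "left_ideal e I" and m: "highest e r I m" for I and m :: "'k galg"
        proof -
          let ?A = "rsym e r :: 'k galg"
          let ?u = "?A * gs s * m"
          have keys: "Poly_Mapping.keys (?A * gs s) \<subseteq> SS e"
          proof
            fix u assume "u \<in> Poly_Mapping.keys (?A * gs s)"
            then obtain v where "v \<in> young_grp e r" "u = v + s"
              using keys_sum[of "\<lambda>v. gs (v + s) :: 'k galg" "young_grp e r"]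
              by (auto simp: rsym_def sum_distrib_right gs_def mult_single)
            then show "u \<in> SS e" using young_grp_SS less.prems(1) by auto
          qed
          have "m + (\<Sum>x\<in>X. gs (tr x y) * m) \<in> I"
            using m y iy by (auto simp: highest_def X_def)
          from left_ideal_mult[OF I keys this]
          have "?u + (\<Sum>x\<in>X. ?A * gs (s + tr x y) * m) \<in> I"
            by (simp add: distrib_left sum_distrib_left mult.assoc flip: gs_mult)
          also have "(\<Sum>x\<in>X. ?A * gs (s + tr x y) * m) =
              (\<Sum>x\<in>X1. ?u) + (\<Sum>x\<in>X2. ?A * gs (s + tr x y) * m)"
            unfolding X12(1) using finX X12 X1 by (subst sum.union_disjoint) auto
          also have "(\<Sum>x\<in>X1. ?u) = scale (of_nat (card X1)) ?u" by (simp add: of_nat_scale)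
          finally have "?u + (scale (of_nat (card X1)) ?u + (\<Sum>x\<in>X2. ?A * gs (s + tr x y) * m)) \<in> I" .
          moreover have "(\<Sum>x\<in>X2. ?A * gs (s + tr x y) * m - scale (\<kappa> x) m) \<in> I"
            by (rule left_idealD(7)[OF I]) (rule \<kappa>[OF _ I m])
          ultimately have "?u + (scale (of_nat (card X1)) ?u + (\<Sum>x\<in>X2. ?A * gs (s + tr x y) * m)) -
              (\<Sum>x\<in>X2. ?A * gs (s + tr x y) * m - scale (\<kappa> x) m) \<in> I"
            by (rule left_idealD(6)[OF I])
          also have "?u + (scale (of_nat (card X1)) ?u + (\<Sum>x\<in>X2. ?A * gs (s + tr x y) * m)) -
              (\<Sum>x\<in>X2. ?A * gs (s + tr x y) * m - scale (\<kappa> x) m) = scale N ?u + scale (\<Sum>x\<in>X2. \<kappa> x) m"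
            by (simp add: N_def scale_add_left scale_1 sum_subtractf scale_sum_left)
          finally have "scale (1 / N) (scale N ?u + scale (\<Sum>x\<in>X2. \<kappa> x) m) \<in> I"
            by (rule left_idealD(3)[OF I])
          then show ?thesis using N by (simp add: scale_simps scale_scale)
        qed
        then show ?thesis unfolding Q_def by blast
      qed
    qed
  qed
  from this[OF assms, of 0] show ?thesis by (simp add: pres_def Q_def)
qed

text \<open>
  For a row-invariant \<open>m\<close>, the relation at a box \<open>y\<close> and a row \<open>i\<close> says that \<open>m\<close> is killed by the symmetrizer of the
  row structure \<open>r(y := i)\<close>: the cosets of the stabilizer of \<open>y\<close> are represented by transpositions.
\<close>

lemma raised_rsym:
  assumes m: "\<And>s. s \<in> young_grp e r \<Longrightarrow> gs s * m = m" and y: "y < e" and i: "i \<noteq> r y"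
  obtains N where "N > 0" "rsym e (r(y := i)) * m =
    scale (of_nat N) (m + (\<Sum>x | x < e \<and> r x = i. gs (tr x y) * (m :: 'k::field_char_0 galg)))"
proof -
  let ?r = "r(y := i)" and ?X = "{x. x < e \<and> r x = i}"
  let ?T = "{t\<in>young_grp e ?r. papp t y = y}"
  have Ty: "t \<in> young_grp e r" if "t \<in> ?T" for t
    unfolding young_grp_def
  proof (intro CollectI conjI allI impI)
    show "t \<in> SS e" using that by (simp add: young_grp_def)
    fix k assume k: "k < e"
    have "papp t k \<noteq> y" if "k \<noteq> y" using that \<open>t \<in> ?T\<close> papp_eq_iff[of t k y] by auto
    then show "r (papp t k) = r k" using that k by (auto simp: young_grp_def split: if_splits)
  qed
  have "rsym e ?r * m = (\<Sum>s\<in>young_grp e ?r. gs s * m)" by (simp add: rsym_def sum_distrib_right)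
  also have "\<dots> = (\<Sum>(z, t)\<in>insert y ?X \<times> ?T. gs (tr z y) * m)"
  proof (rule sum.reindex_bij_witness[of _ "\<lambda>(z, t). tr z y + t" "\<lambda>s. (papp s y, tr (papp s y) y + s)"])
    fix s assume s: "s \<in> young_grp e ?r"
    have sy: "papp s y < e" using s y SS_less young_grp_SS by blast
    have "?r (papp s y) = i" using s y by (auto simp: young_grp_def)
    then have z: "papp s y \<in> insert y ?X" using sy by (auto split: if_splits)
    have "tr (papp s y) y \<in> young_grp e ?r" using \<open>?r (papp s y) = i\<close> sy y by (intro tr_young_grp) auto
    then have t: "tr (papp s y) y + s \<in> ?T" using s young_grp_closed by simp
    with z show "(papp s y, tr (papp s y) y + s) \<in> insert y ?X \<times> ?T" by blast
    have e: "tr (papp s y) y + (tr (papp s y) y + s) = s"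
      by (simp add: papp_inject[symmetric] fun_eq_iff)
    then show "(case (papp s y, tr (papp s y) y + s) of (z, t) \<Rightarrow> tr z y + t) = s" by simp
    have "gs s * m = gs (tr (papp s y) y) * (gs (tr (papp s y) y + s) * m)"
      by (simp add: gs_mult mult.assoc[symmetric] e)
    also have "\<dots> = gs (tr (papp s y) y) * m" using m Ty[OF t] by simp
    finally show "(case (papp s y, tr (papp s y) y + s) of (z, t) \<Rightarrow> gs (tr z y) * m) = gs s * m" by simp
  next
    fix p assume "p \<in> insert y ?X \<times> ?T"
    then obtain z t where p: "p = (z, t)" "z \<in> insert y ?X" "t \<in> ?T" by auto
    have "tr z y \<in> young_grp e ?r" using p y by (intro tr_young_grp) auto
    then show "(case p of (z, t) \<Rightarrow> tr z y + t) \<in> young_grp e ?r" using p young_grp_closed by simp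
    show "(papp (case p of (z, t) \<Rightarrow> tr z y + t) y,
        tr (papp (case p of (z, t) \<Rightarrow> tr z y + t) y) y + (case p of (z, t) \<Rightarrow> tr z y + t)) = p"
      using p by (simp add: papp_inject[symmetric] fun_eq_iff)
  qed
  also have "\<dots> = (\<Sum>z\<in>insert y ?X. scale (of_nat (card ?T)) (gs (tr z y) * m))"
    by (simp add: sum.cartesian_product[symmetric] of_nat_scale)
  also have "\<dots> = scale (of_nat (card ?T)) (m + (\<Sum>x\<in>?X. gs (tr x y) * m))"
  proof -
    have "tr y y = 0" by (simp add: papp_inject[symmetric])
    then show ?thesis using i by (subst sum.insert) (auto simp: scale_add scale_sum)
  qed
  finally show ?thesis
  proof (rule that[rotated])
    have "0 \<in> ?T" using young_grp_closed(1) by auto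
    then show "card ?T > 0" by (auto simp: card_gt_0_iff)
  qed
qed

text \<open>A transposition within a row and, transported by \<open>s\<close>, within a column forces the product to vanish.\<close>

lemma rsym_csym_zero:
  assumes s: "s \<in> SS e" and uv: "u < e" "v < e" "u \<noteq> v" "c u = c v" "r (papp s u) = r (papp s v)"
  shows "rsym e r * gs s * csym e c = (0 :: 'k::field_char_0 galg)"
proof -
  let ?x = "rsym e r * gs s * csym e c :: 'k galg"
  have "?x = rsym e r * gs (tr (papp s u) (papp s v)) * gs s * csym e c"
    using uv s SS_less by (subst rsym_gs) (auto intro!: tr_young_grp)
  also have "\<dots> = rsym e r * gs s * (gs (tr u v) * csym e c)"
    by (simp add: gs_mult add_tr mult.assoc[symmetric]) (simp add: mult.assoc gs_mult add_tr)
  also have "\<dots> = - ?x"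
    using uv by (subst gs_csym) (auto intro!: tr_young_grp simp: sign_swap_id scale_mult scale_minus_left scale_1)
  finally have "?x + ?x = 0" by (metis add.right_inverse)
  then have "scale 2 ?x = 0" by (metis one_add_one scale_1 scale_add_left)
  then have "scale (1/2) (scale 2 ?x) = 0" by (simp add: scale_zero)
  then show ?thesis by (simp add: scale_scale scale_1)
qed

definition rowf :: "nat list \<Rightarrow> nat \<Rightarrow> nat" where "rowf lam k = fst (cells lam ! k)"
definition colf :: "nat list \<Rightarrow> nat \<Rightarrow> nat" where "colf lam k = snd (cells lam ! k)"

lemma length_cells [simp]: "length (cells lam) = sum_list lam"
proof -
  have "length (cells lam) = sum_list (map (\<lambda>i. lam ! i) [0..<length lam])"
    by (simp add: cells_def length_concat comp_def)
  then show ?thesis by (simp add: map_nth)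
qed

lemma set_cells: "set (cells lam) = {(i, j). i < length lam \<and> j < lam ! i}"
  by (auto simp: cells_def)

lemma distinct_cells: "distinct (cells lam)"
proof -
  have "distinct ns \<Longrightarrow> distinct (concat (map (\<lambda>i. map (Pair i) [0..<lam ! i]) ns))" for ns
    by (induction ns) (auto simp: distinct_map inj_on_def)
  then show ?thesis by (simp add: cells_def)
qed

lemma cell_nth: "k < sum_list lam \<Longrightarrow> cells lam ! k = (rowf lam k, colf lam k)"
  by (simp add: rowf_def colf_def)

lemma cell_bound: "k < sum_list lam \<Longrightarrow> rowf lam k < length lam \<and> colf lam k < lam ! rowf lam k"
  using nth_mem[of k "cells lam"] by (simp add: cell_nth set_cells)

lemma cell_inj:
  "k < sum_list lam \<Longrightarrow> l < sum_list lam \<Longrightarrow> rowf lam k = rowf lam l \<Longrightarrow> colf lam k = colf lam l \<Longrightarrow> k = l"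
  using distinct_cells[of lam] by (metis cell_nth length_cells nth_eq_iff_index_eq)

lemma cell_exists:
  assumes "i < length lam" "j < lam ! i"
  obtains k where "k < sum_list lam" "rowf lam k = i" "colf lam k = j"
proof -
  have "(i, j) \<in> set (cells lam)" using assms by (simp add: set_cells)
  then show ?thesis using that by (auto simp: in_set_conv_nth rowf_def colf_def)
qed

lemma partition_mono:
  assumes "partition lam" "i \<le> j" "j < length lam"
  shows "lam ! j \<le> lam ! i"
  using assms sorted_wrt_nth_less[of "(\<ge>)" lam i j] by (cases "i = j") (auto simp: partition_def)

lemma card_row:
  assumes "i < length lam"
  shows "card {k. k < sum_list lam \<and> rowf lam k = i} = lam ! i"
proof -
  have "bij_betw (colf lam) {k. k < sum_list lam \<and> rowf lam k = i} {..<lam ! i}"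
    unfolding bij_betw_def
    using cell_inj cell_bound cell_exists[OF assms] by (auto simp: inj_on_def image_iff) metis
  then show ?thesis by (simp add: bij_betw_same_card)
qed

text \<open>
  Moving a box to a higher row makes the first rows too long for the columns of \<open>lam\<close>: a column contains at most
  \<open>i + 1\<close> boxes of distinct rows \<open>\<le> i\<close>, and the partition \<open>lam\<close> attains this bound in each of its columns.
\<close>

lemma pigeonhole:
  assumes lam: "partition lam" and e: "e = sum_list lam" and y: "y < e" and i: "i < rowf lam y"
    and s: "s \<in> SS e"
  obtains u v where "u < e" "v < e" "u \<noteq> v" "colf lam u = colf lam v"
    "((rowf lam)(y := i)) (papp s u) = ((rowf lam)(y := i)) (papp s v)"
proof (rule ccontr)
  note goal = that
  assume no: "\<not> thesis"
  define r where "r = (rowf lam)(y := i)"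
  have inj: "u = v" if "u < e" "v < e" "colf lam u = colf lam v" "r (papp s u) = r (papp s v)" for u v
    using no goal[of u v] that unfolding r_def by blast
  define P where "P = {k. k < e \<and> r (papp s k) \<le> i}"
  define Q where "Q = {k. k < e \<and> rowf lam k \<le> i}"
  have fin: "finite P" "finite Q" by (simp_all add: P_def Q_def)
  have "papp s ` P = {k. k < e \<and> r k \<le> i}"
  proof (intro equalityI subsetI)
    fix k assume k: "k \<in> {k. k < e \<and> r k \<le> i}"
    then have "k = papp s (inv_into UNIV (papp s) k)" by simp
    then show "k \<in> papp s ` P" using k SS_less_iff[OF s] unfolding P_def by (metis (mono_tags, lifting) image_eqI mem_Collect_eq)
  qed (use SS_less[OF s] in \<open>auto simp: P_def\<close>)
  also have "\<dots> = insert y Q" using y by (auto simp: r_def Q_def)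
  finally have "card (papp s ` P) = card (insert y Q)" by simp
  moreover have "card (papp s ` P) = card P" by (rule card_image) (simp add: inj_on_def)
  moreover have "y \<notin> Q" using i by (simp add: Q_def)
  ultimately have "card P = Suc (card Q)" using fin by simp
  moreover have "card P \<le> card Q"
  proof -
    let ?C = "colf lam ` {..<e}"
    have split: "card A = (\<Sum>c\<in>?C. card {k\<in>A. colf lam k = c})" if "A \<subseteq> {..<e}" for A
    proof -
      have "card A = card (\<Union>c\<in>?C. {k\<in>A. colf lam k = c})" using that by (intro arg_cong[of _ _ card]) auto
      also have "\<dots> = (\<Sum>c\<in>?C. card {k\<in>A. colf lam k = c})"
        by (rule card_UN_disjoint) (use that finite_subset[of _ "{..<e}"] in auto)
      finally show ?thesis .
    qed
    have "card {k\<in>P. colf lam k = c} \<le> card {k\<in>Q. colf lam k = c}" for c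
    proof (cases "\<forall>k<e. colf lam k = c \<longrightarrow> rowf lam k \<le> i")
      case True
      then show ?thesis by (intro card_mono) (auto simp: fin P_def Q_def)
    next
      case False
      then obtain k where k: "k < e" "colf lam k = c" "i < rowf lam k" by auto
      have "card {k\<in>P. colf lam k = c} \<le> card {..i}"
        by (rule card_inj_on_le[of "\<lambda>k. r (papp s k)"]) (auto simp: inj_on_def P_def intro: inj)
      also have "\<dots> \<le> card (rowf lam ` {k\<in>Q. colf lam k = c})"
      proof (rule card_mono)
        show "{..i} \<subseteq> rowf lam ` {k\<in>Q. colf lam k = c}"
        proof
          fix a assume a: "a \<in> {..i}"
          have "a < length lam" "c < lam ! a"
            using partition_mono[OF lam, of a "rowf lam k"] cell_bound[of k lam] k e a by auto
          then obtain l where "l < sum_list lam" "rowf lam l = a" "colf lam l = c" by (rule cell_exists)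
          then show "a \<in> rowf lam ` {k\<in>Q. colf lam k = c}" using a e by (auto simp: Q_def)
        qed
      qed (simp add: fin)
      also have "\<dots> \<le> card {k\<in>Q. colf lam k = c}" by (rule card_image_le) (simp add: fin)
      finally show ?thesis .
    qed
    then have "(\<Sum>c\<in>?C. card {k\<in>P. colf lam k = c}) \<le> (\<Sum>c\<in>?C. card {k\<in>Q. colf lam k = c})"
      by (intro sum_mono) simp
    moreover have "P \<subseteq> {..<e}" "Q \<subseteq> {..<e}" by (auto simp: P_def Q_def)
    ultimately show ?thesis by (simp only: split)
  qed
  ultimately show False by simp
qed

definition young :: "nat list \<Rightarrow> 'k::field_char_0 galg" where
  "young lam = rsym (sum_list lam) (rowf lam) * csym (sum_list lam) (colf lam)"

lemma keys_mult_SS: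
  fixes x y :: "'k::field_char_0 galg"
  assumes "Poly_Mapping.keys x \<subseteq> SS e" "Poly_Mapping.keys y \<subseteq> SS e"
  shows "Poly_Mapping.keys (x * y) \<subseteq> SS e"
proof
  fix u assume "u \<in> Poly_Mapping.keys (x * y)"
  then obtain a b where "u = a + b" "a \<in> Poly_Mapping.keys x" "b \<in> Poly_Mapping.keys y"
    using keys_mult[of x y] by blast
  then show "u \<in> SS e" using assms by auto
qed

lemma keys_sum_SS:
  "(\<And>i. i \<in> A \<Longrightarrow> Poly_Mapping.keys (f i) \<subseteq> SS e) \<Longrightarrow> Poly_Mapping.keys (\<Sum>i\<in>A. f i) \<subseteq> SS e"
  using keys_sum[of f A] by blast

lemma keys_rsym: "Poly_Mapping.keys (rsym e r :: 'k::field_char_0 galg) \<subseteq> SS e"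
  unfolding rsym_def by (rule keys_sum_SS) (auto simp: gs_def young_grp_SS)

lemma keys_csym: "Poly_Mapping.keys (csym e r :: 'k::field_char_0 galg) \<subseteq> SS e"
  unfolding csym_def by (rule keys_sum_SS) (auto simp: gs_def scale_single young_grp_SS)

lemma keys_young: "Poly_Mapping.keys (young lam :: 'k::field_char_0 galg) \<subseteq> SS (sum_list lam)"
  unfolding young_def by (intro keys_mult_SS keys_rsym keys_csym)

lemma left_ideal_zero: "left_ideal e {0}"
  by (simp add: left_ideal_def scale_zero)

lemma highest_young:
  assumes "partition lam"
  shows "highest (sum_list lam) (rowf lam) {0} (young lam :: 'k::field_char_0 galg)"
  unfolding highest_def
proof (intro conjI ballI allI impI)
  let ?e = "sum_list lam"
  show inv: "gs s * young lam = (young lam :: 'k galg)" if "s \<in> young_grp ?e (rowf lam)" for s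
    by (simp only: young_def mult.assoc[symmetric] gs_rsym[OF that])
  fix y i assume y: "y < ?e" and i: "i < rowf lam y"
  let ?r = "(rowf lam)(y := i)"
  obtain N where N: "N > 0" "rsym ?e ?r * young lam =
      scale (of_nat N) (young lam + (\<Sum>x | x < ?e \<and> rowf lam x = i. gs (tr x y) * (young lam :: 'k galg)))"
    by (rule raised_rsym[OF inv y]) (use i in auto)
  have "rsym ?e ?r * young lam = (\<Sum>s\<in>young_grp ?e (rowf lam). rsym ?e ?r * gs s * csym ?e (colf lam) :: 'k galg)"
    unfolding young_def rsym_def[of _ "rowf lam"] by (simp add: sum_distrib_left sum_distrib_right mult.assoc)
  also have "\<dots> = 0"
  proof (rule sum.neutral, rule ballI)
    fix s assume "s \<in> young_grp ?e (rowf lam)"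
    then have s: "s \<in> SS ?e" by (rule young_grp_SS)
    obtain u v where "u < ?e" "v < ?e" "u \<noteq> v" "colf lam u = colf lam v" "?r (papp s u) = ?r (papp s v)"
      by (rule pigeonhole[OF assms refl y i s])
    then show "rsym ?e ?r * gs s * csym ?e (colf lam) = (0::'k galg)"
      by (intro rsym_csym_zero[OF s])
  qed
  finally have "scale (1 / of_nat N) (rsym ?e ?r * young lam) = (0::'k galg)" by (simp add: scale_zero)
  then show "young lam + (\<Sum>x | x < ?e \<and> rowf lam x = i. gs (tr x y) * young lam) \<in> {0::'k galg}"
    using N by (simp add: scale_scale scale_1)
qed

lemma young_sandwich:
  fixes x :: "'k::field_char_0 galg"
  assumes lam: "partition lam" and x: "Poly_Mapping.keys x \<subseteq> SS (sum_list lam)"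
  shows "\<exists>\<nu>. young lam * x * young lam = scale \<nu> (young lam)"
proof -
  let ?e = "sum_list lam"
  have "\<forall>s\<in>SS ?e. \<exists>\<kappa>. rsym ?e (rowf lam) * gs s * young lam = scale \<kappa> (young lam :: 'k galg)"
    using highest_weight_scalar[of _ ?e "rowf lam"] left_ideal_zero highest_young[OF lam]
    by (metis eq_iff_diff_eq_0 singletonD)
  then obtain \<kappa> where \<kappa>: "\<And>s. s \<in> SS ?e \<Longrightarrow> rsym ?e (rowf lam) * gs s * young lam = scale (\<kappa> s) (young lam :: 'k galg)"
    by metis
  let ?z = "csym ?e (colf lam) * x"
  have z: "Poly_Mapping.keys ?z \<subseteq> SS ?e" by (intro keys_mult_SS keys_csym x)
  have "young lam * x * young lam = rsym ?e (rowf lam) * (?z * young lam)"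
    by (simp add: young_def mult.assoc)
  also have "?z * young lam = (\<Sum>s\<in>Poly_Mapping.keys ?z. scale (Poly_Mapping.lookup ?z s) (gs s * young lam))"
    by (rule galg_mult_sum_left)
  also have "rsym ?e (rowf lam) * \<dots> =
      (\<Sum>s\<in>Poly_Mapping.keys ?z. scale (Poly_Mapping.lookup ?z s) (scale (\<kappa> s) (young lam)))"
    using z \<kappa> by (subst sum_distrib_left, intro sum.cong) (auto simp: scale_mult mult.assoc[symmetric])
  finally show ?thesis by (auto simp: scale_scale simp flip: scale_sum_left)
qed

lemma tau_gs: "tau (gs s :: 'k::field_char_0 galg) = (if s = 0 then 1 else 0)"
  by (simp add: tau_def gs_def lookup_single when_def)

lemma tau_young: "tau (young lam :: 'k::field_char_0 galg) = 1"
proof -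
  let ?e = "sum_list lam"
  let ?R = "young_grp ?e (rowf lam)" and ?C = "young_grp ?e (colf lam)"
  have trivial: "p = 0 \<and> q = 0" if "p \<in> ?R" "q \<in> ?C" "p + q = 0" for p q
  proof -
    have "p = - q" using that(3) by (simp add: eq_neg_iff_add_eq_0)
    then have p: "p \<in> ?R" "p \<in> ?C" using that(1) young_grp_closed(3)[OF that(2)] by simp_all
    then have "papp p k = k" if "k < ?e" for k
      using that SS_less[of p ?e k] cell_inj[of "papp p k" lam k] by (simp add: young_grp_def)
    moreover have "papp p k = k" if "\<not> k < ?e" for k
      using that p(1) by (auto simp: young_grp_def SS_def permutes_def)
    ultimately have "papp p = papp 0" by (simp only: fun_eq_iff papp_zero id_apply) blast
    then have "p = 0" by (simp only: papp_inject)
    then show ?thesis using that(3) by simp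
  qed
  have "tau (young lam :: 'k galg) =
      (\<Sum>p\<in>?R. \<Sum>q\<in>?C. of_int (sign (papp q)) * (if p + q = 0 then 1 else 0))"
    unfolding young_def rsym_def csym_def
    by (simp add: sum_distrib_left sum_distrib_right scale_mult gs_mult tau_sum tau_linear tau_gs)
      (simp add: sum.swap[of _ ?R])
  also have "\<dots> = (\<Sum>p\<in>?R. \<Sum>q\<in>?C. if p = 0 then if q = 0 then 1 else 0 else 0)"
    using trivial by (intro sum.cong refl) auto
  also have "\<dots> = 1" by (simp add: young_grp_closed sum.If_cases)
  finally show ?thesis .
qed

text \<open>
  The coefficients of the symmetrizers are integers, for which the form \<open>tau (x * star y)\<close> is positive
  definite; here \<open>star\<close> is the anti-automorphism that inverts permutations.
\<close>

definition star :: "'k::field_char_0 galg \<Rightarrow> 'k galg" where "star x = push uminus x"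

definition integral :: "'k::field_char_0 galg \<Rightarrow> bool" where
  "integral x \<longleftrightarrow> (\<forall>s. Poly_Mapping.lookup x s \<in> \<int>)"

lemma star_gs [simp]: "star (gs s) = gs (- s)" by (simp add: star_def gs_def push_single)

lemma star_linear: "star (x + y) = star x + star y" "star (scale c x) = scale c (star x)"
  by (simp_all add: star_def push_add push_scale)

lemma star_sum: "star (\<Sum>i\<in>A. f i) = (\<Sum>i\<in>A. star (f i))"
  by (simp add: star_def push_sum)

lemma star_mult: "star (x * y) = star y * star x" for x y :: "'k::field_char_0 galg"
proof -
  have 1: "star (gs s * y) = star y * gs (- s)" for s and y :: "'k galg"
  proof -
    have "star (gs s * (\<Sum>u\<in>K. scale (f u) (gs u))) = star (\<Sum>u\<in>K. scale (f u) (gs u)) * gs (- s)"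
      for K and f :: "sperm \<Rightarrow> 'k"
      by (simp add: sum_distrib_left sum_distrib_right scale_mult star_sum star_linear gs_mult minus_add)
    from this[of "Poly_Mapping.lookup y" "Poly_Mapping.keys y"] show ?thesis
      by (simp only: galg_sum_gs[symmetric])
  qed
  have "star ((\<Sum>u\<in>K. scale (f u) (gs u)) * y) = star y * star (\<Sum>u\<in>K. scale (f u) (gs u))"
    for K and f :: "sperm \<Rightarrow> 'k"
    by (simp add: sum_distrib_left sum_distrib_right scale_mult star_sum star_linear 1)
  from this[of "Poly_Mapping.lookup x" "Poly_Mapping.keys x"] show ?thesis
    by (simp only: galg_sum_gs[symmetric])
qed

lemma sum_young_grp_uminus: "(\<Sum>s\<in>young_grp e r. f (- s)) = (\<Sum>s\<in>young_grp e r. f s)"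
  by (rule sum.reindex_bij_witness[of _ uminus uminus]) (auto intro: young_grp_closed)

lemma star_rsym: "star (rsym e r) = rsym e r"
  unfolding rsym_def star_sum star_gs by (rule sum_young_grp_uminus)

lemma star_csym: "star (csym e r) = csym e r"
proof -
  have "star (csym e r) = (\<Sum>s\<in>young_grp e r. scale (of_int (sign (papp (- s)))) (gs (- s)))"
    by (simp only: csym_def star_sum star_linear star_gs sign_papp_uminus)
  also have "\<dots> = csym e r" unfolding csym_def by (rule sum_young_grp_uminus)
  finally show ?thesis .
qed

lemma integral_gs: "integral (scale (of_int n) (gs s))"
  by (simp add: integral_def gs_def scale_single lookup_single when_def)

lemma integral_sum: "(\<And>i. i \<in> A \<Longrightarrow> integral (f i)) \<Longrightarrow> integral (\<Sum>i\<in>A. f i)"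
  by (auto simp: integral_def lookup_sum intro!: Ints_sum)

lemma integral_mult: "integral x \<Longrightarrow> integral y \<Longrightarrow> integral (x * y)"
proof -
  assume x: "integral x" and y: "integral y"
  have "Poly_Mapping.lookup (x * y) s \<in> \<int>" for s
    unfolding galg_mult_sum_left[of x y] lookup_sum lookup_scale lookup_mult_gs
    using x y by (auto simp: integral_def intro!: Ints_sum Ints_mult)
  then show ?thesis by (simp add: integral_def)
qed

lemma integral_rsym: "integral (rsym e r)"
  unfolding rsym_def using integral_gs[of 1] by (intro integral_sum) (simp add: scale_1)

lemma integral_csym: "integral (csym e r)"
  unfolding csym_def by (intro integral_sum integral_gs)

lemma star_positive:
  fixes x :: "'k::field_char_0 galg"
  assumes x: "integral x" and 0: "x * star x = 0"
  shows "x = 0"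
proof -
  let ?K = "Poly_Mapping.keys x" and ?f = "Poly_Mapping.lookup x"
  have "tau (x * gs (- s)) = ?f s" for s
    unfolding tau_commute[of x] by (simp add: tau_def lookup_mult_gs)
  then have t1: "tau (x * (\<Sum>s\<in>K. scale (f s) (gs (- s)))) = (\<Sum>s\<in>K. f s * ?f s)" for K f
    by (simp add: sum_distrib_left scale_mult tau_sum tau_linear)
  have t2: "star x = (\<Sum>s\<in>?K. scale (?f s) (gs (- s)))"
    by (subst galg_sum_gs) (simp add: star_sum star_linear)
  have "(\<Sum>s\<in>?K. ?f s * ?f s) = tau (x * star x)" unfolding t2 t1 ..
  then have "(\<Sum>s\<in>?K. ?f s * ?f s) = 0" by (simp add: 0 tau_def)
  moreover have "\<forall>s. \<exists>n. ?f s = of_int n" using x by (auto simp: integral_def elim: Ints_cases)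
  then obtain z where z: "\<And>s. ?f s = of_int (z s)" using choice[of "\<lambda>s n. ?f s = of_int n"] by blast
  ultimately have "of_int (\<Sum>s\<in>?K. z s * z s) = (0::'k)" by simp
  then have "(\<Sum>s\<in>?K. z s * z s) = 0" by (simp only: of_int_eq_0_iff)
  then have "\<forall>s\<in>?K. z s * z s = 0" by (subst (asm) sum_nonneg_eq_0_iff) auto
  then have "?f s = 0" if "s \<in> ?K" for s using that z by simp
  then show ?thesis by (intro poly_mapping_eqI) (auto simp: in_keys_iff)
qed

lemma rsym_sq: "rsym e r * rsym e r = scale (of_nat (card (young_grp e r))) (rsym e r)"
proof -
  have "rsym e r * rsym e r = (\<Sum>s\<in>young_grp e r. gs s * rsym e r)"
    unfolding rsym_def[of e r] sum_distrib_right ..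
  then show ?thesis by (simp add: gs_rsym of_nat_scale)
qed

lemma csym_sq: "csym e r * csym e r = scale (of_nat (card (young_grp e r))) (csym e r)"
proof -
  have 1: "of_int (sign p) * of_int (sign p) = (1::'k::field_char_0)" for p :: "nat \<Rightarrow> nat"
    by (simp flip: of_int_mult)
  have "csym e r * csym e r = (\<Sum>s\<in>young_grp e r. scale (of_int (sign (papp s))) (gs s * csym e r))"
    by (simp add: csym_def[of e r] sum_distrib_right scale_mult)
  then show ?thesis by (simp add: gs_csym scale_scale 1 scale_1 of_nat_scale)
qed

definition hook :: "nat list \<Rightarrow> 'k::field_char_0" where
  "hook lam = tau (young lam * young lam)"

text \<open>
  With \<open>a\<close> and \<open>b\<close> the row and column symmetrizers, \<open>a b a\<close> is self-adjoint and proportional to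
  \<open>(a b) (a b)\<^sup>*\<close>.  Hence it does not vanish, nor does its square, which a vanishing hook number would force.
\<close>

lemma young_sq:
  assumes lam: "partition lam"
  shows "young lam * young lam = scale (hook lam) (young lam :: 'k::field_char_0 galg)"
    and "hook lam \<noteq> (0::'k)"
proof -
  let ?e = "sum_list lam"
  let ?a = "rsym ?e (rowf lam) :: 'k galg" and ?b = "csym ?e (colf lam) :: 'k galg"
  let ?na = "of_nat (card (young_grp ?e (rowf lam))) :: 'k" and ?nb = "of_nat (card (young_grp ?e (colf lam))) :: 'k"
  let ?c = "young lam :: 'k galg"
  obtain \<nu> where \<nu>: "?c * ?c = scale \<nu> ?c"
    using young_sandwich[OF lam, of 1] by (auto simp: SS_closed)
  then have hook: "hook lam = \<nu>" by (simp add: hook_def tau_linear tau_young)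
  then show "?c * ?c = scale (hook lam) ?c" using \<nu> by simp
  have N: "?na \<noteq> 0" "?nb \<noteq> 0" using young_grp_card by (simp_all add: less_imp_neq[THEN not_sym])
  have c: "?c = ?a * ?b" by (simp add: young_def)
  have int: "integral ?c" "integral (?c * ?a)"
    unfolding c by (intro integral_mult integral_rsym integral_csym)+
  have "tau ?c = 1" by (rule tau_young)
  then have c0: "?c \<noteq> 0" by (auto simp: tau_def)
  have "?c * star ?c = ?a * (?b * ?b) * ?a"
    by (simp only: c star_mult star_rsym star_csym mult.assoc)
  also have "\<dots> = scale ?nb (?c * ?a)" by (simp add: csym_sq scale_mult c)
  finally have "?c * ?a \<noteq> 0" using star_positive[OF int(1)] c0 by (auto simp: scale_zero)
  then have "(?c * ?a) * star (?c * ?a) \<noteq> 0" using star_positive[OF int(2)] by blast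
  also have "(?c * ?a) * star (?c * ?a) = ?a * ?b * (?a * ?a) * ?b * ?a"
    by (simp only: c star_mult star_rsym star_csym mult.assoc)
  also have "\<dots> = scale ?na (?c * ?c * ?a)" by (simp add: rsym_sq scale_mult c mult.assoc)
  finally have "?c * ?c \<noteq> 0" by (auto simp: scale_zero)
  then show "hook lam \<noteq> (0::'k)" using \<nu> hook by (auto simp: scale_0)
qed

lemma young_extract:
  fixes z' :: "'k::field_char_0 galg"
  assumes lam: "partition lam" and z': "Poly_Mapping.keys z' \<subseteq> SS (sum_list lam)"
  defines "z \<equiv> z' * young lam"
  shows "young lam * z = scale (hook lam * tau z) (young lam)"
proof -
  obtain \<nu> where \<nu>: "young lam * z' * young lam = scale \<nu> (young lam)"
    using young_sandwich[OF lam z'] by blast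
  have "\<nu> = tau (young lam * z)"
    using arg_cong[OF \<nu>, of tau] by (simp add: z_def tau_linear tau_young mult.assoc)
  also have "\<dots> = tau (z' * (young lam * young lam))"
    by (subst tau_commute) (simp add: z_def mult.assoc)
  also have "\<dots> = hook lam * tau z"
    by (simp add: young_sq(1)[OF lam] scale_mult tau_linear z_def)
  finally show ?thesis using \<nu> by (simp add: z_def mult.assoc)
qed

lemma young_grp_conj:
  assumes g: "g \<in> SS e" and r: "\<And>k l. k < e \<Longrightarrow> l < e \<Longrightarrow> r k = r l \<longleftrightarrow> r' (papp g k) = r' (papp g l)"
  shows "rsym e r = gs (- g) * rsym e r' * (gs g :: 'k::field_char_0 galg)"
proof -
  have "rsym e r = (\<Sum>s\<in>young_grp e r'. gs (- g + s + g) :: 'k galg)"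
    unfolding rsym_def
  proof (rule sum.reindex_bij_witness[of _ "\<lambda>s. - g + s + g" "\<lambda>s. g + s + - g"])
    fix s assume s: "s \<in> young_grp e r"
    have "r' (papp (g + s + - g) k) = r' k" if "k < e" for k
    proof -
      let ?l = "papp (- g) k"
      have l: "?l < e" using g that SS_less SS_closed(3) by blast
      then have "r (papp s ?l) = r ?l" using s by (simp add: young_grp_def)
      moreover have "papp s ?l < e" by (rule SS_less[OF young_grp_SS[OF s] l])
      ultimately have "r' (papp g (papp s ?l)) = r' (papp g ?l)" using r l by blast
      then show ?thesis by (simp del: add_uminus_conv_diff)
    qed
    moreover have "g + s + - g \<in> SS e" by (intro SS_closed g young_grp_SS[OF s])
    ultimately show "g + s + - g \<in> young_grp e r'" unfolding young_grp_def by blast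
  next
    fix s assume s: "s \<in> young_grp e r'"
    have "r (papp (- g + s + g) k) = r k" if "k < e" for k
    proof -
      have "papp g k < e" by (rule SS_less[OF g that])
      then have 1: "r' (papp s (papp g k)) = r' (papp g k)" using s by (simp add: young_grp_def)
      have 2: "papp (- g + s + g) k < e"
        by (rule SS_less[OF _ that]) (intro SS_closed g young_grp_SS[OF s])
      have "papp g (papp (- g + s + g) k) = papp s (papp g k)" by simp
      then show ?thesis using r[OF 2 that] 1 by simp
    qed
    moreover have "- g + s + g \<in> SS e" by (intro SS_closed g young_grp_SS[OF s])
    ultimately show "- g + s + g \<in> young_grp e r" unfolding young_grp_def by blast
  qed (simp_all add: add.assoc[symmetric], simp_all add: diff_conv_add_uminus add.assoc del: add_uminus_conv_diff)
  then show ?thesis by (simp add: rsym_def sum_distrib_left sum_distrib_right gs_mult)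
qed

text \<open>Up to renumbering its boxes, every set partition is given by the rows of a standard Young diagram.\<close>

lemma standardize:
  fixes r :: "nat \<Rightarrow> nat"
  obtains nu g where "partition nu" "sum_list nu = e" "g \<in> SS e"
    "\<And>k l. k < e \<Longrightarrow> l < e \<Longrightarrow> r k = r l \<longleftrightarrow> rowf nu (papp g k) = rowf nu (papp g l)"
proof -
  define xs where "xs = map r [0..<e]"
  define vs where "vs = rev (sort_key (count_list xs) (remdups xs))"
  define nu where "nu = map (count_list xs) vs"
  have vs: "set vs = set xs" "distinct vs" by (simp_all add: vs_def)
  have "sorted (map (count_list xs) (sort_key (count_list xs) (remdups xs)))" by simp
  then have "sorted_wrt (\<ge>) nu"
    unfolding nu_def vs_def rev_map[symmetric] sorted_wrt_rev by simp
  moreover have "0 \<notin> set nu" using vs by (auto simp: nu_def count_list_0_iff)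
  ultimately have part: "partition nu" by (simp add: partition_def)
  have "sum_list nu = sum (count_list xs) (set xs)"
    using vs by (simp add: nu_def sum_list_distinct_conv_sum_set)
  also have "\<dots> = length xs" by (rule sum_count_set) auto
  finally have sum: "sum_list nu = e" by (simp add: xs_def)
  define ys where "ys = map (\<lambda>c. vs ! fst c) (cells nu)"
  have ys: "ys = concat (map (\<lambda>v. replicate (count_list xs v) v) vs)"
  proof -
    have "ys = concat (map (\<lambda>i. map (\<lambda>j. vs ! i) [0..<nu ! i]) [0..<length nu])"
      by (simp add: ys_def cells_def map_concat comp_def)
    also have "\<dots> = concat (map (\<lambda>i. (\<lambda>v. replicate (count_list xs v) v) (vs ! i)) [0..<length vs])"
      by (intro arg_cong[of _ _ concat] map_cong) (auto simp: nu_def map_replicate_const)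
    also have "map (\<lambda>i. (\<lambda>v. replicate (count_list xs v) v) (vs ! i)) [0..<length vs] =
        map (\<lambda>v. replicate (count_list xs v) v) vs"
      by (rule nth_equalityI) auto
    finally show ?thesis .
  qed
  have "count (mset (concat (map (\<lambda>v. replicate (f v) v) ws))) v = (if v \<in> set ws then f v else 0)"
    if "distinct ws" for ws and f :: "nat \<Rightarrow> nat" and v
    using that by (induction ws) auto
  then have "mset xs = mset ys"
    using vs by (intro multiset_eqI) (simp add: ys count_mset count_list_0_iff)
  then obtain p where p: "p permutes {..<length ys}" "permute_list p ys = xs"
    by (rule mset_eq_permutation)
  have len: "length ys = e" using p(2) by (metis length_map length_permute_list length_upt minus_nat.diff_0 xs_def)
  define g where "g = Sperm p"
  have g: "papp g = p" unfolding g_def by (rule Sperm_inverse) (use p in auto)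
  have nth: "r k = vs ! rowf nu (p k)" if "k < e" for k
  proof -
    have "r k = permute_list p ys ! k" using that by (simp add: p(2) xs_def)
    also have "\<dots> = ys ! p k" using p(1) that len by (simp add: permute_list_nth)
    also have "\<dots> = vs ! rowf nu (p k)"
      using that len p(1) permutes_in_image[OF p(1), of k] by (simp add: ys_def rowf_def sum)
    finally show ?thesis .
  qed
  have "r k = r l \<longleftrightarrow> rowf nu (papp g k) = rowf nu (papp g l)" if "k < e" "l < e" for k l
  proof -
    have "p k < e" "p l < e" using that len permutes_in_image[OF p(1)] by auto
    then have "rowf nu (p k) < length vs" "rowf nu (p l) < length vs"
      using cell_bound[of "p k" nu] cell_bound[of "p l" nu] by (simp_all add: sum) (simp_all add: nu_def)
    then show ?thesis using that vs(2) by (simp add: nth g nth_eq_iff_index_eq)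
  qed
  moreover have "g \<in> SS e" using p len by (simp add: SS_def g)
  ultimately show ?thesis using that part sum by blast
qed

text \<open>
  Every left ideal that contains all \<open>young mu * gs x\<close> is everything.  Otherwise choose \<open>mu\<close> such that
  \<open>rsym mu * gs x\<close> is not in the ideal and such that the number of pairs of boxes in a common row is
  maximal.  Moving a box to a higher row of \<open>mu\<close> increases this number; hence \<open>m = rsym mu * gs x\<close> is a
  highest weight vector modulo the ideal.  By \<open>highest_weight_scalar\<close>, \<open>young mu\<close> then acts on \<open>m\<close> by
  the same scalar as on \<open>young mu\<close>, the nonzero hook number.
\<close>

lemma young_exhaustive:
  fixes I :: "'k::field_char_0 galg set"
  assumes I: "left_ideal e I"
    and young: "\<And>mu x. partition mu \<Longrightarrow> sum_list mu = e \<Longrightarrow> x \<in> SS e \<Longrightarrow> young mu * gs x \<in> I"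
  shows "1 \<in> I"
proof (rule ccontr)
  assume 1: "1 \<notin> I"
  define bad where "bad mu \<longleftrightarrow> partition mu \<and> sum_list mu = e \<and>
    (\<exists>x\<in>SS e. rsym e (rowf mu) * gs x \<notin> I)" for mu
  define pairs where "pairs r = {(k, l). k < e \<and> l < e \<and> r k = (r l :: nat)}" for r :: "nat \<Rightarrow> nat"
  have fin: "finite (pairs r)" for r
    by (rule finite_subset[of _ "{..<e} \<times> {..<e}"]) (auto simp: pairs_def)
  have le: "card (pairs r) \<le> e * e" for r
    using card_mono[of "{..<e} \<times> {..<e}" "pairs r"] by (auto simp: pairs_def)
  have std: "\<exists>nu. bad nu \<and> card (pairs (rowf nu)) = card (pairs r)"
    if x: "x \<in> SS e" "rsym e r * gs x \<notin> I" for r x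
  proof -
    obtain nu g where nu: "partition nu" "sum_list nu = e" "g \<in> SS e"
      and eq: "\<And>k l. k < e \<Longrightarrow> l < e \<Longrightarrow> r k = r l \<longleftrightarrow> rowf nu (papp g k) = rowf nu (papp g l)"
      using standardize[where r = r and e = e] by blast
    have conj: "rsym e r = gs (- g) * rsym e (rowf nu) * (gs g :: 'k galg)"
      by (rule young_grp_conj[OF nu(3)]) (rule eq)
    have "rsym e r * gs x = gs (- g) * (rsym e (rowf nu) * (gs (g + x) :: 'k galg))"
      unfolding conj by (simp add: mult.assoc gs_mult)
    then have "rsym e (rowf nu) * gs (g + x) \<notin> I"
      using x(2) left_idealD(4)[OF I SS_closed(3)[OF nu(3)]] by auto
    then have "bad nu" using nu x(1) by (auto simp: bad_def)
    moreover have "card (pairs r) = card (pairs (rowf nu))"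
    proof (rule bij_betw_same_card[of "map_prod (papp g) (papp g)"], rule bij_betw_imageI)
      show "inj_on (map_prod (papp g) (papp g)) (pairs r)" by (auto simp: inj_on_def)
      show "map_prod (papp g) (papp g) ` pairs r = pairs (rowf nu)"
      proof (intro equalityI subsetI)
        fix q assume "q \<in> pairs (rowf nu)"
        then obtain k l where kl: "q = (k, l)" "k < e" "l < e" "rowf nu k = rowf nu l" by (auto simp: pairs_def)
        let ?k = "papp (- g) k" and ?l = "papp (- g) l"
        have b: "?k < e" "?l < e" using kl nu(3) SS_less SS_closed(3) by blast+
        have "papp g ?k = k" "papp g ?l = l" by simp_all
        then have "(?k, ?l) \<in> pairs r" "q = map_prod (papp g) (papp g) (?k, ?l)"
          using kl b eq[OF b] by (simp_all add: pairs_def)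
        then show "q \<in> map_prod (papp g) (papp g) ` pairs r" by blast
      next
        fix q assume "q \<in> map_prod (papp g) (papp g) ` pairs r"
        then obtain k l where "q = (papp g k, papp g l)" "k < e" "l < e" "r k = r l" by (auto simp: pairs_def)
        then show "q \<in> pairs (rowf nu)" using SS_less[OF nu(3)] eq[of k l] by (simp add: pairs_def)
      qed
    qed
    ultimately show ?thesis by metis
  qed
  have "rsym e id = (gs 0 :: 'k galg)"
  proof -
    have "s = 0" if "s \<in> young_grp e id" for s
    proof -
      have "papp s k = papp 0 k" for k
        using that by (cases "k < e") (auto simp: young_grp_def SS_def permutes_def)
      then show ?thesis by (intro iffD1[OF papp_inject] ext)
    qed
    then have "young_grp e id = {0}" using young_grp_closed(1)[of e id] by blast
    then show ?thesis by (simp add: rsym_def)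
  qed
  then have "rsym e id * gs 0 \<notin> I" using 1 by simp
  then have "\<exists>nu. bad nu" using std[of 0 id] SS_closed(1) by blast
  then obtain mu where mu: "bad mu" "\<And>nu. bad nu \<Longrightarrow> card (pairs (rowf nu)) \<le> card (pairs (rowf mu))"
    using ex_has_greatest_nat[of bad _ "\<lambda>nu. card (pairs (rowf nu))" "Suc (e * e)"] le by (metis le_imp_less_Suc)
  have part: "partition mu" "sum_list mu = e" using mu(1) by (auto simp: bad_def)
  obtain x where x: "x \<in> SS e" "rsym e (rowf mu) * gs x \<notin> I" using mu(1) by (auto simp: bad_def)
  let ?r = "rowf mu"
  define m where "m = rsym e ?r * (gs x :: 'k galg)"
  have raised: "rsym e (?r(y := i)) * gs s \<in> I" if y: "y < e" and i: "i < ?r y" and s: "s \<in> SS e" for y i s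
  proof (rule ccontr)
    assume "rsym e (?r(y := i)) * gs s \<notin> I"
    then obtain nu where "bad nu" "card (pairs (rowf nu)) = card (pairs (?r(y := i)))" using std[OF s] by blast
    then have "card (pairs (?r(y := i))) \<le> card (pairs ?r)" using mu(2) by metis
    moreover have "card (pairs ?r) < card (pairs (?r(y := i)))"
    proof -
      define row where "row j = {k. k < e \<and> k \<noteq> y \<and> ?r k = j}" for j
      define rest where "rest = {(k, l). k < e \<and> l < e \<and> k \<noteq> y \<and> l \<noteq> y \<and> ?r k = ?r l}"
      have finr: "finite (row j)" for j by (simp add: row_def)
      have frest: "finite rest" by (rule finite_subset[OF _ fin[of ?r]]) (auto simp: rest_def pairs_def)
      have count: "card (pairs (?r(y := j))) = card rest + (1 + 2 * card (row j))" for j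
      proof -
        have "pairs (?r(y := j)) = rest \<union> (insert (y, y) ({y} \<times> row j \<union> row j \<times> {y}))"
          using y by (auto simp: pairs_def rest_def row_def split: if_splits)
        moreover have "card (insert (y, y) ({y} \<times> row j \<union> row j \<times> {y})) = 1 + 2 * card (row j)"
        proof -
          have "card ({y} \<times> row j \<union> row j \<times> {y}) = card ({y} \<times> row j) + card (row j \<times> {y})"
            by (rule card_Un_disjoint) (auto simp: finr, auto simp: row_def)
          moreover have "(y, y) \<notin> {y} \<times> row j \<union> row j \<times> {y}" by (auto simp: row_def)
          ultimately show ?thesis by (simp add: finr card_cartesian_product)
        qed
        moreover have "card (rest \<union> T) = card rest + card T"
          if "T = insert (y, y) ({y} \<times> row j \<union> row j \<times> {y})" for T
          by (rule card_Un_disjoint) (auto simp: frest finr that, auto simp: rest_def)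
        ultimately show ?thesis by metis
      qed
      have bd: "?r y < length mu" using cell_bound[of y mu] y part by simp
      have "insert y (row (?r y)) = {k. k < sum_list mu \<and> ?r k = ?r y}" using y part by (auto simp: row_def)
      then have "card (insert y (row (?r y))) = mu ! ?r y" using card_row[OF bd] by simp
      then have "Suc (card (row (?r y))) = mu ! ?r y" using finr by (simp add: row_def)
      moreover have "row i = {k. k < sum_list mu \<and> ?r k = i}" using i part by (auto simp: row_def)
      then have "card (row i) = mu ! i" using card_row[of i mu] i bd by simp
      moreover have "mu ! ?r y \<le> mu ! i" using partition_mono[OF part(1), of i "?r y"] i bd by simp
      ultimately show ?thesis using count[of i] count[of "?r y"] by simp
    qed
    ultimately show False by simp
  qed
  have inv: "gs s * m = m" if "s \<in> young_grp e ?r" for s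
    using that by (simp add: m_def gs_rsym flip: mult.assoc)
  have hw: "highest e ?r I m"
    unfolding highest_def
  proof (intro conjI ballI allI impI inv)
    fix y i assume y: "y < e" and i: "i < ?r y"
    obtain N where N: "N > 0" "rsym e (?r(y := i)) * m =
        scale (of_nat N) (m + (\<Sum>x | x < e \<and> ?r x = i. gs (tr x y) * m))"
      by (rule raised_rsym[OF inv y]) (use i in auto)
    have "rsym e (?r(y := i)) * m = (\<Sum>s\<in>young_grp e ?r. rsym e (?r(y := i)) * gs (s + x))"
      by (simp add: m_def rsym_def[of e ?r] sum_distrib_left sum_distrib_right gs_mult)
    also have "\<dots> \<in> I"
      by (intro left_idealD(7)[OF I] raised y i SS_closed x young_grp_SS)
    finally have "scale (1 / of_nat N) (rsym e (?r(y := i)) * m) \<in> I" by (rule left_idealD(3)[OF I])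
    then show "m + (\<Sum>x | x < e \<and> ?r x = i. gs (tr x y) * m) \<in> I"
      using N by (simp add: scale_scale scale_1)
  qed
  obtain \<kappa> where \<kappa>: "\<And>s J (m' :: 'k galg). s \<in> SS e \<Longrightarrow> left_ideal e J \<Longrightarrow> highest e ?r J m' \<Longrightarrow>
      rsym e ?r * gs s * m' - scale (\<kappa> s) m' \<in> J"
    using highest_weight_scalar[of _ e ?r] by metis
  let ?C = "young_grp e (colf mu)"
  define K where "K = (\<Sum>q\<in>?C. of_int (sign (papp q)) * \<kappa> q)"
  have K: "young mu * m' - scale K m' \<in> J" if J: "left_ideal e J" and h: "highest e ?r J m'" for J and m' :: "'k galg"
  proof -
    have "young mu * m' - scale K m' =
        (\<Sum>q\<in>?C. scale (of_int (sign (papp q))) (rsym e ?r * gs q * m' - scale (\<kappa> q) m'))"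
      by (simp add: young_def part(2) csym_def sum_distrib_left sum_distrib_right scale_mult mult.assoc
          scale_diff scale_scale sum_subtractf K_def scale_sum_left)
    also have "\<dots> \<in> J" by (intro left_idealD(7)[OF J] left_idealD(3)[OF J] \<kappa> J h young_grp_SS)
    finally show ?thesis .
  qed
  have "highest e ?r {0} (young mu :: 'k galg)" using highest_young[OF part(1)] unfolding part(2) .
  from K[OF left_ideal_zero this] have "young mu * young mu = scale K (young mu :: 'k galg)" by simp
  then have "scale (hook mu) (young mu) = scale K (young mu :: 'k galg)" using young_sq(1)[OF part(1)] by metis
  then have "tau (scale (hook mu) (young mu)) = tau (scale K (young mu :: 'k galg))" by (rule arg_cong)
  then have "K = hook mu" by (simp add: tau_linear tau_young)
  then have K0: "K \<noteq> 0" using young_sq(2)[OF part(1)] by simp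
  have "young mu * m \<in> I"
  proof -
    have "young mu * m = (\<Sum>s\<in>young_grp e ?r. young mu * gs (s + x))"
      by (simp add: m_def rsym_def[of e ?r] sum_distrib_left sum_distrib_right gs_mult)
    also have "\<dots> \<in> I" by (intro left_idealD(7)[OF I] young part SS_closed x young_grp_SS)
    finally show ?thesis .
  qed
  then have "young mu * m - (young mu * m - scale K m) \<in> I"
    by (intro left_idealD(6)[OF I] K[OF I hw])
  then have "scale K m \<in> I" by simp
  then have "scale (1 / K) (scale K m) \<in> I" by (rule left_idealD(3)[OF I])
  then show False using K0 x(2) by (simp add: scale_scale scale_1 m_def)
qed

section \<open>Tensors and Schur functors\<close>

text \<open>The linear extension of a map on basis vectors.\<close>

definition lext :: "('x \<Rightarrow> 'y \<Rightarrow>\<^sub>0 'k) \<Rightarrow> ('x \<Rightarrow>\<^sub>0 'k::field_char_0) \<Rightarrow> ('y \<Rightarrow>\<^sub>0 'k)" where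
  "lext f t = (\<Sum>x\<in>Poly_Mapping.keys t. scale (Poly_Mapping.lookup t x) (f x))"

definition linear_op :: "(('x \<Rightarrow>\<^sub>0 'k::field_char_0) \<Rightarrow> ('y \<Rightarrow>\<^sub>0 'k)) \<Rightarrow> bool" where
  "linear_op F \<longleftrightarrow> (\<forall>x y. F (x + y) = F x + F y) \<and> (\<forall>c x. F (scale c x) = scale c (F x))"

abbreviation sg :: "'x \<Rightarrow> ('x \<Rightarrow>\<^sub>0 'k::field_char_0)" where "sg x \<equiv> Poly_Mapping.single x 1"

lemma linear_opD: "linear_op F \<Longrightarrow> F (x + y) = F x + F y" "linear_op F \<Longrightarrow> F (scale c x) = scale c (F x)"
  by (simp_all add: linear_op_def)

lemma linear_op_zero: "linear_op F \<Longrightarrow> F 0 = 0"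
  using linear_opD(2)[of F 0 0] by (simp add: scale_0)

lemma linear_op_diff: "linear_op F \<Longrightarrow> F (x - y) = F x - F y"
  using linear_opD(1)[of F "x - y" y] by (simp add: algebra_simps)

lemma linear_op_sum: "linear_op F \<Longrightarrow> F (\<Sum>i\<in>A. f i) = (\<Sum>i\<in>A. F (f i))"
  by (induction A rule: infinite_finite_induct) (auto simp: linear_op_zero linear_opD)

lemma lext_sup:
  assumes "finite S" "Poly_Mapping.keys t \<subseteq> S"
  shows "lext f t = (\<Sum>x\<in>S. scale (Poly_Mapping.lookup t x) (f x))"
  unfolding lext_def by (rule sum.mono_neutral_left) (use assms in \<open>auto simp: in_keys_iff scale_0\<close>)

lemma linear_lext: "linear_op (lext f)"
  unfolding linear_op_def
proof (intro conjI allI)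
  fix s t :: "'a \<Rightarrow>\<^sub>0 'b" and c
  let ?S = "Poly_Mapping.keys s \<union> Poly_Mapping.keys t"
  have S: "finite ?S" "Poly_Mapping.keys s \<subseteq> ?S" "Poly_Mapping.keys t \<subseteq> ?S"
    "Poly_Mapping.keys (s + t) \<subseteq> ?S" by (auto simp: keys_add)
  show "lext f (s + t) = lext f s + lext f t"
    unfolding lext_sup[OF S(1,2)] lext_sup[OF S(1,3)] lext_sup[OF S(1,4)]
    by (simp add: lookup_add scale_add_left sum.distrib)
  show "lext f (scale c s) = scale c (lext f s)"
    unfolding lext_sup[OF finite_keys keys_scale[of c s]]
    by (simp add: lext_def lookup_scale scale_sum scale_scale)
qed

lemma lext_sg [simp]: "lext f (sg x) = f x"
  by (simp add: lext_def scale_1)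

lemma lext_zero [simp]: "lext f 0 = 0" by (simp add: lext_def)

lemma lext_cong: "(\<And>x. x \<in> Poly_Mapping.keys t \<Longrightarrow> f x = g x) \<Longrightarrow> lext f t = lext g t"
  unfolding lext_def by (rule sum.cong) auto

lemma linear_op_lext: "linear_op F \<Longrightarrow> F (lext f t) = lext (\<lambda>x. F (f x)) t"
  by (simp add: lext_def linear_op_sum linear_opD)

lemma lext_sgs: "lext sg t = t"
  by (simp add: lext_def scale_single sum_singles[symmetric])

lemma linear_op_eq:
  assumes "linear_op F" "linear_op G" "\<And>w. w \<in> Poly_Mapping.keys t \<Longrightarrow> F (sg w) = G (sg w)"
  shows "F t = G t"
proof -
  have "F (lext sg t) = G (lext sg t)"
    unfolding linear_op_lext[OF assms(1)] linear_op_lext[OF assms(2)] by (rule lext_cong) (rule assms)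
  then show ?thesis by (simp add: lext_sgs)
qed

lemma linear_push: "linear_op (push f)" by (simp add: linear_op_def push_add push_scale)

lemma linear_scale: "linear_op (scale c :: ('x \<Rightarrow>\<^sub>0 'k::field_char_0) \<Rightarrow> _)"
  by (simp add: linear_op_def scale_add scale_scale mult.commute)

lemma linear_comp: "linear_op F \<Longrightarrow> linear_op G \<Longrightarrow> linear_op (\<lambda>x. F (G x))"
  by (simp add: linear_op_def)

lemma linear_id: "linear_op (\<lambda>x. x)" by (simp add: linear_op_def)

lemma lext_swap: "lext (\<lambda>x. lext (f x) t) s = lext (\<lambda>y. lext (\<lambda>x. f x y) s) t"
  by (simp add: lext_def scale_sum scale_scale mult.commute) (rule sum.swap)

text \<open>The right action of the group algebra on tensors by place permutations.\<close>

definition ract :: "('i list \<Rightarrow>\<^sub>0 'k::field_char_0) \<Rightarrow> 'k galg \<Rightarrow> ('i list \<Rightarrow>\<^sub>0 'k)" where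
  "ract t x = lext (\<lambda>s. push (permute_list (papp s)) t) x"

definition tens :: "nat \<Rightarrow> ('i list \<Rightarrow>\<^sub>0 'k::field_char_0) set" where
  "tens d = {t. \<forall>w\<in>Poly_Mapping.keys t. length w = d}"

lemma tens_zero [simp]: "0 \<in> tens d" by (simp add: tens_def)
lemma tens_add [intro]: "s \<in> tens d \<Longrightarrow> t \<in> tens d \<Longrightarrow> s + t \<in> tens d"
  using keys_add[of s t] by (auto simp: tens_def)
lemma tens_scale [intro]: "t \<in> tens d \<Longrightarrow> scale c t \<in> tens d"
  using keys_scale[of c t] by (auto simp: tens_def)
lemma tens_sum [intro]: "(\<And>i. i \<in> A \<Longrightarrow> f i \<in> tens d) \<Longrightarrow> (\<Sum>i\<in>A. f i) \<in> tens d"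
  by (induction A rule: infinite_finite_induct) auto
lemma tens_sg [simp]: "sg w \<in> tens d \<longleftrightarrow> length w = d" by (simp add: tens_def)
lemma tens_lext [intro]: "(\<And>w. w \<in> Poly_Mapping.keys t \<Longrightarrow> f w \<in> tens d) \<Longrightarrow> lext f t \<in> tens d"
  unfolding lext_def by (intro tens_sum tens_scale)
lemma tens_push: "(\<And>w. w \<in> Poly_Mapping.keys t \<Longrightarrow> length (f w) = d) \<Longrightarrow> push f t \<in> tens d"
  using keys_push[of f t] by (auto simp: tens_def)

lemma linear_ract_right: "linear_op (\<lambda>x. ract t x)"
  unfolding ract_def by (rule linear_lext)

lemma linear_ract_left: "linear_op (\<lambda>t. ract t x)"
  unfolding linear_op_def ract_def
  by (auto simp: push_add push_scale lext_def scale_add scale_scale sum.distrib scale_sum mult.commute)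

lemma ract_gs: "ract t (gs s) = push (permute_list (papp s)) t"
  by (simp add: ract_def gs_def)

lemma ract_one [simp]: "ract t 1 = t"
proof -
  have "ract t 1 = push (permute_list id) t" using ract_gs[of t 0] by simp
  also have "\<dots> = push (\<lambda>x. x) t" by (rule push_cong) simp
  also have "\<dots> = t" by (rule poly_mapping_eqI) (simp add: lookup_push when_def in_keys_iff)
  finally show ?thesis .
qed

lemma ract_zero [simp]: "ract 0 x = 0"
  by (rule linear_op_zero[OF linear_ract_left])

lemma ract_tens: "t \<in> tens d \<Longrightarrow> ract t x \<in> tens d"
  unfolding ract_def by (intro tens_lext tens_push) (auto simp: tens_def)

lemma permute_list_add:
  "t \<in> SS (length w) \<Longrightarrow> permute_list (papp (s + t)) w = permute_list (papp t) (permute_list (papp s) w)"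
  by (simp add: SS_def permute_list_compose)

lemma ract_assoc:
  assumes t: "t \<in> tens d" and y: "Poly_Mapping.keys y \<subseteq> SS d"
  shows "ract (ract t x) y = ract t (x * y)"
proof (rule linear_op_eq[of "\<lambda>y. ract (ract t x) y" "\<lambda>y. ract t (x * y)" y])
  show "linear_op (\<lambda>y. ract t (x * y))"
    unfolding linear_op_def using linear_opD[OF linear_ract_right[of t]] by (simp add: distrib_left scale_mult)
  fix b assume "b \<in> Poly_Mapping.keys y"
  then have b: "b \<in> SS d" using y by auto
  show "ract (ract t x) (sg b) = ract t (x * sg b)"
  proof (rule linear_op_eq[of "\<lambda>x. ract (ract t x) (sg b)" "\<lambda>x. ract t (x * sg b)" x])
    show "linear_op (\<lambda>x. ract (ract t x) (sg b))"
      by (rule linear_comp[OF linear_ract_left linear_ract_right])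
    show "linear_op (\<lambda>x. ract t (x * sg b))"
      unfolding linear_op_def using linear_opD[OF linear_ract_right[of t]] by (simp add: distrib_right scale_mult)
    fix a
    have "ract (ract t (gs a)) (gs b) = ract t (gs a * gs b)"
      unfolding gs_mult ract_gs push_push
    proof (rule push_cong)
      fix w assume "w \<in> Poly_Mapping.keys t"
      then have "b \<in> SS (length w)" using t b by (simp add: tens_def)
      then show "permute_list (papp b) (permute_list (papp a) w) = permute_list (papp (a + b)) w"
        by (rule permute_list_add[symmetric])
    qed
    then show "ract (ract t (sg a)) (sg b) = ract t (sg a * sg b)" by (simp add: gs_def)
  qed
qed (rule linear_ract_right)

lemma row_group_conv: "row_group lam = papp ` young_grp (sum_list lam) (rowf lam)"
proof -
  have "row_group lam = {p \<in> papp ` SS (sum_list lam). \<forall>k<sum_list lam. rowf lam (p k) = rowf lam k}"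
    unfolding papp_image_SS row_group_def rowf_def by auto
  then show ?thesis by (auto simp: young_grp_def)
qed

lemma col_group_conv: "col_group lam = papp ` young_grp (sum_list lam) (colf lam)"
proof -
  have "col_group lam = {p \<in> papp ` SS (sum_list lam). \<forall>k<sum_list lam. colf lam (p k) = colf lam k}"
    unfolding papp_image_SS col_group_def colf_def by auto
  then show ?thesis by (auto simp: young_grp_def)
qed

lemma young_symmetrizer_ract: "young_symmetrizer lam t = ract t (young lam)"
proof -
  note lin = linear_opD[OF linear_ract_right[of t]] linear_op_sum[OF linear_ract_right[of t]]
  have "ract t (young lam) = (\<Sum>p\<in>young_grp (sum_list lam) (rowf lam). \<Sum>q\<in>young_grp (sum_list lam) (colf lam).
      scale (of_int (sign (papp q))) (push (permute_list (papp p \<circ> papp q)) t))"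
    unfolding young_def rsym_def csym_def
    by (simp add: sum_product scale_mult gs_mult lin ract_gs)
  also have "\<dots> = young_symmetrizer lam t"
    unfolding young_symmetrizer_def row_group_conv col_group_conv
    by (simp add: sum.reindex inj_on_subset[OF inj_papp])
  finally show ?thesis ..
qed

abbreviation VV :: "nat list \<Rightarrow> (nat list \<Rightarrow>\<^sub>0 'k::field_char_0) set" where
  "VV lam \<equiv> carrier (V_part lam)"

lemma V_part_simps [simp]:
  "ring.zero (V_part lam) = 0" "add (V_part lam) = (+)" "module.smult (V_part lam) = scale"
  "act (V_part lam) = tensor_act"
  by (simp_all add: V_part_def schur_def tensor_power_def)

lemma VV_def: "VV lam = (\<lambda>t. ract t (young lam)) ` tens (sum_list lam)"
  by (simp add: V_part_def schur_def tensor_power_def tens_def young_symmetrizer_ract)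

lemma VV_iff:
  assumes lam: "partition lam"
  shows "(x :: nat list \<Rightarrow>\<^sub>0 'k::field_char_0) \<in> VV lam \<longleftrightarrow>
    x \<in> tens (sum_list lam) \<and> ract x (young lam) = scale (hook lam) x"
proof
  assume "x \<in> VV lam"
  then obtain t :: "nat list \<Rightarrow>\<^sub>0 'k" where t: "t \<in> tens (sum_list lam)" "x = ract t (young lam)"
    by (auto simp: VV_def)
  have "ract x (young lam) = ract t (young lam * young lam)" using t ract_assoc keys_young by blast
  also have "\<dots> = scale (hook lam) x"
    using t by (simp add: young_sq(1)[OF lam] linear_opD[OF linear_ract_right])
  finally show "x \<in> tens (sum_list lam) \<and> ract x (young lam) = scale (hook lam) x"
    using t ract_tens by auto
next
  assume x: "x \<in> tens (sum_list lam) \<and> ract x (young lam) = scale (hook lam) x"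
  have "x = ract (scale (1 / hook lam) x) (young lam)"
    using x young_sq(2)[OF lam, where 'k='k] by (simp add: linear_opD[OF linear_ract_left] scale_scale scale_1)
  then show "x \<in> VV lam" unfolding VV_def using x by blast
qed

lemma VV_tens: "x \<in> VV lam \<Longrightarrow> x \<in> tens (sum_list lam)" by (auto simp: VV_def ract_tens)

lemma VV_closed:
  "0 \<in> VV lam" "x \<in> VV lam \<Longrightarrow> y \<in> VV lam \<Longrightarrow> x + y \<in> VV lam" "x \<in> VV lam \<Longrightarrow> scale c x \<in> VV lam"
  "t \<in> tens (sum_list lam) \<Longrightarrow> ract t (young lam) \<in> VV lam"
proof -
  note lin = linear_opD[OF linear_ract_left, symmetric]
  show 4: "t \<in> tens (sum_list lam) \<Longrightarrow> ract t (young lam) \<in> VV lam" for t by (auto simp: VV_def)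
  show "0 \<in> VV lam" using 4[of 0] by simp
  show "x \<in> VV lam \<Longrightarrow> y \<in> VV lam \<Longrightarrow> x + y \<in> VV lam" unfolding VV_def by (auto simp: lin)
  show "x \<in> VV lam \<Longrightarrow> scale c x \<in> VV lam" unfolding VV_def by (auto simp: lin)
qed

lemma VV_diff: "x \<in> VV lam \<Longrightarrow> y \<in> VV lam \<Longrightarrow> x - y \<in> VV lam"
  using VV_closed(2)[of x lam "scale (- 1) y"] VV_closed(3)[of y lam "- 1"] by (simp add: scale_minus_left scale_1)

lemma VV_sum: "(\<And>i. i \<in> A \<Longrightarrow> f i \<in> VV lam) \<Longrightarrow> (\<Sum>i\<in>A. f i) \<in> VV lam"
  by (induction A rule: infinite_finite_induct) (auto intro: VV_closed)

text \<open>Linear operators that commute with place permutations preserve the Schur functors.\<close>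

lemma VV_natural:
  fixes F :: "(nat list \<Rightarrow>\<^sub>0 'k::field_char_0) \<Rightarrow> (nat list \<Rightarrow>\<^sub>0 'k)"
  assumes lin: "linear_op F" and F: "\<And>t. t \<in> tens (sum_list lam) \<Longrightarrow> F t \<in> tens (sum_list lam)"
    and comm: "\<And>s w. s \<in> SS (sum_list lam) \<Longrightarrow> length w = sum_list lam \<Longrightarrow>
      F (sg (permute_list (papp s) w)) = push (permute_list (papp s)) (F (sg w))"
    and t: "t \<in> tens (sum_list lam)"
  shows "F (ract t (young lam)) = ract (F t) (young lam)"
proof (rule linear_op_eq[OF linear_comp[OF lin linear_ract_left] linear_comp[OF linear_ract_left lin]])
  fix w assume "w \<in> Poly_Mapping.keys t"
  then have w: "length w = sum_list lam" using t by (simp add: tens_def)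
  show "F (ract (sg w) (young lam)) = ract (F (sg w)) (young lam)"
    unfolding ract_def linear_op_lext[OF lin]
    by (rule lext_cong) (use w keys_young[of lam] in \<open>auto simp: push_single intro!: comm\<close>)
qed

text \<open>
  The derivation of the tensor algebra that extends the elementary matrix sending the \<open>i\<close>-th basis vector
  to the \<open>p\<close>-th.
\<close>

definition edge :: "nat \<Rightarrow> nat \<Rightarrow> (nat list \<Rightarrow>\<^sub>0 'k::field_char_0) \<Rightarrow> (nat list \<Rightarrow>\<^sub>0 'k)" where
  "edge p i = lext (\<lambda>w. \<Sum>j | j < length w \<and> w ! j = i. sg (w[j := p]))"

lemma linear_edge: "linear_op (edge p i)"
  unfolding edge_def by (rule linear_lext)

lemma edge_sg: "edge p i (sg w) = (\<Sum>j | j < length w \<and> w ! j = i. sg (w[j := p]))"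
  by (simp add: edge_def)

lemma edge_tens: "t \<in> tens d \<Longrightarrow> edge p i t \<in> tens d"
  unfolding edge_def by (intro tens_lext tens_sum) (simp add: tens_def)

lemma lookup_edge:
  "Poly_Mapping.lookup (edge p i t) v = (\<Sum>j | j < length v \<and> v ! j = p. Poly_Mapping.lookup t (v[j := i]))"
proof -
  have fin: "finite {j. j < length w \<and> P j}" for w :: "nat list" and P by simp
  have 1: "(\<Sum>j | j < length w \<and> w ! j = i. (1 :: 'a) when w[j := p] = v) =
      (\<Sum>j | j < length v \<and> v ! j = p. 1 when w = v[j := i])" for w
    unfolding when_def
    by (simp add: sum.If_cases Collect_conj_eq[symmetric] conj_assoc)
      (rule arg_cong[of _ _ card], auto simp: list_update_same_conv)
  have "Poly_Mapping.lookup (edge p i t) v = (\<Sum>w\<in>Poly_Mapping.keys t. Poly_Mapping.lookup t w *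
      (\<Sum>j | j < length w \<and> w ! j = i. (1 when w[j := p] = v)))"
    by (simp add: edge_def lext_def lookup_sum lookup_scale lookup_single)
  also have "\<dots> = (\<Sum>j | j < length v \<and> v ! j = p.
      \<Sum>w\<in>Poly_Mapping.keys t. Poly_Mapping.lookup t w * (1 when w = v[j := i]))"
    unfolding 1 sum_distrib_left by (rule sum.swap)
  also have "\<dots> = (\<Sum>j | j < length v \<and> v ! j = p. Poly_Mapping.lookup t (v[j := i]))"
    by (intro sum.cong refl) (simp add: when_def if_distrib[of "\<lambda>x. _ * x"] in_keys_iff cong: if_cong)
  finally show ?thesis .
qed

lemma permute_list_update:
  assumes "s \<in> SS (length w)" "j < length w"
  shows "permute_list (papp s) (w[papp s j := p]) = (permute_list (papp s) w)[j := p]"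
  using assms SS_less[OF assms(1)] by (intro nth_equalityI) (auto simp: permute_list_def nth_list_update)

lemma edge_permute:
  assumes s: "s \<in> SS (length w)"
  shows "edge p i (sg (permute_list (papp s) w)) = push (permute_list (papp s)) (edge p i (sg w))"
proof -
  have nth: "permute_list (papp s) w ! j = w ! papp s j" if "j < length w" for j
    using that by (simp add: permute_list_def)
  have "push (permute_list (papp s)) (edge p i (sg w)) =
      (\<Sum>j | j < length w \<and> w ! j = i. sg (permute_list (papp s) (w[j := p])))"
    by (simp add: edge_sg push_sum push_single)
  also have "\<dots> = (\<Sum>j | j < length w \<and> w ! papp s j = i. sg ((permute_list (papp s) w)[j := p]))"
    by (rule sum.reindex_bij_witness[of _ "papp s" "papp (- s)"])
      (use s SS_less[OF s] SS_less[OF SS_closed(3)[OF s]] in \<open>auto simp: permute_list_update simp flip: permute_list_update\<close>)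
  also have "\<dots> = edge p i (sg (permute_list (papp s) w))"
    unfolding edge_sg by (rule sum.cong) (auto simp: nth)
  finally show ?thesis ..
qed

lemma edge_ract:
  "t \<in> tens (sum_list lam) \<Longrightarrow> edge p i (ract t (young lam)) = ract (edge p i t) (young lam)"
  by (rule VV_natural[OF linear_edge edge_tens]) (auto intro: edge_permute)

lemma edge_VV: "x \<in> VV lam \<Longrightarrow> edge p i x \<in> VV lam"
  unfolding VV_def by (auto simp: edge_ract intro: edge_tens)

text \<open>
  The composite of the derivations that replace the letters of \<open>u\<close> by the distinct letters of \<open>ps\<close>.  On tensors
  that do not involve the letters of \<open>ps\<close>, every word of \<open>edges u ps x\<close> contains each letter of \<open>ps\<close> exactly
  once, and its coefficient is that of the word with these letters changed back.
\<close>

definition edges :: "nat list \<Rightarrow> nat list \<Rightarrow> (nat list \<Rightarrow>\<^sub>0 'k::field_char_0) \<Rightarrow> (nat list \<Rightarrow>\<^sub>0 'k)" where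
  "edges u ps t = foldr (\<lambda>(i, p). edge p i) (zip u ps) t"

lemma edges_Nil [simp]: "edges [] ps t = t" "edges u [] t = t"
  by (simp_all add: edges_def)

lemma edges_Cons [simp]: "edges (i # u) (p # ps) t = edge p i (edges u ps t)"
  by (simp add: edges_def)

lemma linear_edges: "linear_op (edges u ps :: (nat list \<Rightarrow>\<^sub>0 'k::field_char_0) \<Rightarrow> _)"
proof (induction u arbitrary: ps)
  case Nil
  have "edges [] ps = (\<lambda>t :: nat list \<Rightarrow>\<^sub>0 'k. t)" by (simp add: fun_eq_iff)
  then show ?case by (simp add: linear_id)
next
  case (Cons i u)
  note IH = Cons.IH
  show ?case
  proof (cases ps)
    case Nil
    then have "edges (i # u) ps = (\<lambda>t :: nat list \<Rightarrow>\<^sub>0 'k. t)" by (simp add: fun_eq_iff)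
    then show ?thesis by (simp only: linear_id)
  next
    case (Cons p qs)
    then have "edges (i # u) ps = (\<lambda>t :: nat list \<Rightarrow>\<^sub>0 'k. edge p i (edges u qs t))" by (simp add: fun_eq_iff)
    then show ?thesis using linear_comp[OF linear_edge IH[of qs]] by (simp only:)
  qed
qed

lemma lookup_edges:
  assumes "length u = length ps" "distinct ps" "\<forall>i\<in>set u. i < n" "\<forall>p\<in>set ps. n \<le> p"
    and "\<forall>w\<in>Poly_Mapping.keys t. \<forall>l\<in>set w. l < n"
  shows "Poly_Mapping.lookup (edges u ps t) v =
    (if mset (filter ((\<le>) n) v) = mset ps
     then Poly_Mapping.lookup t (map (\<lambda>l. case map_of (zip ps u) l of Some i \<Rightarrow> i | None \<Rightarrow> l) v) else 0)"
  using assms(1-4)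
proof (induction u ps arbitrary: v rule: list_induct2)
  case Nil
  show ?case
  proof (cases "filter ((\<le>) n) v = []")
    case False
    then obtain l where "l \<in> set v" "n \<le> l" by (auto simp: filter_empty_conv)
    then have "v \<notin> Poly_Mapping.keys t" using assms(5) by force
    then show ?thesis using False by (simp add: in_keys_iff)
  qed simp
next
  case (Cons i u p ps)
  let ?h = "\<lambda>v. mset (filter ((\<le>) n) v)"
  let ?J = "{j. j < length v \<and> v ! j = p}"
  let ?r = "\<lambda>ps u l. case map_of (zip ps u) l of Some i \<Rightarrow> i | None \<Rightarrow> (l::nat)"
  have pi: "n \<le> p" "i < n" "p \<notin> set ps" "\<And>q. q \<in> set ps \<Longrightarrow> n \<le> q" using Cons.prems by auto
  have IH: "Poly_Mapping.lookup (edges u ps t) v = (if ?h v = mset ps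
      then Poly_Mapping.lookup t (map (?r ps u) v) else 0)" for v
    using Cons by simp
  have step: "Poly_Mapping.lookup (edges (i # u) (p # ps) t) v =
      (\<Sum>j\<in>?J. Poly_Mapping.lookup (edges u ps t) (v[j := i]))"
    by (simp add: lookup_edge)
  have heavy: "?h v = add_mset p (?h (v[j := i]))" if "j \<in> ?J" for j
  proof -
    have v: "v = take j v @ p # drop (Suc j) v" "v[j := i] = take j v @ i # drop (Suc j) v"
      using that id_take_nth_drop[of j v] upd_conv_take_nth_drop[of j v i] by auto
    show ?thesis by (subst v(2), subst v(1)) (use pi in simp)
  qed
  show ?case
  proof (cases "?h v = mset (p # ps)")
    case False
    then have "?h (v[j := i]) \<noteq> mset ps" if "j \<in> ?J" for j using heavy[OF that] by auto
    then show ?thesis using False unfolding step IH by simp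
  next
    case True
    have "count (?h v) p = 1" using True pi by (simp add: not_in_iff[symmetric])
    moreover have "count_list (filter Q xs) p = count_list xs p" if "Q p" for Q and xs :: "nat list"
      using that by (induction xs) auto
    then have "count (?h v) p = count_list v p"
      using pi by (simp add: count_mset)
    ultimately have "count_list v p = 1" by simp
    moreover from this have "p \<in> set v" by (metis count_list_0_iff zero_neq_one)
    then obtain v1 v2 where v12: "v = v1 @ p # v2" "p \<notin> set v1" by (meson split_list_first)
    ultimately have "count_list v2 p = 0" by simp
    then have v: "v = v1 @ p # v2" "p \<notin> set v1" "p \<notin> set v2" using v12 by (simp_all add: count_list_0_iff)
    have "j = length v1" if "j \<in> ?J" for j
    proof (rule ccontr)
      assume "j \<noteq> length v1"
      then consider "j < length v1" | k where "j = Suc (length v1 + k)" by (metis less_imp_Suc_add linorder_neqE_nat)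
      then have "v ! j \<noteq> p"
      proof cases
        case 1
        then show ?thesis using v by (auto simp: nth_append in_set_conv_nth)
      next
        case 2
        then have "k < length v2" using that v(1) by simp
        then show ?thesis using v 2 by (auto simp: nth_append in_set_conv_nth)
      qed
      then show False using that by simp
    qed
    moreover have "length v1 \<in> ?J" using v(1) by simp
    ultimately have J: "?J = {length v1}" by blast
    have up: "v[length v1 := i] = v1 @ i # v2" by (simp add: v(1))
    have "?h (v[length v1 := i]) = mset ps" using heavy[of "length v1"] J True by simp
    moreover have "map (?r ps u) (v[length v1 := i]) = map (?r (p # ps) (i # u)) v"
    proof -
      have "?r ps u i = i" using pi by (auto split: option.splits dest!: map_of_SomeD set_zip_leftD) force
      moreover have "?r ps u l = ?r (p # ps) (i # u) l" if "l \<noteq> p" for l using that by simp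
      ultimately show ?thesis unfolding up v(1) using v(2,3) by auto
    qed
    ultimately show ?thesis unfolding step IH J using True by simp
  qed
qed

lemma edges_full:
  assumes len: "length u = d" "length ps = d" and ps: "distinct ps" "\<forall>p\<in>set ps. n \<le> p" and u: "\<forall>i\<in>set u. i < n"
    and t: "t \<in> tens d" "\<forall>w\<in>Poly_Mapping.keys t. \<forall>l\<in>set w. l < n"
  shows "edges u ps t = ract (sg ps)
    (\<Sum>s\<in>SS d. scale (Poly_Mapping.lookup t (permute_list (papp s) u)) (gs s))"
proof (rule poly_mapping_eqI)
  fix v
  let ?r = "\<lambda>l. case map_of (zip ps u) l of Some i \<Rightarrow> i | None \<Rightarrow> l"
  have rps: "map ?r ps = u"
    by (rule nth_equalityI) (use len ps in \<open>auto simp: map_of_zip_nth\<close>)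
  have rhs: "Poly_Mapping.lookup (ract (sg ps) (\<Sum>s\<in>SS d. scale (Poly_Mapping.lookup t (permute_list (papp s) u)) (gs s))) v =
      (\<Sum>s\<in>SS d. Poly_Mapping.lookup t (permute_list (papp s) u) * (1 when permute_list (papp s) ps = v))"
    by (simp add: linear_op_sum[OF linear_ract_right] linear_opD[OF linear_ract_right] ract_gs push_single
        lookup_sum lookup_scale lookup_single)
  have lhs: "Poly_Mapping.lookup (edges u ps t) v =
      (if mset (filter ((\<le>) n) v) = mset ps then Poly_Mapping.lookup t (map ?r v) else 0)"
    by (rule lookup_edges) (use assms in auto)
  show "Poly_Mapping.lookup (edges u ps t) v = Poly_Mapping.lookup (ract (sg ps)
      (\<Sum>s\<in>SS d. scale (Poly_Mapping.lookup t (permute_list (papp s) u)) (gs s))) v"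
  proof (cases "\<exists>s\<in>SS d. permute_list (papp s) ps = v")
    case True
    then obtain s where s: "s \<in> SS d" "permute_list (papp s) ps = v" by blast
    have perm: "papp s permutes {..<length ps}" using s len by (simp add: SS_def)
    have "set v = set ps" "mset v = mset ps" using s(2) perm by auto
    moreover have "filter ((\<le>) n) v = v" using ps \<open>set v = set ps\<close> by (simp add: filter_id_conv)
    moreover have "map ?r v = permute_list (papp s) u"
      using permute_list_map[OF perm, of ?r] s(2) rps by simp
    moreover have "permute_list (papp s') ps = v \<longleftrightarrow> s' = s" if "s' \<in> SS d" for s'
    proof
      assume eq: "permute_list (papp s') ps = v"
      have "papp s' k = papp s k" for k
      proof (cases "k < d")
        case True
        then have "ps ! papp s' k = ps ! papp s k"
          using arg_cong[OF trans[OF eq s(2)[symmetric]], of "\<lambda>x. x ! k"] len by (simp add: permute_list_def)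
        then show ?thesis using ps(1) len True SS_less[OF that] SS_less[OF s(1)] by (simp add: nth_eq_iff_index_eq)
      next
        case False
        then show ?thesis using that s(1) by (auto simp: SS_def permutes_def)
      qed
      then show "s' = s" by (intro iffD1[OF papp_inject] ext)
    qed (use s in simp)
    then have "(\<Sum>s'\<in>SS d. Poly_Mapping.lookup t (permute_list (papp s') u) * (1 when permute_list (papp s') ps = v)) =
        (\<Sum>s'\<in>SS d. if s' = s then Poly_Mapping.lookup t (permute_list (papp s) u) else 0)"
      by (intro sum.cong refl) (auto simp: when_def)
    ultimately show ?thesis unfolding lhs rhs using s(1) by simp
  next
    case False
    have "Poly_Mapping.lookup (edges u ps t) v = 0"
    proof (rule ccontr)
      assume "Poly_Mapping.lookup (edges u ps t) v \<noteq> 0"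
      then have h: "mset (filter ((\<le>) n) v) = mset ps" and k: "map ?r v \<in> Poly_Mapping.keys t"
        unfolding lhs by (auto simp: in_keys_iff split: if_splits)
      have "length v = d" using k t(1) by (auto simp: tens_def)
      moreover have "length (filter ((\<le>) n) v) = d" using arg_cong[OF h, of size] len by (simp only: size_mset)
      ultimately have "filter ((\<le>) n) v = v" by (metis filter_id_conv length_filter_less less_irrefl)
      then have "mset v = mset ps" using h by simp
      then obtain p where "p permutes {..<length ps}" "permute_list p ps = v" by (rule mset_eq_permutation)
      moreover have "p \<in> papp ` SS d" using calculation len by (simp add: papp_image_SS)
      ultimately show False using False by auto
    qed
    then show ?thesis unfolding rhs using False by (auto simp: when_def intro!: sum.neutral[symmetric])
  qed
qed

text \<open>
  Up to the hook number, antisymmetrizing and symmetrizing the new letters extracts a single coefficient of an element \<open>x\<close> of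
  \<open>V\<^sub>\<lambda>\<close>: this is \<open>young_extract\<close>, as the coefficients of \<open>x\<close> on the rearrangements of a word form a left
  multiple of the Young symmetrizer.
\<close>

definition probe :: "nat list \<Rightarrow> nat list \<Rightarrow> nat list \<Rightarrow> (nat list \<Rightarrow>\<^sub>0 'k::field_char_0) \<Rightarrow> (nat list \<Rightarrow>\<^sub>0 'k)" where
  "probe lam u ps t = lext (\<lambda>s. edges u (permute_list (papp s) ps) t) (young lam)"

lemma probe_coefficient:
  fixes x :: "nat list \<Rightarrow>\<^sub>0 'k::field_char_0"
  assumes lam: "partition lam" and x: "x \<in> VV lam" "\<forall>w\<in>Poly_Mapping.keys x. \<forall>l\<in>set w. l < n"
    and len: "length u = sum_list lam" "length ps = sum_list lam"
    and ps: "distinct ps" "\<forall>p\<in>set ps. n \<le> p" and u: "\<forall>i\<in>set u. i < n"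
  shows "probe lam u ps x = scale (hook lam * Poly_Mapping.lookup x u) (ract (sg ps) (young lam))"
proof -
  let ?d = "sum_list lam"
  define Z where "Z t = (\<Sum>s\<in>SS ?d. scale (Poly_Mapping.lookup t (permute_list (papp s) u)) (gs s))"
    for t :: "nat list \<Rightarrow>\<^sub>0 'k"
  have linZ: "linear_op Z"
    by (simp add: linear_op_def Z_def lookup_add lookup_scale scale_add_left sum.distrib scale_sum scale_scale)
  have keysZ: "Poly_Mapping.keys (Z t) \<subseteq> SS ?d" for t
    unfolding Z_def by (rule keys_sum_SS) (auto simp: gs_def scale_single)
  have Zperm: "Z (push (permute_list (papp r)) t) = Z t * gs r" if r: "r \<in> SS ?d" and t: "t \<in> tens ?d" for r t
  proof -
    have "Z t * gs r = (\<Sum>s\<in>SS ?d. scale (Poly_Mapping.lookup t (permute_list (papp s) u)) (gs (s + r)))"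
      by (simp add: Z_def sum_distrib_right scale_mult gs_mult)
    also have "\<dots> = (\<Sum>s\<in>SS ?d. scale (Poly_Mapping.lookup (push (permute_list (papp r)) t) (permute_list (papp s) u)) (gs s))"
    proof (rule sum.reindex_bij_witness[of _ "\<lambda>s. s + - r" "\<lambda>s. s + r"])
      fix s assume s: "s \<in> SS ?d"
      have inj: "inj_on (permute_list (papp r)) {w::nat list. length w = ?d}"
      proof (rule inj_on_inverseI[of _ "permute_list (papp (- r))"])
        fix w :: "nat list" assume "w \<in> {w. length w = ?d}"
        then show "permute_list (papp (- r)) (permute_list (papp r) w) = w"
          using permute_list_add[of "- r" w r] SS_closed(3)[OF r] by (simp del: papp_simps) simp
      qed
      have "permute_list (papp (s + r)) u = permute_list (papp r) (permute_list (papp s) u)"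
        using r len by (intro permute_list_add) simp
      moreover have "Poly_Mapping.keys t \<subseteq> {w. length w = ?d}" "length (permute_list (papp s) u) = ?d"
        using t len by (auto simp: tens_def)
      ultimately show "scale (Poly_Mapping.lookup (push (permute_list (papp r)) t) (permute_list (papp (s + r)) u)) (gs (s + r)) =
          scale (Poly_Mapping.lookup t (permute_list (papp s) u)) (gs (s + r))"
        using lookup_push_inj[OF inj, of t "permute_list (papp s) u"] by (simp only: mem_Collect_eq)
    qed (auto simp: add.assoc simp del: add_uminus_conv_diff intro!: SS_closed r)
    finally show ?thesis by (simp add: Z_def)
  qed
  obtain x' where x': "x' \<in> tens ?d" "x = ract x' (young lam)" using x(1) by (auto simp: VV_def)
  have "Z x = lext (\<lambda>s. Z (push (permute_list (papp s)) x')) (young lam)"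
    unfolding x'(2) ract_def by (rule linear_op_lext[OF linZ])
  also have "\<dots> = lext (\<lambda>s. Z x' * gs s) (young lam)"
    by (rule lext_cong) (use Zperm keys_young x'(1) in blast)
  also have "\<dots> = Z x' * lext gs (young lam)"
    by (simp add: lext_def sum_distrib_left scale_mult)
  also have "lext gs (young lam) = lext sg (young lam :: 'k galg)" by (rule lext_cong) (simp add: gs_def)
  also have "\<dots> = young lam" by (rule lext_sgs)
  finally have Zx: "Z x = Z x' * young lam" .
  have tauZ: "tau (Z x) = Poly_Mapping.lookup x u"
  proof -
    have "tau (Z x) = (\<Sum>s\<in>SS ?d. if s = 0 then Poly_Mapping.lookup x u else 0)"
      unfolding Z_def tau_sum by (rule sum.cong) (auto simp: tau_linear tau_gs)
    then show ?thesis by (simp add: SS_closed(1))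
  qed
  have "probe lam u ps x = lext (\<lambda>s. ract (sg ps) (gs s * Z x)) (young lam)"
    unfolding probe_def
  proof (rule lext_cong)
    fix s assume "s \<in> Poly_Mapping.keys (young lam :: 'k galg)"
    then have s: "s \<in> SS ?d" using keys_young by blast
    then have perm: "papp s permutes {..<length ps}" using len by (simp add: SS_def)
    have "edges u (permute_list (papp s) ps) x = ract (sg (permute_list (papp s) ps)) (Z x)"
      unfolding Z_def by (rule edges_full[where n = n]) (use len ps u x VV_tens[OF x(1)] perm in auto)
    also have "sg (permute_list (papp s) ps) = ract (sg ps) (gs s)" by (simp add: ract_gs push_single)
    also have "ract (ract (sg ps) (gs s)) (Z x) = ract (sg ps) (gs s * Z x)"
      by (rule ract_assoc[OF _ keysZ]) (simp add: len)
    finally show "edges u (permute_list (papp s) ps) x = ract (sg ps) (gs s * Z x)" .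
  qed
  also have "\<dots> = ract (sg ps) (lext (\<lambda>s. gs s * Z x) (young lam))"
    by (rule linear_op_lext[OF linear_ract_right, symmetric])
  also have "lext (\<lambda>s. gs s * Z x) (young lam) = young lam * Z x"
    unfolding lext_def by (rule galg_mult_sum_left[symmetric])
  also have "\<dots> = scale (hook lam * Poly_Mapping.lookup x u) (young lam)"
    using young_extract[OF lam keysZ[of x']] by (simp add: Zx[symmetric] tauZ)
  finally show ?thesis by (simp add: linear_opD[OF linear_ract_right])
qed

lemma probe_closed:
  assumes U: "\<And>x y. x \<in> U \<Longrightarrow> y \<in> U \<Longrightarrow> x + y \<in> U" "\<And>c x. x \<in> U \<Longrightarrow> scale c x \<in> U" "0 \<in> U"
    and edge: "\<And>p i x. p \<noteq> i \<Longrightarrow> x \<in> U \<Longrightarrow> edge p i x \<in> U"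
    and "x \<in> U" "set u \<inter> set ps = {}" "length ps = sum_list lam"
  shows "probe lam u ps x \<in> U"
proof -
  have edges: "set u \<inter> set ps = {} \<Longrightarrow> edges u ps x \<in> U" for u ps
  proof (induction u arbitrary: ps)
    case (Cons i u)
    then show ?case by (cases ps) (auto intro!: edge \<open>x \<in> U\<close>)
  qed (simp add: \<open>x \<in> U\<close>)
  have sum: "(\<And>i. i \<in> A \<Longrightarrow> f i \<in> U) \<Longrightarrow> (\<Sum>i\<in>A. f i) \<in> U" for f and A :: "sperm set"
    by (induction A rule: infinite_finite_induct) (auto intro: U)
  show ?thesis
    unfolding probe_def lext_def
  proof (intro sum U(2) edges)
    fix s assume "s \<in> Poly_Mapping.keys (young lam :: 'a galg)"
    then have "papp s permutes {..<length ps}" using keys_young assms(7) by (auto simp: SS_def)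
    then show "set u \<inter> set (permute_list (papp s) ps) = {}" using assms(6) by simp
  qed
qed

lemma bounded_letters:
  obtains n where "\<forall>w\<in>Poly_Mapping.keys (t :: nat list \<Rightarrow>\<^sub>0 'k::zero). \<forall>l\<in>set w. l < n" "m \<le> n"
proof -
  let ?L = "insert m (\<Union>w\<in>Poly_Mapping.keys t. set w)"
  have "finite ?L" by simp
  then have *: "l \<in> ?L \<Longrightarrow> l < Suc (Max ?L)" for l by (intro le_imp_less_Suc Max_ge)
  show ?thesis
  proof (rule that)
    show "\<forall>w\<in>Poly_Mapping.keys t. \<forall>l\<in>set w. l < Suc (Max ?L)" by (intro ballI *) blast
    show "m \<le> Suc (Max ?L)" by (intro less_imp_le *) blast
  qed
qed

text \<open>
  The Schur functors are irreducible: probing a nonzero coefficient of an element of a subrepresentation gives \<open>ract (sg ps)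
  (young lam)\<close> with distinct and arbitrarily large letters \<open>ps\<close>, which are then replaced by any others one at a time.
\<close>

lemma VV_irreducible:
  fixes U :: "(nat list \<Rightarrow>\<^sub>0 'k::field_char_0) set"
  assumes lam: "partition lam" and sub: "U \<subseteq> VV lam"
    and U: "\<And>x y. x \<in> U \<Longrightarrow> y \<in> U \<Longrightarrow> x + y \<in> U" "\<And>c x. x \<in> U \<Longrightarrow> scale c x \<in> U" "0 \<in> U"
    and edge: "\<And>p i x. p \<noteq> i \<Longrightarrow> x \<in> U \<Longrightarrow> edge p i x \<in> U"
    and x: "x \<in> U" "x \<noteq> 0"
  shows "U = VV lam"
proof -
  let ?d = "sum_list lam"
  have word: "ract (sg q) (young lam) \<in> U" if q: "length q = ?d" for q
  proof -
    obtain n where n: "\<forall>w\<in>Poly_Mapping.keys x. \<forall>l\<in>set w. l < n" "Suc (Max (insert 0 (set q))) \<le> n"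
      using bounded_letters by blast
    have qn: "l < n" if "l \<in> set q" for l
    proof -
      have "l \<le> Max (insert 0 (set q))" using that by (intro Max_ge) auto
      then show ?thesis using n(2) by linarith
    qed
    obtain u where u: "u \<in> Poly_Mapping.keys x" using x(2) by (metis keys_eq_empty ex_in_conv)
    then have lu: "length u = ?d" using sub x(1) VV_tens by (auto simp: tens_def)
    define ps where "ps = [n..<n + ?d]"
    have ps: "length ps = ?d" "distinct ps" "\<forall>p\<in>set ps. n \<le> p" by (simp_all add: ps_def)
    have "set u \<inter> set ps = {}" using n(1) u ps(3) by (meson disjoint_iff leD)
    then have "probe lam u ps x \<in> U"
      by (intro probe_closed[OF U edge x(1)]) (use ps in auto)
    also have "probe lam u ps x = scale (hook lam * Poly_Mapping.lookup x u) (ract (sg ps) (young lam))"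
      by (rule probe_coefficient[where n = n]) (use lam sub x(1) n(1) u lu ps in auto)
    finally have "scale (1 / (hook lam * Poly_Mapping.lookup x u))
        (scale (hook lam * Poly_Mapping.lookup x u) (ract (sg ps) (young lam))) \<in> U" by (rule U(2))
    moreover have "hook lam * Poly_Mapping.lookup x u \<noteq> 0"
      using young_sq(2)[OF lam, where 'k='k] u by (simp add: in_keys_iff)
    ultimately have start: "ract (sg ps) (young lam) \<in> U" by (simp add: scale_scale scale_1)
    define st where "st k = take k q @ drop k ps" for k
    have "ract (sg (st k)) (young lam) \<in> U" if "k \<le> ?d" for k
      using that
    proof (induction k)
      case 0
      then show ?case using start by (simp add: st_def)
    next
      case (Suc k)
      have st: "st k = take k q @ (n + k) # drop (Suc k) ps" "st (Suc k) = take k q @ q ! k # drop (Suc k) ps"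
        using Suc.prems q ps(1) by (simp_all add: st_def take_Suc_conv_app_nth Cons_nth_drop_Suc[symmetric]) (simp add: ps_def)
      have "{j. j < length (st k) \<and> st k ! j = n + k} = {k}"
      proof -
        have "j = k" if "j < length (st k)" "st k ! j = n + k" for j
        proof (rule ccontr)
          assume "j \<noteq> k"
          then consider "j < k" | "k < j" by linarith
          then show False
          proof cases
            case 1
            then have "st k ! j = q ! j" using Suc.prems q by (simp add: st(1) nth_append)
            then show False using qn[of "q ! j"] that(2) 1 Suc.prems q by simp
          next
            case 2
            then have "st k ! j = ps ! j" using Suc.prems q ps(1) that(1) by (simp add: st_def nth_append)
            moreover have "ps ! j = n + j" using that(1) Suc.prems q ps(1) by (simp add: st_def ps_def)
            ultimately show False using that(2) 2 by simp
          qed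
        qed
        moreover have "st k ! k = n + k" "k < length (st k)" using Suc.prems q by (simp_all add: st(1) nth_append)
        ultimately show ?thesis by blast
      qed
      moreover have "(st k)[k := q ! k] = st (Suc k)" using Suc.prems q by (simp add: st list_update_append)
      ultimately have "edge (q ! k) (n + k) (sg (st k)) = (sg (st (Suc k)) :: nat list \<Rightarrow>\<^sub>0 'k)" by (simp add: edge_sg)
      moreover have "edge (q ! k) (n + k) (ract (sg (st k)) (young lam)) \<in> U"
        using Suc qn[of "q ! k"] q by (intro edge) auto
      moreover have "length (st k) = ?d" using Suc.prems q ps(1) by (simp add: st_def)
      then have "edge (q ! k) (n + k) (ract (sg (st k)) (young lam)) =
          ract (edge (q ! k) (n + k) (sg (st k))) (young lam :: 'k galg)"
        by (intro edge_ract) simp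
      ultimately show ?case by simp
    qed
    from this[of ?d] show ?thesis using q ps(1) by (simp add: st_def)
  qed
  have "VV lam \<subseteq> U"
  proof
    fix y :: "nat list \<Rightarrow>\<^sub>0 'k" assume "y \<in> VV lam"
    then obtain t where t: "t \<in> tens ?d" "y = ract t (young lam)" by (auto simp: VV_def)
    have "y = ract (lext sg t) (young lam)" by (simp add: t(2) lext_sgs)
    also have "\<dots> = lext (\<lambda>w. ract (sg w) (young lam)) t" by (rule linear_op_lext[OF linear_ract_left])
    also have "\<dots> \<in> U"
    proof -
      have sum: "(\<And>i. i \<in> A \<Longrightarrow> f i \<in> U) \<Longrightarrow> (\<Sum>i\<in>A. f i) \<in> U" for f and A :: "nat list set"
        by (induction A rule: infinite_finite_induct) (auto intro: U)
      show ?thesis unfolding lext_def using t(1) by (intro sum U(2) word) (simp add: tens_def)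
    qed
    finally show "y \<in> U" .
  qed
  then show ?thesis using sub by blast
qed

section \<open>Polynomial families in a vector space\<close>

lemma KK_simps [simp]:
  "carrier KK = UNIV" "x \<otimes>\<^bsub>KK\<^esub> y = x * y" "\<one>\<^bsub>KK\<^esub> = 1" "\<zero>\<^bsub>KK\<^esub> = 0" "x \<oplus>\<^bsub>KK\<^esub> y = x + y"
  by (simp_all add: KK_def)

lemma cring_KK: "cring (KK :: 'k::field_char_0 ring)"
proof (rule cringI)
  show "abelian_group (KK :: 'k ring)"
    by (rule abelian_groupI) (auto simp: add.assoc add.commute intro: exI[of _ "- _"])
  show "comm_monoid (KK :: 'k ring)" by (rule comm_monoidI) (auto simp: mult.assoc mult.commute)
qed (simp add: algebra_simps)

locale kmod =
  fixes M :: "('k::field_char_0, 'a) gl_module" (structure)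
  assumes mod: "module KK M"
begin

sublocale module KK M by (rule mod)

lemma smult_c [simp, intro]: "x \<in> carrier M \<Longrightarrow> c \<odot> x \<in> carrier M"
  by simp

lemma smult_simps:
  assumes "x \<in> carrier M"
  shows "(c + d) \<odot> x = c \<odot> x \<oplus> d \<odot> x" "c \<odot> (d \<odot> x) = (c * d) \<odot> x" "1 \<odot> x = x" "0 \<odot> x = \<zero>"
    "(- c) \<odot> x = \<ominus> (c \<odot> x)" "(c - d) \<odot> x = c \<odot> x \<ominus> d \<odot> x"
proof -
  show 1: "(c + d) \<odot> x = c \<odot> x \<oplus> d \<odot> x" for c d using smult_l_distr[of c d x] assms by simp
  show "c \<odot> (d \<odot> x) = (c * d) \<odot> x" using smult_assoc1[of c d x] assms by simp
  show "1 \<odot> x = x" using smult_one assms by simp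
  show 0: "0 \<odot> x = \<zero>" using 1[of 0 0] M.add.l_cancel_one'[of "0 \<odot> x" "0 \<odot> x"] assms by simp
  show m: "(- c) \<odot> x = \<ominus> (c \<odot> x)" for c
    by (rule M.minus_equality[symmetric]) (use 1[of "- c" c] 0 assms in simp_all)
  show "(c - d) \<odot> x = c \<odot> x \<ominus> d \<odot> x"
    using 1[of c "- d"] by (simp add: m M.minus_eq)
qed

lemma smult_zero_right [simp]: "c \<odot> \<zero> = \<zero>"
  using smult_simps(2)[of \<zero> c 0] smult_simps(4)[of \<zero>] by simp

lemma smult_add_right: "x \<in> carrier M \<Longrightarrow> y \<in> carrier M \<Longrightarrow> c \<odot> (x \<oplus> y) = c \<odot> x \<oplus> c \<odot> y"
  using smult_r_distr[of c x y] by simp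

lemma smult_cancel: "x \<in> carrier M \<Longrightarrow> c \<noteq> 0 \<Longrightarrow> (1 / c) \<odot> (c \<odot> x) = x"
  by (simp add: smult_simps)

definition subspace :: "'a set \<Rightarrow> bool" where
  "subspace W \<longleftrightarrow> W \<subseteq> carrier M \<and> \<zero> \<in> W \<and> (\<forall>x\<in>W. \<forall>y\<in>W. x \<oplus> y \<in> W) \<and> (\<forall>c. \<forall>x\<in>W. c \<odot> x \<in> W)"

lemma subspaceD:
  assumes "subspace W"
  shows "x \<in> W \<Longrightarrow> x \<in> carrier M" "\<zero> \<in> W" "x \<in> W \<Longrightarrow> y \<in> W \<Longrightarrow> x \<oplus> y \<in> W" "x \<in> W \<Longrightarrow> c \<odot> x \<in> W"
    "x \<in> W \<Longrightarrow> \<ominus> x \<in> W" "x \<in> W \<Longrightarrow> y \<in> W \<Longrightarrow> x \<ominus> y \<in> W"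
proof -
  show 1: "x \<in> W \<Longrightarrow> x \<in> carrier M" "\<zero> \<in> W" "x \<in> W \<Longrightarrow> y \<in> W \<Longrightarrow> x \<oplus> y \<in> W" "x \<in> W \<Longrightarrow> c \<odot> x \<in> W"
    for x y c using assms by (auto simp: subspace_def)
  show m: "x \<in> W \<Longrightarrow> \<ominus> x \<in> W" for x using 1(4)[of x "- 1"] 1(1)[of x] by (simp add: smult_simps)
  show "x \<in> W \<Longrightarrow> y \<in> W \<Longrightarrow> x \<ominus> y \<in> W" using 1(3) m by (simp add: M.minus_eq)
qed

lemma module_subspace:
  assumes W: "subspace W"
  shows "module KK (M\<lparr>carrier := W\<rparr>)"
proof (rule moduleI[OF cring_KK])
  note W' = subspaceD[OF W]
  show "abelian_group (M\<lparr>carrier := W\<rparr>)"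
  proof (rule abelian_groupI)
    fix x assume x: "x \<in> carrier (M\<lparr>carrier := W\<rparr>)"
    then show "\<exists>y\<in>carrier (M\<lparr>carrier := W\<rparr>). y \<oplus>\<^bsub>M\<lparr>carrier := W\<rparr>\<^esub> x = \<zero>\<^bsub>M\<lparr>carrier := W\<rparr>\<^esub>"
      using W'(5)[of x] W'(1)[of x] by (intro bexI[of _ "\<ominus> x"]) (auto simp: M.l_neg)
  qed (auto simp: W'(2,3) dest!: W'(1) intro: M.a_assoc M.a_comm)
qed (use subspaceD[OF W] in \<open>auto simp: smult_simps smult_add_right\<close>)

text \<open>Polynomial functions of a scalar with coefficients in \<open>M\<close>, of degree at most \<open>N\<close>.\<close>

primrec polyfn :: "nat \<Rightarrow> ('k \<Rightarrow> 'a) \<Rightarrow> bool" where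
  "polyfn 0 u \<longleftrightarrow> (\<exists>c\<in>carrier M. u = (\<lambda>_. c))"
| "polyfn (Suc N) u \<longleftrightarrow> (\<exists>c\<in>carrier M. \<exists>v. polyfn N v \<and> u = (\<lambda>t. c \<oplus> t \<odot> v t))"

lemma polyfn_closed: "polyfn N u \<Longrightarrow> u t \<in> carrier M"
  by (induction N arbitrary: u) auto

lemma polyfn_const: "c \<in> carrier M \<Longrightarrow> polyfn N (\<lambda>_. c)"
proof (induction N arbitrary: c)
  case (Suc N)
  show ?case
    unfolding polyfn.simps by (intro bexI[of _ c] exI[of _ "\<lambda>_. \<zero>"] conjI Suc) (use Suc.prems in auto)
qed auto

lemma polyfn_Suc: "polyfn N u \<Longrightarrow> polyfn (Suc N) u"
proof (induction N arbitrary: u)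
  case 0
  then show ?case using polyfn_const[of _ "Suc 0"] by auto
next
  case (Suc N)
  then obtain c v where "c \<in> carrier M" "polyfn N v" "u = (\<lambda>t. c \<oplus> t \<odot> v t)" by auto
  then show ?case using Suc.IH[of v] unfolding polyfn.simps(2)[of "Suc N"] by blast
qed

lemma polyfn_mono: "polyfn N u \<Longrightarrow> N \<le> N' \<Longrightarrow> polyfn N' u"
  by (induction N') (auto simp: le_Suc_eq simp del: polyfn.simps(2) intro: polyfn_Suc)

lemma polyfn_add: "polyfn N u \<Longrightarrow> polyfn N v \<Longrightarrow> polyfn N (\<lambda>t. u t \<oplus> v t)"
proof (induction N arbitrary: u v)
  case (Suc N)
  obtain c u' where u: "c \<in> carrier M" "polyfn N u'" "u = (\<lambda>t. c \<oplus> t \<odot> u' t)" using Suc.prems by auto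
  obtain d v' where v: "d \<in> carrier M" "polyfn N v'" "v = (\<lambda>t. d \<oplus> t \<odot> v' t)" using Suc.prems by auto
  have "u t \<oplus> v t = (c \<oplus> d) \<oplus> t \<odot> (u' t \<oplus> v' t)" for t
    using u(1) v(1) polyfn_closed[OF u(2), of t] polyfn_closed[OF v(2), of t]
    by (simp add: u(3) v(3) smult_add_right M.a_ac)
  then show ?case
    unfolding polyfn.simps using u(1) v(1) Suc.IH[OF u(2) v(2)]
    by (intro bexI[of _ "c \<oplus> d"] exI[of _ "\<lambda>t. u' t \<oplus> v' t"]) auto
qed auto

definition poly :: "('k \<Rightarrow> 'a) \<Rightarrow> bool" where "poly u \<longleftrightarrow> (\<exists>N. polyfn N u)"

lemma poly_closed: "poly u \<Longrightarrow> u t \<in> carrier M" by (auto simp: poly_def intro: polyfn_closed)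

lemma poly_const: "c \<in> carrier M \<Longrightarrow> poly (\<lambda>_. c)" unfolding poly_def by (blast intro: polyfn_const)

lemma poly_add: "poly u \<Longrightarrow> poly v \<Longrightarrow> poly (\<lambda>t. u t \<oplus> v t)"
  unfolding poly_def using polyfn_add polyfn_mono max.cobounded1 max.cobounded2 by metis

lemma poly_step: "c \<in> carrier M \<Longrightarrow> poly v \<Longrightarrow> poly (\<lambda>t. c \<oplus> t \<odot> v t)"
proof -
  assume c: "c \<in> carrier M" and "poly v"
  then obtain N where "polyfn N v" by (auto simp: poly_def)
  then have "polyfn (Suc N) (\<lambda>t. c \<oplus> t \<odot> v t)" using c by auto
  then show ?thesis unfolding poly_def by blast
qed

lemma poly_times: "poly v \<Longrightarrow> poly (\<lambda>t. t \<odot> v t)"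
  using poly_step[of \<zero> v] poly_closed[of v] by simp

lemma poly_cases:
  assumes "poly u"
  obtains "u = (\<lambda>_. u 0)" | c v where "c \<in> carrier M" "poly v" "u = (\<lambda>t. c \<oplus> t \<odot> v t)"
proof -
  obtain N where "polyfn N u" using assms by (auto simp: poly_def)
  then show ?thesis using that by (cases N) (auto simp: poly_def)
qed

text \<open>Division by \<open>t - a\<close>.\<close>

lemma polyfn_divide:
  "polyfn (Suc N) u \<Longrightarrow> \<exists>w. polyfn N w \<and> (\<forall>t. u t = u a \<oplus> (t - a) \<odot> w t)"
proof (induction N arbitrary: u)
  case 0
  then obtain c d where "c \<in> carrier M" "d \<in> carrier M" "u = (\<lambda>t. c \<oplus> t \<odot> d)" by auto
  then have "\<forall>t. u t = u a \<oplus> (t - a) \<odot> d"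
    by (auto simp: M.a_assoc M.minus_eq simp flip: smult_simps(1))
  moreover have "polyfn 0 (\<lambda>_. d)" by (rule polyfn_const[OF \<open>d \<in> carrier M\<close>])
  ultimately show ?case by blast
next
  case (Suc N)
  then obtain c v where v: "c \<in> carrier M" "polyfn (Suc N) v" "u = (\<lambda>t. c \<oplus> t \<odot> v t)"
    unfolding polyfn.simps(2)[of "Suc N"] by blast
  from Suc.IH[OF v(2)] obtain w where w: "polyfn N w" "\<And>t. v t = v a \<oplus> (t - a) \<odot> w t" by blast
  have va: "v a \<in> carrier M" by (rule polyfn_closed[OF v(2)])
  have "u t = u a \<oplus> (t - a) \<odot> (v a \<oplus> t \<odot> w t)" for t
  proof -
    have wt: "w t \<in> carrier M" by (rule polyfn_closed[OF w(1)])
    have "u a \<oplus> (t - a) \<odot> (v a \<oplus> t \<odot> w t) = c \<oplus> ((a + (t - a)) \<odot> v a \<oplus> ((t - a) * t) \<odot> w t)"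
      using v(1) va wt by (simp only: v(3) smult_add_right smult_simps(1,2) M.a_assoc smult_c M.add.m_closed)
    also have "\<dots> = c \<oplus> t \<odot> (v a \<oplus> (t - a) \<odot> w t)"
      using v(1) va wt by (simp add: smult_add_right smult_simps(2) mult.commute)
    also have "\<dots> = u t" by (simp only: v(3) w(2)[of t, symmetric])
    finally show ?thesis by simp
  qed
  moreover have "polyfn (Suc N) (\<lambda>t. v a \<oplus> t \<odot> w t)" using va w(1) by auto
  ultimately show ?case by blast
qed

text \<open>The Vandermonde argument, the ground field being infinite.\<close>

lemma polyfn_cofinite:
  assumes W: "subspace W"
  shows "polyfn N u \<Longrightarrow> finite E \<Longrightarrow> (\<And>t. t \<notin> E \<Longrightarrow> u t \<in> W) \<Longrightarrow> u t \<in> W"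
proof (induction N arbitrary: u E t)
  case 0
  obtain s where "s \<notin> E" using ex_new_if_finite[OF infinite_UNIV_char_0 \<open>finite E\<close>] by blast
  then show ?case using 0 by auto
next
  case (Suc N)
  obtain a where a: "a \<notin> E" using ex_new_if_finite[OF infinite_UNIV_char_0 \<open>finite E\<close>] by blast
  obtain w where w: "polyfn N w" "\<And>t. u t = u a \<oplus> (t - a) \<odot> w t" using polyfn_divide[OF Suc.prems(1)] by blast
  note c = polyfn_closed[OF w(1)] polyfn_closed[OF Suc.prems(1)]
  have ua: "u a \<in> W" using Suc.prems(3) a by blast
  have "w s \<in> W" if "s \<notin> insert a E" for s
  proof -
    have "(s - a) \<odot> w s = u s \<ominus> u a"
      unfolding w(2)[of s] using c[of s] c[of a] by (simp add: M.minus_eq M.a_comm[of "u a"] M.a_assoc M.r_neg)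
    also have "\<dots> \<in> W" using Suc.prems(3) that ua by (intro subspaceD(6)[OF W]) auto
    finally have "(1 / (s - a)) \<odot> ((s - a) \<odot> w s) \<in> W" by (rule subspaceD(4)[OF W])
    moreover have "s - a \<noteq> 0" using that by simp
    ultimately show ?thesis using smult_cancel[OF c(1)[of s]] by metis
  qed
  then have "w t \<in> W" using Suc.IH[OF w(1), of "insert a E"] Suc.prems(2) by blast
  then show ?case unfolding w(2)[of t] using ua by (intro subspaceD[OF W])
qed

lemma poly_cofinite: "subspace W \<Longrightarrow> poly u \<Longrightarrow> finite E \<Longrightarrow> (\<And>t. t \<notin> E \<Longrightarrow> u t \<in> W) \<Longrightarrow> u t \<in> W"
  unfolding poly_def using polyfn_cofinite by blast

lemma poly_times_subspace:
  assumes W: "subspace W" and v: "poly v" and "\<And>t. t \<odot> v t \<in> W"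
  shows "v t \<in> W"
proof (rule poly_cofinite[OF W v, of "{0}"])
  fix t :: 'k assume "t \<notin> {0}"
  have "(1 / t) \<odot> (t \<odot> v t) \<in> W" using assms(3) by (rule subspaceD(4)[OF W])
  then show "v t \<in> W" using \<open>t \<notin> {0}\<close> poly_closed[OF v] by (simp add: smult_simps)
qed simp

end

lemma poly_subspace:
  fixes M :: "('k::field_char_0, 'a) gl_module"
  assumes M: "kmod M" and W: "kmod.subspace M W" and u: "kmod.poly M u" and uW: "\<And>t. u t \<in> W"
  shows "kmod.poly (M\<lparr>carrier := W\<rparr>) u"
proof -
  interpret M: kmod M by (rule M)
  interpret W: kmod "M\<lparr>carrier := W\<rparr>" by (rule kmod.intro[OF M.module_subspace[OF W]])
  have "M.polyfn N u \<Longrightarrow> (\<And>t. u t \<in> W) \<Longrightarrow> W.polyfn N u" for N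
  proof (induction N arbitrary: u)
    case (Suc N)
    then obtain c v where v: "c \<in> carrier M" "M.polyfn N v" "u = (\<lambda>t. c \<oplus>\<^bsub>M\<^esub> t \<odot>\<^bsub>M\<^esub> v t)" by auto
    have pv: "M.poly v" using v(2) by (auto simp: M.poly_def)
    have c: "c \<in> W" using Suc.prems(2)[of 0] v(1) M.poly_closed[OF pv] by (simp add: v(3) M.smult_simps)
    have "v t \<in> W" for t
    proof (rule M.poly_times_subspace[OF W pv])
      fix t
      have "t \<odot>\<^bsub>M\<^esub> v t = u t \<ominus>\<^bsub>M\<^esub> c"
        using v(1) M.poly_closed[OF pv, of t]
        by (simp add: v(3) M.minus_eq M.M.a_comm[of c] M.M.a_assoc M.M.r_neg)
      then show "t \<odot>\<^bsub>M\<^esub> v t \<in> W" using M.subspaceD(6)[OF W Suc.prems(2) c] by simp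
    qed
    then show ?case using c Suc.IH[OF v(2)] v(3) by auto
  next
    case 0
    then obtain c where "u = (\<lambda>_. c)" by auto
    then show ?case using "0.prems"(2)[of 0] by auto
  qed
  then show ?thesis using u uW by (auto simp: M.poly_def W.poly_def)
qed

lemma poly_hom:
  fixes M :: "('k::field_char_0, 'a) gl_module" and M' :: "('k, 'b) gl_module"
  assumes M: "kmod M" "kmod M'" and f: "\<And>x. x \<in> carrier M \<Longrightarrow> f x \<in> carrier M'"
    "\<And>x y. x \<in> carrier M \<Longrightarrow> y \<in> carrier M \<Longrightarrow> f (x \<oplus>\<^bsub>M\<^esub> y) = f x \<oplus>\<^bsub>M'\<^esub> f y"
    "\<And>c x. x \<in> carrier M \<Longrightarrow> f (c \<odot>\<^bsub>M\<^esub> x) = c \<odot>\<^bsub>M'\<^esub> f x"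
    and u: "kmod.poly M u"
  shows "kmod.poly M' (\<lambda>t. f (u t))"
proof -
  interpret M: kmod M by (rule M)
  interpret M': kmod M' by (rule M)
  have "M.polyfn N u \<Longrightarrow> M'.polyfn N (\<lambda>t. f (u t))" for N
  proof (induction N arbitrary: u)
    case (Suc N)
    then obtain c v where v: "c \<in> carrier M" "M.polyfn N v" "u = (\<lambda>t. c \<oplus>\<^bsub>M\<^esub> t \<odot>\<^bsub>M\<^esub> v t)" by auto
    have "f (u t) = f c \<oplus>\<^bsub>M'\<^esub> t \<odot>\<^bsub>M'\<^esub> f (v t)" for t
      using v(1) M.polyfn_closed[OF v(2), of t] by (simp add: v(3) f)
    then show ?case using Suc.IH[OF v(2)] f(1)[OF v(1)] by auto
  qed (auto simp: f)
  then show ?thesis using u by (auto simp: M.poly_def M'.poly_def)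
qed


section \<open>Infinitesimal action\<close>

text \<open>The elementary unipotent matrix that sends the \<open>i\<close>-th basis vector \<open>e\<^sub>i\<close> to \<open>e\<^sub>i + s e\<^sub>p\<close>.\<close>

definition el :: "nat \<Rightarrow> nat \<Rightarrow> 'k::field_char_0 \<Rightarrow> 'k mat" where
  "el p i s a b = mat_one a b + (if a = p \<and> b = i then s else 0)"

lemma el_GL:
  fixes s :: "'k::field_char_0"
  assumes "p \<noteq> i"
  shows "el p i s \<in> GL"
proof -
  define n where "n = Suc (max p i)"
  have block: "el p i s \<in> mat_block n" for s :: 'k
    by (auto simp: el_def mat_block_def n_def)
  have mult: "mat_mult (el p i s) (el p i r) = el p i (s + r)" for s r :: 'k
  proof (intro ext)
    fix a b
    have sub: "{k. el p i s a k \<noteq> 0} \<subseteq> {a, i}" by (auto simp: el_def mat_one_def)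
    have "mat_mult (el p i s) (el p i r) a b = (\<Sum>k\<in>{a, i}. el p i s a k * el p i r k b)"
      unfolding mat_mult_def by (rule sum.mono_neutral_left) (use sub in auto)
    also have "\<dots> = el p i (s + r) a b"
      using assms by (cases "a = i") (auto simp: el_def mat_one_def)
    finally show "mat_mult (el p i s) (el p i r) a b = el p i (s + r) a b" .
  qed
  have "el p i 0 = (mat_one :: 'k mat)" by (simp add: el_def fun_eq_iff)
  then have "el p i s \<in> GLn n"
    unfolding GLn_def using block mult[of s "- s"] mult[of "- s" s] by (auto intro!: bexI[of _ "el p i (- s)"])
  then show ?thesis unfolding GL_def by (auto simp: n_def intro!: bexI[of _ "n"])
qed

lemma shift_el: "shift_mat n (el p i s) = el (n + p) (n + i) s"
  by (auto simp: shift_mat_def el_def mat_one_def fun_eq_iff)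

text \<open>
  \<open>lie M p i x x'\<close> says that the unipotent subgroup acts on \<open>x\<close> polynomially, with derivative \<open>x'\<close> at \<open>s = 0\<close>.
\<close>

definition lie :: "('k::field_char_0, 'a) gl_module \<Rightarrow> nat \<Rightarrow> nat \<Rightarrow> 'a \<Rightarrow> 'a \<Rightarrow> bool" where
  "lie M p i x x' \<longleftrightarrow> x \<in> carrier M \<and>
     (\<exists>v. kmod.poly M v \<and> v 0 = x' \<and> (\<forall>s. act M (el p i s) x = x \<oplus>\<^bsub>M\<^esub> s \<odot>\<^bsub>M\<^esub> v s))"

context kmod
begin

lemma lieI: "x \<in> carrier M \<Longrightarrow> poly v \<Longrightarrow> v 0 = x' \<Longrightarrow> (\<And>s. act M (el p i s) x = x \<oplus> s \<odot> v s) \<Longrightarrow> lie M p i x x'"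
  by (auto simp: lie_def)

lemma lieE:
  assumes "lie M p i x x'"
  obtains v where "x \<in> carrier M" "poly v" "v 0 = x'" "\<And>s. act M (el p i s) x = x \<oplus> s \<odot> v s"
  using assms by (auto simp: lie_def)

lemma lie_closed: "lie M p i x x' \<Longrightarrow> x \<in> carrier M \<and> x' \<in> carrier M"
  by (erule lieE) (auto intro: poly_closed)

lemma lie_subspace:
  assumes W: "subspace W" and x: "x \<in> W" and st: "\<And>s. act M (el p i s) x \<in> W" and l: "lie M p i x x'"
  shows "x' \<in> W"
proof -
  obtain v where v: "x \<in> carrier M" "poly v" "v 0 = x'" "\<And>s. act M (el p i s) x = x \<oplus> s \<odot> v s"
    using l unfolding lie_def by blast
  have "v 0 \<in> W"
  proof (rule poly_times_subspace[OF W v(2)])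
    fix s
    have "s \<odot> v s = act M (el p i s) x \<ominus> x"
      using v(1) poly_closed[OF v(2), of s] by (simp add: v(4) M.minus_eq M.a_comm[of x] M.a_assoc M.r_neg)
    then show "s \<odot> v s \<in> W" using subspaceD(6)[OF W st x] by simp
  qed
  then show ?thesis by (simp add: v(3))
qed

lemma lie_add:
  assumes add: "\<And>s x y. x \<in> carrier M \<Longrightarrow> y \<in> carrier M \<Longrightarrow>
      act M (el p i s) (x \<oplus> y) = act M (el p i s) x \<oplus> act M (el p i s) y"
    and l: "lie M p i x x'" "lie M p i y y'"
  shows "lie M p i (x \<oplus> y) (x' \<oplus> y')"
proof -
  obtain u where u: "x \<in> carrier M" "poly u" "u 0 = x'" "\<And>s. act M (el p i s) x = x \<oplus> s \<odot> u s"
    using l(1) unfolding lie_def by blast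
  obtain v where v: "y \<in> carrier M" "poly v" "v 0 = y'" "\<And>s. act M (el p i s) y = y \<oplus> s \<odot> v s"
    using l(2) unfolding lie_def by blast
  show ?thesis
  proof (rule lieI[of _ "\<lambda>s. u s \<oplus> v s"])
    fix s
    show "act M (el p i s) (x \<oplus> y) = x \<oplus> y \<oplus> s \<odot> (u s \<oplus> v s)"
      using u(1) v(1) poly_closed[OF u(2), of s] poly_closed[OF v(2), of s]
      by (simp add: add u(4) v(4) smult_add_right M.a_ac)
  qed (use u v in \<open>auto intro: poly_add\<close>)
qed

lemma lie_const: "x \<in> carrier M \<Longrightarrow> (\<And>s. act M (el p i s) x = x) \<Longrightarrow> lie M p i x \<zero>"
  by (rule lieI[of _ "\<lambda>_. \<zero>"]) (auto intro: poly_const)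

end

lemma lie_hom:
  fixes M :: "('k::field_char_0, 'a) gl_module" and M' :: "('k, 'b) gl_module"
  assumes M: "kmod M" "kmod M'" and f: "\<And>x. x \<in> carrier M \<Longrightarrow> f x \<in> carrier M'"
    "\<And>x y. x \<in> carrier M \<Longrightarrow> y \<in> carrier M \<Longrightarrow> f (x \<oplus>\<^bsub>M\<^esub> y) = f x \<oplus>\<^bsub>M'\<^esub> f y"
    "\<And>c x. x \<in> carrier M \<Longrightarrow> f (c \<odot>\<^bsub>M\<^esub> x) = c \<odot>\<^bsub>M'\<^esub> f x"
    and eq: "\<And>s. act M' (el p i s) (f x) = f (act M (el p i s) x)"
    and l: "lie M p i x x'"
  shows "lie M' p i (f x) (f x')"
proof -
  interpret M: kmod M by (rule M)
  interpret M': kmod M' by (rule M)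
  obtain v where v: "x \<in> carrier M" "M.poly v" "v 0 = x'" "\<And>s. act M (el p i s) x = x \<oplus>\<^bsub>M\<^esub> s \<odot>\<^bsub>M\<^esub> v s"
    using l unfolding lie_def by blast
  show ?thesis
  proof (rule M'.lieI)
    show "M'.poly (\<lambda>s. f (v s))" by (rule poly_hom[OF M f v(2)])
    show "act M' (el p i s) (f x) = f x \<oplus>\<^bsub>M'\<^esub> s \<odot>\<^bsub>M'\<^esub> f (v s)" for s
      using v(1) M.poly_closed[OF v(2), of s] by (simp add: eq v(4) f)
  qed (use v f in auto)
qed

definition fincol :: "('i \<Rightarrow> 'i \<Rightarrow> 'k::field_char_0) \<Rightarrow> bool" where
  "fincol m \<longleftrightarrow> (\<forall>j. finite {i. m i j \<noteq> 0})"

lemma fincol_GL: "g \<in> GL \<Longrightarrow> fincol g" "g \<in> GL \<Longrightarrow> fincol (shift_mat n g)"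
  by (simp_all add: fincol_def GL_finite_column shift_mat_finite_column)

lemma lookup_tensor_act_sg:
  "fincol m \<Longrightarrow> Poly_Mapping.lookup (tensor_act m (sg w)) v = tensor_coeff m v w"
  by (simp add: lookup_tensor_act fincol_def)

lemma tensor_act_lext:
  assumes "fincol m"
  shows "tensor_act m t = lext (\<lambda>w. tensor_act m (sg w)) t"
proof (rule poly_mapping_eqI)
  fix v
  have "Poly_Mapping.lookup (tensor_act m t) v = (\<Sum>w\<in>Poly_Mapping.keys t. tensor_coeff m v w * Poly_Mapping.lookup t w)"
    using assms by (simp add: lookup_tensor_act fincol_def)
  then show "Poly_Mapping.lookup (tensor_act m t) v = Poly_Mapping.lookup (lext (\<lambda>w. tensor_act m (sg w)) t) v"
    by (simp add: lext_def lookup_sum lookup_scale lookup_tensor_act_sg[OF assms] mult.commute)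
qed

lemma linear_tensor_act: "fincol m \<Longrightarrow> linear_op (tensor_act m)"
  using linear_lext[of "\<lambda>w. tensor_act m (sg w)"] by (simp add: linear_op_def flip: tensor_act_lext)

lemma tensor_act_keys_length:
  assumes "fincol m" "v \<in> Poly_Mapping.keys (tensor_act m (sg w))"
  shows "length v = length w"
  using assms by (auto simp: in_keys_iff lookup_tensor_act_sg tensor_coeff_def split: if_splits)

lemma tensor_act_tens: "fincol m \<Longrightarrow> t \<in> tens d \<Longrightarrow> tensor_act m t \<in> tens d"
  by (subst tensor_act_lext, assumption, rule tens_lext) (auto simp: tens_def dest: tensor_act_keys_length)

lemma tensor_act_Nil [simp]: "fincol m \<Longrightarrow> tensor_act m (sg []) = sg []"
  by (rule poly_mapping_eqI) (auto simp: lookup_tensor_act_sg tensor_coeff_def lookup_single when_def)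

lemma lookup_push_Cons:
  "Poly_Mapping.lookup (push (Cons b) t) (c # v) = (Poly_Mapping.lookup t v when b = c)"
  "Poly_Mapping.lookup (push (Cons b) t) [] = 0"
  by (auto simp: lookup_push when_def in_keys_iff)

lemma tensor_act_Cons:
  assumes m: "fincol m"
  shows "tensor_act m (sg (a # w)) = (\<Sum>b | m b a \<noteq> 0. scale (m b a) (push (Cons b) (tensor_act m (sg w))))"
proof (rule poly_mapping_eqI)
  fix v
  have fin: "finite {b. m b a \<noteq> 0}" using m by (simp add: fincol_def)
  show "Poly_Mapping.lookup (tensor_act m (sg (a # w))) v =
      Poly_Mapping.lookup (\<Sum>b | m b a \<noteq> 0. scale (m b a) (push (Cons b) (tensor_act m (sg w)))) v"
  proof (cases v)
    case Nil
    then show ?thesis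
      by (simp add: lookup_tensor_act_sg[OF m] tensor_coeff_def lookup_sum lookup_scale lookup_push_Cons)
  next
    case (Cons c v')
    have "tensor_coeff m (c # v') (a # w) = m c a * tensor_coeff m v' w"
      by (simp add: tensor_coeff_def prod.lessThan_Suc_shift del: prod.lessThan_Suc)
    also have "\<dots> = (\<Sum>b | m b a \<noteq> 0. if b = c then m c a * tensor_coeff m v' w else 0)"
      using fin by simp
    finally show ?thesis
      by (simp add: Cons lookup_tensor_act_sg[OF m] lookup_sum lookup_scale lookup_push_Cons when_def
          if_distrib[of "\<lambda>x. _ * x"] cong: if_cong)
  qed
qed

lemma permute_list_inverse:
  assumes "s \<in> SS (length w)"
  shows "permute_list (papp s) (permute_list (papp (- s)) w) = w"
    "permute_list (papp (- s)) (permute_list (papp s) w) = w"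
  using permute_list_add[of s w "- s"] permute_list_add[of "- s" w s] assms SS_closed(3)[OF assms]
  by (simp_all del: papp_simps) (simp_all add: id_def)

lemma tensor_act_permute:
  fixes w :: "nat list"
  assumes m: "fincol m" and s: "s \<in> SS (length w)"
  shows "tensor_act m (sg (permute_list (papp s) w)) = push (permute_list (papp s)) (tensor_act m (sg w))"
proof (rule poly_mapping_eqI)
  fix v
  let ?A = "{w' :: nat list. length w' = length w}"
  have inj: "inj_on (permute_list (papp s)) ?A"
    by (rule inj_on_inverseI[of _ "permute_list (papp (- s))"], rule permute_list_inverse(2)) (use s in simp)
  have keys: "Poly_Mapping.keys (tensor_act m (sg w)) \<subseteq> ?A" using tensor_act_keys_length[OF m] by auto
  show "Poly_Mapping.lookup (tensor_act m (sg (permute_list (papp s) w))) v =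
      Poly_Mapping.lookup (push (permute_list (papp s)) (tensor_act m (sg w))) v"
  proof (cases "length v = length w")
    case True
    define u where "u = permute_list (papp (- s)) v"
    have u: "v = permute_list (papp s) u" "length u = length w"
      using permute_list_inverse(1)[of s v] s True by (simp_all add: u_def del: papp_simps)
    have "tensor_coeff m v (permute_list (papp s) w) = (\<Prod>k<length w. m (u ! papp s k) (w ! papp s k))"
      using u(2) by (simp add: tensor_coeff_def u(1)) (rule prod.cong, auto simp: permute_list_def)
    also have "\<dots> = (\<Prod>k<length w. m (u ! k) (w ! k))"
      using prod.permute[of "papp s" "{..<length w}" "\<lambda>k. m (u ! k) (w ! k)"] s by (simp add: SS_def comp_def)
    also have "\<dots> = tensor_coeff m u w" using u(2) by (simp add: tensor_coeff_def)
    finally show ?thesis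
      using lookup_push_inj[OF inj keys, of u] u by (simp add: lookup_tensor_act_sg[OF m])
  next
    case False
    then have "v \<notin> Poly_Mapping.keys (push (permute_list (papp s)) (tensor_act m (sg w)))"
      using keys_push keys by fastforce
    then show ?thesis using False by (simp add: lookup_tensor_act_sg[OF m] tensor_coeff_def in_keys_iff)
  qed
qed

lemma tensor_act_ract:
  "fincol m \<Longrightarrow> t \<in> tens (sum_list lam) \<Longrightarrow>
    tensor_act m (ract t (young lam)) = ract (tensor_act m t) (young lam)"
  for t :: "nat list \<Rightarrow>\<^sub>0 'k::field_char_0"
  by (rule VV_natural[OF linear_tensor_act]) (auto intro: tensor_act_permute tensor_act_tens)

lemma tensor_act_VV: "fincol m \<Longrightarrow> x \<in> VV lam \<Longrightarrow> tensor_act m x \<in> VV lam"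
  unfolding VV_def by (auto simp: tensor_act_ract intro: tensor_act_tens)

lemma kmod_poly_mapping:
  fixes M :: "('k::field_char_0, 'x \<Rightarrow>\<^sub>0 'k) gl_module"
  assumes M: "ring.zero M = 0" "add M = (+)" "module.smult M = scale" and W: "0 \<in> carrier M"
    "\<And>x y. x \<in> carrier M \<Longrightarrow> y \<in> carrier M \<Longrightarrow> x + y \<in> carrier M"
    "\<And>c x. x \<in> carrier M \<Longrightarrow> scale c x \<in> carrier M"
  shows "kmod M"
proof (rule kmod.intro, rule moduleI[OF cring_KK])
  show "abelian_group M"
  proof (rule abelian_groupI)
    fix x assume "x \<in> carrier M"
    then show "\<exists>y\<in>carrier M. y \<oplus>\<^bsub>M\<^esub> x = \<zero>\<^bsub>M\<^esub>"
      using W(3)[of x "- 1"] by (intro bexI[of _ "scale (- 1) x"]) (auto simp: M scale_minus_left scale_1)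
  qed (auto simp: M W add.assoc add.commute)
qed (auto simp: M W scale_simps)

abbreviation TP :: "nat \<Rightarrow> ('k::field_char_0, nat list \<Rightarrow>\<^sub>0 'k) gl_module" where
  "TP d \<equiv> tensor_power UNIV (\<lambda>g. g) d"

lemma TP_simps [simp]:
  "carrier (TP d) = tens d" "ring.zero (TP d) = 0" "add (TP d) = (+)" "module.smult (TP d) = scale"
  "act (TP d) = tensor_act"
  by (simp_all add: tensor_power_def tens_def)

lemma kmod_TP: "kmod (TP d)" by (rule kmod_poly_mapping) auto

lemma kmod_V_part: "kmod (V_part lam)"
  by (rule kmod_poly_mapping) (auto intro: VV_closed)

lemma lie_word:
  assumes "p \<noteq> i"
  shows "lie (TP (length w)) p i (sg w) (edge p i (sg w) :: nat list \<Rightarrow>\<^sub>0 'k::field_char_0)"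
proof (induction w)
  case Nil
  interpret kmod "TP 0 :: ('k, _) gl_module" by (rule kmod_TP)
  have "edge p i (sg []) = (0 :: nat list \<Rightarrow>\<^sub>0 'k)" by (simp add: edge_sg)
  moreover have "lie (TP 0) p i (sg []) (ring.zero (TP 0 :: ('k, _) gl_module))"
    by (rule lie_const) (simp_all add: fincol_GL(1)[OF el_GL[OF assms]])
  ultimately show ?case by simp
next
  case (Cons a w)
  let ?T = "TP (length w) :: ('k, _) gl_module" and ?T' = "TP (Suc (length w)) :: ('k, _) gl_module"
  interpret T: kmod ?T by (rule kmod_TP)
  interpret T': kmod ?T' by (rule kmod_TP)
  obtain v where v: "T.poly v" "v 0 = edge p i (sg w)"
    "\<And>s. tensor_act (el p i s) (sg w) = sg w + scale s (v s)"
    using Cons.IH unfolding lie_def by auto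
  have cons: "push (Cons b) t \<in> tens (Suc (length w))" if "t \<in> tens (length w)" for b and t :: "nat list \<Rightarrow>\<^sub>0 'k"
    using that by (intro tens_push) (auto simp: tens_def)
  have poly: "T'.poly (\<lambda>s. push (Cons b) (u s))" if "T.poly u" for b u
    by (rule poly_hom[OF kmod_TP kmod_TP]) (use cons that in \<open>auto simp: push_add push_scale\<close>)
  have "T.poly (\<lambda>s. sg w + scale s (v s))" using T.poly_step[of "sg w" v] v(1) by simp
  note X = poly[OF this]
  define v' where "v' s = push (Cons a) (v s) + (if a = i then push (Cons p) (sg w + scale s (v s)) else 0)" for s
  have "T'.poly v'"
    using T'.poly_add[OF poly[OF v(1), of a] X[of p]] poly[OF v(1), of a] by (cases "a = i") (simp_all add: v'_def[abs_def])
  moreover have "v' 0 = edge p i (sg (a # w))"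
  proof -
    have "{j. j < length (a # w) \<and> (a # w) ! j = i} =
        (if a = i then {0} else {}) \<union> Suc ` {j. j < length w \<and> w ! j = i}"
      by (auto simp: nth_Cons' image_iff split: if_splits) (metis Suc_pred less_Suc_eq_0_disj not_less0 not_less_eq)+
    then have "edge p i (sg (a # w)) = (\<Sum>j\<in>(if a = i then {0} else {}) \<union> Suc ` {j. j < length w \<and> w ! j = i}. sg ((a # w)[j := p]) :: nat list \<Rightarrow>\<^sub>0 'k)"
      by (simp add: edge_sg)
    also have "\<dots> = (if a = i then sg (p # w) else 0) + (\<Sum>j | j < length w \<and> w ! j = i. sg (a # w[j := p]))"
      by (subst sum.union_disjoint) (auto simp: sum.reindex)
    finally show ?thesis by (simp add: v'_def v(2) edge_sg push_sum push_single scale_0 add.commute)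
  qed
  moreover have "tensor_act (el p i s) (sg (a # w)) = sg (a # w) + scale s (v' s)" for s
  proof -
    have "{b. el p i s b a \<noteq> 0} = (if a = i \<and> s \<noteq> 0 then {a, p} else {a})"
      using assms by (auto simp: el_def mat_one_def split: if_splits)
    then show ?thesis
      unfolding tensor_act_Cons[OF fincol_GL(1)[OF el_GL[OF assms]]] v(3) v'_def using assms
      by (auto simp: el_def mat_one_def push_add push_single push_scale scale_simps scale_add)
  qed
  ultimately have "lie ?T' p i (sg (a # w)) (edge p i (sg (a # w)))" by (intro T'.lieI[of _ v']) simp_all
  then show ?case by simp
qed

lemma lie_tensor:
  assumes "p \<noteq> i" "t \<in> tens d"
  shows "lie (TP d) p i t (edge p i t :: nat list \<Rightarrow>\<^sub>0 'k::field_char_0)"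
proof -
  interpret kmod "TP d :: ('k, _) gl_module" by (rule kmod_TP)
  note lin = linear_opD[OF linear_tensor_act[OF fincol_GL(1)[OF el_GL[OF assms(1)]]]]
  have scale: "lie (TP d) p i (scale c x) (scale c x')" if "lie (TP d) p i x x'" for c and x x' :: "nat list \<Rightarrow>\<^sub>0 'k"
    by (rule lie_hom[OF kmod_TP kmod_TP _ _ _ _ that]) (auto simp: lin scale_add scale_scale mult.commute)
  have "lie (TP d) p i (\<Sum>w\<in>A. scale (c w) (sg w)) (\<Sum>w\<in>A. scale (c w) (edge p i (sg w)))"
    if "finite A" "\<And>w. w \<in> A \<Longrightarrow> length w = d" for A and c :: "nat list \<Rightarrow> 'k"
    using that
  proof (induction A rule: finite_induct)
    case empty
    have "lie (TP d) p i 0 (ring.zero (TP d :: ('k, _) gl_module))"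
      by (rule lie_const) (simp_all add: linear_op_zero[OF linear_tensor_act[OF fincol_GL(1)[OF el_GL[OF assms(1)]]]])
    then show ?case by simp
  next
    case (insert w A)
    have "lie (TP d) p i (scale (c w) (sg w)) (scale (c w) (edge p i (sg w)))"
      using lie_word[OF assms(1), of w] insert.prems by (intro scale) auto
    from lie_add[OF _ this insert.IH] show ?case using insert by (simp add: lin)
  qed
  from this[of "Poly_Mapping.keys t" "Poly_Mapping.lookup t"] show ?thesis
    using assms(2) lext_sgs[of t] linear_op_lext[OF linear_edge, of p i sg t] by (simp add: lext_def tens_def)
qed

lemma lie_restrict:
  fixes M :: "('k::field_char_0, 'a) gl_module"
  assumes M: "kmod M" and W: "kmod.subspace M W" and x: "x \<in> W" and st: "\<And>s. act M (el p i s) x \<in> W"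
    and l: "lie M p i x x'"
  shows "lie (M\<lparr>carrier := W\<rparr>) p i x x'"
proof -
  interpret M: kmod M by (rule M)
  obtain v where v: "x \<in> carrier M" "M.poly v" "v 0 = x'" "\<And>s. act M (el p i s) x = x \<oplus>\<^bsub>M\<^esub> s \<odot>\<^bsub>M\<^esub> v s"
    using l unfolding lie_def by blast
  have "v t \<in> W" for t
  proof (rule M.poly_times_subspace[OF W v(2)])
    fix s
    have "s \<odot>\<^bsub>M\<^esub> v s = act M (el p i s) x \<ominus>\<^bsub>M\<^esub> x"
      using v(1) M.poly_closed[OF v(2), of s] by (simp add: v(4) M.minus_eq M.M.a_comm[of x] M.M.a_assoc M.M.r_neg)
    then show "s \<odot>\<^bsub>M\<^esub> v s \<in> W" using M.subspaceD(6)[OF W st x] by simp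
  qed
  then have "kmod.poly (M\<lparr>carrier := W\<rparr>) v" by (rule poly_subspace[OF M W v(2)])
  then show ?thesis unfolding lie_def using x v by auto
qed

lemma V_part_restrict: "V_part lam = (TP (sum_list lam))\<lparr>carrier := VV lam\<rparr>"
  by (simp add: V_part_def schur_def)

lemma subspace_VV: "kmod.subspace (TP (sum_list lam)) (VV lam)"
  unfolding kmod.subspace_def[OF kmod_TP] by (auto intro: VV_closed VV_tens)

lemma lie_V_part:
  assumes "p \<noteq> i" "x \<in> VV lam"
  shows "lie (V_part lam) p i x (edge p i x)"
  by (subst V_part_restrict, rule lie_restrict[OF kmod_TP subspace_VV assms(2) _ lie_tensor[OF assms(1) VV_tens[OF assms(2)]]])
    (simp add: tensor_act_VV[OF fincol_GL(1)[OF el_GL[OF assms(1)]] assms(2)])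

lemma V_part_simple:
  fixes U :: "(nat list \<Rightarrow>\<^sub>0 'k::field_char_0) set"
  assumes lam: "partition lam" and sub: "kmod.subspace (V_part lam) U" and st: "gl_stable (V_part lam) U"
    and x: "x \<in> U" "x \<noteq> 0"
  shows "U = VV lam"
proof -
  interpret kmod "V_part lam :: ('k, _) gl_module" by (rule kmod_V_part)
  show ?thesis
  proof (rule VV_irreducible[OF lam _ _ _ _ _ x])
    show "U \<subseteq> VV lam" "0 \<in> U" "\<And>x y. x \<in> U \<Longrightarrow> y \<in> U \<Longrightarrow> x + y \<in> U" "\<And>c x. x \<in> U \<Longrightarrow> scale c x \<in> U"
      using sub by (auto simp: subspace_def)
    fix p i :: nat and y assume "p \<noteq> i" "y \<in> U"
    then show "edge p i y \<in> U"
      using sub st by (intro lie_subspace[OF sub \<open>y \<in> U\<close> _ lie_V_part]) (auto simp: gl_stable_def el_GL subspace_def)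
  qed
qed

section \<open>The decomposition of a shifted Schur functor\<close>

text \<open>
  A template is a word of length \<open>d\<close> whose letters \<open>\<ge> n\<close> are \<open>n, \<dots>, n + e - 1\<close>, each once; they are place-holders for
  the letters of a word of length \<open>e\<close>.  A template thus gives an embedding of the \<open>e\<close>-th tensor power of \<open>V\<close> in the
  \<open>d\<close>-th tensor power of \<open>K\<^sup>n \<oplus> V\<close>.
\<close>

definition template :: "nat \<Rightarrow> nat \<Rightarrow> nat \<Rightarrow> nat list \<Rightarrow> bool" where
  "template n e d t \<longleftrightarrow> length t = d \<and> mset (filter ((\<le>) n) t) = mset [n..<n + e]"

definition fill :: "nat \<Rightarrow> nat list \<Rightarrow> nat list \<Rightarrow> nat list" where
  "fill n t u = map (\<lambda>l. if l < n then l else n + u ! (l - n)) t"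

lemma template_normal:
  assumes "template n e d t"
  obtains l s where "s \<in> SS d" "\<forall>x\<in>set l. x < n" "length l + e = d"
    "\<And>u. length u = e \<Longrightarrow> fill n t u = permute_list (papp s) (l @ map ((+) n) u)"
proof -
  define l where "l = filter (\<lambda>x. x < n) t"
  have "mset t = mset (filter (\<lambda>x. x < n) t) + mset (filter (\<lambda>x. \<not> x < n) t)"
    by (simp add: multiset_partition)
  then have m: "mset t = mset (l @ [n..<n + e])" using assms by (simp add: template_def l_def not_less)
  then obtain p where p: "p permutes {..<length (l @ [n..<n + e])}" "permute_list p (l @ [n..<n + e]) = t"
    by (rule mset_eq_permutation)
  have len: "length l + e = d" using arg_cong[OF m, of size] assms by (simp add: template_def)
  have "p \<in> papp ` SS d" unfolding papp_image_SS using p(1) len by simp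
  then obtain s where s: "s \<in> SS d" "papp s = p" by blast
  have "fill n t u = permute_list (papp s) (l @ map ((+) n) u)" if u: "length u = e" for u
  proof -
    have "map (\<lambda>l. if l < n then l else n + u ! (l - n)) l = l"
      by (rule map_idI) (auto simp: l_def)
    moreover have "map (\<lambda>l. if l < n then l else n + u ! (l - n)) [n..<n + e] = map ((+) n) u"
      using u by (intro nth_equalityI) auto
    ultimately have "map (\<lambda>l. if l < n then l else n + u ! (l - n)) (l @ [n..<n + e]) = l @ map ((+) n) u"
      by simp
    then show ?thesis unfolding fill_def p(2)[symmetric] permute_list_map[OF p(1), symmetric] s(2) by simp
  qed
  then show ?thesis using that[OF s(1) _ len] by (auto simp: l_def)
qed

lemma template_exists:
  assumes "length w = d"
  obtains e t u where "template n e d t" "length u = e" "w = fill n t u" "e = length (filter ((\<le>) n) w)"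
proof -
  define l where "l = filter (\<lambda>x. x < n) w"
  define u where "u = map (\<lambda>x. x - n) (filter ((\<le>) n) w)"
  have "map ((+) n) u = map (\<lambda>x. x) (filter ((\<le>) n) w)" unfolding u_def map_map by (rule map_cong) auto
  then have "map ((+) n) u = filter ((\<le>) n) w" by simp
  moreover have "mset w = mset (filter (\<lambda>x. x < n) w) + mset (filter (\<lambda>x. \<not> x < n) w)"
    by (simp add: multiset_partition)
  ultimately have m: "mset w = mset (l @ map ((+) n) u)" by (simp add: l_def not_less)
  then obtain p where p: "p permutes {..<length (l @ map ((+) n) u)}" "permute_list p (l @ map ((+) n) u) = w"
    by (rule mset_eq_permutation)
  define t where "t = permute_list p (l @ [n..<n + length u])"
  have p': "p permutes {..<length (l @ [n..<n + length u])}" using p(1) by simp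
  have "mset (filter ((\<le>) n) t) = filter_mset ((\<le>) n) (mset (l @ [n..<n + length u]))"
    unfolding t_def mset_filter mset_permute_list[OF p'] ..
  also have "\<dots> = mset (filter ((\<le>) n) l @ filter ((\<le>) n) [n..<n + length u])"
    unfolding mset_filter[symmetric] filter_append ..
  also have "filter ((\<le>) n) l = []" by (auto simp: l_def filter_empty_conv)
  also have "filter ((\<le>) n) [n..<n + length u] = [n..<n + length u]" by (rule filter_True) auto
  finally have "mset (filter ((\<le>) n) t) = mset [n..<n + length u]" by (simp only: append_Nil)
  moreover have "length t = d" using assms arg_cong[OF m, of size] by (simp add: t_def)
  ultimately have temp: "template n (length u) d t" by (simp only: template_def)
  have "map (\<lambda>l. if l < n then l else n + u ! (l - n)) l = l"
    by (rule map_idI) (auto simp: l_def)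
  moreover have "map (\<lambda>l. if l < n then l else n + u ! (l - n)) [n..<n + length u] = map ((+) n) u"
    by (intro nth_equalityI) auto
  ultimately have "map (\<lambda>l. if l < n then l else n + u ! (l - n)) (l @ [n..<n + length u]) = l @ map ((+) n) u"
    by simp
  then have "w = fill n t u"
    unfolding fill_def t_def permute_list_map[OF p', symmetric] using p(2) by simp
  moreover have "length u = length (filter ((\<le>) n) w)" by (simp add: u_def)
  ultimately show ?thesis using that[OF temp refl] by simp
qed

lemma keys_gs: "Poly_Mapping.keys (gs s) = {s}"
  by (simp add: gs_def)

lemma finite_templates: "finite {t. template n e d t}"
proof (rule finite_subset)
  show "{t. template n e d t} \<subseteq> {t. set t \<subseteq> {..<n + e} \<and> length t = d}"
  proof (intro subsetI CollectI conjI)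
    fix t x assume t: "t \<in> {t. template n e d t}" and "x \<in> set t"
    have "set (filter ((\<le>) n) t) = set [n..<n + e]"
      using t by (intro mset_eq_setD) (simp only: template_def mem_Collect_eq)
    then show "x \<in> {..<n + e}" using \<open>x \<in> set t\<close> by (cases "n \<le> x") auto
  qed (simp add: template_def)
qed (simp add: finite_lists_length_eq)

lemma finite_partitions: "finite {mu. partition mu \<and> sum_list mu = e}"
proof (rule finite_subset)
  show "{mu. partition mu \<and> sum_list mu = e} \<subseteq> {mu. set mu \<subseteq> {..e} \<and> length mu \<le> e}"
  proof (clarify, intro conjI)
    fix mu assume mu: "partition mu"
    show "set mu \<subseteq> {..sum_list mu}" by (auto intro: member_le_sum_list)
    have "0 \<notin> set mu" using mu by (simp add: partition_def)
    then show "length mu \<le> sum_list mu" by (induction mu) auto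
  qed
qed (simp add: finite_lists_length_le)

definition emb :: "nat \<Rightarrow> nat list \<Rightarrow> nat list \<Rightarrow> (nat list \<Rightarrow>\<^sub>0 'k::field_char_0) \<Rightarrow> (nat list \<Rightarrow>\<^sub>0 'k)" where
  "emb n lam t x = ract (push (fill n t) x) (young lam)"

definition pure :: "nat \<Rightarrow> (nat list \<Rightarrow>\<^sub>0 'k::field_char_0) \<Rightarrow> (nat list \<Rightarrow>\<^sub>0 'k)" where
  "pure n x = push (map ((+) n)) x"

definition mixed :: "nat \<Rightarrow> nat list \<Rightarrow> (nat list \<Rightarrow>\<^sub>0 'k::field_char_0) set" where
  "mixed n lam = {x \<in> VV lam. \<forall>w\<in>Poly_Mapping.keys x. \<exists>l\<in>set w. l < n}"

lemma linear_emb: "linear_op (emb n lam t)"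
  unfolding emb_def by (rule linear_comp[OF linear_ract_left linear_push])

lemma shift_mat_col_heavy: "a = n + a' \<Longrightarrow> {b. shift_mat n g b a \<noteq> 0} = (+) n ` {b. g b a' \<noteq> 0}"
proof (intro equalityI subsetI)
  fix b assume "a = n + a'" "b \<in> {b. shift_mat n g b a \<noteq> 0}"
  then have "b \<ge> n" "g (b - n) a' \<noteq> 0" by (auto simp: shift_mat_def mat_one_def split: if_splits)
  then show "b \<in> (+) n ` {b. g b a' \<noteq> 0}" by (intro image_eqI[of _ _ "b - n"]) auto
qed (auto simp: shift_mat_def)

lemma tensor_act_shift_heavy:
  assumes g: "g \<in> GL"
  shows "tensor_act (shift_mat n g) (push (map ((+) n)) x) = push (map ((+) n)) (tensor_act g x)"
proof (rule linear_op_eq[of "\<lambda>x. tensor_act (shift_mat n g) (push (map ((+) n)) x)" "\<lambda>x. push (map ((+) n)) (tensor_act g x)"])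
  note f = fincol_GL(1)[OF g] fincol_GL(2)[OF g, of n]
  show "linear_op (\<lambda>x. tensor_act (shift_mat n g) (push (map ((+) n)) x))"
    "linear_op (\<lambda>x. push (map ((+) n)) (tensor_act g x))"
    using f by (auto intro: linear_comp linear_push linear_tensor_act)
  show "tensor_act (shift_mat n g) (push (map ((+) n)) (sg w)) = push (map ((+) n)) (tensor_act g (sg w))" for w
  proof (induction w)
    case (Cons a w)
    have "tensor_act (shift_mat n g) (push (map ((+) n)) (sg (a # w))) =
        (\<Sum>b\<in>(+) n ` {b. g b a \<noteq> 0}. scale (shift_mat n g b (n + a))
          (push (Cons b) (push (map ((+) n)) (tensor_act g (sg w)))))"
      using Cons by (simp add: push_single tensor_act_Cons[OF f(2)] shift_mat_col_heavy)
    also have "\<dots> = (\<Sum>b | g b a \<noteq> 0. scale (g b a) (push (Cons (n + b)) (push (map ((+) n)) (tensor_act g (sg w)))))"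
      by (subst sum.reindex) (auto simp: shift_mat_def)
    also have "\<dots> = push (map ((+) n)) (tensor_act g (sg (a # w)))"
      by (simp add: tensor_act_Cons[OF f(1)] push_sum push_scale push_push)
    finally show ?case .
  qed (simp add: push_single f)
qed

lemma tensor_act_shift_light:
  assumes g: "g \<in> GL" and l: "\<forall>a\<in>set l. a < n"
  shows "tensor_act (shift_mat n g) (sg (l @ w)) = push ((@) l) (tensor_act (shift_mat n g) (sg w))"
  using l
proof (induction l)
  case Nil
  have "push (\<lambda>w. w) x = x" for x :: "nat list \<Rightarrow>\<^sub>0 'a"
    by (rule poly_mapping_eqI) (simp add: lookup_push when_def in_keys_iff)
  then show ?case by simp
next
  case (Cons a l)
  have "{b. shift_mat n g b a \<noteq> 0} = {a}" using Cons.prems by (auto simp: shift_mat_def mat_one_def split: if_splits)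
  moreover have "shift_mat n g a a = 1" using Cons.prems by (simp add: shift_mat_def mat_one_def)
  ultimately show ?case
    using Cons by (simp add: tensor_act_Cons[OF fincol_GL(2)[OF g]] scale_1 push_push)
qed

lemma tensor_act_fill:
  fixes x :: "nat list \<Rightarrow>\<^sub>0 'k::field_char_0"
  assumes g: "g \<in> GL" and t: "template n e d t" and x: "x \<in> tens e"
  shows "tensor_act (shift_mat n g) (push (fill n t) x) = push (fill n t) (tensor_act g x)"
proof -
  note f = fincol_GL(1)[OF g] fincol_GL(2)[OF g, of n]
  obtain l s where s: "s \<in> SS d" and l: "\<forall>x\<in>set l. x < n" "length l + e = d"
    and fill: "\<And>u. length u = e \<Longrightarrow> fill n t u = permute_list (papp s) (l @ map ((+) n) u)"
    using template_normal[OF t] by metis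
  show ?thesis
  proof (rule linear_op_eq[of "\<lambda>x. tensor_act (shift_mat n g) (push (fill n t) x)" "\<lambda>x. push (fill n t) (tensor_act g x)"])
    show "linear_op (\<lambda>x :: nat list \<Rightarrow>\<^sub>0 'k. tensor_act (shift_mat n g) (push (fill n t) x))"
      "linear_op (\<lambda>x :: nat list \<Rightarrow>\<^sub>0 'k. push (fill n t) (tensor_act g x))"
      using f by (auto intro: linear_comp linear_push linear_tensor_act)
    fix u assume "u \<in> Poly_Mapping.keys x"
    then have u: "length u = e" using x by (simp add: tens_def)
    have keys: "length v = e" if "v \<in> Poly_Mapping.keys (tensor_act g (sg u))" for v
      using tensor_act_keys_length[OF f(1) that] u by simp
    have "tensor_act (shift_mat n g) (push (fill n t) (sg u)) =
        push (permute_list (papp s)) (push ((@) l) (tensor_act (shift_mat n g) (push (map ((+) n)) (sg u))))"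
      using s l u by (simp add: push_single fill tensor_act_permute[OF f(2)] tensor_act_shift_light[OF g])
    also have "\<dots> = push (\<lambda>v. permute_list (papp s) (l @ map ((+) n) v)) (tensor_act g (sg u))"
      by (simp add: tensor_act_shift_heavy[OF g] push_push)
    also have "\<dots> = push (fill n t) (tensor_act g (sg u))"
      by (rule push_cong) (simp add: fill keys)
    finally show "tensor_act (shift_mat n g) (push (fill n t) (sg u)) = push (fill n t) (tensor_act g (sg u))" .
  qed
qed

lemma fill_tens: "template n e d t \<Longrightarrow> push (fill n t) x \<in> tens d"
  by (rule tens_push) (simp add: fill_def template_def)

lemma emb_hom:
  assumes t: "template n (sum_list mu) (sum_list lam) t"
  shows "emb n lam t \<in> gl_hom (V_part mu) (Sh n (V_part lam) :: ('k::field_char_0, _) gl_module)"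
  unfolding gl_hom_def
proof (intro CollectI conjI ballI allI funcsetI)
  note lin = linear_opD[OF linear_emb]
  fix g :: "'k mat" and x y :: "nat list \<Rightarrow>\<^sub>0 'k" assume g: "g \<in> GL" and x: "x \<in> VV mu"
  show "emb n lam t (act (V_part mu) g x) = act (Sh n (V_part lam)) g (emb n lam t x)"
    using tensor_act_fill[OF g t VV_tens[OF x]] tensor_act_ract[OF fincol_GL(2)[OF g] fill_tens[OF t]]
    by (simp add: emb_def)
qed (use fill_tens[OF t] in \<open>auto simp: linear_opD[OF linear_emb], auto simp: emb_def intro: VV_closed\<close>)

lemma pure_VV:
  assumes x: "x \<in> VV lam"
  shows "pure n x \<in> VV lam"
proof -
  obtain t where t: "t \<in> tens (sum_list lam)" "x = ract t (young lam)" using x by (auto simp: VV_def)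
  have "pure n x = young_symmetrizer lam (push (map ((+) n)) t)"
    unfolding pure_def t(2) young_symmetrizer_ract[symmetric]
    by (rule push_young) (use t(1) in \<open>simp add: tens_def\<close>)
  also have "\<dots> \<in> VV lam"
    unfolding young_symmetrizer_ract by (intro VV_closed tens_push) (use t(1) in \<open>auto simp: tens_def\<close>)
  finally show ?thesis .
qed

lemma pure_hom: "pure n \<in> gl_hom (V_part lam) (Sh n (V_part lam) :: ('k::field_char_0, _) gl_module)"
  unfolding gl_hom_def
  by (auto simp: pure_VV, auto simp: pure_def push_add push_scale tensor_act_shift_heavy)

text \<open>Sums of images of families of homomorphisms from Schur functors, and independence of such families.\<close>

type_synonym 'k schur_map = "nat list \<times> ((nat list \<Rightarrow>\<^sub>0 'k) \<Rightarrow> (nat list \<Rightarrow>\<^sub>0 'k))"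

primrec span_images :: "'k::field_char_0 schur_map list \<Rightarrow> (nat list \<Rightarrow>\<^sub>0 'k) set" where
  "span_images [] = {0}"
| "span_images (f # fs) = {snd f x + y |x y. x \<in> VV (fst f) \<and> y \<in> span_images fs}"

primrec independent :: "'k::field_char_0 schur_map list \<Rightarrow> bool" where
  "independent [] = True"
| "independent (f # fs) \<longleftrightarrow> independent fs \<and> (\<forall>x\<in>VV (fst f). snd f x \<in> span_images fs \<longrightarrow> x = 0)"

definition schur_maps :: "nat \<Rightarrow> nat list \<Rightarrow> 'k::field_char_0 schur_map set" where
  "schur_maps n lam = {f. partition (fst f) \<and> snd f \<in> gl_hom (V_part (fst f)) (Sh n (V_part lam))}"

lemma schur_mapsD:
  assumes "f \<in> schur_maps n lam"
  shows "x \<in> VV (fst f) \<Longrightarrow> snd f x \<in> VV lam"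
    "x \<in> VV (fst f) \<Longrightarrow> y \<in> VV (fst f) \<Longrightarrow> snd f (x + y) = snd f x + snd f y"
    "x \<in> VV (fst f) \<Longrightarrow> snd f (scale c x) = scale c (snd f x)"
    "g \<in> GL \<Longrightarrow> x \<in> VV (fst f) \<Longrightarrow> snd f (tensor_act g x) = tensor_act (shift_mat n g) (snd f x)"
    "snd f 0 = 0"
proof -
  have h: "snd f \<in> gl_hom (V_part (fst f)) (Sh n (V_part lam))" using assms by (simp add: schur_maps_def)
  show "x \<in> VV (fst f) \<Longrightarrow> snd f x \<in> VV lam"
    "x \<in> VV (fst f) \<Longrightarrow> y \<in> VV (fst f) \<Longrightarrow> snd f (x + y) = snd f x + snd f y"
    "g \<in> GL \<Longrightarrow> x \<in> VV (fst f) \<Longrightarrow> snd f (tensor_act g x) = tensor_act (shift_mat n g) (snd f x)"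
    using h by (auto simp: gl_hom_def)
  show s: "x \<in> VV (fst f) \<Longrightarrow> snd f (scale c x) = scale c (snd f x)" for c x using h by (simp add: gl_hom_def)
  show "snd f 0 = 0" using s[OF VV_closed(1), of 0] by (simp add: scale_0 scale_zero)
qed

lemma span_images_closed:
  assumes "set fs \<subseteq> schur_maps n lam"
  shows "0 \<in> span_images fs" "x \<in> span_images fs \<Longrightarrow> x \<in> VV lam"
    "x \<in> span_images fs \<Longrightarrow> y \<in> span_images fs \<Longrightarrow> x + y \<in> span_images fs"
    "x \<in> span_images fs \<Longrightarrow> scale c x \<in> span_images fs"
    "g \<in> GL \<Longrightarrow> x \<in> span_images fs \<Longrightarrow> tensor_act (shift_mat n g) x \<in> span_images fs"
proof -
  note lin = linear_opD[OF linear_tensor_act[OF fincol_GL(2)]]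
  have "0 \<in> span_images fs \<and> (\<forall>x\<in>span_images fs. x \<in> VV lam \<and> (\<forall>y\<in>span_images fs. x + y \<in> span_images fs) \<and>
      (\<forall>c. scale c x \<in> span_images fs) \<and> (\<forall>g\<in>GL. tensor_act (shift_mat n g) x \<in> span_images fs))"
    using assms
  proof (induction fs)
    case Nil
    have "tensor_act (shift_mat n g) 0 = (0 :: nat list \<Rightarrow>\<^sub>0 'a)" if "g \<in> GL" for g
      by (rule linear_op_zero[OF linear_tensor_act[OF fincol_GL(2)[OF that]]])
    then show ?case by (simp add: VV_closed scale_zero)
  next
    case (Cons f fs)
    note f = schur_mapsD[of f n lam]
    have fl: "f \<in> schur_maps n lam" "set fs \<subseteq> schur_maps n lam" using Cons.prems by auto
    note IH = Cons.IH[OF fl(2)]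
    show ?case
    proof (intro conjI ballI allI)
      show "0 \<in> span_images (f # fs)" using f(5)[OF fl(1)] IH VV_closed(1) by (auto intro!: exI[of _ 0])
    next
      fix z c assume "z \<in> span_images (f # fs)"
      then obtain x y where xy: "x \<in> VV (fst f)" "y \<in> span_images fs" "z = snd f x + y" by auto
      show "z \<in> VV lam" unfolding xy(3) by (intro VV_closed(2) f(1)[OF fl(1)] xy(1)) (use IH xy(2) in blast)
      show "scale c z \<in> span_images (f # fs)"
        using xy f(3)[OF fl(1) xy(1), of c, symmetric] IH VV_closed(3)[OF xy(1), of c] by (auto simp: scale_add)
      fix z' assume "z' \<in> span_images (f # fs)"
      then obtain x' y' where xy': "x' \<in> VV (fst f)" "y' \<in> span_images fs" "z' = snd f x' + y'" by auto
      have "z + z' = snd f (x + x') + (y + y')" using f(2)[OF fl(1) xy(1) xy'(1)] xy xy' by simp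
      then show "z + z' \<in> span_images (f # fs)"
        using VV_closed(2)[OF xy(1) xy'(1)] IH xy(2) xy'(2) unfolding span_images.simps by blast
    next
      fix z and g :: "'a mat" assume "z \<in> span_images (f # fs)" and g: "g \<in> GL"
      then obtain x y where xy: "x \<in> VV (fst f)" "y \<in> span_images fs" "z = snd f x + y" by auto
      have "tensor_act (shift_mat n g) z = snd f (tensor_act g x) + tensor_act (shift_mat n g) y"
        using f(4)[OF fl(1) g xy(1)] xy by (simp add: lin[OF g])
      then show "tensor_act (shift_mat n g) z \<in> span_images (f # fs)"
        using tensor_act_VV[OF fincol_GL(1)[OF g] xy(1)] IH xy(2) g unfolding span_images.simps by blast
    qed
  qed
  then show "0 \<in> span_images fs" "x \<in> span_images fs \<Longrightarrow> x \<in> VV lam"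
    "x \<in> span_images fs \<Longrightarrow> y \<in> span_images fs \<Longrightarrow> x + y \<in> span_images fs"
    "x \<in> span_images fs \<Longrightarrow> scale c x \<in> span_images fs"
    "g \<in> GL \<Longrightarrow> x \<in> span_images fs \<Longrightarrow> tensor_act (shift_mat n g) x \<in> span_images fs" by auto
qed

lemma span_images_sum:
  "set fs \<subseteq> schur_maps n lam \<Longrightarrow> (\<And>i. i \<in> A \<Longrightarrow> f i \<in> span_images fs) \<Longrightarrow> (\<Sum>i\<in>A. f i) \<in> span_images fs"
  by (induction A rule: infinite_finite_induct) (auto intro: span_images_closed(1,3))

text \<open>
  As the Schur functors are simple, the image of each map lies in the sum of the images of others or is independent of it.
\<close>

lemma independent_subfamily:
  "set fs \<subseteq> schur_maps n lam \<Longrightarrow>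
    \<exists>hs. set hs \<subseteq> set fs \<and> independent hs \<and> span_images fs \<subseteq> span_images (hs :: 'k::field_char_0 schur_map list)"
proof (induction fs)
  case Nil
  then show ?case by (intro exI[of _ "[]"]) auto
next
  case (Cons f fs)
  then obtain hs where hs: "set hs \<subseteq> set fs" "independent hs" "span_images fs \<subseteq> span_images hs" by auto
  have fl: "f \<in> schur_maps n lam" and hl: "set hs \<subseteq> schur_maps n lam" using Cons.prems hs(1) by auto
  note f = schur_mapsD[OF fl] and W = span_images_closed[OF hl]
  define U where "U = {x \<in> VV (fst f). snd f x \<in> span_images hs}"
  interpret V: kmod "V_part (fst f) :: ('k, _) gl_module" by (rule kmod_V_part)
  have U: "V.subspace U"
    unfolding V.subspace_def U_def using f W VV_closed by auto
  have st: "gl_stable (V_part (fst f)) U"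
    unfolding gl_stable_def U_def using f W by (auto simp: tensor_act_VV fincol_GL)
  show ?case
  proof (cases "\<exists>x\<in>U. x \<noteq> 0")
    case True
    then have "U = VV (fst f)" using V_part_simple[OF _ U st] fl by (auto simp: schur_maps_def)
    then have "snd f x + y \<in> span_images hs" if "x \<in> VV (fst f)" "y \<in> span_images fs" for x y
      using that hs(3) W(3) by (auto simp: U_def)
    then have "span_images (f # fs) \<subseteq> span_images hs" by auto
    then show ?thesis using hs by (intro exI[of _ hs]) auto
  next
    case False
    then have "independent (f # hs)" using hs(2) by (auto simp: U_def)
    moreover have "span_images (f # fs) \<subseteq> span_images (f # hs)" using hs(3) by auto
    ultimately show ?thesis using hs(1) by (intro exI[of _ "f # hs"]) auto
  qed
qed


text \<open>An independent family spanning a shifted Schur functor identifies it with a direct sum.\<close>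

definition sum_maps :: "'k::field_char_0 schur_map list \<Rightarrow> (nat \<Rightarrow> nat list \<Rightarrow>\<^sub>0 'k) \<Rightarrow> (nat list \<Rightarrow>\<^sub>0 'k)" where
  "sum_maps fs y = (\<Sum>j<length fs. snd (fs ! j) (y j))"

lemma sum_maps_Cons: "sum_maps (f # fs) y = snd f (y 0) + sum_maps fs (\<lambda>j. y (Suc j))"
  by (simp add: sum_maps_def sum.lessThan_Suc_shift del: sum.lessThan_Suc)

lemma V_tuple_simps [simp]:
  "add (V_tuple mu) x y = (\<lambda>i. x i + y i)" "module.smult (V_tuple mu) c x = (\<lambda>i. scale c (x i))"
  "act (V_tuple mu) g x = (\<lambda>i. tensor_act g (x i))" "ring.zero (V_tuple mu) = (\<lambda>i. 0)"
  by (simp_all add: V_tuple_def gl_dsum_def)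

lemma V_tuple_carrier:
  "y \<in> carrier (V_tuple mu) \<longleftrightarrow> (\<forall>j<length mu. y j \<in> VV (mu ! j)) \<and> (\<forall>j\<ge>length mu. y j = 0)"
  by (auto simp: V_tuple_def gl_dsum_def not_less)

lemma sum_maps_image:
  "span_images fs = sum_maps fs ` {y. \<forall>j<length fs. y j \<in> VV (fst (fs ! j))}"
proof (induction fs)
  case Nil
  then show ?case by (auto simp: sum_maps_def)
next
  case (Cons f fs)
  show ?case
  proof (intro equalityI subsetI)
    fix z assume "z \<in> span_images (f # fs)"
    then obtain x y where xy: "x \<in> VV (fst f)" "\<forall>j<length fs. y j \<in> VV (fst (fs ! j))" "z = snd f x + sum_maps fs y"
      unfolding span_images.simps Cons.IH by blast
    then show "z \<in> sum_maps (f # fs) ` {y. \<forall>j<length (f # fs). y j \<in> VV (fst ((f # fs) ! j))}"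
      by (intro image_eqI[of _ _ "case_nat x y"]) (auto simp: sum_maps_Cons nth_Cons split: nat.splits)
  next
    fix z assume "z \<in> sum_maps (f # fs) ` {y. \<forall>j<length (f # fs). y j \<in> VV (fst ((f # fs) ! j))}"
    then obtain y where y: "\<forall>j<length (f # fs). y j \<in> VV (fst ((f # fs) ! j))" "z = sum_maps (f # fs) y" by blast
    have "y 0 \<in> VV (fst f)" "\<forall>j<length fs. y (Suc j) \<in> VV (fst (fs ! j))" using y(1) by auto
    then show "z \<in> span_images (f # fs)" unfolding span_images.simps Cons.IH y(2) sum_maps_Cons by blast
  qed
qed

lemma independent_zero:
  "set fs \<subseteq> schur_maps n lam \<Longrightarrow> independent fs \<Longrightarrow> \<forall>j<length fs. y j \<in> VV (fst (fs ! j)) \<Longrightarrow>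
    sum_maps fs y = 0 \<Longrightarrow> j < length fs \<Longrightarrow> y j = 0"
proof (induction fs arbitrary: y j)
  case (Cons f fs)
  have fl: "f \<in> schur_maps n lam" "set fs \<subseteq> schur_maps n lam" using Cons.prems by auto
  have y: "y 0 \<in> VV (fst f)" "\<forall>j<length fs. y (Suc j) \<in> VV (fst (fs ! j))" using Cons.prems(3) by auto
  have "sum_maps fs (\<lambda>j. y (Suc j)) \<in> span_images fs" unfolding sum_maps_image using y by blast
  then have "scale (- 1) (sum_maps fs (\<lambda>j. y (Suc j))) \<in> span_images fs" by (rule span_images_closed(4)[OF fl(2)])
  moreover have eq: "snd f (y 0) + sum_maps fs (\<lambda>j. y (Suc j)) = 0" using Cons.prems(4) by (simp add: sum_maps_Cons)
  then have "snd f (y 0) = scale (- 1) (sum_maps fs (\<lambda>j. y (Suc j)))"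
    by (simp add: scale_minus_left scale_1 eq_neg_iff_add_eq_0)
  ultimately have y0: "y 0 = 0" using Cons.prems(2) y(1) by auto
  then have "sum_maps fs (\<lambda>j. y (Suc j)) = 0" using eq schur_mapsD(5)[OF fl(1)] by simp
  then have "y (Suc j) = 0" if "j < length fs" for j
    using Cons.IH[OF fl(2) _ y(2)] Cons.prems(2) that by simp
  then show ?case using y0 Cons.prems(5) by (cases j) auto
qed simp

lemma sum_maps_iso:
  assumes fs: "set fs \<subseteq> schur_maps n lam" "independent fs" "span_images fs = VV lam"
  shows "sum_maps fs \<in> gl_iso (V_tuple (map fst fs)) (Sh n (V_part lam) :: ('k::field_char_0, _) gl_module)"
proof -
  let ?V = "V_tuple (map fst fs) :: ('k, _) gl_module"
  have f: "fs ! j \<in> schur_maps n lam" if "j < length fs" for j using fs(1) that by auto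
  have c: "y \<in> carrier ?V \<Longrightarrow> j < length fs \<Longrightarrow> y j \<in> VV (fst (fs ! j))" for y j by (simp add: V_tuple_carrier)
  have add: "sum_maps fs (\<lambda>i. x i + y i) = sum_maps fs x + sum_maps fs y"
    if "x \<in> carrier ?V" "y \<in> carrier ?V" for x y
    unfolding sum_maps_def sum.distrib[symmetric]
    by (rule sum.cong) (use that c schur_mapsD(2)[OF f] in auto)
  have scale: "sum_maps fs (\<lambda>i. scale a (x i)) = scale a (sum_maps fs x)" if "x \<in> carrier ?V" for x a
    unfolding sum_maps_def scale_sum by (rule sum.cong) (use that c schur_mapsD(3)[OF f] in auto)
  have act: "sum_maps fs (\<lambda>i. tensor_act g (x i)) = tensor_act (shift_mat n g) (sum_maps fs x)"
    if "x \<in> carrier ?V" "g \<in> GL" for x g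
    unfolding sum_maps_def linear_op_sum[OF linear_tensor_act[OF fincol_GL(2)[OF that(2)]]]
    by (rule sum.cong) (use that c schur_mapsD(4)[OF f] in auto)
  have im: "sum_maps fs ` carrier ?V = VV lam"
  proof -
    have "sum_maps fs y \<in> sum_maps fs ` carrier ?V" if "\<forall>j<length fs. y j \<in> VV (fst (fs ! j))" for y
    proof (rule image_eqI[of _ _ "\<lambda>j. if j < length fs then y j else 0"])
      show "sum_maps fs y = sum_maps fs (\<lambda>j. if j < length fs then y j else 0)"
        unfolding sum_maps_def by (rule sum.cong) auto
    qed (use that in \<open>simp add: V_tuple_carrier\<close>)
    then show ?thesis unfolding fs(3)[symmetric] sum_maps_image by (auto simp: V_tuple_carrier)
  qed
  have "sum_maps fs \<in> gl_hom ?V (Sh n (V_part lam))"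
    unfolding gl_hom_def using add scale act im by auto
  moreover have "inj_on (sum_maps fs) (carrier ?V)"
  proof (rule inj_onI)
    fix x y assume x: "x \<in> carrier ?V" and y: "y \<in> carrier ?V" and eq: "sum_maps fs x = sum_maps fs y"
    have y': "(\<lambda>i. scale (- 1) (y i)) \<in> carrier ?V"
      unfolding V_tuple_carrier using y by (auto simp: V_tuple_carrier scale_zero intro: VV_closed(3))
    let ?z = "\<lambda>i. x i + scale (- 1) (y i)"
    have z: "sum_maps fs ?z = 0"
      unfolding add[OF x y'] scale[OF y] eq by (simp add: scale_minus_left scale_1)
    have "\<forall>j<length fs. ?z j \<in> VV (fst (fs ! j))" using c[OF x] c[OF y'] VV_closed(2) by blast
    from independent_zero[OF fs(1,2) this z] have "?z j = 0" if "j < length fs" for j using that .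
    then have "x j = y j" if "j < length fs" for j using that by (simp add: scale_minus_left scale_1)
    moreover have "x j = y j" if "\<not> j < length fs" for j using x y that by (simp add: V_tuple_carrier)
    ultimately show "x = y" by blast
  qed
  ultimately show ?thesis using im by (simp add: gl_iso_def bij_betw_def)
qed

text \<open>By exhaustion, Schur functors and templates generate every element whose words have exactly \<open>e\<close> heavy letters.\<close>

lemma span_images_template:
  assumes fs: "set fs \<subseteq> schur_maps n lam"
    and all: "\<And>mu t. partition mu \<Longrightarrow> sum_list mu = e \<Longrightarrow> template n e (sum_list lam) t \<Longrightarrow> (mu, emb n lam t) \<in> set fs"
    and t: "template n e (sum_list lam) t" and u: "length u = e"
  shows "emb n lam t (sg u) \<in> span_images (fs :: 'k::field_char_0 schur_map list)"
proof -
  note W = span_images_closed[OF fs]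
  have img: "snd f x \<in> span_images fs" if "f \<in> set fs" "x \<in> VV (fst f)" for f x
  proof -
    have "set gs \<subseteq> schur_maps n lam \<Longrightarrow> f \<in> set gs \<Longrightarrow> snd f x \<in> span_images gs" for gs
    proof (induction gs)
      case (Cons g gs)
      note h = Cons.prems
      have z: "0 \<in> span_images gs" by (rule span_images_closed(1)) (use h in auto)
      show ?case
      proof (cases "f = g")
        case True
        then have "snd g x + 0 \<in> span_images (g # gs)"
          unfolding span_images.simps using that(2) z by blast
        then show ?thesis using True by (simp del: span_images.simps)
      next
        case False
        then have "snd f x \<in> span_images gs" using Cons by auto
        moreover have "snd g 0 = 0" by (rule schur_mapsD(5)) (use h in auto)
        moreover have "0 \<in> VV (fst g)" by (rule VV_closed(1))
        ultimately have "snd g 0 + snd f x \<in> span_images (g # gs)" unfolding span_images.simps by blast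
        then show ?thesis using \<open>snd g 0 = 0\<close> by (simp del: span_images.simps)
      qed
    qed simp
    then show ?thesis using fs that(1) by blast
  qed
  define I where "I = {z :: 'k galg. Poly_Mapping.keys z \<subseteq> SS e \<and>
    (\<forall>t u. template n e (sum_list lam) t \<longrightarrow> length u = e \<longrightarrow> emb n lam t (ract (sg u) z) \<in> span_images fs)}"
  have "left_ideal e I"
    unfolding left_ideal_def
  proof (intro conjI ballI allI)
    show "0 \<in> I" using W(1) by (simp add: I_def linear_op_zero[OF linear_ract_right] linear_op_zero[OF linear_emb])
    fix x assume x: "x \<in> I"
    show "scale c x \<in> I" for c
      using x keys_scale[of c x] W(4)
      by (auto simp: I_def linear_opD[OF linear_ract_right] linear_opD[OF linear_emb])
    show "x + y \<in> I" if "y \<in> I" for y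
      using x that keys_add[of x y] W(3)
      by (auto simp: I_def linear_opD[OF linear_ract_right] linear_opD[OF linear_emb])
    fix s assume s: "s \<in> SS e"
    have "ract (sg u) (gs s * x) = ract (sg (permute_list (papp s) u)) x" if "length u = e" for u :: "nat list"
      using ract_assoc[of "sg u" e x "gs s"] x that by (simp add: I_def ract_gs push_single)
    moreover have "Poly_Mapping.keys (gs s * x) \<subseteq> SS e"
      by (rule keys_mult_SS) (use x s in \<open>auto simp: I_def gs_def\<close>)
    ultimately show "gs s * x \<in> I" using x by (simp add: I_def)
  qed
  moreover have "young mu * gs s \<in> I" if mu: "partition mu" "sum_list mu = e" and s: "s \<in> SS e" for mu s
    unfolding I_def
  proof (intro CollectI conjI allI impI)
    show "Poly_Mapping.keys (young mu * gs s :: 'k galg) \<subseteq> SS e"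
      using keys_young[of mu] mu s by (intro keys_mult_SS) (auto simp: gs_def)
    fix t u :: "nat list" assume t: "template n e (sum_list lam) t" and u: "length u = e"
    define x where "x = ract (sg u) (young mu :: 'k galg)"
    have x: "x \<in> VV mu" unfolding x_def using u mu by (intro VV_closed) simp
    define t' where "t' = map (\<lambda>l. if l < n then l else n + papp s (l - n)) t"
    have t': "template n e (sum_list lam) t'"
      unfolding template_def
    proof
      have "filter ((\<le>) n) t' = map (\<lambda>l. n + papp s (l - n)) (filter ((\<le>) n) t)"
        unfolding t'_def by (induction t) auto
      then have "mset (filter ((\<le>) n) t') = image_mset (\<lambda>l. n + papp s (l - n)) (mset (filter ((\<le>) n) t))" by simp
      also have "mset (filter ((\<le>) n) t) = mset_set {n..<n + e}" using t by (simp add: template_def)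
      also have "image_mset (\<lambda>l. n + papp s (l - n)) (mset_set {n..<n + e}) =
          mset_set ((\<lambda>l. n + papp s (l - n)) ` {n..<n + e})"
        by (rule image_mset_mset_set) (auto simp: inj_on_def)
      also have "(\<lambda>l. n + papp s (l - n)) ` {n..<n + e} = {n..<n + e}"
      proof (rule card_subset_eq)
        have "papp s (l - n) < e" if "n \<le> l" "l < n + e" for l
          by (rule SS_less[OF s]) (use that in linarith)
        then show "(\<lambda>l. n + papp s (l - n)) ` {n..<n + e} \<subseteq> {n..<n + e}" by auto
        show "card ((\<lambda>l. n + papp s (l - n)) ` {n..<n + e}) = card {n..<n + e}"
          by (rule card_image) (auto simp: inj_on_def)
      qed simp
      finally show "mset (filter ((\<le>) n) t') = mset [n..<n + e]" by simp
    qed (use t in \<open>simp add: t'_def template_def\<close>)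
    have heavy: "l - n < e" if "l \<in> set t" "n \<le> l" for l
    proof -
      have "set (filter ((\<le>) n) t) = set [n..<n + e]"
        using t by (intro mset_eq_setD) (simp only: template_def)
      moreover have "l \<in> set (filter ((\<le>) n) t)" using that by simp
      ultimately have "l \<in> set [n..<n + e]" by (simp only:)
      then show ?thesis by auto
    qed
    have keys: "length w = e" if "w \<in> Poly_Mapping.keys x" for w
      using VV_tens[OF x] that mu by (auto simp: tens_def)
    have "emb n lam t (ract (sg u) (young mu * gs s)) = emb n lam t (push (permute_list (papp s)) x)"
    proof -
      have "ract (sg u) (young mu * gs s) = ract x (gs s)"
        unfolding x_def by (rule ract_assoc[symmetric]) (use s u in \<open>auto simp: keys_gs\<close>)
      then show ?thesis by (simp only: ract_gs)
    qed
    also have "\<dots> = emb n lam t' x"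
      unfolding emb_def push_push
    proof (intro arg_cong[of _ _ "\<lambda>x. ract x _"] push_cong)
      fix w assume "w \<in> Poly_Mapping.keys x"
      then show "fill n t (permute_list (papp s) w) = fill n t' w"
        using keys heavy by (auto simp: fill_def t'_def permute_list_def)
    qed
    also have "\<dots> \<in> span_images fs" using img[OF all[OF mu t']] x by simp
    finally show "emb n lam t (ract (sg u) (young mu * gs s)) \<in> span_images fs" .
  qed
  ultimately have "1 \<in> I" by (rule young_exhaustive)
  then show ?thesis using t u by (auto simp: I_def)
qed

lemma fill_mixed:
  assumes "template n e d t" "e < d" "length u = e"
  shows "\<exists>l\<in>set (fill n t u). l < n"
proof -
  obtain l s where s: "s \<in> SS d" "\<forall>x\<in>set l. x < n" "length l + e = d"
    and f: "fill n t u = permute_list (papp s) (l @ map ((+) n) u)" using template_normal[OF assms(1)] assms(3) by metis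
  have "papp s permutes {..<length (l @ map ((+) n) u)}" using s assms by (simp add: SS_def)
  then have "set (fill n t u) = set (l @ map ((+) n) u)" unfolding f by (rule set_permute_list)
  moreover obtain x where "x \<in> set l" using s(3) assms(2) by (cases l) auto
  ultimately show ?thesis using s(2) by auto
qed

lemma mixed_closed:
  "0 \<in> mixed n lam" "x \<in> mixed n lam \<Longrightarrow> y \<in> mixed n lam \<Longrightarrow> x + y \<in> mixed n lam"
  "x \<in> mixed n lam \<Longrightarrow> scale c x \<in> mixed n lam"
  using keys_add[of x y] keys_scale[of c x] by (auto simp: mixed_def intro: VV_closed)

lemma keys_lext: "Poly_Mapping.keys (lext f t) \<subseteq> (\<Union>x\<in>Poly_Mapping.keys t. Poly_Mapping.keys (f x))"
  unfolding lext_def by (rule order_trans[OF keys_sum UN_mono[OF order_refl keys_scale]])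

lemma mixed_ract:
  fixes t :: "nat list \<Rightarrow>\<^sub>0 'k::field_char_0"
  assumes "t \<in> tens (sum_list lam)" "\<And>w. w \<in> Poly_Mapping.keys t \<Longrightarrow> \<exists>l\<in>set w. l < n"
  shows "ract t (young lam) \<in> mixed n lam"
  unfolding mixed_def
proof (intro CollectI conjI ballI)
  show "ract t (young lam) \<in> VV lam" using assms(1) by (rule VV_closed(4))
  fix w assume w: "w \<in> Poly_Mapping.keys (ract t (young lam))"
  have "w \<in> (\<Union>s\<in>Poly_Mapping.keys (young lam :: 'k galg). Poly_Mapping.keys (push (permute_list (papp s)) t))"
    by (rule subsetD[OF keys_lext w[unfolded ract_def]])
  then obtain s where s: "s \<in> Poly_Mapping.keys (young lam :: 'k galg)"
      "w \<in> Poly_Mapping.keys (push (permute_list (papp s)) t)"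
    by blast
  obtain w' where w': "w' \<in> Poly_Mapping.keys t" "w = permute_list (papp s) w'"
    using subsetD[OF keys_push s(2)] by blast
  have "papp s permutes {..<length w'}" using s(1) keys_young w'(1) assms(1) by (auto simp: SS_def tens_def)
  then have "set w = set w'" unfolding w'(2) by (rule set_permute_list)
  then show "\<exists>l\<in>set w. l < n" using assms(2)[OF w'(1)] by simp
qed

text \<open>
  The shift splitting: \<open>V\<^sub>\<lambda>\<close> itself is embedded as the pure tensors, and the mixed ones are generated by Schur functors of
  smaller degree.
\<close>

theorem shift_splitting_exists:
  fixes lam :: "nat list"
  assumes lam: "partition lam"
  obtains mu and \<phi> :: "(nat \<Rightarrow> nat list \<Rightarrow>\<^sub>0 'k::field_char_0) \<Rightarrow> (nat list \<Rightarrow>\<^sub>0 'k)" where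
    "shift_splitting n lam mu \<phi>"
    "(\<lambda>y. \<phi> (case_nat 0 y)) ` carrier (V_tuple mu) = mixed n lam"
    "\<And>x :: nat list \<Rightarrow>\<^sub>0 'k. x \<in> VV lam \<Longrightarrow> \<exists>a\<in>VV lam. \<exists>b\<in>mixed n lam. x = pure n a + b"
proof -
  let ?d = "sum_list lam"
  define F :: "'k schur_map set" where "F = (\<Union>e<?d. \<Union>mu\<in>{mu. partition mu \<and> sum_list mu = e}. \<Union>t\<in>{t. template n e ?d t}. {(mu, emb n lam t)})"
  have "finite F" unfolding F_def by (intro finite_UN_I finite_partitions finite_templates) auto
  then obtain fs where fs: "set fs = F" using finite_list by blast
  have maps: "set fs \<subseteq> schur_maps n lam" unfolding fs F_def using emb_hom by (auto simp: schur_maps_def)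
  obtain hs where hs: "set hs \<subseteq> set fs" "independent hs" "span_images fs \<subseteq> span_images hs"
    using independent_subfamily[OF maps] by blast
  have mapsh: "set hs \<subseteq> schur_maps n lam" using maps hs by blast
  have mix: "span_images gs \<subseteq> mixed n lam" if "set gs \<subseteq> set fs" for gs
    using that
  proof (induction gs)
    case (Cons f gs)
    then obtain e mu t where f: "f = (mu, emb n lam t)" "e < ?d" "sum_list mu = e" "template n e ?d t"
      unfolding fs F_def by auto
    have "snd f x \<in> mixed n lam" if x: "x \<in> VV (fst f)" for x
    proof -
      have "push (fill n t) x \<in> tens ?d" by (rule fill_tens[OF f(4)])
      moreover have "\<exists>l\<in>set w. l < n" if w: "w \<in> Poly_Mapping.keys (push (fill n t) x)" for w
      proof -
        obtain u where u: "u \<in> Poly_Mapping.keys x" "w = fill n t u"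
          using subsetD[OF keys_push w] by blast
        then show ?thesis using fill_mixed[OF f(4,2)] VV_tens[OF x] f(1,3) by (auto simp: tens_def)
      qed
      ultimately show ?thesis unfolding f(1) snd_conv emb_def by (rule mixed_ract)
    qed
    then show ?case using Cons mixed_closed(2) by fastforce
  qed (simp add: mixed_closed)
  let ?f0 = "(lam, pure n) :: 'k schur_map"
  have f0: "?f0 \<in> schur_maps n lam" using lam pure_hom by (simp add: schur_maps_def)
  have pure_mixed: "x = 0" if "x \<in> VV lam" "pure n x \<in> mixed n lam" for x :: "nat list \<Rightarrow>\<^sub>0 'k"
  proof (rule ccontr)
    assume "x \<noteq> 0"
    then obtain w where w: "w \<in> Poly_Mapping.keys x" by (metis keys_eq_empty ex_in_conv)
    have inj: "inj_on (map ((+) n)) UNIV" by (simp add: inj_on_def)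
    have "Poly_Mapping.lookup (pure n x) (map ((+) n) w) = Poly_Mapping.lookup x w"
      unfolding pure_def by (rule lookup_push_inj[OF inj]) auto
    then have "map ((+) n) w \<in> Poly_Mapping.keys (pure n x)" using w by (simp add: in_keys_iff)
    then show False using that(2) by (fastforce simp: mixed_def)
  qed
  have ind: "independent (?f0 # hs)" using hs(2) pure_mixed mix[OF hs(1)] by auto
  have maps0: "set (?f0 # hs) \<subseteq> schur_maps n lam" using f0 mapsh by simp
  have span: "span_images (?f0 # hs) = VV lam"
  proof (intro equalityI subsetI)
    fix x assume "x \<in> span_images (?f0 # hs)"
    then show "x \<in> VV lam" by (rule span_images_closed(2)[OF maps0])
  next
    fix x :: "nat list \<Rightarrow>\<^sub>0 'k" assume "x \<in> VV lam"
    then obtain t where t: "t \<in> tens ?d" "x = ract t (young lam)" by (auto simp: VV_def)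
    have word: "ract (sg w) (young lam) \<in> span_images (?f0 # hs)" if w: "length w = ?d" for w
    proof -
      obtain e tt u where tt: "template n e ?d tt" "length u = e" "w = fill n tt u" "e = length (filter ((\<le>) n) w)"
        by (rule template_exists[OF w])
      show ?thesis
      proof (cases "e < ?d")
        case True
        have "emb n lam tt (sg u) \<in> span_images fs"
          by (rule span_images_template[OF maps _ tt(1,2)]) (use True in \<open>auto simp: fs F_def\<close>)
        then have "ract (sg w) (young lam) \<in> span_images hs"
          using hs(3) tt(3) by (auto simp: emb_def push_single)
        moreover have "0 \<in> VV (fst ?f0)" by (rule VV_closed(1))
        ultimately have "snd ?f0 0 + ract (sg w) (young lam) \<in> span_images (?f0 # hs)"
          unfolding span_images.simps by blast
        then show ?thesis using schur_mapsD(5)[OF f0] by (simp del: span_images.simps)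
      next
        case False
        then have "filter ((\<le>) n) w = w" using tt(4) w by (metis length_filter_less filter_id_conv)
        then have heavy: "\<forall>l\<in>set w. n \<le> l" by (simp add: filter_id_conv)
        define v where "v = map (\<lambda>l. l - n) w"
        have v: "w = map ((+) n) v" unfolding v_def map_map using heavy by (intro map_idI[symmetric]) auto
        have "ract (sg w) (young lam) = (pure n (ract (sg v) (young lam)) :: nat list \<Rightarrow>\<^sub>0 'k)"
          unfolding pure_def young_symmetrizer_ract[symmetric] using w v by (subst push_young) (auto simp: push_single)
        moreover have "ract (sg v) (young lam) \<in> (VV lam :: (nat list \<Rightarrow>\<^sub>0 'k) set)"
          using w v by (intro VV_closed) auto
        moreover from this have "pure n (ract (sg v) (young lam)) + 0 \<in> span_images (?f0 # hs)"
          using span_images_closed(1)[OF mapsh] unfolding span_images.simps fst_conv snd_conv by blast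
        ultimately show ?thesis by (simp del: span_images.simps)
      qed
    qed
    have "ract (lext sg t) (young lam) = lext (\<lambda>w. ract (sg w) (young lam)) t"
      by (rule linear_op_lext[OF linear_ract_left])
    then have "x = lext (\<lambda>w. ract (sg w) (young lam)) t" by (simp add: t(2) lext_sgs)
    then show "x \<in> span_images (?f0 # hs)"
      unfolding lext_def using t(1)
      by (simp only:) (intro span_images_sum[OF maps0] span_images_closed(4)[OF maps0] word, simp add: tens_def)
  qed
  define mu where "mu = map fst hs"
  define \<phi> where "\<phi> = sum_maps (?f0 # hs)"
  have iso: "\<phi> \<in> gl_iso (V_tuple (lam # mu)) (Sh n (V_part lam))"
    using sum_maps_iso[OF maps0 ind span] by (simp add: \<phi>_def mu_def)
  have "\<forall>p\<in>set mu. partition p \<and> sum_list p < ?d" using hs(1) by (auto simp: mu_def fs F_def)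
  then have ss: "shift_splitting n lam mu \<phi>" using iso by (simp add: shift_splitting_def)
  have im: "(\<lambda>y. \<phi> (case_nat 0 y)) ` carrier (V_tuple mu) = span_images hs"
  proof -
    have "\<phi> (case_nat 0 y) = sum_maps hs y" for y
      using schur_mapsD(5)[OF f0] by (simp add: \<phi>_def sum_maps_Cons)
    moreover have "sum_maps hs y \<in> sum_maps hs ` carrier (V_tuple mu)" if "\<forall>j<length hs. y j \<in> VV (fst (hs ! j))" for y
    proof (rule image_eqI[of _ _ "\<lambda>j. if j < length hs then y j else 0"])
      show "sum_maps hs y = sum_maps hs (\<lambda>j. if j < length hs then y j else 0)"
        unfolding sum_maps_def by (rule sum.cong) auto
    qed (use that in \<open>simp add: V_tuple_carrier mu_def\<close>)
    ultimately show ?thesis unfolding sum_maps_image by (auto simp: V_tuple_carrier mu_def)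
  qed
  have split: "\<exists>a\<in>VV lam. \<exists>b\<in>span_images hs. x = pure n a + b" if "x \<in> VV lam" for x :: "nat list \<Rightarrow>\<^sub>0 'k"
  proof -
    have "x \<in> span_images (?f0 # hs)" using that unfolding span .
    then show ?thesis unfolding span_images.simps fst_conv snd_conv by blast
  qed
  have eq: "span_images hs = mixed n lam"
  proof (intro equalityI subsetI)
    fix x :: "nat list \<Rightarrow>\<^sub>0 'k" assume x: "x \<in> mixed n lam"
    then obtain a b where ab: "a \<in> VV lam" "b \<in> span_images hs" "x = pure n a + b"
      using split[of x] unfolding mixed_def by blast
    have "x + scale (- 1) b \<in> mixed n lam"
      using mix[OF hs(1)] ab(2) x by (intro mixed_closed) auto
    moreover have "x + scale (- 1) b = pure n a" using ab(3) by (simp add: scale_minus_left scale_1)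
    ultimately have "a = 0" using pure_mixed ab(1) by simp
    then show "x \<in> span_images hs" using ab by (simp add: pure_def)
  qed (use mix[OF hs(1)] in blast)
  show ?thesis by (rule that[OF ss im[unfolded eq]]) (rule split[unfolded eq])
qed

section \<open>Quotients and homomorphisms of algebras\<close>

locale kalg =
  fixes M :: "('k::field_char_0, 'a) gl_module" (structure)
  assumes alg: "algebra KK M"
begin

sublocale kmod M by (rule kmod.intro) (rule algebra.module[OF alg])
sublocale A: cring M by (rule algebra.M_cring[OF alg])

lemma smult_mult:
  "x \<in> carrier M \<Longrightarrow> y \<in> carrier M \<Longrightarrow> (c \<odot> x) \<otimes> y = c \<odot> (x \<otimes> y)"
  "x \<in> carrier M \<Longrightarrow> y \<in> carrier M \<Longrightarrow> x \<otimes> (c \<odot> y) = c \<odot> (x \<otimes> y)"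
proof -
  show 1: "x \<in> carrier M \<Longrightarrow> y \<in> carrier M \<Longrightarrow> (c \<odot> x) \<otimes> y = c \<odot> (x \<otimes> y)" for x y
    using algebra.smult_assoc2[OF alg, of c x y] by simp
  show "x \<in> carrier M \<Longrightarrow> y \<in> carrier M \<Longrightarrow> x \<otimes> (c \<odot> y) = c \<odot> (x \<otimes> y)"
    using 1[of y x] by (simp add: A.m_comm)
qed

lemma smult_one_mult: "x \<in> carrier M \<Longrightarrow> c \<odot> x = (c \<odot> \<one>) \<otimes> x"
  by (simp add: smult_mult)

lemma ideal_subspace: assumes "ideal I M" shows "subspace I"
proof -
  interpret I: ideal I M by fact
  have "c \<odot> x \<in> I" if "x \<in> I" for c x
    using I.I_l_closed[OF that, of "c \<odot> \<one>"] I.Icarr[OF that] by (simp flip: smult_one_mult)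
  then show ?thesis by (auto simp: subspace_def I.a_subset[THEN subsetD] I.zero_closed I.a_closed)
qed

lemma poly_mult:
  assumes "poly u" "poly v"
  shows "poly (\<lambda>t. u t \<otimes> v t)"
proof -
  have const: "polyfn N v \<Longrightarrow> c \<in> carrier M \<Longrightarrow> polyfn N (\<lambda>t. c \<otimes> v t)" for N c v
  proof (induction N arbitrary: v)
    case (Suc N)
    then obtain d w where w: "d \<in> carrier M" "polyfn N w" "v = (\<lambda>t. d \<oplus> t \<odot> w t)" by auto
    have "c \<otimes> v t = c \<otimes> d \<oplus> t \<odot> (c \<otimes> w t)" for t
      using Suc.prems(2) w(1) polyfn_closed[OF w(2), of t] by (simp add: w(3) A.r_distr smult_mult)
    then show ?case using Suc.IH[OF w(2) Suc.prems(2)] Suc.prems(2) w(1)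
      by (auto intro!: bexI[of _ "c \<otimes> d"] exI[of _ "\<lambda>t. c \<otimes> w t"])
  qed auto
  have "polyfn N u \<Longrightarrow> poly (\<lambda>t. u t \<otimes> v t)" for N u
  proof (induction N arbitrary: u)
    case 0
    then show ?case using const assms(2) unfolding poly_def by auto
  next
    case (Suc N)
    then obtain c w where w: "c \<in> carrier M" "polyfn N w" "u = (\<lambda>t. c \<oplus> t \<odot> w t)" by auto
    have eq: "(\<lambda>t. u t \<otimes> v t) = (\<lambda>t. c \<otimes> v t \<oplus> t \<odot> (w t \<otimes> v t))"
      using w(1) polyfn_closed[OF w(2)] poly_closed[OF assms(2)] by (auto simp: w(3) A.l_distr smult_mult)
    have "poly (\<lambda>t. c \<otimes> v t)" using const[OF _ w(1)] assms(2) unfolding poly_def by blast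
    then show ?case unfolding eq by (intro poly_add poly_times Suc.IH[OF w(2)])
  qed
  then show ?thesis using assms(1) unfolding poly_def by blast
qed

lemma lie_mult:
  assumes mult: "\<And>s x y. x \<in> carrier M \<Longrightarrow> y \<in> carrier M \<Longrightarrow>
      act M (el p i s) (x \<otimes> y) = act M (el p i s) x \<otimes> act M (el p i s) y"
    and l: "lie M p i x x'" "lie M p i y y'"
  shows "lie M p i (x \<otimes> y) (x' \<otimes> y \<oplus> x \<otimes> y')"
proof -
  obtain u where u: "x \<in> carrier M" "poly u" "u 0 = x'" "\<And>s. act M (el p i s) x = x \<oplus> s \<odot> u s"
    using l(1) unfolding lie_def by blast
  obtain v where v: "y \<in> carrier M" "poly v" "v 0 = y'" "\<And>s. act M (el p i s) y = y \<oplus> s \<odot> v s"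
    using l(2) unfolding lie_def by blast
  note c = u(1) v(1) poly_closed[OF u(2)] poly_closed[OF v(2)]
  show ?thesis
  proof (rule lieI[of _ "\<lambda>s. (u s \<otimes> y \<oplus> x \<otimes> v s) \<oplus> s \<odot> (u s \<otimes> v s)"])
    show "poly (\<lambda>s. (u s \<otimes> y \<oplus> x \<otimes> v s) \<oplus> s \<odot> (u s \<otimes> v s))"
      by (intro poly_add poly_times poly_mult poly_const c u(2) v(2))
    fix s
    have "act M (el p i s) (x \<otimes> y) = (x \<oplus> s \<odot> u s) \<otimes> (y \<oplus> s \<odot> v s)"
      using mult u(1,4) v(1,4) by simp
    also have "\<dots> = x \<otimes> y \<oplus> s \<odot> ((u s \<otimes> y \<oplus> x \<otimes> v s) \<oplus> s \<odot> (u s \<otimes> v s))"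
      using u(1) v(1) poly_closed[OF u(2), of s] poly_closed[OF v(2), of s]
      by (simp add: A.l_distr A.r_distr smult_mult smult_add_right smult_simps M.a_ac)
    finally show "act M (el p i s) (x \<otimes> y) = \<dots>" .
  qed (use c u(3) v(3) in \<open>auto simp: smult_simps\<close>)
qed

end

definition alg_hom :: "('k::field_char_0, 'a) gl_module \<Rightarrow> ('k, 'b) gl_module \<Rightarrow> ('a \<Rightarrow> 'b) set" where
  "alg_hom A A' = {f \<in> ring_hom A A'. \<forall>c. \<forall>x\<in>carrier A. f (c \<odot>\<^bsub>A\<^esub> x) = c \<odot>\<^bsub>A'\<^esub> f x}"

lemma alg_homD:
  assumes "f \<in> alg_hom A A'"
  shows "x \<in> carrier A \<Longrightarrow> f x \<in> carrier A'"
    "x \<in> carrier A \<Longrightarrow> y \<in> carrier A \<Longrightarrow> f (x \<oplus>\<^bsub>A\<^esub> y) = f x \<oplus>\<^bsub>A'\<^esub> f y"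
    "x \<in> carrier A \<Longrightarrow> y \<in> carrier A \<Longrightarrow> f (x \<otimes>\<^bsub>A\<^esub> y) = f x \<otimes>\<^bsub>A'\<^esub> f y"
    "f \<one>\<^bsub>A\<^esub> = \<one>\<^bsub>A'\<^esub>" "x \<in> carrier A \<Longrightarrow> f (c \<odot>\<^bsub>A\<^esub> x) = c \<odot>\<^bsub>A'\<^esub> f x" "f \<in> ring_hom A A'"
  using assms by (auto simp: alg_hom_def ring_hom_def)

lemma alg_homI:
  assumes "\<And>x. x \<in> carrier A \<Longrightarrow> f x \<in> carrier A'"
    "\<And>x y. x \<in> carrier A \<Longrightarrow> y \<in> carrier A \<Longrightarrow> f (x \<oplus>\<^bsub>A\<^esub> y) = f x \<oplus>\<^bsub>A'\<^esub> f y"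
    "\<And>x y. x \<in> carrier A \<Longrightarrow> y \<in> carrier A \<Longrightarrow> f (x \<otimes>\<^bsub>A\<^esub> y) = f x \<otimes>\<^bsub>A'\<^esub> f y"
    "f \<one>\<^bsub>A\<^esub> = \<one>\<^bsub>A'\<^esub>" "\<And>c x. x \<in> carrier A \<Longrightarrow> f (c \<odot>\<^bsub>A\<^esub> x) = c \<odot>\<^bsub>A'\<^esub> f x"
  shows "f \<in> alg_hom A A'"
  using assms by (auto simp: alg_hom_def ring_hom_def)

lemma alg_hom_zero:
  assumes "kalg A" "kalg A'" "f \<in> alg_hom A A'"
  shows "f \<zero>\<^bsub>A\<^esub> = \<zero>\<^bsub>A'\<^esub>"
proof -
  interpret A: kalg A by fact
  interpret A': kalg A' by fact
  show ?thesis using alg_homD(5)[OF assms(3), of "\<zero>\<^bsub>A\<^esub>" 0] alg_homD(1)[OF assms(3), of "\<zero>\<^bsub>A\<^esub>"]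
    by (simp add: A'.smult_simps)
qed

text \<open>The preimage of an ideal contains the ideal generated by a set as soon as it contains the set.\<close>

lemma alg_hom_Idl:
  assumes A: "kalg A" "kalg A'" and f: "f \<in> alg_hom A A'" and I': "ideal I' A'"
    and S: "S \<subseteq> carrier A" "\<And>x. x \<in> S \<Longrightarrow> f x \<in> I'" and x: "x \<in> Idl\<^bsub>A\<^esub> S"
  shows "f x \<in> I'"
proof -
  interpret A: kalg A by (rule A)
  interpret A': kalg A' by (rule A)
  interpret I': ideal I' A' by (rule I')
  note S' = A'.subspaceD[OF A'.ideal_subspace[OF I']]
  have "ideal {x \<in> carrier A. f x \<in> I'} A"
  proof (rule idealI[OF A.A.ring_axioms])
    have "\<ominus>\<^bsub>A\<^esub> x = (- 1) \<odot>\<^bsub>A\<^esub> x" if "x \<in> carrier A" for x using that by (simp add: A.smult_simps)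
    then show "subgroup {x \<in> carrier A. f x \<in> I'} (add_monoid A)"
      by (intro subgroup.intro)
        (auto simp: alg_homD[OF f] alg_hom_zero[OF A f] S' a_inv_def[symmetric] intro!: S')
  qed (auto simp: alg_homD[OF f] I'.I_l_closed I'.I_r_closed)
  then have "Idl\<^bsub>A\<^esub> S \<subseteq> {x \<in> carrier A. f x \<in> I'}"
    by (rule A.A.genideal_minimal) (use S in auto)
  then show ?thesis using x by blast
qed

lemma gl_quot_simps [simp]:
  "carrier (gl_quot A I) = carrier (A Quot I)" "monoid.mult (gl_quot A I) = monoid.mult (A Quot I)"
  "one (gl_quot A I) = one (A Quot I)" "ring.zero (gl_quot A I) = ring.zero (A Quot I)"
  "add (gl_quot A I) = add (A Quot I)" "act (gl_quot A I) g = quot_map A I (act A g)"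
  by (simp_all add: gl_quot_def quot_map_def fun_eq_iff)

lemma quot_carrier: "carrier (gl_quot A I) = {I +>\<^bsub>A\<^esub> x |x. x \<in> carrier A}"
  by (auto simp: FactRing_simps)

text \<open>A map that respects congruence modulo the ideals is induced on cosets.\<close>

lemma quot_map_coset:
  assumes A: "kalg A" "kalg A'" and I: "ideal I A" "ideal I' A'"
    and f: "\<And>x. x \<in> carrier A \<Longrightarrow> f x \<in> carrier A'"
    and add: "\<And>x y. x \<in> carrier A \<Longrightarrow> y \<in> carrier A \<Longrightarrow> f (x \<oplus>\<^bsub>A\<^esub> y) = f x \<oplus>\<^bsub>A'\<^esub> f y"
    and fI: "\<And>x. x \<in> I \<Longrightarrow> f x \<in> I'" and x: "x \<in> carrier A"
  shows "quot_map A' I' f (I +>\<^bsub>A\<^esub> x) = I' +>\<^bsub>A'\<^esub> f x"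
proof -
  interpret A: kalg A by (rule A)
  interpret A': kalg A' by (rule A)
  interpret I: ideal I A by (rule I)
  interpret I': ideal I' A' by (rule I)
  have "I' +>\<^bsub>A'\<^esub> f y = I' +>\<^bsub>A'\<^esub> f x" if y: "y \<in> I +>\<^bsub>A\<^esub> x" for y
  proof -
    obtain h where h: "h \<in> I" "y = h \<oplus>\<^bsub>A\<^esub> x" using y by (auto simp: a_r_coset_def r_coset_def)
    have "f y \<ominus>\<^bsub>A'\<^esub> f x = f h"
      using h x I.Icarr[OF h(1)] f by (simp add: add A'.M.minus_eq A'.M.a_assoc A'.M.r_neg)
    then show ?thesis
      using fI[OF h(1)] h x I.Icarr[OF h(1)] f A'.A.quotient_eq_iff_same_a_r_cos[OF I(2), of "f y" "f x"] by simp
  qed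
  moreover have "x \<in> I +>\<^bsub>A\<^esub> x" using x by (rule I.a_rcos_self)
  ultimately show ?thesis unfolding quot_map_def by blast
qed

lemma cring_cong:
  fixes R :: "('a, 'm) ring_scheme" and S :: "('a, 'n) ring_scheme"
  assumes "cring R" and eq: "carrier S = carrier R" "monoid.mult S = monoid.mult R" "one S = one R"
    "ring.zero S = ring.zero R" "add S = add R"
  shows "cring S"
proof -
  interpret R: cring R by fact
  show ?thesis
  proof (rule cringI)
    show "abelian_group S"
    proof (rule abelian_groupI)
      fix x assume "x \<in> carrier S"
      then show "\<exists>y\<in>carrier S. y \<oplus>\<^bsub>S\<^esub> x = \<zero>\<^bsub>S\<^esub>"
        by (intro bexI[of _ "\<ominus>\<^bsub>R\<^esub> x"]) (simp_all add: eq R.l_neg)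
    qed (simp_all add: eq R.a_ac)
    show "comm_monoid S" by (rule comm_monoidI) (simp_all add: eq R.m_ac)
  qed (simp add: eq R.l_distr)
qed

locale kquot = kalg A for A :: "('k::field_char_0, 'a) gl_module" +
  fixes I
  assumes id: "ideal I A"
begin

sublocale I: ideal I A by (rule id)

lemma cls_closed [simp]: "x \<in> carrier A \<Longrightarrow> I +>\<^bsub>A\<^esub> x \<in> carrier (gl_quot A I)"
  unfolding quot_carrier by blast

lemma cls_eq: "x \<in> carrier A \<Longrightarrow> y \<in> carrier A \<Longrightarrow> I +>\<^bsub>A\<^esub> x = I +>\<^bsub>A\<^esub> y \<longleftrightarrow> x \<ominus>\<^bsub>A\<^esub> y \<in> I"
  using A.quotient_eq_iff_same_a_r_cos[OF id] by blast

lemma cls_zero_iff: "x \<in> carrier A \<Longrightarrow> I +>\<^bsub>A\<^esub> x = \<zero>\<^bsub>gl_quot A I\<^esub> \<longleftrightarrow> x \<in> I"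
  using I.rcos_const_imp_mem A.a_rcos_zero[OF id] by (auto simp: FactRing_def)

lemma cls_add: "x \<in> carrier A \<Longrightarrow> y \<in> carrier A \<Longrightarrow>
    (I +>\<^bsub>A\<^esub> x) \<oplus>\<^bsub>gl_quot A I\<^esub> (I +>\<^bsub>A\<^esub> y) = I +>\<^bsub>A\<^esub> (x \<oplus>\<^bsub>A\<^esub> y)"
  by (simp add: FactRing_def I.a_rcos_sum)

lemma cls_mult: "x \<in> carrier A \<Longrightarrow> y \<in> carrier A \<Longrightarrow>
    (I +>\<^bsub>A\<^esub> x) \<otimes>\<^bsub>gl_quot A I\<^esub> (I +>\<^bsub>A\<^esub> y) = I +>\<^bsub>A\<^esub> (x \<otimes>\<^bsub>A\<^esub> y)"
  by (simp add: FactRing_def I.rcoset_mult_add)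

lemma cls_one: "I +>\<^bsub>A\<^esub> \<one>\<^bsub>A\<^esub> = \<one>\<^bsub>gl_quot A I\<^esub>" by (simp add: FactRing_def)

lemma cls_smult:
  assumes x: "x \<in> carrier A"
  shows "c \<odot>\<^bsub>gl_quot A I\<^esub> (I +>\<^bsub>A\<^esub> x) = I +>\<^bsub>A\<^esub> (c \<odot>\<^bsub>A\<^esub> x)"
proof -
  have "c \<odot>\<^bsub>gl_quot A I\<^esub> (I +>\<^bsub>A\<^esub> x) = quot_map A I (module.smult A c) (I +>\<^bsub>A\<^esub> x)"
    by (simp add: gl_quot_def quot_map_def)
  also have "\<dots> = I +>\<^bsub>A\<^esub> (c \<odot>\<^bsub>A\<^esub> x)"
    by (rule quot_map_coset[OF kalg_axioms kalg_axioms id id]) (use x subspaceD(4)[OF ideal_subspace[OF id]] in \<open>auto simp: smult_add_right\<close>)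
  finally show ?thesis .
qed

lemma quot_cases:
  assumes "z \<in> carrier (gl_quot A I)"
  obtains x where "x \<in> carrier A" "z = I +>\<^bsub>A\<^esub> x"
  using assms unfolding quot_carrier by blast

lemma kalg_quot: "kalg (gl_quot A I)"
proof (rule kalg.intro, rule algebraI[OF cring_KK])
  have "cring (A Quot I)" by (rule I.quotient_is_cring[OF A.is_cring])
  then show "cring (gl_quot A I)" by (rule cring_cong) simp_all
qed (auto elim!: quot_cases simp: cls_smult cls_add cls_mult smult_simps smult_add_right smult_mult simp del: gl_quot_simps)

lemma cls_hom: "(\<lambda>x. I +>\<^bsub>A\<^esub> x) \<in> alg_hom A (gl_quot A I)"
  by (rule alg_homI) (simp_all add: cls_add cls_mult cls_smult cls_one del: gl_quot_simps)

end

lemma quot_map_hom: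
  assumes A: "kalg A" "kalg A'" and I: "ideal I A" "ideal I' A'" and f: "f \<in> alg_hom A A'"
    and fI: "\<And>x. x \<in> I \<Longrightarrow> f x \<in> I'"
  shows "quot_map A' I' f \<in> alg_hom (gl_quot A I) (gl_quot A' I')"
    "x \<in> carrier A \<Longrightarrow> quot_map A' I' f (I +>\<^bsub>A\<^esub> x) = I' +>\<^bsub>A'\<^esub> f x"
proof -
  interpret Q: kquot A I by (rule kquot.intro[OF A(1)]) (rule kquot_axioms.intro[OF I(1)])
  interpret Q': kquot A' I' by (rule kquot.intro[OF A(2)]) (rule kquot_axioms.intro[OF I(2)])
  note fD = alg_homD[OF f]
  show eq: "quot_map A' I' f (I +>\<^bsub>A\<^esub> x) = I' +>\<^bsub>A'\<^esub> f x" if "x \<in> carrier A" for x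
    by (rule quot_map_coset[OF A I _ _ fI that]) (auto simp: fD)
  show "quot_map A' I' f \<in> alg_hom (gl_quot A I) (gl_quot A' I')"
    by (rule alg_homI)
      (auto elim!: Q.quot_cases simp: eq fD Q.cls_add Q.cls_mult Q.cls_smult Q'.cls_add Q'.cls_mult Q'.cls_smult
        Q'.cls_one Q.cls_one[symmetric] simp del: gl_quot_simps)
qed


section \<open>Symmetric algebras\<close>

lemma free_sym_simps [simp]:
  "x \<otimes>\<^bsub>free_sym M\<^esub> y = x * y" "\<one>\<^bsub>free_sym M\<^esub> = 1" "\<zero>\<^bsub>free_sym M\<^esub> = 0" "x \<oplus>\<^bsub>free_sym M\<^esub> y = x + y"
  "c \<odot>\<^bsub>free_sym M\<^esub> x = scale c x" "act (free_sym M) g = push (push (act M g))"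
  by (simp_all add: free_sym_def)

lemma free_sym_carrier: "p \<in> carrier (free_sym M) \<longleftrightarrow> (\<forall>m\<in>Poly_Mapping.keys p. Poly_Mapping.keys m \<subseteq> carrier M)"
  by (simp add: free_sym_def)

lemma scale_times: "scale c p * q = scale c (p * q)"
  for p q :: "('a \<Rightarrow>\<^sub>0 nat) \<Rightarrow>\<^sub>0 'k::field_char_0"
  by (simp add: scale_def mult_map_scale_conv_mult mult.assoc)

lemma kalg_free_sym: "kalg (free_sym M :: ('k::field_char_0, _) gl_module)"
proof -
  let ?F = "free_sym M :: ('k, _) gl_module"
  have add: "p + q \<in> carrier ?F" if "p \<in> carrier ?F" "q \<in> carrier ?F" for p q
    using that keys_add[of p q] by (auto simp: free_sym_carrier)
  have scale: "scale c p \<in> carrier ?F" if "p \<in> carrier ?F" for c p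
    using that keys_scale[of c p] by (auto simp: free_sym_carrier)
  have mult: "p * q \<in> carrier ?F" if "p \<in> carrier ?F" "q \<in> carrier ?F" for p q
    unfolding free_sym_carrier
  proof
    fix m assume "m \<in> Poly_Mapping.keys (p * q)"
    then obtain a b where "m = a + b" "a \<in> Poly_Mapping.keys p" "b \<in> Poly_Mapping.keys q"
      using keys_mult[of p q] by blast
    then show "Poly_Mapping.keys m \<subseteq> carrier M" using that keys_add[of a b] by (fastforce simp: free_sym_carrier)
  qed
  have one: "0 \<in> carrier ?F" "1 \<in> carrier ?F" by (auto simp: free_sym_carrier)
  have neg: "\<exists>y\<in>carrier ?F. x + y = 0" if "x \<in> carrier ?F" for x
    using scale[OF that, of "- 1"] by (intro bexI[of _ "scale (- 1) x"]) (simp_all add: scale_minus_left scale_1)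
  have "cring ?F"
  proof (rule cringI)
    show "abelian_group ?F" by (rule abelian_groupI) (auto simp: add one neg add.assoc add.commute)
    show "comm_monoid ?F" by (rule comm_monoidI) (auto simp: mult one mult.assoc mult.commute)
  qed (simp add: distrib_right)
  then show ?thesis
    by (intro kalg.intro algebraI cring_KK) (auto simp: scale scale_simps scale_times)
qed

lemma vec_var_carrier [simp]: "vec_var x \<in> carrier (free_sym M) \<longleftrightarrow> x \<in> carrier M"
  by (auto simp: vec_var_def free_sym_carrier)

lemma sym_rels_carrier:
  assumes "kmod M"
  shows "sym_rels M \<subseteq> carrier (free_sym M :: ('k::field_char_0, _) gl_module)"
proof -
  interpret kmod M by fact
  interpret F: kalg "free_sym M :: ('k, _) gl_module" by (rule kalg_free_sym)
  have "p - q \<in> carrier (free_sym M)" if "p \<in> carrier (free_sym M)" "q \<in> carrier (free_sym M)" for p q :: "_ \<Rightarrow>\<^sub>0 'k"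
    using F.M.add.m_closed[OF that(1) F.smult_c[OF that(2), of "- 1"]] by (simp add: scale_minus_left scale_1)
  moreover have "scale c p \<in> carrier (free_sym M)" if "p \<in> carrier (free_sym M)" for c and p :: "_ \<Rightarrow>\<^sub>0 'k"
    using F.smult_c[OF that] by simp
  ultimately show ?thesis unfolding sym_rels_def by auto
qed

definition eta :: "('k::field_char_0, 'a) gl_module \<Rightarrow> 'a \<Rightarrow> (('a \<Rightarrow>\<^sub>0 nat) \<Rightarrow>\<^sub>0 'k) set" where
  "eta M x = sym_ideal M +>\<^bsub>free_sym M\<^esub> vec_var x"

lemma kquot_Sym: "kmod M \<Longrightarrow> kquot (free_sym M) (sym_ideal M)"
  unfolding sym_ideal_def
  by (intro kquot.intro kquot_axioms.intro kalg_free_sym ring.genideal_ideal sym_rels_carrier)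
    (rule cring.axioms(1)[OF algebra.M_cring[OF kalg.alg[OF kalg_free_sym]]])

lemma kalg_Sym: "kmod M \<Longrightarrow> kalg (Sym M)"
  unfolding Sym_def by (rule kquot.kalg_quot[OF kquot_Sym])

lemma sym_rel_mem:
  assumes M: "kmod M"
  shows "r \<in> sym_rels M \<Longrightarrow> r \<in> sym_ideal M"
proof -
  interpret F: kalg "free_sym M" by (rule kalg_free_sym)
  show "r \<in> sym_rels M \<Longrightarrow> r \<in> sym_ideal M"
    unfolding sym_ideal_def using F.A.genideal_self[OF sym_rels_carrier[OF M]] by blast
qed

lemma free_sym_minus:
  assumes "p \<in> carrier (free_sym M)" "q \<in> carrier (free_sym M)"
  shows "p \<ominus>\<^bsub>free_sym M\<^esub> q = p - (q :: ('a \<Rightarrow>\<^sub>0 nat) \<Rightarrow>\<^sub>0 'k::field_char_0)"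
proof -
  interpret F: kalg "free_sym M :: ('k, _) gl_module" by (rule kalg_free_sym)
  have "p \<ominus>\<^bsub>free_sym M\<^esub> q = p \<oplus>\<^bsub>free_sym M\<^esub> ((- 1) \<odot>\<^bsub>free_sym M\<^esub> q)"
    using F.smult_simps(5)[OF assms(2), of 1] F.smult_simps(3)[OF assms(2)] unfolding F.M.minus_eq by simp
  then show ?thesis by (simp add: scale_minus_left scale_1)
qed

lemma eta_props:
  assumes M: "kmod M"
  shows "x \<in> carrier M \<Longrightarrow> eta M x \<in> carrier (Sym M)"
    "x \<in> carrier M \<Longrightarrow> y \<in> carrier M \<Longrightarrow> eta M (x \<oplus>\<^bsub>M\<^esub> y) = eta M x \<oplus>\<^bsub>Sym M\<^esub> eta M y"
    "x \<in> carrier M \<Longrightarrow> eta M (c \<odot>\<^bsub>M\<^esub> x) = c \<odot>\<^bsub>Sym M\<^esub> eta M x"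
proof -
  interpret M: kmod M by (rule M)
  interpret Q: kquot "free_sym M" "sym_ideal M" by (rule kquot_Sym[OF M])
  show "x \<in> carrier M \<Longrightarrow> eta M x \<in> carrier (Sym M)" unfolding eta_def Sym_def by (rule Q.cls_closed) simp
  have add: "vec_var x + vec_var y \<in> carrier (free_sym M)" if "x \<in> carrier M" "y \<in> carrier M" for x y
    using Q.M.add.m_closed[of "vec_var x" "vec_var y"] that by simp
  have scale: "scale c (vec_var x) \<in> carrier (free_sym M)" if "x \<in> carrier M" for x c
    using Q.smult_c[of "vec_var x" c] that by simp
  show "eta M (x \<oplus>\<^bsub>M\<^esub> y) = eta M x \<oplus>\<^bsub>Sym M\<^esub> eta M y" if x: "x \<in> carrier M" "y \<in> carrier M"
  proof -
    have "vec_var (x \<oplus>\<^bsub>M\<^esub> y) - vec_var x - vec_var y \<in> sym_ideal M"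
      by (rule sym_rel_mem[OF M]) (use x in \<open>auto simp: sym_rels_def\<close>)
    then have "vec_var (x \<oplus>\<^bsub>M\<^esub> y) \<ominus>\<^bsub>free_sym M\<^esub> (vec_var x + vec_var y) \<in> sym_ideal M"
      using x add[OF x] by (subst free_sym_minus) (auto simp: diff_diff_eq)
    then have "eta M (x \<oplus>\<^bsub>M\<^esub> y) = sym_ideal M +>\<^bsub>free_sym M\<^esub> (vec_var x + vec_var y)"
      unfolding eta_def using x add[OF x] by (subst Q.cls_eq) auto
    then show ?thesis using x Q.cls_add[of "vec_var x" "vec_var y"] by (simp add: eta_def Sym_def del: gl_quot_simps)
  qed
  show "eta M (c \<odot>\<^bsub>M\<^esub> x) = c \<odot>\<^bsub>Sym M\<^esub> eta M x" if x: "x \<in> carrier M"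
  proof -
    have "vec_var (c \<odot>\<^bsub>M\<^esub> x) - scale c (vec_var x) \<in> sym_ideal M"
      by (rule sym_rel_mem[OF M]) (use x in \<open>auto simp: sym_rels_def\<close>)
    then have "vec_var (c \<odot>\<^bsub>M\<^esub> x) \<ominus>\<^bsub>free_sym M\<^esub> scale c (vec_var x) \<in> sym_ideal M"
      using x scale[OF x] by (subst free_sym_minus) auto
    then have "eta M (c \<odot>\<^bsub>M\<^esub> x) = sym_ideal M +>\<^bsub>free_sym M\<^esub> scale c (vec_var x)"
      unfolding eta_def using x scale[OF x] by (subst Q.cls_eq) auto
    then show ?thesis using x Q.cls_smult[of "vec_var x" c] by (simp add: eta_def Sym_def del: gl_quot_simps)
  qed
qed

text \<open>The symmetric algebra is generated by the image of \<open>M\<close>.\<close>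

lemma Sym_induct:
  fixes M :: "('k::field_char_0, 'a) gl_module"
  assumes M: "kmod M" and z: "z \<in> carrier (Sym M)"
    and const: "\<And>c. P (c \<odot>\<^bsub>Sym M\<^esub> \<one>\<^bsub>Sym M\<^esub>)" and var: "\<And>x. x \<in> carrier M \<Longrightarrow> P (eta M x)"
    and add: "\<And>x y. x \<in> carrier (Sym M) \<Longrightarrow> y \<in> carrier (Sym M) \<Longrightarrow> P x \<Longrightarrow> P y \<Longrightarrow> P (x \<oplus>\<^bsub>Sym M\<^esub> y)"
    and mult: "\<And>x y. x \<in> carrier (Sym M) \<Longrightarrow> y \<in> carrier (Sym M) \<Longrightarrow> P x \<Longrightarrow> P y \<Longrightarrow> P (x \<otimes>\<^bsub>Sym M\<^esub> y)"
  shows "P z"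
proof -
  interpret Q: kquot "free_sym M" "sym_ideal M" by (rule kquot_Sym[OF M])
  let ?c = "\<lambda>p. sym_ideal M +>\<^bsub>free_sym M\<^esub> p"
  have closed: "p \<in> carrier (free_sym M) \<Longrightarrow> ?c p \<in> carrier (Sym M)" for p unfolding Sym_def by (rule Q.cls_closed)
  have c: "P (?c (scale c 1))" for c
    using const[of c] Q.cls_smult[of 1 c] Q.cls_one Q.A.one_closed unfolding Sym_def by (simp del: gl_quot_simps)
  have mono: "P (?c (Poly_Mapping.single m 1)) \<and> Poly_Mapping.single m (1::'k) \<in> carrier (free_sym M)"
    if "Poly_Mapping.keys m \<subseteq> carrier M" for m
    using that
  proof (induction "\<Sum>x\<in>Poly_Mapping.keys m. Poly_Mapping.lookup m x" arbitrary: m)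
    case 0
    then have "m = 0" by (intro poly_mapping_eqI) (auto simp: in_keys_iff)
    then show ?case using c[of 1] Q.A.one_closed by (simp add: scale_1)
  next
    case (Suc n)
    then obtain x where x: "x \<in> Poly_Mapping.keys m" by (metis all_not_in_conv sum.empty nat.distinct(1))
    define m' where "m' = m - Poly_Mapping.single x 1"
    have m: "m = m' + Poly_Mapping.single x 1"
      using x by (intro poly_mapping_eqI) (auto simp: m'_def lookup_add lookup_minus lookup_single when_def in_keys_iff)
    have keys: "Poly_Mapping.keys m' \<subseteq> Poly_Mapping.keys m"
      by (auto simp: m'_def in_keys_iff lookup_minus)
    have "(\<Sum>y\<in>Poly_Mapping.keys m. Poly_Mapping.lookup m y) = (\<Sum>y\<in>Poly_Mapping.keys m. Poly_Mapping.lookup m' y) + 1"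
      using x by (subst m) (simp add: lookup_add sum.distrib lookup_single when_def)
    moreover have "(\<Sum>y\<in>Poly_Mapping.keys m. Poly_Mapping.lookup m' y) = (\<Sum>y\<in>Poly_Mapping.keys m'. Poly_Mapping.lookup m' y)"
      by (rule sum.mono_neutral_right) (use keys in \<open>auto simp: in_keys_iff\<close>)
    ultimately have "n = (\<Sum>y\<in>Poly_Mapping.keys m'. Poly_Mapping.lookup m' y)" using Suc.hyps(2) by simp
    from Suc.hyps(1)[OF this] have IH: "P (?c (Poly_Mapping.single m' 1))" "Poly_Mapping.single m' (1::'k) \<in> carrier (free_sym M)"
      using keys Suc.prems by auto
    have xc: "x \<in> carrier M" using x Suc.prems by blast
    have eq: "Poly_Mapping.single m (1::'k) = Poly_Mapping.single m' 1 * vec_var x"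
      by (simp add: m vec_var_def mult_single)
    have "Poly_Mapping.single m' (1::'k) * vec_var x \<in> carrier (free_sym M)"
      using Q.A.m_closed[OF IH(2), of "vec_var x"] xc by simp
    moreover have "P (?c (Poly_Mapping.single m' 1 * vec_var x))"
      using mult[OF closed[OF IH(2)] eta_props(1)[OF M xc] IH(1) var[OF xc]]
        Q.cls_mult[OF IH(2), of "vec_var x"] xc by (simp add: eta_def Sym_def del: gl_quot_simps)
    ultimately show ?case by (simp add: eq)
  qed
  have tm: "P (?c (Poly_Mapping.single m a)) \<and> Poly_Mapping.single m (a::'k) \<in> carrier (free_sym M)"
    if "Poly_Mapping.keys m \<subseteq> carrier M" for m a
  proof -
    note m = mono[OF that]
    have e: "Poly_Mapping.single m a = scale a 1 * Poly_Mapping.single m (1::'k)"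
      by (simp add: scale_times scale_single)
    have a: "scale a 1 \<in> carrier (free_sym M)" using Q.smult_c[OF Q.A.one_closed, of a] by simp
    have "P (?c (scale a 1) \<otimes>\<^bsub>Sym M\<^esub> ?c (Poly_Mapping.single m 1))"
      using m a closed c by (intro mult) auto
    then show ?thesis
      using Q.cls_mult[OF a conjunct2[OF m]] Q.A.m_closed[OF a conjunct2[OF m]] by (simp add: e Sym_def del: gl_quot_simps)
  qed
  obtain p where p: "p \<in> carrier (free_sym M)" "z = ?c p" using z Q.quot_cases unfolding Sym_def by metis
  have "P (?c (\<Sum>m\<in>K. Poly_Mapping.single m (f m))) \<and> (\<Sum>m\<in>K. Poly_Mapping.single m (f m)) \<in> carrier (free_sym M)"
    if "finite K" "\<And>m. m \<in> K \<Longrightarrow> Poly_Mapping.keys m \<subseteq> carrier M" for K and f :: "_ \<Rightarrow> 'k"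
    using that
  proof (induction K rule: finite_induct)
    case empty
    then show ?case using c[of 0] Q.M.zero_closed by (simp add: scale_0)
  next
    case (insert m K)
    let ?s = "\<Sum>m\<in>K. Poly_Mapping.single m (f m)"
    have IH: "P (?c ?s)" "?s \<in> carrier (free_sym M)" using insert by auto
    have t: "P (?c (Poly_Mapping.single m (f m)))" "Poly_Mapping.single m (f m) \<in> carrier (free_sym M)"
      using tm insert.prems by auto
    have "P (?c (Poly_Mapping.single m (f m)) \<oplus>\<^bsub>Sym M\<^esub> ?c ?s)"
      using IH t closed by (intro add) auto
    then show ?case
      using Q.cls_add[OF t(2) IH(2)] Q.M.add.m_closed[OF t(2) IH(2)] insert.hyps
      by (simp add: Sym_def del: gl_quot_simps)
  qed
  from this[of "Poly_Mapping.keys p" "Poly_Mapping.lookup p"] show ?thesis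
    using p by (simp add: free_sym_carrier sum_singles[symmetric])
qed

definition lin_map :: "('k::field_char_0, 'a) gl_module \<Rightarrow> ('k, 'b) gl_module \<Rightarrow> ('a \<Rightarrow> 'b) \<Rightarrow> bool" where
  "lin_map M N f \<longleftrightarrow> (\<forall>x\<in>carrier M. f x \<in> carrier N) \<and>
     (\<forall>x\<in>carrier M. \<forall>y\<in>carrier M. f (x \<oplus>\<^bsub>M\<^esub> y) = f x \<oplus>\<^bsub>N\<^esub> f y) \<and>
     (\<forall>c. \<forall>x\<in>carrier M. f (c \<odot>\<^bsub>M\<^esub> x) = c \<odot>\<^bsub>N\<^esub> f x)"

lemma push_mult:
  fixes p q :: "'a::monoid_add \<Rightarrow>\<^sub>0 'k::field_char_0"
  assumes f: "\<And>x y. f (x + y) = f x + f y"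
  shows "push f (p * q) = push f p * (push f q :: 'b::monoid_add \<Rightarrow>\<^sub>0 'k)"
proof -
  have "push f ((\<Sum>x\<in>K. Poly_Mapping.single x (a x)) * (\<Sum>y\<in>L. Poly_Mapping.single y (b y))) =
      push f (\<Sum>x\<in>K. Poly_Mapping.single x (a x)) * push f (\<Sum>y\<in>L. Poly_Mapping.single y (b y))"
    for K L and a b :: "'a \<Rightarrow> 'k"
    by (simp add: sum_product push_sum push_single mult_single f)
  from this[of "Poly_Mapping.lookup p" "Poly_Mapping.keys p" "Poly_Mapping.lookup q" "Poly_Mapping.keys q"]
  show ?thesis by (simp only: sum_singles[symmetric])
qed

lemma sym_map_hom:
  fixes M :: "('k::field_char_0, 'a) gl_module" and N :: "('k, 'b) gl_module"
  assumes M: "kmod M" "kmod N" and f: "lin_map M N f"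
  shows "sym_map N f \<in> alg_hom (Sym M) (Sym N)" "x \<in> carrier M \<Longrightarrow> sym_map N f (eta M x) = eta N (f x)"
proof -
  let ?F = "push (push f) :: (('a \<Rightarrow>\<^sub>0 nat) \<Rightarrow>\<^sub>0 'k) \<Rightarrow> _"
  interpret Q: kquot "free_sym M" "sym_ideal M" by (rule kquot_Sym[OF M(1)])
  interpret Q': kquot "free_sym N" "sym_ideal N" by (rule kquot_Sym[OF M(2)])
  have fD: "x \<in> carrier M \<Longrightarrow> f x \<in> carrier N" "x \<in> carrier M \<Longrightarrow> y \<in> carrier M \<Longrightarrow> f (x \<oplus>\<^bsub>M\<^esub> y) = f x \<oplus>\<^bsub>N\<^esub> f y"
    "x \<in> carrier M \<Longrightarrow> f (c \<odot>\<^bsub>M\<^esub> x) = c \<odot>\<^bsub>N\<^esub> f x" for x y c using f by (auto simp: lin_map_def)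
  have var: "?F (vec_var x) = vec_var (f x)" for x by (simp add: vec_var_def push_single)
  have F: "?F \<in> alg_hom (free_sym M) (free_sym N)"
  proof (rule alg_homI)
    fix p assume p: "p \<in> carrier (free_sym M)"
    show "?F p \<in> carrier (free_sym N)"
      unfolding free_sym_carrier
    proof
      fix m assume "m \<in> Poly_Mapping.keys (?F p)"
      then have "m \<in> push f ` Poly_Mapping.keys p" using keys_push by (rule rev_subsetD)
      then obtain m' where m': "m' \<in> Poly_Mapping.keys p" "m = push f m'" by blast
      have "Poly_Mapping.keys m \<subseteq> f ` Poly_Mapping.keys m'" unfolding m'(2) by (rule keys_push)
      moreover have "Poly_Mapping.keys m' \<subseteq> carrier M" using m'(1) p by (simp add: free_sym_carrier)
      ultimately show "Poly_Mapping.keys m \<subseteq> carrier N" using fD(1) by (simp add: image_subset_iff subset_iff) blast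
    qed
  next
    fix p q :: "('a \<Rightarrow>\<^sub>0 nat) \<Rightarrow>\<^sub>0 'k"
    have "push f (x + y) = push f x + push f y" for x y :: "'a \<Rightarrow>\<^sub>0 nat" by (rule push_add)
    then have "?F (p * q) = ?F p * ?F q" by (rule push_mult)
    then show "?F (p \<otimes>\<^bsub>free_sym M\<^esub> q) = ?F p \<otimes>\<^bsub>free_sym N\<^esub> ?F q" by simp
  next
    have "?F (Poly_Mapping.single 0 1) = Poly_Mapping.single 0 1" by (simp only: push_single push_zero)
    then show "?F \<one>\<^bsub>free_sym M\<^esub> = \<one>\<^bsub>free_sym N\<^esub>" by simp
  qed (simp_all add: push_add push_scale)
  have "?F p \<in> sym_ideal N" if "p \<in> sym_ideal M" for p
  proof (rule alg_hom_Idl[OF kalg_free_sym kalg_free_sym F Q'.id sym_rels_carrier[OF M(1)] _ that[unfolded sym_ideal_def]])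
    fix r assume "r \<in> sym_rels M"
    then consider x y where "x \<in> carrier M" "y \<in> carrier M" "r = vec_var (x \<oplus>\<^bsub>M\<^esub> y) - vec_var x - vec_var y"
      | c x where "x \<in> carrier M" "r = vec_var (c \<odot>\<^bsub>M\<^esub> x) - scale c (vec_var x)"
      unfolding sym_rels_def by blast
    then have "?F r \<in> sym_rels N"
    proof cases
      case 1
      then have "?F r = vec_var (f x \<oplus>\<^bsub>N\<^esub> f y) - vec_var (f x) - vec_var (f y)"
        by (simp add: linear_op_diff[OF linear_push] var fD)
      then show ?thesis unfolding sym_rels_def using 1 fD(1) by blast
    next
      case 2
      then have "?F r = vec_var (c \<odot>\<^bsub>N\<^esub> f x) - scale c (vec_var (f x))"
        by (simp add: linear_op_diff[OF linear_push] push_scale var fD)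
      then show ?thesis unfolding sym_rels_def using 2 fD(1) by blast
    qed
    then show "?F r \<in> sym_ideal N" by (rule sym_rel_mem[OF M(2)])
  qed
  note q = quot_map_hom[OF kalg_free_sym kalg_free_sym Q.id Q'.id F this]
  show "sym_map N f \<in> alg_hom (Sym M) (Sym N)" unfolding sym_map_def Sym_def by (rule q(1))
  show "x \<in> carrier M \<Longrightarrow> sym_map N f (eta M x) = eta N (f x)"
    unfolding sym_map_def eta_def by (subst q(2)) (auto simp: var)
qed

section \<open>Tensor products\<close>

definition pmul :: "('k::field_char_0, 'a) gl_module \<Rightarrow> ('k, 'b) gl_module \<Rightarrow> 'a \<times> 'b \<Rightarrow> 'a \<times> 'b \<Rightarrow> 'a \<times> 'b" where
  "pmul A C p q = (fst p \<otimes>\<^bsub>A\<^esub> fst q, snd p \<otimes>\<^bsub>C\<^esub> snd q)"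

lemma free_pairs_simps [simp]:
  "\<one>\<^bsub>free_pairs A C\<^esub> = sg (\<one>\<^bsub>A\<^esub>, \<one>\<^bsub>C\<^esub>)" "\<zero>\<^bsub>free_pairs A C\<^esub> = 0" "x \<oplus>\<^bsub>free_pairs A C\<^esub> y = x + y"
  "c \<odot>\<^bsub>free_pairs A C\<^esub> x = scale c x" "act (free_pairs A C) g = push (map_prod (act A g) (act C g))"
  by (simp_all add: free_pairs_def)

lemma free_pairs_carrier: "t \<in> carrier (free_pairs A C) \<longleftrightarrow> Poly_Mapping.keys t \<subseteq> carrier A \<times> carrier C"
  by (simp add: free_pairs_def)

lemma free_pairs_mult: "s \<otimes>\<^bsub>free_pairs A C\<^esub> t = lext (\<lambda>p. lext (\<lambda>q. sg (pmul A C p q)) t) s"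
  by (simp add: free_pairs_def lext_def pmul_def scale_sum scale_single)

lemma free_pairs_mult_sg: "sg p \<otimes>\<^bsub>free_pairs A C\<^esub> sg q = sg (pmul A C p q)"
  by (simp add: free_pairs_mult)

lemma linear_free_pairs_mult:
  "linear_op (\<lambda>s. s \<otimes>\<^bsub>free_pairs A C\<^esub> t)" "linear_op (\<lambda>t. s \<otimes>\<^bsub>free_pairs A C\<^esub> t)"
proof -
  show "linear_op (\<lambda>s. s \<otimes>\<^bsub>free_pairs A C\<^esub> t)" unfolding free_pairs_mult by (rule linear_lext)
  have "(\<lambda>t. s \<otimes>\<^bsub>free_pairs A C\<^esub> t) = lext (\<lambda>q. lext (\<lambda>p. sg (pmul A C p q)) s)"
    by (rule ext, unfold free_pairs_mult, rule lext_swap)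
  then show "linear_op (\<lambda>t. s \<otimes>\<^bsub>free_pairs A C\<^esub> t)" by (simp only: linear_lext)
qed

lemma free_pairs_sum:
  assumes "t \<in> carrier (free_pairs A C)"
    and zero: "P 0" and add: "\<And>s t. s \<in> carrier (free_pairs A C) \<Longrightarrow> t \<in> carrier (free_pairs A C) \<Longrightarrow> P s \<Longrightarrow> P t \<Longrightarrow> P (s + t)"
    and sg: "\<And>a c k. a \<in> carrier A \<Longrightarrow> c \<in> carrier C \<Longrightarrow> P (scale k (sg (a, c)))"
  shows "P (t :: 'a \<times> 'b \<Rightarrow>\<^sub>0 'k::field_char_0)"
proof -
  have "P (\<Sum>p\<in>K. Poly_Mapping.single p (f p)) \<and> (\<Sum>p\<in>K. Poly_Mapping.single p (f p)) \<in> carrier (free_pairs A C)"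
    if "finite K" "K \<subseteq> carrier A \<times> carrier C" for K and f :: "_ \<Rightarrow> 'k"
    using that
  proof (induction K rule: finite_induct)
    case empty
    then show ?case using zero by (simp add: free_pairs_carrier)
  next
    case (insert p K)
    then have p: "fst p \<in> carrier A" "snd p \<in> carrier C" by auto
    have "P (Poly_Mapping.single p (f p))" using sg[OF p, of "f p"] by (simp add: scale_single)
    moreover have "Poly_Mapping.single p (f p) \<in> carrier (free_pairs A C)"
      using insert.prems by (auto simp: free_pairs_carrier)
    moreover have "(\<Sum>p\<in>K. Poly_Mapping.single p (f p)) + Poly_Mapping.single p (f p) \<in> carrier (free_pairs A C)"
      using calculation(2) insert keys_add[of "\<Sum>p\<in>K. Poly_Mapping.single p (f p)" "Poly_Mapping.single p (f p)"]
      by (auto simp: free_pairs_carrier)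
    ultimately show ?case using insert add by (simp add: add.commute)
  qed
  from this[of "Poly_Mapping.keys t" "Poly_Mapping.lookup t"] show ?thesis
    using assms(1) by (simp add: free_pairs_carrier sum_singles[symmetric])
qed

lemma kalg_free_pairs:
  fixes A :: "('k::field_char_0, 'a) gl_module" and C :: "('k, 'b) gl_module"
  assumes "kalg A" "kalg C"
  shows "kalg (free_pairs A C)"
proof -
  interpret A: kalg A by fact
  interpret C: kalg C by fact
  let ?F = "free_pairs A C"
  note lin = linear_free_pairs_mult[of A C]
  have add: "s + t \<in> carrier ?F" if "s \<in> carrier ?F" "t \<in> carrier ?F" for s t
    using that keys_add[of s t] by (auto simp: free_pairs_carrier)
  have scale: "scale c t \<in> carrier ?F" if "t \<in> carrier ?F" for c t
    using that keys_scale[of c t] by (auto simp: free_pairs_carrier)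
  have lext: "lext f t \<in> carrier ?F" if "\<And>p. p \<in> Poly_Mapping.keys t \<Longrightarrow> f p \<in> carrier ?F" for t :: "'a \<times> 'b \<Rightarrow>\<^sub>0 'k" and f
    using that keys_lext[of f t] by (fastforce simp: free_pairs_carrier)
  have mult: "s \<otimes>\<^bsub>?F\<^esub> t \<in> carrier ?F" if "s \<in> carrier ?F" "t \<in> carrier ?F" for s t
    unfolding free_pairs_mult using that
    by (intro lext) (auto simp: free_pairs_carrier pmul_def dest!: subsetD)
  have neg: "\<exists>y\<in>carrier ?F. x + y = 0" if "x \<in> carrier ?F" for x
    using scale[OF that, of "- 1"] by (intro bexI[of _ "scale (- 1) x"]) (simp_all add: scale_minus_left scale_1)
  have k: "fst p \<in> carrier A" "snd p \<in> carrier C" if "p \<in> Poly_Mapping.keys s" "s \<in> carrier ?F" for p s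
    using that by (auto simp: free_pairs_carrier)
  have assoc: "s \<otimes>\<^bsub>?F\<^esub> t \<otimes>\<^bsub>?F\<^esub> u = s \<otimes>\<^bsub>?F\<^esub> (t \<otimes>\<^bsub>?F\<^esub> u)"
    if stu: "s \<in> carrier ?F" "t \<in> carrier ?F" "u \<in> carrier ?F" for s t u
  proof (rule linear_op_eq[OF linear_comp[OF lin(1) lin(1)] lin(1)])
    fix p assume p: "p \<in> Poly_Mapping.keys s"
    show "sg p \<otimes>\<^bsub>?F\<^esub> t \<otimes>\<^bsub>?F\<^esub> u = sg p \<otimes>\<^bsub>?F\<^esub> (t \<otimes>\<^bsub>?F\<^esub> u)"
    proof (rule linear_op_eq[OF linear_comp[OF lin(1) lin(2)] linear_comp[OF lin(2) lin(1)]])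
      fix q assume q: "q \<in> Poly_Mapping.keys t"
      show "sg p \<otimes>\<^bsub>?F\<^esub> sg q \<otimes>\<^bsub>?F\<^esub> u = sg p \<otimes>\<^bsub>?F\<^esub> (sg q \<otimes>\<^bsub>?F\<^esub> u)"
      proof (rule linear_op_eq[OF lin(2) linear_comp[OF lin(2) lin(2)]])
        fix r assume r: "r \<in> Poly_Mapping.keys u"
        show "sg p \<otimes>\<^bsub>?F\<^esub> sg q \<otimes>\<^bsub>?F\<^esub> sg r = sg p \<otimes>\<^bsub>?F\<^esub> (sg q \<otimes>\<^bsub>?F\<^esub> sg r)"
          using k[OF p stu(1)] k[OF q stu(2)] k[OF r stu(3)]
          by (simp add: free_pairs_mult_sg pmul_def A.A.m_assoc C.A.m_assoc)
      qed
    qed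
  qed
  have comm: "s \<otimes>\<^bsub>?F\<^esub> t = t \<otimes>\<^bsub>?F\<^esub> s" if st: "s \<in> carrier ?F" "t \<in> carrier ?F" for s t
  proof (rule linear_op_eq[OF lin(1) lin(2)])
    fix p assume p: "p \<in> Poly_Mapping.keys s"
    show "sg p \<otimes>\<^bsub>?F\<^esub> t = t \<otimes>\<^bsub>?F\<^esub> sg p"
    proof (rule linear_op_eq[OF lin(2) lin(1)])
      fix q assume q: "q \<in> Poly_Mapping.keys t"
      show "sg p \<otimes>\<^bsub>?F\<^esub> sg q = sg q \<otimes>\<^bsub>?F\<^esub> sg p"
        using k[OF p st(1)] k[OF q st(2)] by (simp add: free_pairs_mult_sg pmul_def A.A.m_comm C.A.m_comm)
    qed
  qed
  have one: "\<one>\<^bsub>?F\<^esub> \<otimes>\<^bsub>?F\<^esub> s = s" if s: "s \<in> carrier ?F" for s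
  proof (rule linear_op_eq[OF lin(2) linear_id])
    fix p assume p: "p \<in> Poly_Mapping.keys s"
    show "\<one>\<^bsub>?F\<^esub> \<otimes>\<^bsub>?F\<^esub> sg p = sg p" using k[OF p s] by (simp add: free_pairs_mult_sg pmul_def)
  qed
  have mem: "0 \<in> carrier ?F" "\<one>\<^bsub>?F\<^esub> \<in> carrier ?F" by (auto simp: free_pairs_carrier)
  have "cring ?F"
  proof (rule cringI)
    show "abelian_group ?F" by (rule abelian_groupI) (auto simp: add mem neg add.assoc add.commute)
    show "comm_monoid ?F" by (rule comm_monoidI) (use mult mem assoc one comm in auto)
  qed (simp add: linear_opD[OF lin(1)])
  then show ?thesis
    by (intro kalg.intro algebraI cring_KK) (auto simp: scale scale_simps linear_opD[OF lin(1)])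
qed

lemma bilinear_relsE:
  assumes "r \<in> bilinear_rels A C"
  obtains (add_left) x y z where "x \<in> carrier A" "y \<in> carrier A" "z \<in> carrier C"
      "r = sg (x \<oplus>\<^bsub>A\<^esub> y, z) - sg (x, z) - sg (y, z)"
    | (add_right) x y z where "x \<in> carrier A" "y \<in> carrier C" "z \<in> carrier C"
      "r = sg (x, y \<oplus>\<^bsub>C\<^esub> z) - sg (x, y) - sg (x, z)"
    | (smult_left) k x z where "x \<in> carrier A" "z \<in> carrier C" "r = sg (k \<odot>\<^bsub>A\<^esub> x, z) - scale k (sg (x, z))"
    | (smult_right) k x z where "x \<in> carrier A" "z \<in> carrier C" "r = sg (x, k \<odot>\<^bsub>C\<^esub> z) - scale k (sg (x, z))"
  using assms unfolding bilinear_rels_def pair_var_def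
proof (elim UnE CollectE exE conjE)
qed (rule that; assumption)+

definition tns :: "('k::field_char_0, 'a) gl_module \<Rightarrow> ('k, 'b) gl_module \<Rightarrow> 'a \<Rightarrow> 'b \<Rightarrow> (('a \<times> 'b) \<Rightarrow>\<^sub>0 'k) set" where
  "tns A C a c = tensor_ideal A C +>\<^bsub>free_pairs A C\<^esub> sg (a, c)"

locale kpair = A: kalg A + C: kalg C
  for A :: "('k::field_char_0, 'a) gl_module" and C :: "('k, 'b) gl_module"
begin

sublocale F: kalg "free_pairs A C"
  by (rule kalg_free_pairs) unfold_locales

lemma sg_carrier [simp]: "sg (a, c) \<in> carrier (free_pairs A C) \<longleftrightarrow> a \<in> carrier A \<and> c \<in> carrier C"
  by (simp add: free_pairs_carrier)

lemma F_closed: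
  "s \<in> carrier (free_pairs A C) \<Longrightarrow> t \<in> carrier (free_pairs A C) \<Longrightarrow> s + t \<in> carrier (free_pairs A C)"
  "s \<in> carrier (free_pairs A C) \<Longrightarrow> scale k s \<in> carrier (free_pairs A C)"
  "s \<in> carrier (free_pairs A C) \<Longrightarrow> t \<in> carrier (free_pairs A C) \<Longrightarrow> s - t \<in> carrier (free_pairs A C)"
  "s \<in> carrier (free_pairs A C) \<Longrightarrow> t \<in> carrier (free_pairs A C) \<Longrightarrow> s \<ominus>\<^bsub>free_pairs A C\<^esub> t = s - t"
proof -
  show a: "s \<in> carrier (free_pairs A C) \<Longrightarrow> t \<in> carrier (free_pairs A C) \<Longrightarrow> s + t \<in> carrier (free_pairs A C)" for s t
    using F.M.add.m_closed[of s t] by simp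
  show sc: "s \<in> carrier (free_pairs A C) \<Longrightarrow> scale k s \<in> carrier (free_pairs A C)" for s k
    using F.smult_c[of s k] by simp
  show "s \<in> carrier (free_pairs A C) \<Longrightarrow> t \<in> carrier (free_pairs A C) \<Longrightarrow> s - t \<in> carrier (free_pairs A C)"
    using a[of s "scale (- 1) t"] sc[of t "- 1"] by (simp add: scale_minus_left scale_1)
  show "s \<in> carrier (free_pairs A C) \<Longrightarrow> t \<in> carrier (free_pairs A C) \<Longrightarrow> s \<ominus>\<^bsub>free_pairs A C\<^esub> t = s - t"
    using F.smult_simps(5)[of t 1] F.smult_simps(3)[of t] unfolding F.M.minus_eq
    by (simp add: scale_minus_left scale_1)
qed

lemma rels_carrier: "bilinear_rels A C \<subseteq> carrier (free_pairs A C)"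
  unfolding bilinear_rels_def pair_var_def by (auto intro!: F_closed)

sublocale Q: kquot "free_pairs A C" "tensor_ideal A C"
  unfolding tensor_ideal_def
  by (intro kquot.intro kquot_axioms.intro F.kalg_axioms F.A.genideal_ideal rels_carrier)

lemma kalg_tensor: "kalg (tensor A C)"
  unfolding tensor_def by (rule Q.kalg_quot)

sublocale T: kalg "tensor A C" by (rule kalg_tensor)

lemma rel_mem: "r \<in> bilinear_rels A C \<Longrightarrow> r \<in> tensor_ideal A C"
  unfolding tensor_ideal_def using F.A.genideal_self[OF rels_carrier] by blast

abbreviation "cl \<equiv> (+>\<^bsub>free_pairs A C\<^esub>) (tensor_ideal A C)"

lemma cl_eqI: "s \<in> carrier (free_pairs A C) \<Longrightarrow> t \<in> carrier (free_pairs A C) \<Longrightarrow> s - t \<in> bilinear_rels A C \<Longrightarrow> cl s = cl t"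
  by (simp add: Q.cls_eq F_closed rel_mem)

lemma cl_hom: "cl \<in> alg_hom (free_pairs A C) (tensor A C)"
  unfolding tensor_def by (rule Q.cls_hom)

lemma cl_ops:
  "s \<in> carrier (free_pairs A C) \<Longrightarrow> cl s \<in> carrier (tensor A C)"
  "s \<in> carrier (free_pairs A C) \<Longrightarrow> t \<in> carrier (free_pairs A C) \<Longrightarrow> cl (s + t) = cl s \<oplus>\<^bsub>tensor A C\<^esub> cl t"
  "s \<in> carrier (free_pairs A C) \<Longrightarrow> cl (scale k s) = k \<odot>\<^bsub>tensor A C\<^esub> cl s"
  using alg_homD[OF cl_hom] by auto

lemma tns_closed [simp]: "a \<in> carrier A \<Longrightarrow> c \<in> carrier C \<Longrightarrow> tns A C a c \<in> carrier (tensor A C)"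
  unfolding tns_def by (rule cl_ops) simp

lemma tns_add_left: "a \<in> carrier A \<Longrightarrow> a' \<in> carrier A \<Longrightarrow> c \<in> carrier C \<Longrightarrow>
    tns A C (a \<oplus>\<^bsub>A\<^esub> a') c = tns A C a c \<oplus>\<^bsub>tensor A C\<^esub> tns A C a' c"
  unfolding tns_def
  by (subst cl_ops(2)[symmetric], simp, simp, rule cl_eqI)
    (auto simp: F_closed, auto simp: bilinear_rels_def pair_var_def diff_diff_eq[symmetric])

lemma tns_add_right: "a \<in> carrier A \<Longrightarrow> c \<in> carrier C \<Longrightarrow> c' \<in> carrier C \<Longrightarrow>
    tns A C a (c \<oplus>\<^bsub>C\<^esub> c') = tns A C a c \<oplus>\<^bsub>tensor A C\<^esub> tns A C a c'"
  unfolding tns_def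
  by (subst cl_ops(2)[symmetric], simp, simp, rule cl_eqI)
    (auto simp: F_closed, auto simp: bilinear_rels_def pair_var_def diff_diff_eq[symmetric])

lemma tns_smult_left: "a \<in> carrier A \<Longrightarrow> c \<in> carrier C \<Longrightarrow>
    tns A C (k \<odot>\<^bsub>A\<^esub> a) c = k \<odot>\<^bsub>tensor A C\<^esub> tns A C a c"
  unfolding tns_def
  by (subst cl_ops(3)[symmetric], simp, rule cl_eqI) (auto simp: F_closed, auto simp: bilinear_rels_def pair_var_def)

lemma tns_smult_right: "a \<in> carrier A \<Longrightarrow> c \<in> carrier C \<Longrightarrow>
    tns A C a (k \<odot>\<^bsub>C\<^esub> c) = k \<odot>\<^bsub>tensor A C\<^esub> tns A C a c"
  unfolding tns_def
  by (subst cl_ops(3)[symmetric], simp, rule cl_eqI) (auto simp: F_closed, auto simp: bilinear_rels_def pair_var_def)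

lemma tns_mult: "a \<in> carrier A \<Longrightarrow> c \<in> carrier C \<Longrightarrow> a' \<in> carrier A \<Longrightarrow> c' \<in> carrier C \<Longrightarrow>
    tns A C a c \<otimes>\<^bsub>tensor A C\<^esub> tns A C a' c' = tns A C (a \<otimes>\<^bsub>A\<^esub> a') (c \<otimes>\<^bsub>C\<^esub> c')"
  unfolding tns_def using alg_homD(3)[OF cl_hom, of "sg (a, c)" "sg (a', c')"]
  by (simp add: free_pairs_mult_sg pmul_def)

lemma tns_one: "tns A C \<one>\<^bsub>A\<^esub> \<one>\<^bsub>C\<^esub> = \<one>\<^bsub>tensor A C\<^esub>"
  unfolding tns_def using alg_homD(4)[OF cl_hom] by simp

lemma tensor_cases:
  assumes "z \<in> carrier (tensor A C)"
  obtains t where "t \<in> carrier (free_pairs A C)" "z = cl t"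
  using assms Q.quot_cases unfolding tensor_def by blast

lemma tensor_induct:
  assumes z: "z \<in> carrier (tensor A C)" and tns: "\<And>a c. a \<in> carrier A \<Longrightarrow> c \<in> carrier C \<Longrightarrow> P (tns A C a c)"
    and add: "\<And>x y. x \<in> carrier (tensor A C) \<Longrightarrow> y \<in> carrier (tensor A C) \<Longrightarrow> P x \<Longrightarrow> P y \<Longrightarrow> P (x \<oplus>\<^bsub>tensor A C\<^esub> y)"
  shows "P z"
proof -
  obtain t where t: "t \<in> carrier (free_pairs A C)" "z = cl t" using z by (rule tensor_cases)
  have "P (cl t)" using t(1)
  proof (rule free_pairs_sum)
    have "cl 0 = tns A C \<zero>\<^bsub>A\<^esub> \<zero>\<^bsub>C\<^esub>"
      using tns_smult_left[of "\<zero>\<^bsub>A\<^esub>" "\<zero>\<^bsub>C\<^esub>" 0] cl_ops(3)[of "sg (\<zero>\<^bsub>A\<^esub>, \<zero>\<^bsub>C\<^esub>)" 0]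
      by (simp add: scale_0 tns_def)
    then show "P (cl 0)" using tns by simp
  next
    fix a c k assume ac: "a \<in> carrier A" "c \<in> carrier C"
    have "cl (scale k (sg (a, c))) = tns A C (k \<odot>\<^bsub>A\<^esub> a) c"
      using ac by (simp add: cl_ops(3) tns_smult_left) (simp add: tns_def)
    then show "P (cl (scale k (sg (a, c))))" using tns ac by simp
  qed (simp add: cl_ops add)
  then show ?thesis by (simp add: t)
qed

end

lemma linear_lin_map_push:
  assumes "kpair A C" "kpair A' C'" and f: "lin_map A A' f" "lin_map C C' f'" and t: "t \<in> carrier (free_pairs A C)"
  shows "push (map_prod f f') t \<in> carrier (free_pairs A' C')"
proof -
  have "Poly_Mapping.keys t \<subseteq> carrier A \<times> carrier C" using t by (simp add: free_pairs_carrier)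
  then have "map_prod f f' ` Poly_Mapping.keys t \<subseteq> carrier A' \<times> carrier C'"
    using f by (auto simp: lin_map_def)
  then show ?thesis unfolding free_pairs_carrier using keys_push[of "map_prod f f'" t] by (rule order_trans[rotated])
qed

lemma alg_hom_lin_map: "f \<in> alg_hom A A' \<Longrightarrow> lin_map A A' f"
  by (simp add: lin_map_def alg_homD)

lemma tensor_map_hom:
  fixes A :: "('k::field_char_0, 'a) gl_module" and A' :: "('k, 'a2) gl_module"
    and C :: "('k, 'c) gl_module" and C' :: "('k, 'c2) gl_module"
  assumes p: "kpair A C" "kpair A' C'" and f: "f \<in> alg_hom A A'" "f' \<in> alg_hom C C'"
  shows "tensor_map A' C' f f' \<in> alg_hom (tensor A C) (tensor A' C')"
    and "a \<in> carrier A \<Longrightarrow> c \<in> carrier C \<Longrightarrow> tensor_map A' C' f f' (tns A C a c) = tns A' C' (f a) (f' c)"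
    and "t \<in> carrier (free_pairs A C) \<Longrightarrow> tensor_map A' C' f f' (tensor_ideal A C +>\<^bsub>free_pairs A C\<^esub> t) =
      tensor_ideal A' C' +>\<^bsub>free_pairs A' C'\<^esub> push (map_prod f f') t"
proof -
  interpret P: kpair A C by (rule p)
  interpret P': kpair A' C' by (rule p)
  let ?G = "push (map_prod f f') :: _ \<Rightarrow> _ \<Rightarrow>\<^sub>0 'k"
  let ?F = "free_pairs A C" and ?F' = "free_pairs A' C'"
  note fD = alg_homD[OF f(1)] and fD' = alg_homD[OF f(2)]
  have closed: "?G t \<in> carrier ?F'" if "t \<in> carrier ?F" for t
    by (rule linear_lin_map_push[OF p alg_hom_lin_map[OF f(1)] alg_hom_lin_map[OF f(2)] that])
  have mult: "?G (s \<otimes>\<^bsub>?F\<^esub> t) = ?G s \<otimes>\<^bsub>?F'\<^esub> ?G t" if st: "s \<in> carrier ?F" "t \<in> carrier ?F" for s t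
  proof (rule linear_op_eq[OF linear_comp[OF linear_push linear_free_pairs_mult(1)] linear_comp[OF linear_free_pairs_mult(1) linear_push]])
    fix x assume x: "x \<in> Poly_Mapping.keys s"
    show "?G (sg x \<otimes>\<^bsub>?F\<^esub> t) = ?G (sg x) \<otimes>\<^bsub>?F'\<^esub> ?G t"
    proof (rule linear_op_eq[OF linear_comp[OF linear_push linear_free_pairs_mult(2)] linear_comp[OF linear_free_pairs_mult(2) linear_push]])
      fix y assume y: "y \<in> Poly_Mapping.keys t"
      have "fst x \<in> carrier A" "snd x \<in> carrier C" "fst y \<in> carrier A" "snd y \<in> carrier C"
        using st x y by (auto simp: free_pairs_carrier)
      then show "?G (sg x \<otimes>\<^bsub>?F\<^esub> sg y) = ?G (sg x) \<otimes>\<^bsub>?F'\<^esub> ?G (sg y)"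
        by (simp add: push_single free_pairs_mult_sg pmul_def fD fD' map_prod_def split_beta)
    qed
  qed
  have G: "?G \<in> alg_hom ?F ?F'"
    by (rule alg_homI) (simp_all add: closed mult push_add push_scale push_single fD fD')
  have rel: "?G t \<in> tensor_ideal A' C'" if "t \<in> tensor_ideal A C" for t
  proof (rule alg_hom_Idl[OF P.F.kalg_axioms P'.F.kalg_axioms G P'.Q.id P.rels_carrier _ that[unfolded tensor_ideal_def]])
    fix r assume "r \<in> bilinear_rels A C"
    then have "?G r \<in> bilinear_rels A' C'"
    proof (cases rule: bilinear_relsE)
      case (add_left x y z)
      have "?G r = sg (f x \<oplus>\<^bsub>A'\<^esub> f y, f' z) - sg (f x, f' z) - sg (f y, f' z)"
        by (simp add: add_left linear_op_diff[OF linear_push] push_single fD)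
      then show ?thesis unfolding bilinear_rels_def pair_var_def using add_left(1-3) fD(1) fD'(1) by blast
    next
      case (add_right x y z)
      have "?G r = sg (f x, f' y \<oplus>\<^bsub>C'\<^esub> f' z) - sg (f x, f' y) - sg (f x, f' z)"
        by (simp add: add_right linear_op_diff[OF linear_push] push_single fD')
      then show ?thesis unfolding bilinear_rels_def pair_var_def using add_right(1-3) fD(1) fD'(1) by blast
    next
      case (smult_left k x z)
      have "?G r = sg (k \<odot>\<^bsub>A'\<^esub> f x, f' z) - scale k (sg (f x, f' z))"
        by (simp add: smult_left linear_op_diff[OF linear_push] push_single push_scale fD)
      then show ?thesis unfolding bilinear_rels_def pair_var_def using smult_left(1-2) fD(1) fD'(1) by blast
    next
      case (smult_right k x z)
      have "?G r = sg (f x, k \<odot>\<^bsub>C'\<^esub> f' z) - scale k (sg (f x, f' z))"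
        by (simp add: smult_right linear_op_diff[OF linear_push] push_single push_scale fD')
      then show ?thesis unfolding bilinear_rels_def pair_var_def using smult_right(1-2) fD(1) fD'(1) by blast
    qed
    then show "?G r \<in> tensor_ideal A' C'" by (rule P'.rel_mem)
  qed
  note q = quot_map_hom[OF P.F.kalg_axioms P'.F.kalg_axioms P.Q.id P'.Q.id G rel]
  show "tensor_map A' C' f f' \<in> alg_hom (tensor A C) (tensor A' C')"
    unfolding tensor_map_def tensor_def by (rule q(1))
  show 3: "t \<in> carrier (free_pairs A C) \<Longrightarrow> tensor_map A' C' f f' (tensor_ideal A C +>\<^bsub>free_pairs A C\<^esub> t) =
      tensor_ideal A' C' +>\<^bsub>free_pairs A' C'\<^esub> push (map_prod f f') t" for t
    unfolding tensor_map_def by (rule q(2))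
  show "a \<in> carrier A \<Longrightarrow> c \<in> carrier C \<Longrightarrow> tensor_map A' C' f f' (tns A C a c) = tns A' C' (f a) (f' c)"
    unfolding tns_def by (subst 3) (auto simp: push_single)
qed

text \<open>
  The kernel of \<open>A \<otimes> C \<rightarrow> A/I \<otimes> C\<close> is contained in every ideal \<open>J\<close> that contains \<open>I \<otimes> 1\<close>: a set-theoretic section of
  \<open>A \<rightarrow> A/I\<close> induces a homomorphism from \<open>A/I \<otimes> C\<close> to the quotient by \<open>J\<close>.
\<close>

lemma tensor_kernel_le:
  fixes A :: "('k::field_char_0, 'a) gl_module" and C :: "('k, 'c) gl_module"
  assumes p: "kpair A C" and I: "ideal I A" and J: "ideal J (tensor A C)"
    and IJ: "\<And>a. a \<in> I \<Longrightarrow> tns A C a \<one>\<^bsub>C\<^esub> \<in> J"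
    and z: "z \<in> carrier (tensor A C)"
    and ker: "tensor_map (gl_quot A I) C (\<lambda>x. I +>\<^bsub>A\<^esub> x) (\<lambda>c. c) z = \<zero>\<^bsub>tensor (gl_quot A I) C\<^esub>"
  shows "z \<in> J"
proof -
  interpret P: kpair A C by (rule p)
  interpret AI: kquot A I using I P.A.kalg_axioms by (simp add: kquot_def kquot_axioms_def)
  interpret TJ: kquot "tensor A C" J using J P.T.kalg_axioms by (simp add: kquot_def kquot_axioms_def)
  interpret QA: kalg "gl_quot A I" by (rule AI.kalg_quot)
  interpret QT: kalg "gl_quot (tensor A C) J" by (rule TJ.kalg_quot)
  interpret P': kpair "gl_quot A I" C by unfold_locales
  let ?T = "tensor A C" and ?QT = "gl_quot (tensor A C) J" and ?F' = "free_pairs (gl_quot A I) C"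
  define s where "s X = (SOME x. x \<in> carrier A \<and> X = I +>\<^bsub>A\<^esub> x)" for X
  have s: "s X \<in> carrier A" "I +>\<^bsub>A\<^esub> s X = X" if "X \<in> carrier (gl_quot A I)" for X
  proof -
    have "\<exists>x. x \<in> carrier A \<and> X = I +>\<^bsub>A\<^esub> x" using that AI.quot_cases by blast
    from someI_ex[OF this] show "s X \<in> carrier A" "I +>\<^bsub>A\<^esub> s X = X" unfolding s_def by auto
  qed
  define j where "j a c = J +>\<^bsub>?T\<^esub> tns A C a c" for a c
  have jc: "j a c \<in> carrier ?QT" if "a \<in> carrier A" "c \<in> carrier C" for a c
    unfolding j_def using that by (intro TJ.cls_closed) simp
  have j_cong: "j a c = j a' c" if a: "a \<in> carrier A" "a' \<in> carrier A" "c \<in> carrier C" and eq: "I +>\<^bsub>A\<^esub> a = I +>\<^bsub>A\<^esub> a'" for a a' c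
  proof -
    have d: "a \<ominus>\<^bsub>A\<^esub> a' \<in> I" using eq a AI.cls_eq by simp
    have "tns A C a c = tns A C ((a \<ominus>\<^bsub>A\<^esub> a') \<oplus>\<^bsub>A\<^esub> a') c"
      using a by (simp add: P.A.M.minus_eq P.A.M.a_assoc P.A.M.l_neg)
    also have "\<dots> = tns A C (a \<ominus>\<^bsub>A\<^esub> a') c \<oplus>\<^bsub>?T\<^esub> tns A C a' c" using a by (intro P.tns_add_left) auto
    finally have "tns A C a c \<ominus>\<^bsub>?T\<^esub> tns A C a' c = tns A C (a \<ominus>\<^bsub>A\<^esub> a') c"
      using a by (simp add: P.T.M.minus_eq P.T.M.a_assoc P.T.M.r_neg)
    also have "\<dots> = tns A C (a \<ominus>\<^bsub>A\<^esub> a') \<one>\<^bsub>C\<^esub> \<otimes>\<^bsub>?T\<^esub> tns A C \<one>\<^bsub>A\<^esub> c"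
      using a by (subst P.tns_mult) auto
    also have "\<dots> \<in> J" using a by (intro TJ.I.I_r_closed IJ d) auto
    finally show ?thesis unfolding j_def using a by (subst TJ.cls_eq) auto
  qed
  have j_ops: "j (a \<oplus>\<^bsub>A\<^esub> a') c = j a c \<oplus>\<^bsub>?QT\<^esub> j a' c" "j (k \<odot>\<^bsub>A\<^esub> a) c = k \<odot>\<^bsub>?QT\<^esub> j a c"
    "j a (c \<oplus>\<^bsub>C\<^esub> c') = j a c \<oplus>\<^bsub>?QT\<^esub> j a c'" "j a (k \<odot>\<^bsub>C\<^esub> c) = k \<odot>\<^bsub>?QT\<^esub> j a c"
    "j (a \<otimes>\<^bsub>A\<^esub> a') (c \<otimes>\<^bsub>C\<^esub> c') = j a c \<otimes>\<^bsub>?QT\<^esub> j a' c'"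
    if "a \<in> carrier A" "a' \<in> carrier A" "c \<in> carrier C" "c' \<in> carrier C" for a a' c c' k
    unfolding j_def using that
    by (simp_all add: P.tns_add_left P.tns_smult_left P.tns_add_right P.tns_smult_right P.tns_mult[symmetric]
        TJ.cls_add TJ.cls_smult TJ.cls_mult del: gl_quot_simps)
  define \<Phi> where "\<Phi> G = J +>\<^bsub>?T\<^esub> P.cl (push (map_prod s (\<lambda>c. c)) G)" for G
  have push_closed: "push (map_prod s (\<lambda>c. c)) G \<in> carrier (free_pairs A C)" if "G \<in> carrier ?F'" for G
  proof -
    have "Poly_Mapping.keys G \<subseteq> carrier (gl_quot A I) \<times> carrier C" using that by (simp only: free_pairs_carrier)
    then have "map_prod s (\<lambda>c. c) ` Poly_Mapping.keys G \<subseteq> carrier A \<times> carrier C" using s(1) by (auto simp del: gl_quot_simps)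
    then show ?thesis unfolding free_pairs_carrier by (rule order_trans[OF keys_push])
  qed
  have \<Phi>_closed: "\<Phi> G \<in> carrier ?QT" if "G \<in> carrier ?F'" for G
    unfolding \<Phi>_def by (intro TJ.cls_closed P.cl_ops push_closed that)
  have \<Phi>_add: "\<Phi> (G + H) = \<Phi> G \<oplus>\<^bsub>?QT\<^esub> \<Phi> H" if "G \<in> carrier ?F'" "H \<in> carrier ?F'" for G H
    unfolding \<Phi>_def push_add using push_closed that by (simp add: P.cl_ops TJ.cls_add del: gl_quot_simps)
  have \<Phi>_scale: "\<Phi> (scale k G) = k \<odot>\<^bsub>?QT\<^esub> \<Phi> G" if "G \<in> carrier ?F'" for G k
    unfolding \<Phi>_def push_scale using push_closed that by (simp add: P.cl_ops TJ.cls_smult del: gl_quot_simps)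
  have \<Phi>_sg: "\<Phi> (sg (X, c)) = j (s X) c" for X c
    by (simp add: \<Phi>_def push_single j_def tns_def)
  have \<Phi>_zero: "\<Phi> 0 = \<zero>\<^bsub>?QT\<^esub>"
    using \<Phi>_scale[of 0 0] \<Phi>_closed[of 0] P'.F.M.zero_closed by (simp add: scale_0 QT.smult_simps del: gl_quot_simps)
  have \<Phi>_mult_sg: "\<Phi> (sg (X, c) \<otimes>\<^bsub>?F'\<^esub> sg (Y, d)) = \<Phi> (sg (X, c)) \<otimes>\<^bsub>?QT\<^esub> \<Phi> (sg (Y, d))"
    if X: "X \<in> carrier (gl_quot A I)" "Y \<in> carrier (gl_quot A I)" and c: "c \<in> carrier C" "d \<in> carrier C" for X Y c d
  proof -
    have XY: "X \<otimes>\<^bsub>gl_quot A I\<^esub> Y \<in> carrier (gl_quot A I)" using X by (rule QA.A.m_closed)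
    have "I +>\<^bsub>A\<^esub> s (X \<otimes>\<^bsub>gl_quot A I\<^esub> Y) = I +>\<^bsub>A\<^esub> (s X \<otimes>\<^bsub>A\<^esub> s Y)"
      using s(2)[OF XY] AI.cls_mult[OF s(1)[OF X(1)] s(1)[OF X(2)]] s(2)[OF X(1)] s(2)[OF X(2)] by metis
    then have "j (s (X \<otimes>\<^bsub>gl_quot A I\<^esub> Y)) (c \<otimes>\<^bsub>C\<^esub> d) = j (s X \<otimes>\<^bsub>A\<^esub> s Y) (c \<otimes>\<^bsub>C\<^esub> d)"
      using s(1) X XY c by (intro j_cong) auto
    also have "\<dots> = j (s X) c \<otimes>\<^bsub>?QT\<^esub> j (s Y) d" using s(1) X c by (intro j_ops(5)) auto
    finally show ?thesis unfolding free_pairs_mult_sg pmul_def fst_conv snd_conv \<Phi>_sg .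
  qed
  note lin = linear_opD[OF linear_free_pairs_mult(1)[of "gl_quot A I" C]] linear_opD[OF linear_free_pairs_mult(2)[of "gl_quot A I" C]]
    linear_op_zero[OF linear_free_pairs_mult(1)[of "gl_quot A I" C]] linear_op_zero[OF linear_free_pairs_mult(2)[of "gl_quot A I" C]]
  have \<Phi>_mult: "\<Phi> (G \<otimes>\<^bsub>?F'\<^esub> H) = \<Phi> G \<otimes>\<^bsub>?QT\<^esub> \<Phi> H" if G: "G \<in> carrier ?F'" and H: "H \<in> carrier ?F'" for G H
    using G
  proof (rule free_pairs_sum)
    show "\<Phi> (0 \<otimes>\<^bsub>?F'\<^esub> H) = \<Phi> 0 \<otimes>\<^bsub>?QT\<^esub> \<Phi> H"
      using \<Phi>_closed[OF H] by (simp add: lin \<Phi>_zero QT.A.l_null del: gl_quot_simps)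
    fix G G' assume G: "G \<in> carrier ?F'" "G' \<in> carrier ?F'" "\<Phi> (G \<otimes>\<^bsub>?F'\<^esub> H) = \<Phi> G \<otimes>\<^bsub>?QT\<^esub> \<Phi> H" "\<Phi> (G' \<otimes>\<^bsub>?F'\<^esub> H) = \<Phi> G' \<otimes>\<^bsub>?QT\<^esub> \<Phi> H"
    show "\<Phi> ((G + G') \<otimes>\<^bsub>?F'\<^esub> H) = \<Phi> (G + G') \<otimes>\<^bsub>?QT\<^esub> \<Phi> H"
      using G H \<Phi>_closed P'.F.A.m_closed by (simp add: lin \<Phi>_add QT.A.l_distr del: gl_quot_simps)
  next
    fix X c k assume X: "X \<in> carrier (gl_quot A I)" and c: "c \<in> carrier C"
    have Xc: "sg (X, c) \<in> carrier ?F'" using X c by (simp del: gl_quot_simps)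
    have "\<Phi> (sg (X, c) \<otimes>\<^bsub>?F'\<^esub> H) = \<Phi> (sg (X, c)) \<otimes>\<^bsub>?QT\<^esub> \<Phi> H"
      using H
    proof (rule free_pairs_sum)
      show "\<Phi> (sg (X, c) \<otimes>\<^bsub>?F'\<^esub> 0) = \<Phi> (sg (X, c)) \<otimes>\<^bsub>?QT\<^esub> \<Phi> 0"
        using \<Phi>_closed[OF Xc] by (simp add: lin \<Phi>_zero QT.A.r_null del: gl_quot_simps)
      fix G G' assume "G \<in> carrier ?F'" "G' \<in> carrier ?F'" "\<Phi> (sg (X, c) \<otimes>\<^bsub>?F'\<^esub> G) = \<Phi> (sg (X, c)) \<otimes>\<^bsub>?QT\<^esub> \<Phi> G"
        "\<Phi> (sg (X, c) \<otimes>\<^bsub>?F'\<^esub> G') = \<Phi> (sg (X, c)) \<otimes>\<^bsub>?QT\<^esub> \<Phi> G'"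
      then show "\<Phi> (sg (X, c) \<otimes>\<^bsub>?F'\<^esub> (G + G')) = \<Phi> (sg (X, c)) \<otimes>\<^bsub>?QT\<^esub> \<Phi> (G + G')"
        using Xc \<Phi>_closed P'.F.A.m_closed by (simp add: lin \<Phi>_add QT.A.r_distr del: gl_quot_simps)
    next
      fix Y d l assume Y: "Y \<in> carrier (gl_quot A I)" and d: "d \<in> carrier C"
      have Yd: "sg (Y, d) \<in> carrier ?F'" using Y d by (simp del: gl_quot_simps)
      show "\<Phi> (sg (X, c) \<otimes>\<^bsub>?F'\<^esub> scale l (sg (Y, d))) = \<Phi> (sg (X, c)) \<otimes>\<^bsub>?QT\<^esub> \<Phi> (scale l (sg (Y, d)))"
        using \<Phi>_mult_sg[OF X Y c d] \<Phi>_closed[OF Xc] \<Phi>_closed[OF Yd] P'.F.A.m_closed[OF Xc Yd]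
        by (simp add: lin \<Phi>_scale[OF Yd] \<Phi>_scale QT.smult_mult del: gl_quot_simps)
    qed
    then show "\<Phi> (scale k (sg (X, c)) \<otimes>\<^bsub>?F'\<^esub> H) = \<Phi> (scale k (sg (X, c))) \<otimes>\<^bsub>?QT\<^esub> \<Phi> H"
      using \<Phi>_closed[OF Xc] \<Phi>_closed[OF H] P'.F.A.m_closed[OF Xc H]
      by (simp add: lin \<Phi>_scale[OF Xc] \<Phi>_scale QT.smult_mult del: gl_quot_simps)
  qed
  have one: "\<Phi> \<one>\<^bsub>?F'\<^esub> = \<one>\<^bsub>?QT\<^esub>"
  proof -
    have "I +>\<^bsub>A\<^esub> s \<one>\<^bsub>gl_quot A I\<^esub> = I +>\<^bsub>A\<^esub> \<one>\<^bsub>A\<^esub>" using s(2)[OF QA.A.one_closed] AI.cls_one by simp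
    then have "j (s \<one>\<^bsub>gl_quot A I\<^esub>) \<one>\<^bsub>C\<^esub> = j \<one>\<^bsub>A\<^esub> \<one>\<^bsub>C\<^esub>" using s(1)[OF QA.A.one_closed] by (intro j_cong) auto
    then show ?thesis using TJ.cls_one by (simp add: \<Phi>_sg j_def P.tns_one del: gl_quot_simps)
  qed
  have \<Phi>: "\<Phi> \<in> alg_hom ?F' ?QT"
    by (rule alg_homI) (simp_all only: \<Phi>_closed \<Phi>_add \<Phi>_mult one \<Phi>_scale free_pairs_simps(3,4))
  have j_zero: "x \<ominus>\<^bsub>?QT\<^esub> x = \<zero>\<^bsub>?QT\<^esub>" if "x \<in> carrier ?QT" for x
    using that by (simp add: QT.M.minus_eq QT.M.r_neg del: gl_quot_simps)
  have \<Phi>_diff: "\<Phi> (G - H) = \<Phi> G \<ominus>\<^bsub>?QT\<^esub> \<Phi> H" if "G \<in> carrier ?F'" "H \<in> carrier ?F'" for G H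
    using \<Phi>_add[OF that(1) P'.F_closed(2)[OF that(2), of "- 1"]] \<Phi>_scale[OF that(2), of "- 1"] \<Phi>_closed[OF that(2)]
    by (simp add: scale_minus_left scale_1 QT.M.minus_eq QT.smult_simps del: gl_quot_simps)
  have zero: "\<Phi> G \<in> {\<zero>\<^bsub>?QT\<^esub>}" if "G \<in> tensor_ideal (gl_quot A I) C" for G
  proof (rule alg_hom_Idl[OF P'.F.kalg_axioms QT.kalg_axioms \<Phi> QT.A.zeroideal P'.rels_carrier _ that[unfolded tensor_ideal_def]])
    fix r assume "r \<in> bilinear_rels (gl_quot A I) C"
    then have "\<Phi> r = \<zero>\<^bsub>?QT\<^esub>"
    proof (cases rule: bilinear_relsE)
      case (add_left x y z)
      note 1 = this
      have xy: "x \<oplus>\<^bsub>gl_quot A I\<^esub> y \<in> carrier (gl_quot A I)" using 1 by (intro QA.M.add.m_closed)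
      have "I +>\<^bsub>A\<^esub> s (x \<oplus>\<^bsub>gl_quot A I\<^esub> y) = I +>\<^bsub>A\<^esub> (s x \<oplus>\<^bsub>A\<^esub> s y)"
        using s(2)[OF xy] AI.cls_add[OF s(1)[OF 1(1)] s(1)[OF 1(2)]] s(2)[OF 1(1)] s(2)[OF 1(2)] by metis
      then have "j (s (x \<oplus>\<^bsub>gl_quot A I\<^esub> y)) z = j (s x \<oplus>\<^bsub>A\<^esub> s y) z"
        using s(1) 1 xy by (intro j_cong) auto
      also have "\<dots> = j (s x) z \<oplus>\<^bsub>?QT\<^esub> j (s y) z" using s(1) 1 by (intro j_ops(1)[OF _ _ _ 1(3)]) auto
      finally have e: "\<Phi> (sg (x \<oplus>\<^bsub>gl_quot A I\<^esub> y, z)) = \<Phi> (sg (x, z) + sg (y, z))"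
        using 1 by (subst \<Phi>_add) (simp_all add: \<Phi>_sg del: gl_quot_simps)
      have "sg (x, z) + sg (y, z) \<in> carrier ?F'" using 1 by (intro P'.F_closed) (simp_all del: gl_quot_simps)
      then show ?thesis unfolding 1(4) diff_diff_eq
        using \<Phi>_diff[of "sg (x \<oplus>\<^bsub>gl_quot A I\<^esub> y, z)" "sg (x, z) + sg (y, z)"] xy 1(3) e j_zero \<Phi>_closed
        by (simp del: gl_quot_simps)
    next
      case (add_right x y z)
      note 2 = this
      have yz: "y \<oplus>\<^bsub>C\<^esub> z \<in> carrier C" using 2 by simp
      have "j (s x) (y \<oplus>\<^bsub>C\<^esub> z) = j (s x) y \<oplus>\<^bsub>?QT\<^esub> j (s x) z" using s(1) 2 by (intro j_ops(3)[OF _ s(1)[OF 2(1)]]) auto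
      then have e: "\<Phi> (sg (x, y \<oplus>\<^bsub>C\<^esub> z)) = \<Phi> (sg (x, y) + sg (x, z))"
        using 2 by (subst \<Phi>_add) (simp_all add: \<Phi>_sg del: gl_quot_simps)
      have "sg (x, y) + sg (x, z) \<in> carrier ?F'" using 2 by (intro P'.F_closed) (simp_all del: gl_quot_simps)
      then show ?thesis unfolding 2(4) diff_diff_eq
        using \<Phi>_diff[of "sg (x, y \<oplus>\<^bsub>C\<^esub> z)" "sg (x, y) + sg (x, z)"] yz 2(1) e j_zero \<Phi>_closed
        by (simp del: gl_quot_simps)
    next
      case (smult_left k x z)
      note 3 = this
      have kx: "k \<odot>\<^bsub>gl_quot A I\<^esub> x \<in> carrier (gl_quot A I)" using 3 by (intro QA.smult_c)
      have "I +>\<^bsub>A\<^esub> s (k \<odot>\<^bsub>gl_quot A I\<^esub> x) = I +>\<^bsub>A\<^esub> (k \<odot>\<^bsub>A\<^esub> s x)"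
        using s(2)[OF kx] AI.cls_smult[OF s(1)[OF 3(1)], of k] s(2)[OF 3(1)] by metis
      then have "j (s (k \<odot>\<^bsub>gl_quot A I\<^esub> x)) z = j (k \<odot>\<^bsub>A\<^esub> s x) z"
        using s(1) 3 kx by (intro j_cong) auto
      also have "\<dots> = k \<odot>\<^bsub>?QT\<^esub> j (s x) z" using s(1) 3 by (intro j_ops(2)[OF _ s(1)[OF 3(1)] _ 3(2)]) auto
      finally have e: "\<Phi> (sg (k \<odot>\<^bsub>gl_quot A I\<^esub> x, z)) = \<Phi> (scale k (sg (x, z)))"
        using 3 by (subst \<Phi>_scale) (simp_all add: \<Phi>_sg del: gl_quot_simps)
      have "scale k (sg (x, z)) \<in> carrier ?F'" using 3 by (intro P'.F_closed) (simp_all del: gl_quot_simps)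
      then show ?thesis unfolding 3(3)
        using \<Phi>_diff[of "sg (k \<odot>\<^bsub>gl_quot A I\<^esub> x, z)" "scale k (sg (x, z))"] kx 3(2) e j_zero \<Phi>_closed
        by (simp del: gl_quot_simps)
    next
      case (smult_right k x z)
      note 4 = this
      have "j (s x) (k \<odot>\<^bsub>C\<^esub> z) = k \<odot>\<^bsub>?QT\<^esub> j (s x) z" using s(1) 4 by (intro j_ops(4)[OF _ s(1)[OF 4(1)] _ 4(2)]) auto
      then have e: "\<Phi> (sg (x, k \<odot>\<^bsub>C\<^esub> z)) = \<Phi> (scale k (sg (x, z)))"
        using 4 by (subst \<Phi>_scale) (simp_all add: \<Phi>_sg del: gl_quot_simps)
      have "scale k (sg (x, z)) \<in> carrier ?F'" using 4 by (intro P'.F_closed) (simp_all del: gl_quot_simps)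
      then show ?thesis unfolding 4(3)
        using \<Phi>_diff[of "sg (x, k \<odot>\<^bsub>C\<^esub> z)" "scale k (sg (x, z))"] 4(1,2) e j_zero \<Phi>_closed
        by (simp del: gl_quot_simps)
    qed
    then show "\<Phi> r \<in> {\<zero>\<^bsub>?QT\<^esub>}" by simp
  qed
  obtain t where t: "t \<in> carrier (free_pairs A C)" "z = P.cl t" using z by (rule P.tensor_cases)
  define G where "G = push (map_prod (\<lambda>x. I +>\<^bsub>A\<^esub> x) (\<lambda>c. c)) t"
  have id: "(\<lambda>c. c) \<in> alg_hom C C" by (rule alg_homI) auto
  have Gc: "G \<in> carrier ?F'"
    unfolding G_def by (rule linear_lin_map_push[OF p P'.kpair_axioms alg_hom_lin_map[OF AI.cls_hom] alg_hom_lin_map[OF id] t(1)])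
  have "P'.cl G = \<zero>\<^bsub>gl_quot ?F' (tensor_ideal (gl_quot A I) C)\<^esub>"
    using ker tensor_map_hom(3)[OF p P'.kpair_axioms AI.cls_hom id t(1)] unfolding t(2) G_def tensor_def by simp
  then have "G \<in> tensor_ideal (gl_quot A I) C" using P'.Q.cls_zero_iff[OF Gc] by blast
  then have "\<Phi> G = \<zero>\<^bsub>?QT\<^esub>" using zero by blast
  moreover have "\<Phi> (push (map_prod (\<lambda>x. I +>\<^bsub>A\<^esub> x) (\<lambda>c. c)) t) = J +>\<^bsub>?T\<^esub> P.cl t"
    using t(1)
  proof (rule free_pairs_sum)
    have "P.cl 0 = \<zero>\<^bsub>?T\<^esub>" using alg_hom_zero[OF P.F.kalg_axioms P.T.kalg_axioms P.cl_hom] by simp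
    then show "\<Phi> (push (map_prod (\<lambda>x. I +>\<^bsub>A\<^esub> x) (\<lambda>c. c)) 0) = J +>\<^bsub>?T\<^esub> P.cl 0"
      using TJ.cls_zero_iff[of "\<zero>\<^bsub>?T\<^esub>"] TJ.I.zero_closed by (simp add: \<Phi>_zero del: gl_quot_simps)
  next
    fix u v assume u: "u \<in> carrier (free_pairs A C)" "v \<in> carrier (free_pairs A C)"
      and IH: "\<Phi> (push (map_prod (\<lambda>x. I +>\<^bsub>A\<^esub> x) (\<lambda>c. c)) u) = J +>\<^bsub>?T\<^esub> P.cl u"
      "\<Phi> (push (map_prod (\<lambda>x. I +>\<^bsub>A\<^esub> x) (\<lambda>c. c)) v) = J +>\<^bsub>?T\<^esub> P.cl v"
    note c = linear_lin_map_push[OF p P'.kpair_axioms alg_hom_lin_map[OF AI.cls_hom] alg_hom_lin_map[OF id]]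
    show "\<Phi> (push (map_prod (\<lambda>x. I +>\<^bsub>A\<^esub> x) (\<lambda>c. c)) (u + v)) = J +>\<^bsub>?T\<^esub> P.cl (u + v)"
      using u c by (simp add: push_add \<Phi>_add IH P.cl_ops TJ.cls_add del: gl_quot_simps)
  next
    fix a c k assume a: "a \<in> carrier A" and c: "c \<in> carrier C"
    have Xc: "sg (I +>\<^bsub>A\<^esub> a, c) \<in> carrier ?F'" using a c AI.cls_closed by (simp del: gl_quot_simps)
    have "j (s (I +>\<^bsub>A\<^esub> a)) c = j a c" using s AI.cls_closed a c by (intro j_cong) auto
    then show "\<Phi> (push (map_prod (\<lambda>x. I +>\<^bsub>A\<^esub> x) (\<lambda>c. c)) (scale k (sg (a, c)))) = J +>\<^bsub>?T\<^esub> P.cl (scale k (sg (a, c)))"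
      using a c by (simp add: push_scale push_single \<Phi>_scale[OF Xc] \<Phi>_sg P.cl_ops TJ.cls_smult[symmetric] del: gl_quot_simps)
        (simp add: j_def tns_def)
  qed
  ultimately have "J +>\<^bsub>?T\<^esub> z = \<zero>\<^bsub>?QT\<^esub>" unfolding G_def t(2) by simp
  then show ?thesis using TJ.cls_zero_iff[OF z] by blast
qed

section \<open>Functions on a product with an affine space\<close>

definition iota :: "('k::field_char_0, 'b) gl_module \<Rightarrow> ('k, 'a) gl_module \<Rightarrow> 'b \<Rightarrow> _" where
  "iota B M b = tns B (Sym M) b \<one>\<^bsub>Sym M\<^esub>"

definition et :: "('k::field_char_0, 'b) gl_module \<Rightarrow> ('k, 'a) gl_module \<Rightarrow> 'a \<Rightarrow> _" where
  "et B M x = tns B (Sym M) \<one>\<^bsub>B\<^esub> (eta M x)"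

locale kts = B: kalg B + M: kmod M
  for B :: "('k::field_char_0, 'b) gl_module" and M :: "('k, 'a) gl_module"
begin

sublocale S: kalg "Sym M" by (rule kalg_Sym[OF M.kmod_axioms])
sublocale P: kpair B "Sym M" by unfold_locales

abbreviation "R \<equiv> tensor B (Sym M)"

lemma iota_hom: "iota B M \<in> alg_hom B R"
  unfolding iota_def
  by (rule alg_homI) (simp_all add: P.tns_add_left P.tns_smult_left P.tns_mult P.tns_one)

lemmas iota_simps = alg_homD(1-5)[OF iota_hom]

lemma iota_zero: "iota B M \<zero>\<^bsub>B\<^esub> = \<zero>\<^bsub>R\<^esub>"
  by (rule alg_hom_zero[OF B.kalg_axioms P.T.kalg_axioms iota_hom])

lemma et_simps:
  "x \<in> carrier M \<Longrightarrow> et B M x \<in> carrier R"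
  "x \<in> carrier M \<Longrightarrow> y \<in> carrier M \<Longrightarrow> et B M (x \<oplus>\<^bsub>M\<^esub> y) = et B M x \<oplus>\<^bsub>R\<^esub> et B M y"
  "x \<in> carrier M \<Longrightarrow> et B M (c \<odot>\<^bsub>M\<^esub> x) = c \<odot>\<^bsub>R\<^esub> et B M x"
  unfolding et_def by (simp_all add: eta_props[OF M.kmod_axioms] P.tns_add_right P.tns_smult_right)

lemma TS_induct:
  assumes z: "z \<in> carrier R" and b: "\<And>b. b \<in> carrier B \<Longrightarrow> Q (iota B M b)" and x: "\<And>x. x \<in> carrier M \<Longrightarrow> Q (et B M x)"
    and add: "\<And>x y. x \<in> carrier R \<Longrightarrow> y \<in> carrier R \<Longrightarrow> Q x \<Longrightarrow> Q y \<Longrightarrow> Q (x \<oplus>\<^bsub>R\<^esub> y)"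
    and mult: "\<And>x y. x \<in> carrier R \<Longrightarrow> y \<in> carrier R \<Longrightarrow> Q x \<Longrightarrow> Q y \<Longrightarrow> Q (x \<otimes>\<^bsub>R\<^esub> y)"
  shows "Q z"
  using z
proof (rule P.tensor_induct[where P = Q])
  fix a c assume a: "a \<in> carrier B" and c: "c \<in> carrier (Sym M)"
  have "Q (tns B (Sym M) \<one>\<^bsub>B\<^esub> c)"
    using c
  proof (rule Sym_induct[OF M.kmod_axioms])
    fix k
    have "tns B (Sym M) \<one>\<^bsub>B\<^esub> (k \<odot>\<^bsub>Sym M\<^esub> \<one>\<^bsub>Sym M\<^esub>) = iota B M (k \<odot>\<^bsub>B\<^esub> \<one>\<^bsub>B\<^esub>)"
      by (simp add: iota_def P.tns_smult_left P.tns_smult_right)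
    then show "Q (tns B (Sym M) \<one>\<^bsub>B\<^esub> (k \<odot>\<^bsub>Sym M\<^esub> \<one>\<^bsub>Sym M\<^esub>))" using b by simp
  next
    fix x assume "x \<in> carrier M"
    then show "Q (tns B (Sym M) \<one>\<^bsub>B\<^esub> (eta M x))" using assms(3) by (simp add: et_def)
  next
    fix x y assume "x \<in> carrier (Sym M)" "y \<in> carrier (Sym M)" "Q (tns B (Sym M) \<one>\<^bsub>B\<^esub> x)" "Q (tns B (Sym M) \<one>\<^bsub>B\<^esub> y)"
    then show "Q (tns B (Sym M) \<one>\<^bsub>B\<^esub> (x \<oplus>\<^bsub>Sym M\<^esub> y))" by (simp add: P.tns_add_right add)
  next
    fix x y assume *: "x \<in> carrier (Sym M)" "y \<in> carrier (Sym M)" "Q (tns B (Sym M) \<one>\<^bsub>B\<^esub> x)" "Q (tns B (Sym M) \<one>\<^bsub>B\<^esub> y)"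
    then have "Q (tns B (Sym M) \<one>\<^bsub>B\<^esub> x \<otimes>\<^bsub>R\<^esub> tns B (Sym M) \<one>\<^bsub>B\<^esub> y)" by (intro mult) auto
    then show "Q (tns B (Sym M) \<one>\<^bsub>B\<^esub> (x \<otimes>\<^bsub>Sym M\<^esub> y))" using * by (simp add: P.tns_mult)
  qed
  then have "Q (iota B M a \<otimes>\<^bsub>R\<^esub> tns B (Sym M) \<one>\<^bsub>B\<^esub> c)" using a c b by (intro mult) (auto simp: iota_simps)
  then show "Q (tns B (Sym M) a c)" using a c by (simp add: iota_def P.tns_mult)
qed (rule add)

lemma TS_act:
  assumes "act B g \<in> alg_hom B B" "lin_map M M (act M g)"
  shows "act R g \<in> alg_hom R R" "b \<in> carrier B \<Longrightarrow> act R g (iota B M b) = iota B M (act B g b)"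
    "x \<in> carrier M \<Longrightarrow> act R g (et B M x) = et B M (act M g x)"
proof -
  have actS: "act (Sym M) g = sym_map M (act M g)"
    unfolding Sym_def sym_map_def by simp
  have S: "act (Sym M) g \<in> alg_hom (Sym M) (Sym M)" "x \<in> carrier M \<Longrightarrow> act (Sym M) g (eta M x) = eta M (act M g x)"
    unfolding actS by (intro sym_map_hom M.kmod_axioms assms(2); assumption)+
  have eq: "act R g = tensor_map B (Sym M) (act B g) (act (Sym M) g)"
    unfolding tensor_def tensor_map_def by simp
  note tm = tensor_map_hom[OF P.kpair_axioms P.kpair_axioms assms(1) S(1)]
  show "act R g \<in> alg_hom R R" unfolding eq by (rule tm(1))
  show "b \<in> carrier B \<Longrightarrow> act R g (iota B M b) = iota B M (act B g b)"
    unfolding eq iota_def by (simp add: tm(2) alg_homD(4)[OF S(1)])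
  show "act R g (et B M x) = et B M (act M g x)" if "x \<in> carrier M"
    unfolding eq et_def using that S(2) by (simp add: tm(2) eta_props(1)[OF M.kmod_axioms] alg_homD(4)[OF assms(1)])
qed

end

lemma alg_hom_pow:
  assumes A: "kalg A" "kalg A'" and f: "f \<in> alg_hom A A'" and x: "x \<in> carrier A"
  shows "f (x [^]\<^bsub>A\<^esub> (n::nat)) = f x [^]\<^bsub>A'\<^esub> n"
proof -
  interpret A: kalg A by (rule A)
  interpret A': kalg A' by (rule A)
  show ?thesis by (induction n) (use x in \<open>simp_all add: alg_homD[OF f]\<close>)
qed

lemma shift_mat_mult:
  assumes "\<And>i. finite {k. g i k \<noteq> 0}"
  shows "mat_mult (shift_mat n g) (shift_mat n h) = shift_mat n (mat_mult g h)"
proof (intro ext)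
  fix i j
  show "mat_mult (shift_mat n g) (shift_mat n h) i j = shift_mat n (mat_mult g h) i j"
  proof (cases "i < n")
    case True
    then have "{k. shift_mat n g i k \<noteq> 0} = {i}" by (auto simp: shift_mat_def mat_one_def split: if_splits)
    then show ?thesis using True by (simp add: mat_mult_def shift_mat_def mat_one_def)
  next
    case False
    then have "{k. shift_mat n g i k \<noteq> 0} = (+) n ` {k. g (i - n) k \<noteq> 0}"
    proof (intro equalityI subsetI)
      fix k assume "k \<in> {k. shift_mat n g i k \<noteq> 0}"
      then have "k \<ge> n" "g (i - n) (k - n) \<noteq> 0" using False by (auto simp: shift_mat_def mat_one_def split: if_splits)
      then show "k \<in> (+) n ` {k. g (i - n) k \<noteq> 0}" by (intro image_eqI[of _ _ "k - n"]) auto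
    qed (auto simp: shift_mat_def)
    then have "mat_mult (shift_mat n g) (shift_mat n h) i j = (\<Sum>k | g (i - n) k \<noteq> 0. g (i - n) k * shift_mat n h (n + k) j)"
      using False by (simp add: mat_mult_def sum.reindex shift_mat_def)
    then show ?thesis using False by (auto simp: shift_mat_def mat_mult_def mat_one_def)
  qed
qed

lemma shift_mat_GL:
  assumes "g \<in> GL"
  shows "shift_mat n g \<in> GL"
proof -
  obtain m h where m: "m \<ge> 1" "g \<in> mat_block m" "h \<in> mat_block m" "mat_mult g h = mat_one" "mat_mult h g = mat_one"
    using assms by (auto simp: GL_def GLn_def)
  have fin: "finite {k. g' i k \<noteq> 0}" if "g' \<in> mat_block m" for g' :: "'a mat" and i
  proof (rule finite_subset)
    show "{k. g' i k \<noteq> 0} \<subseteq> {..<m} \<union> {i}"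
      using that by (auto simp: mat_block_def mat_one_def) (metis not_le)
  qed simp
  have block: "shift_mat n g' \<in> mat_block (n + m)" if "g' \<in> mat_block m" for g' :: "'a mat"
    using that by (auto simp: mat_block_def shift_mat_def mat_one_def)
  have one: "shift_mat n mat_one = (mat_one :: 'a mat)" by (auto simp: shift_mat_def mat_one_def fun_eq_iff)
  have "shift_mat n g \<in> GLn (n + m)"
    unfolding GLn_def using m block shift_mat_mult[OF fin[OF m(2)], where n = n and h = h] shift_mat_mult[OF fin[OF m(3)], where n = n and h = g]
    by (auto simp: one intro!: bexI[of _ "shift_mat n h"])
  then show ?thesis unfolding GL_def using m(1) by (auto intro!: bexI[of _ "n + m"])
qed

lemma shift_mat_add: "shift_mat n (shift_mat m g) = shift_mat (n + m) g"
  by (auto simp: shift_mat_def mat_one_def fun_eq_iff)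

definition fixed :: "('k::field_char_0, 'b) gl_module \<Rightarrow> nat \<Rightarrow> 'b \<Rightarrow> bool" where
  "fixed B n b \<longleftrightarrow> b \<in> carrier B \<and> (\<forall>g\<in>GL. act B (shift_mat n g) b = b)"

definition light :: "nat \<Rightarrow> (nat list \<Rightarrow>\<^sub>0 'k::zero) \<Rightarrow> bool" where
  "light n x \<longleftrightarrow> (\<forall>w\<in>Poly_Mapping.keys x. \<forall>l\<in>set w. l < n)"

lemma fixed_mono: "fixed B n b \<Longrightarrow> n \<le> m \<Longrightarrow> fixed B m b"
  unfolding fixed_def using shift_mat_add[of n "m - n"] shift_mat_GL by (metis le_add_diff_inverse)

lemma light_mono: "light n x \<Longrightarrow> n \<le> m \<Longrightarrow> light m x"
  unfolding light_def by fastforce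

lemma lin_map_V_part:
  assumes g: "g \<in> GL"
  shows "lin_map (V_part lam) (V_part lam) (act (V_part lam) g)"
  using linear_opD[OF linear_tensor_act[OF fincol_GL(1)[OF g]]] g
  by (simp add: lin_map_def tensor_act_VV fincol_GL)

lemma tensor_act_light:
  assumes g: "g \<in> GL" and x: "light n x"
  shows "tensor_act (shift_mat n g) x = x"
proof -
  note f = fincol_GL(2)[OF g, of n]
  have sg: "tensor_act (shift_mat n g) (sg w) = sg w" if "\<forall>l\<in>set w. l < n" for w
    using tensor_act_shift_light[OF g that, of "[]"] f by (simp add: push_single)
  show ?thesis
    by (rule linear_op_eq[OF linear_tensor_act[OF f] linear_id], rule sg) (use x in \<open>simp add: light_def\<close>)
qed

text \<open>A polynomial representation: its elements are fixed by a subgroup \<open>diag(1\<^sub>n, GL)\<close>, and unipotents act polynomially.\<close>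

lemma dsum_poly:
  fixes d :: "'i \<Rightarrow> nat" and T :: "('k::field_char_0, 'i \<Rightarrow> nat list \<Rightarrow>\<^sub>0 'k) gl_module"
  defines "T \<equiv> gl_dsum UNIV (\<lambda>i. TP (d i))"
  assumes x: "x \<in> carrier T" and pi: "p \<noteq> i"
  shows "kmod T" "\<exists>x'. lie T p i x x'"
proof -
  have T: "carrier T = {f. (\<forall>i. f i \<in> tens (d i)) \<and> finite {i. f i \<noteq> 0}}" "ring.zero T = (\<lambda>i. 0)"
    "x \<oplus>\<^bsub>T\<^esub> y = (\<lambda>i. x i + y i)" "c \<odot>\<^bsub>T\<^esub> x = (\<lambda>i. scale c (x i))" "act T g x = (\<lambda>i. tensor_act g (x i))" for x y c g
    by (simp_all add: T_def gl_dsum_def)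
  have fin: "finite {i. x i + y i \<noteq> 0}" if "finite {i. x i \<noteq> 0}" "finite {i. y i \<noteq> 0}" for x y :: "'i \<Rightarrow> nat list \<Rightarrow>\<^sub>0 'k"
    by (rule finite_subset[OF _ finite_UnI[OF that]]) auto
  have fin': "finite {i. scale c (x i) \<noteq> 0}" if "finite {i. x i \<noteq> 0}" for x :: "'i \<Rightarrow> nat list \<Rightarrow>\<^sub>0 'k" and c
    by (rule finite_subset[OF _ that]) (auto simp: scale_zero)
  have neg: "- t \<in> tens k" if "t \<in> tens k" for t :: "nat list \<Rightarrow>\<^sub>0 'k" and k
    using tens_scale[OF that, of "- 1"] by (simp add: scale_minus_left scale_1)
  show kT: "kmod T"
  proof (rule kmod.intro, rule moduleI[OF cring_KK])
    show "abelian_group T"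
    proof (rule abelian_groupI)
      fix x assume "x \<in> carrier T"
      then show "\<exists>y\<in>carrier T. y \<oplus>\<^bsub>T\<^esub> x = \<zero>\<^bsub>T\<^esub>"
        by (intro bexI[of _ "\<lambda>i. scale (- 1) (x i)"]) (auto simp: T neg scale_minus_left scale_1)
    qed (auto simp: T fin add.assoc add.commute)
  qed (auto simp: T fin' scale_simps)
  interpret T: kmod T by (rule kT)
  define single where "single i t = (\<lambda>j. if j = i then t else (0 :: nat list \<Rightarrow>\<^sub>0 'k))" for i :: 'i and t
  have f: "fincol (el p i s :: 'k mat)" for s by (rule fincol_GL(1)[OF el_GL[OF pi]])
  note lin = linear_opD[OF linear_tensor_act[OF f]] linear_op_zero[OF linear_tensor_act[OF f]]
  have lie_single: "lie T p i (single j t) (single j (edge p i t))" if "t \<in> tens (d j)" for j t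
    by (rule lie_hom[OF kmod_TP[of "d j"] kT _ _ _ _ lie_tensor[OF pi that]])
      (auto simp: T single_def lin scale_zero)
  have "\<exists>x'. lie T p i x x'" if "finite K" "x \<in> carrier T" "{i. x i \<noteq> 0} \<subseteq> K" for K x
    using that
  proof (induction K arbitrary: x rule: finite_induct)
    case empty
    then have "x = ring.zero T" by (auto simp: T)
    then show ?case using T.lie_const[of "ring.zero T" p i] by (auto simp: T lin)
  next
    case (insert j K)
    define y where "y = x(j := 0)"
    have "y \<in> carrier T" "{i. y i \<noteq> 0} \<subseteq> K"
      using insert.prems by (auto simp: T y_def intro: finite_subset[of _ "{i. x i \<noteq> 0}"])
    then obtain y' where "lie T p i y y'" using insert.IH by blast
    moreover have "lie T p i (single j (x j)) (single j (edge p i (x j)))"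
      using insert.prems by (intro lie_single) (auto simp: T)
    ultimately have "lie T p i (y \<oplus>\<^bsub>T\<^esub> single j (x j)) (y' \<oplus>\<^bsub>T\<^esub> single j (edge p i (x j)))"
      by (intro T.lie_add) (auto simp: T lin)
    moreover have "y \<oplus>\<^bsub>T\<^esub> single j (x j) = x" by (auto simp: T y_def single_def)
    ultimately show ?case by auto
  qed
  then show "\<exists>x'. lie T p i x x'" using x by (auto simp: T)
qed

lemma polynomial_rep_props:
  fixes B :: "('k::field_char_0, 'b) gl_module"
  assumes B: "polynomial_rep B" and b: "b \<in> carrier B"
  shows "\<exists>n. fixed B n b" "p \<noteq> i \<Longrightarrow> \<exists>b'. lie B p i b b'"
proof -
  have kB: "kmod B" using B by (intro kmod.intro) (simp add: polynomial_rep_def gl_rep_def)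
  obtain d :: "'b \<times> nat \<Rightarrow> nat" and N \<theta> where
    N: "submodule N KK (gl_dsum UNIV (\<lambda>i. TP (d i)))" "gl_stable (gl_dsum UNIV (\<lambda>i. TP (d i))) N"
    and \<theta>: "\<theta> \<in> gl_hom ((gl_dsum UNIV (\<lambda>i. TP (d i)))\<lparr>carrier := N\<rparr>) B" "\<theta> ` N = carrier B"
    using B unfolding polynomial_rep_def Let_def by metis
  define T :: "('k, _) gl_module" where "T = gl_dsum UNIV (\<lambda>i. TP (d i))"
  obtain x where x: "x \<in> N" "b = \<theta> x" using b \<theta>(2) by blast
  have sub: "subgroup N (add_monoid T)" and sm: "\<And>c x. x \<in> N \<Longrightarrow> c \<odot>\<^bsub>T\<^esub> x \<in> N"
    using N(1) unfolding submodule_def submodule_axioms_def T_def by auto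
  have xT: "x \<in> carrier T" using subgroup.subset[OF sub] x(1) by auto
  have st: "act T g y \<in> N" if "g \<in> GL" "y \<in> N" for g y using N(2) that by (simp add: gl_stable_def T_def)
  have T: "x \<in> carrier T \<longleftrightarrow> (\<forall>i. x i \<in> tens (d i)) \<and> finite {i. x i \<noteq> 0}" "act T g x = (\<lambda>i. tensor_act g (x i))" for x g
    by (simp_all add: T_def gl_dsum_def)
  have \<theta>_act: "\<theta> (act T g y) = act B g (\<theta> y)" if "g \<in> GL" "y \<in> N" for g y
    using \<theta>(1) that by (simp add: gl_hom_def T_def)
  show "\<exists>n. fixed B n b"
  proof -
    have "finite (\<Union>i\<in>{i. x i \<noteq> 0}. \<Union>w\<in>Poly_Mapping.keys (x i). set w)" using xT by (simp add: T)
    then obtain n where n: "\<forall>l\<in>(\<Union>i\<in>{i. x i \<noteq> 0}. \<Union>w\<in>Poly_Mapping.keys (x i). set w). l < n"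
      using finite_nat_set_iff_bounded by blast
    have "light n (x i)" for i using n unfolding light_def by (cases "x i = 0") (simp, blast)
    then have "act T (shift_mat n g) x = x" if "g \<in> GL" for g using that by (simp add: T(2) tensor_act_light)
    then have "act B (shift_mat n g) b = b" if "g \<in> GL" for g
      using \<theta>_act[OF shift_mat_GL[OF that] x(1), of n] that by (simp add: x(2))
    then show ?thesis using b by (auto simp: fixed_def)
  qed
  assume pi: "p \<noteq> i"
  have kT: "kmod T" and ex: "\<exists>x'. lie T p i x x'" using dsum_poly[OF xT[unfolded T_def] pi] by (simp_all add: T_def)
  interpret T: kmod T by (rule kT)
  have N: "T.subspace N"
    unfolding T.subspace_def using subgroup.subset[OF sub] subgroup.one_closed[OF sub] subgroup.m_closed[OF sub] sm by auto
  obtain x' where "lie T p i x x'" using ex by blast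
  then have "lie (T\<lparr>carrier := N\<rparr>) p i x x'" by (rule lie_restrict[OF kT N x(1) st[OF el_GL[OF pi] x(1)]])
  then have "lie B p i (\<theta> x) (\<theta> x')"
    by (rule lie_hom[OF kmod.intro[OF T.module_subspace[OF N]] kB, rotated -1])
      (use \<theta>(1) \<theta>_act[OF el_GL[OF pi] x(1)] in \<open>auto simp: gl_hom_def T_def\<close>)
  then show "\<exists>b'. lie B p i b b'" using x(2) by auto
qed

section \<open>Closed subvarieties whose ideal is stable under partial derivatives\<close>

locale glv =
  fixes B :: "('k::field_char_0, 'b) gl_module" and lam :: "nat list" and J
  assumes Y: "affine_gl_variety B" and lam: "partition lam" "lam \<noteq> []"
    and X: "closed_gl_subvariety (tensor B (Sym (V_part lam))) J"
begin

lemma algebra_B: "algebra KK B" and poly_rep: "polynomial_rep B" and ring_act: "g \<in> GL \<Longrightarrow> act B g \<in> ring_hom B B"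
  using Y by (auto simp: affine_gl_variety_def gl_algebra_def)

sublocale kts B "V_part lam"
  by (intro kts.intro kalg.intro algebra_B kmod_V_part)

lemma act_B: "g \<in> GL \<Longrightarrow> act B g \<in> alg_hom B B"
  using ring_act poly_rep by (auto simp: alg_hom_def polynomial_rep_def gl_rep_def)

lemma act_R:
  assumes "g \<in> GL"
  shows "act R g \<in> alg_hom R R" "b \<in> carrier B \<Longrightarrow> act R g (iota B (V_part lam) b) = iota B (V_part lam) (act B g b)"
    "x \<in> VV lam \<Longrightarrow> act R g (et B (V_part lam) x) = et B (V_part lam) (tensor_act g x)"
  using TS_act[OF act_B[OF assms] lin_map_V_part[OF assms]] by auto

lemma ideal_J: "ideal J R" and stable_J: "g \<in> GL \<Longrightarrow> f \<in> J \<Longrightarrow> act R g f \<in> J"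
  and reduced_J: "reduced (gl_quot R J)"
  using X by (auto simp: closed_gl_subvariety_def gl_stable_def)

sublocale RJ: kquot R J
  by (intro kquot.intro kquot_axioms.intro P.T.kalg_axioms ideal_J)

abbreviation "io \<equiv> iota B (V_part lam)"
abbreviation "e \<equiv> et B (V_part lam)"
abbreviation "d \<equiv> sum_list lam"

lemma e_simps:
  "x \<in> VV lam \<Longrightarrow> e x \<in> carrier R" "x \<in> VV lam \<Longrightarrow> y \<in> VV lam \<Longrightarrow> e (x + y) = e x \<oplus>\<^bsub>R\<^esub> e y"
  "x \<in> VV lam \<Longrightarrow> e (scale c x) = c \<odot>\<^bsub>R\<^esub> e x"
  using et_simps by auto

lemma e_zero: "e 0 = \<zero>\<^bsub>R\<^esub>"
  using e_simps(3)[OF VV_closed(1), of 0] e_simps(1)[OF VV_closed(1)] by (simp add: scale_zero P.T.smult_simps)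

lemma e_sum:
  "finite A \<Longrightarrow> (\<And>w. w \<in> A \<Longrightarrow> f w \<in> VV lam) \<Longrightarrow> e (\<Sum>w\<in>A. f w) = (\<Oplus>\<^bsub>R\<^esub>w\<in>A. e (f w))"
  by (induction A rule: finite_induct) (auto simp: e_zero e_simps VV_sum P.T.M.finsum_insert Pi_def)

text \<open>
  \<open>grad n f g\<close>: the function \<open>f\<close> has an expression that involves only the basis vectors \<open>e\<^sub>i\<close> with \<open>i < n\<close>, and its formal
  partial derivative with respect to the coordinate indexed by the word \<open>w\<close> is \<open>g w\<close>.
\<close>

inductive grad for n where
  grad_io: "b \<in> carrier B \<Longrightarrow> fixed B n b \<Longrightarrow> grad n (io b) (\<lambda>w. \<zero>\<^bsub>R\<^esub>)"
| grad_e: "x \<in> VV lam \<Longrightarrow> light n x \<Longrightarrow> grad n (e x) (\<lambda>w. Poly_Mapping.lookup x w \<odot>\<^bsub>R\<^esub> \<one>\<^bsub>R\<^esub>)"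
| grad_add: "grad n f g \<Longrightarrow> grad n f' g' \<Longrightarrow> grad n (f \<oplus>\<^bsub>R\<^esub> f') (\<lambda>w. g w \<oplus>\<^bsub>R\<^esub> g' w)"
| grad_mult: "grad n f g \<Longrightarrow> grad n f' g' \<Longrightarrow> grad n (f \<otimes>\<^bsub>R\<^esub> f') (\<lambda>w. f \<otimes>\<^bsub>R\<^esub> g' w \<oplus>\<^bsub>R\<^esub> f' \<otimes>\<^bsub>R\<^esub> g w)"

lemma grad_mono: "grad n f g \<Longrightarrow> n \<le> m \<Longrightarrow> grad m f g"
  by (induction rule: grad.induct) (auto intro: grad.intros fixed_mono light_mono)

lemma grad_closed: "grad n f g \<Longrightarrow> f \<in> carrier R \<and> (\<forall>w. g w \<in> carrier R)"
  by (induction rule: grad.induct) (auto simp: iota_simps e_simps)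

lemma fixed_const: "fixed B n (c \<odot>\<^bsub>B\<^esub> \<one>\<^bsub>B\<^esub>)" "fixed B n \<zero>\<^bsub>B\<^esub>"
proof -
  show 1: "fixed B n (c \<odot>\<^bsub>B\<^esub> \<one>\<^bsub>B\<^esub>)" for c
    unfolding fixed_def using alg_homD(4,5)[OF act_B[OF shift_mat_GL]] by auto
  show "fixed B n \<zero>\<^bsub>B\<^esub>" using 1[of 0] by (simp add: B.smult_simps)
qed

lemma grad_const: "grad n (c \<odot>\<^bsub>R\<^esub> \<one>\<^bsub>R\<^esub>) (\<lambda>w. \<zero>\<^bsub>R\<^esub>)" "grad n \<zero>\<^bsub>R\<^esub> (\<lambda>w. \<zero>\<^bsub>R\<^esub>)"
  using grad_io[OF _ fixed_const(1), of c n] grad_io[OF _ fixed_const(2), of n] by (simp_all add: iota_simps iota_zero)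

lemma grad_repr: "grad n f g \<Longrightarrow> \<exists>g'. grad n (g w) g'"
proof (induction rule: grad.induct)
  case (grad_mult f g f' g')
  then show ?case using grad.grad_mult grad.grad_add by meson
qed (use grad_const grad.grad_add in blast)+

definition W :: "nat \<Rightarrow> nat list set" where "W n = {w. length w = d \<and> set w \<subseteq> {..<n}}"

lemma finite_W [simp]: "finite (W n)"
  unfolding W_def using finite_lists_length_eq[of "{..<n}" d] by (simp add: conj_commute)

definition eps :: "nat list \<Rightarrow> nat list \<Rightarrow>\<^sub>0 'k" where
  "eps w = (if length w = d then scale (1 / hook lam) (ract (sg w) (young lam)) else 0)"

lemma eps_VV [simp]: "eps w \<in> VV lam"
  by (auto simp: eps_def intro!: VV_closed)

lemma eps_expand:
  assumes x: "x \<in> VV lam" and l: "light n x"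
  shows "x = (\<Sum>w\<in>W n. scale (Poly_Mapping.lookup x w) (eps w))"
proof -
  have xt: "x \<in> tens d" and xc: "ract x (young lam) = scale (hook lam) x" using x VV_iff[OF lam(1)] by auto
  have keys: "Poly_Mapping.keys x \<subseteq> W n" using xt l by (auto simp: tens_def W_def light_def)
  have "x = scale (1 / hook lam) (ract (lext sg x) (young lam))"
    using young_sq(2)[OF lam(1), where 'k='k] xc by (simp add: lext_sgs scale_scale scale_1)
  also have "ract (lext sg x) (young lam) = lext (\<lambda>w. ract (sg w) (young lam)) x"
    by (rule linear_op_lext[OF linear_ract_left])
  also have "scale (1 / hook lam) \<dots> = lext (\<lambda>w. scale (1 / hook lam) (ract (sg w) (young lam))) x"
    by (rule linear_op_lext[OF linear_scale])
  also have "\<dots> = lext eps x" by (rule lext_cong) (use xt in \<open>simp add: tens_def eps_def\<close>)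
  also have "\<dots> = (\<Sum>w\<in>W n. scale (Poly_Mapping.lookup x w) (eps w))" by (rule lext_sup[OF finite_W keys])
  finally show ?thesis .
qed

lemma e_expand:
  assumes "x \<in> VV lam" "light n x"
  shows "e x = (\<Oplus>\<^bsub>R\<^esub>w\<in>W n. Poly_Mapping.lookup x w \<odot>\<^bsub>R\<^esub> e (eps w))"
proof -
  have "e x = e (\<Sum>w\<in>W n. scale (Poly_Mapping.lookup x w) (eps w))" using eps_expand[OF assms] by simp
  also have "\<dots> = (\<Oplus>\<^bsub>R\<^esub>w\<in>W n. e (scale (Poly_Mapping.lookup x w) (eps w)))"
    by (rule e_sum) (auto intro: VV_closed)
  also have "\<dots> = (\<Oplus>\<^bsub>R\<^esub>w\<in>W n. Poly_Mapping.lookup x w \<odot>\<^bsub>R\<^esub> e (eps w))"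
    by (simp add: e_simps)
  finally show ?thesis .
qed

text \<open>The Euler operator multiplies homogeneous functions by their degree in the coordinates of \<open>V\<^sub>\<lambda>\<close>.\<close>

definition euler :: "nat \<Rightarrow> (nat list \<Rightarrow> _) \<Rightarrow> _" where
  "euler n g = (\<Oplus>\<^bsub>R\<^esub>w\<in>W n. g w \<otimes>\<^bsub>R\<^esub> e (eps w))"

inductive deg where
  deg_io: "b \<in> carrier B \<Longrightarrow> deg 0 (io b)"
| deg_e: "deg N f \<Longrightarrow> x \<in> VV lam \<Longrightarrow> deg (Suc N) (f \<otimes>\<^bsub>R\<^esub> e x)"
| deg_add: "deg N f \<Longrightarrow> deg N f' \<Longrightarrow> deg N (f \<oplus>\<^bsub>R\<^esub> f')"
| deg_Suc: "deg N f \<Longrightarrow> deg (Suc N) f"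

lemma deg_closed: "deg N f \<Longrightarrow> f \<in> carrier R"
  by (induction rule: deg.induct) (auto simp: iota_simps e_simps)

lemma deg_mono: "deg N f \<Longrightarrow> N \<le> N' \<Longrightarrow> deg N' f"
  by (induction N') (auto simp: le_Suc_eq intro: deg_Suc)

lemma deg_mult_io: "deg N f \<Longrightarrow> b \<in> carrier B \<Longrightarrow> deg N (io b \<otimes>\<^bsub>R\<^esub> f)"
proof (induction rule: deg.induct)
  case (deg_io b')
  then show ?case using deg.deg_io[of "b \<otimes>\<^bsub>B\<^esub> b'"] by (simp add: iota_simps)
next
  case (deg_e N f x)
  then show ?case using deg.deg_e[of N "io b \<otimes>\<^bsub>R\<^esub> f" x] deg_closed[of N f]
    by (simp add: P.T.A.m_assoc iota_simps e_simps)
next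
  case (deg_add N f f')
  then show ?case using deg.deg_add deg_closed[of N f] deg_closed[of N f'] by (simp add: P.T.A.r_distr iota_simps)
qed (auto intro: deg_Suc)

lemma deg_mult: "deg N f \<Longrightarrow> deg N' f' \<Longrightarrow> deg (N + N') (f \<otimes>\<^bsub>R\<^esub> f')"
proof (induction rule: deg.induct)
  case (deg_e N f x)
  have c: "f \<in> carrier R" "f' \<in> carrier R" "e x \<in> carrier R"
    using deg_closed deg_e e_simps by auto
  have "f \<otimes>\<^bsub>R\<^esub> e x \<otimes>\<^bsub>R\<^esub> f' = f \<otimes>\<^bsub>R\<^esub> f' \<otimes>\<^bsub>R\<^esub> e x" using c by (simp add: P.T.A.m_ac)
  then show ?case using deg.deg_e[OF deg_e.IH[OF deg_e.prems] deg_e.hyps(2)] by simp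
next
  case (deg_add N f g)
  then show ?case using deg.deg_add deg_closed[of N f] deg_closed[of N g] deg_closed[of N' f']
    by (simp add: P.T.A.l_distr)
qed (auto intro: deg_Suc deg_mult_io)

lemma deg_zero: "deg N \<zero>\<^bsub>R\<^esub>" and deg_one: "deg N \<one>\<^bsub>R\<^esub>"
  using deg_mono[OF deg_io[of "\<zero>\<^bsub>B\<^esub>"], of N] deg_mono[OF deg_io[of "\<one>\<^bsub>B\<^esub>"], of N] by (simp_all add: iota_zero iota_simps)

lemma deg_smult: "deg N f \<Longrightarrow> deg N (c \<odot>\<^bsub>R\<^esub> f)"
  using deg_mult_io[of N f "c \<odot>\<^bsub>B\<^esub> \<one>\<^bsub>B\<^esub>"] deg_closed[of N f] by (simp add: iota_simps P.T.smult_mult)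

lemma deg_minus: "deg N f \<Longrightarrow> deg N f' \<Longrightarrow> deg N (f \<ominus>\<^bsub>R\<^esub> f')"
  using deg_add[of N f "(- 1) \<odot>\<^bsub>R\<^esub> f'"] deg_smult[of N f' "- 1"] deg_closed[of N f']
  by (simp add: P.T.smult_simps P.T.M.minus_eq)

lemma deg_exists: "f \<in> carrier R \<Longrightarrow> \<exists>N. deg N f"
proof (erule TS_induct)
  fix x :: "nat list \<Rightarrow>\<^sub>0 'k" assume "x \<in> VV lam"
  then show "\<exists>N. deg N (e x)" using deg_e[OF deg_one, of x 0] by (auto simp: e_simps)
next
  fix x y assume "\<exists>N. deg N x" "\<exists>N. deg N y"
  then obtain N N' where "deg N x" "deg N' y" by blast
  then have "deg (max N N') x" "deg (max N N') y" by (auto intro: deg_mono)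
  then show "\<exists>N. deg N (x \<oplus>\<^bsub>R\<^esub> y)" using deg_add by blast
qed (use deg_io deg_mult in blast)+

lemma deg_0: "deg N f \<Longrightarrow> N = 0 \<Longrightarrow> \<exists>b\<in>carrier B. f = io b"
proof (induction rule: deg.induct)
  case (deg_add N f f')
  then obtain b b' where "b \<in> carrier B" "b' \<in> carrier B" "f = io b" "f' = io b'" by blast
  then show ?case by (intro bexI[of _ "b \<oplus>\<^bsub>B\<^esub> b'"]) (simp_all add: iota_simps)
qed auto

lemma fixed_exists: "b \<in> carrier B \<Longrightarrow> \<exists>n. fixed B n b"
  by (rule polynomial_rep_props(1)[OF poly_rep])

lemma light_exists: "\<exists>n. light n (x :: nat list \<Rightarrow>\<^sub>0 'k)"
proof -
  obtain n where "\<forall>w\<in>Poly_Mapping.keys x. \<forall>l\<in>set w. l < n" by (rule bounded_letters[of x 0])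
  then show ?thesis unfolding light_def by (rule exI)
qed

text \<open>Degree less than \<open>N\<close>; degree less than 0 has to mean zero, as \<open>deg\<close> starts with constants at 0.\<close>

definition lower :: "nat \<Rightarrow> _ \<Rightarrow> bool" where
  "lower N f \<longleftrightarrow> (case N of 0 \<Rightarrow> f = \<zero>\<^bsub>R\<^esub> | Suc N' \<Rightarrow> deg N' f)"

lemma lower_closed: "lower N f \<Longrightarrow> f \<in> carrier R"
  by (auto simp: lower_def deg_closed split: nat.splits)

lemma lower_deg: "lower N f \<Longrightarrow> deg N f"
  by (auto simp: lower_def deg_zero split: nat.splits intro: deg_Suc)

lemma lower_add: "lower N f \<Longrightarrow> lower N f' \<Longrightarrow> lower N (f \<oplus>\<^bsub>R\<^esub> f')"
  by (auto simp: lower_def deg_add split: nat.splits)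

lemma lower_e: "lower N f \<Longrightarrow> x \<in> VV lam \<Longrightarrow> lower (Suc N) (f \<otimes>\<^bsub>R\<^esub> e x)"
  by (auto simp: lower_def deg_zero e_simps deg_e split: nat.splits)

lemma euler_deg:
  "deg N f \<Longrightarrow> \<exists>n0. \<forall>n\<ge>n0. \<exists>g. grad n f g \<and> (\<forall>w. lower N (g w)) \<and> lower N (euler n g \<ominus>\<^bsub>R\<^esub> of_nat N \<odot>\<^bsub>R\<^esub> f)"
proof (induction rule: deg.induct)
  case (deg_io b)
  obtain n0 where n0: "fixed B n0 b" using fixed_exists deg_io by blast
  have "grad n (io b) (\<lambda>w. \<zero>\<^bsub>R\<^esub>)" if "n \<ge> n0" for n
    using deg_io fixed_mono[OF n0 that] by (rule grad_io)
  moreover have "euler n (\<lambda>w. \<zero>\<^bsub>R\<^esub>) \<ominus>\<^bsub>R\<^esub> of_nat 0 \<odot>\<^bsub>R\<^esub> io b = \<zero>\<^bsub>R\<^esub>" for n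
    using deg_io by (simp add: euler_def e_simps P.T.smult_simps iota_simps P.T.M.minus_eq)
  ultimately show ?case unfolding lower_def by (intro exI[of _ n0]) auto
next
  case (deg_e N f x)
  obtain n0 where n0: "\<And>n. n \<ge> n0 \<Longrightarrow> \<exists>g. grad n f g \<and> (\<forall>w. lower N (g w)) \<and> lower N (euler n g \<ominus>\<^bsub>R\<^esub> of_nat N \<odot>\<^bsub>R\<^esub> f)"
    using deg_e.IH by blast
  obtain m where m: "light m x" using light_exists by blast
  have "\<exists>g. grad n (f \<otimes>\<^bsub>R\<^esub> e x) g \<and> (\<forall>w. lower (Suc N) (g w)) \<and>
      lower (Suc N) (euler n g \<ominus>\<^bsub>R\<^esub> of_nat (Suc N) \<odot>\<^bsub>R\<^esub> (f \<otimes>\<^bsub>R\<^esub> e x))" if n: "n \<ge> max n0 m" for n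
  proof -
    obtain g where g: "grad n f g" "\<And>w. lower N (g w)" "lower N (euler n g \<ominus>\<^bsub>R\<^esub> of_nat N \<odot>\<^bsub>R\<^esub> f)"
      using n0[of n] n by auto
    have l: "light n x" using light_mono[OF m] n by simp
    let ?c = "\<lambda>w. Poly_Mapping.lookup x w \<odot>\<^bsub>R\<^esub> \<one>\<^bsub>R\<^esub>"
    let ?g = "\<lambda>w. f \<otimes>\<^bsub>R\<^esub> ?c w \<oplus>\<^bsub>R\<^esub> e x \<otimes>\<^bsub>R\<^esub> g w"
    have c: "f \<in> carrier R" "e x \<in> carrier R" "\<And>w. g w \<in> carrier R" "\<And>w. e (eps w) \<in> carrier R"
      using deg_closed[OF deg_e.hyps(1)] e_simps(1)[OF deg_e.hyps(2)] lower_closed[OF g(2)] e_simps(1)[OF eps_VV] by auto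
    have Ec: "euler n g \<in> carrier R" unfolding euler_def using c by (intro P.T.M.finsum_closed) auto
    have 1: "grad n (f \<otimes>\<^bsub>R\<^esub> e x) ?g" using g(1) grad_e[OF deg_e.hyps(2) l] by (rule grad_mult)
    have 2: "lower (Suc N) (?g w)" for w
    proof (rule lower_add)
      have "f \<otimes>\<^bsub>R\<^esub> ?c w = Poly_Mapping.lookup x w \<odot>\<^bsub>R\<^esub> f" using c by (simp add: P.T.smult_mult)
      then show "lower (Suc N) (f \<otimes>\<^bsub>R\<^esub> ?c w)" using deg_smult[OF deg_e.hyps(1)] by (simp add: lower_def)
      show "lower (Suc N) (e x \<otimes>\<^bsub>R\<^esub> g w)"
        using lower_e[OF g(2)[of w] deg_e.hyps(2)] c by (simp add: P.T.A.m_comm)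
    qed
    have "euler n ?g = (\<Oplus>\<^bsub>R\<^esub>w\<in>W n. f \<otimes>\<^bsub>R\<^esub> (Poly_Mapping.lookup x w \<odot>\<^bsub>R\<^esub> e (eps w)) \<oplus>\<^bsub>R\<^esub> e x \<otimes>\<^bsub>R\<^esub> (g w \<otimes>\<^bsub>R\<^esub> e (eps w)))"
      unfolding euler_def using c
      by (intro P.T.M.finsum_cong') (auto simp: P.T.A.l_distr P.T.smult_mult P.T.A.m_assoc)
    also have "\<dots> = (\<Oplus>\<^bsub>R\<^esub>w\<in>W n. f \<otimes>\<^bsub>R\<^esub> (Poly_Mapping.lookup x w \<odot>\<^bsub>R\<^esub> e (eps w))) \<oplus>\<^bsub>R\<^esub>
        (\<Oplus>\<^bsub>R\<^esub>w\<in>W n. e x \<otimes>\<^bsub>R\<^esub> (g w \<otimes>\<^bsub>R\<^esub> e (eps w)))"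
      using c by (intro P.T.M.finsum_addf) auto
    also have "\<dots> = f \<otimes>\<^bsub>R\<^esub> (\<Oplus>\<^bsub>R\<^esub>w\<in>W n. Poly_Mapping.lookup x w \<odot>\<^bsub>R\<^esub> e (eps w)) \<oplus>\<^bsub>R\<^esub> e x \<otimes>\<^bsub>R\<^esub> euler n g"
      unfolding euler_def using c by (subst (1 2) P.T.A.finsum_rdistr) auto
    finally have E: "euler n ?g = f \<otimes>\<^bsub>R\<^esub> e x \<oplus>\<^bsub>R\<^esub> e x \<otimes>\<^bsub>R\<^esub> euler n g"
      using e_expand[OF deg_e.hyps(2) l] by simp
    have "euler n ?g \<ominus>\<^bsub>R\<^esub> of_nat (Suc N) \<odot>\<^bsub>R\<^esub> (f \<otimes>\<^bsub>R\<^esub> e x) = (euler n g \<ominus>\<^bsub>R\<^esub> of_nat N \<odot>\<^bsub>R\<^esub> f) \<otimes>\<^bsub>R\<^esub> e x"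
    proof -
      let ?y = "f \<otimes>\<^bsub>R\<^esub> e x"
      have y: "?y \<in> carrier R" using c by simp
      have s: "of_nat (Suc N) \<odot>\<^bsub>R\<^esub> ?y = ?y \<oplus>\<^bsub>R\<^esub> of_nat N \<odot>\<^bsub>R\<^esub> ?y"
        using y P.T.smult_simps(1)[OF y, of 1 "of_nat N"] P.T.smult_simps(3)[OF y] by simp
      have "(euler n g \<ominus>\<^bsub>R\<^esub> of_nat N \<odot>\<^bsub>R\<^esub> f) \<otimes>\<^bsub>R\<^esub> e x = euler n g \<otimes>\<^bsub>R\<^esub> e x \<ominus>\<^bsub>R\<^esub> of_nat N \<odot>\<^bsub>R\<^esub> ?y"
        using c Ec by (simp add: P.T.M.minus_eq P.T.A.l_distr P.T.A.l_minus P.T.smult_mult)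
      also have "\<dots> = euler n ?g \<ominus>\<^bsub>R\<^esub> of_nat (Suc N) \<odot>\<^bsub>R\<^esub> ?y"
        unfolding E s using c Ec y
        by (simp add: P.T.A.m_comm[of "e x"] P.T.M.minus_eq P.T.M.minus_add P.T.M.a_assoc P.T.M.r_neg1 P.T.M.r_neg2
            P.T.M.a_comm[of ?y "euler n g \<otimes>\<^bsub>R\<^esub> e x"])
      finally show ?thesis by simp
    qed
    then have "lower (Suc N) (euler n ?g \<ominus>\<^bsub>R\<^esub> of_nat (Suc N) \<odot>\<^bsub>R\<^esub> (f \<otimes>\<^bsub>R\<^esub> e x))"
      using lower_e[OF g(3) deg_e.hyps(2)] by simp
    then show ?thesis using 1 2 by blast
  qed
  then show ?case by blast
next
  case (deg_add N f f')
  obtain n0 where n0: "\<And>n. n \<ge> n0 \<Longrightarrow> \<exists>g. grad n f g \<and> (\<forall>w. lower N (g w)) \<and> lower N (euler n g \<ominus>\<^bsub>R\<^esub> of_nat N \<odot>\<^bsub>R\<^esub> f)"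
    using deg_add.IH(1) by blast
  obtain n1 where n1: "\<And>n. n \<ge> n1 \<Longrightarrow> \<exists>g. grad n f' g \<and> (\<forall>w. lower N (g w)) \<and> lower N (euler n g \<ominus>\<^bsub>R\<^esub> of_nat N \<odot>\<^bsub>R\<^esub> f')"
    using deg_add.IH(2) by blast
  have "\<exists>g. grad n (f \<oplus>\<^bsub>R\<^esub> f') g \<and> (\<forall>w. lower N (g w)) \<and> lower N (euler n g \<ominus>\<^bsub>R\<^esub> of_nat N \<odot>\<^bsub>R\<^esub> (f \<oplus>\<^bsub>R\<^esub> f'))"
    if n: "n \<ge> max n0 n1" for n
  proof -
    obtain g where g: "grad n f g" "\<And>w. lower N (g w)" "lower N (euler n g \<ominus>\<^bsub>R\<^esub> of_nat N \<odot>\<^bsub>R\<^esub> f)"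
      using n0[of n] n by auto
    obtain g' where g': "grad n f' g'" "\<And>w. lower N (g' w)" "lower N (euler n g' \<ominus>\<^bsub>R\<^esub> of_nat N \<odot>\<^bsub>R\<^esub> f')"
      using n1[of n] n by auto
    have c: "f \<in> carrier R" "f' \<in> carrier R" "\<And>w. g w \<in> carrier R" "\<And>w. g' w \<in> carrier R" "\<And>w. e (eps w) \<in> carrier R"
      using deg_closed deg_add.hyps lower_closed[OF g(2)] lower_closed[OF g'(2)] e_simps(1)[OF eps_VV] by auto
    have Ec: "euler n g \<in> carrier R" "euler n g' \<in> carrier R"
      unfolding euler_def using c by (auto intro!: P.T.M.finsum_closed)
    have "euler n (\<lambda>w. g w \<oplus>\<^bsub>R\<^esub> g' w) = euler n g \<oplus>\<^bsub>R\<^esub> euler n g'"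
      unfolding euler_def using c by (subst P.T.M.finsum_addf[symmetric]) (auto simp: P.T.A.l_distr)
    then have "euler n (\<lambda>w. g w \<oplus>\<^bsub>R\<^esub> g' w) \<ominus>\<^bsub>R\<^esub> of_nat N \<odot>\<^bsub>R\<^esub> (f \<oplus>\<^bsub>R\<^esub> f') =
        (euler n g \<ominus>\<^bsub>R\<^esub> of_nat N \<odot>\<^bsub>R\<^esub> f) \<oplus>\<^bsub>R\<^esub> (euler n g' \<ominus>\<^bsub>R\<^esub> of_nat N \<odot>\<^bsub>R\<^esub> f')"
      using c Ec by (simp add: P.T.M.minus_eq P.T.smult_add_right P.T.M.minus_add P.T.M.a_ac)
    then have "lower N (euler n (\<lambda>w. g w \<oplus>\<^bsub>R\<^esub> g' w) \<ominus>\<^bsub>R\<^esub> of_nat N \<odot>\<^bsub>R\<^esub> (f \<oplus>\<^bsub>R\<^esub> f'))"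
      using lower_add[OF g(3) g'(3)] by simp
    moreover have "lower N (g w \<oplus>\<^bsub>R\<^esub> g' w)" for w by (rule lower_add[OF g(2) g'(2)])
    ultimately show ?thesis using grad_add[OF g(1) g'(1)] by blast
  qed
  then show ?case by blast
next
  case (deg_Suc N f)
  obtain n0 where n0: "\<And>n. n \<ge> n0 \<Longrightarrow> \<exists>g. grad n f g \<and> (\<forall>w. lower N (g w)) \<and> lower N (euler n g \<ominus>\<^bsub>R\<^esub> of_nat N \<odot>\<^bsub>R\<^esub> f)"
    using deg_Suc.IH by blast
  have "\<exists>g. grad n f g \<and> (\<forall>w. lower (Suc N) (g w)) \<and> lower (Suc N) (euler n g \<ominus>\<^bsub>R\<^esub> of_nat (Suc N) \<odot>\<^bsub>R\<^esub> f)" if n: "n \<ge> n0" for n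
  proof -
    obtain g where g: "grad n f g" "\<And>w. lower N (g w)" "lower N (euler n g \<ominus>\<^bsub>R\<^esub> of_nat N \<odot>\<^bsub>R\<^esub> f)"
      using n0[of n] n by auto
    have fc: "f \<in> carrier R" by (rule deg_closed[OF deg_Suc.hyps])
    have Ec: "euler n g \<in> carrier R"
      unfolding euler_def using lower_closed[OF g(2)] e_simps(1)[OF eps_VV] by (auto intro!: P.T.M.finsum_closed)
    have "of_nat (Suc N) \<odot>\<^bsub>R\<^esub> f = of_nat N \<odot>\<^bsub>R\<^esub> f \<oplus>\<^bsub>R\<^esub> f"
      using P.T.smult_simps(1)[OF fc, of "of_nat N" 1] P.T.smult_simps(3)[OF fc] by (simp add: add.commute)
    then have "euler n g \<ominus>\<^bsub>R\<^esub> of_nat (Suc N) \<odot>\<^bsub>R\<^esub> f = (euler n g \<ominus>\<^bsub>R\<^esub> of_nat N \<odot>\<^bsub>R\<^esub> f) \<ominus>\<^bsub>R\<^esub> f"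
      using fc Ec by (simp add: P.T.M.minus_eq P.T.M.minus_add P.T.M.a_ac)
    then have "deg N (euler n g \<ominus>\<^bsub>R\<^esub> of_nat (Suc N) \<odot>\<^bsub>R\<^esub> f)"
      using deg_minus[OF lower_deg[OF g(3)] deg_Suc.hyps] by simp
    then show ?thesis using g(1) lower_deg[OF g(2)] by (auto simp: lower_def)
  qed
  then show ?case by blast
qed

text \<open>
  If the ideal is stable under partial derivatives, then it is generated by functions on \<open>Y\<close>: by induction on the degree
  \<open>N\<close>, an element of the ideal, being \<open>1 / N\<close> times its image under the Euler operator up to terms of lower degree,
  vanishes in the quotient by these functions.
\<close>

lemma derivative_stable:
  assumes st: "\<And>n f g w. grad n f g \<Longrightarrow> f \<in> J \<Longrightarrow> g w \<in> J"
  shows "\<exists>I. closed_gl_subvariety B I \<and> J = product_ideal B (Sym (V_part lam)) I"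
proof -
  define I where "I = {b \<in> carrier B. io b \<in> J}"
  note Jsub = P.T.subspaceD[OF P.T.ideal_subspace[OF ideal_J]]
  have I: "ideal I B"
  proof (rule idealI[OF B.A.ring_axioms])
    have "io (\<ominus>\<^bsub>B\<^esub> b) = \<ominus>\<^bsub>R\<^esub> io b" if "b \<in> carrier B" for b
      using iota_simps(5)[OF that, of "- 1"] that by (simp add: B.smult_simps P.T.smult_simps iota_simps)
    then show "subgroup I (add_monoid B)"
      by (intro subgroup.intro) (auto simp: I_def iota_simps iota_zero Jsub a_inv_def[symmetric] intro!: Jsub)
  qed (auto simp: I_def iota_simps RJ.I.I_l_closed RJ.I.I_r_closed)
  have mem_I: "b \<in> I \<longleftrightarrow> b \<in> carrier B \<and> io b \<in> J" for b by (simp add: I_def)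
  interpret BI: kquot B I using I B.kalg_axioms by (simp add: kquot_def kquot_axioms_def)
  interpret QB: kalg "gl_quot B I" by (rule BI.kalg_quot)
  interpret K: kts "gl_quot B I" "V_part lam" by (intro kts.intro QB.kalg_axioms kmod_V_part)
  let ?C = "Sym (V_part lam) :: ('k, _) gl_module"
  let ?T = "tensor (gl_quot B I) ?C"
  define pr where "pr = tensor_map (gl_quot B I) ?C (\<lambda>x. I +>\<^bsub>B\<^esub> x) (\<lambda>c. c)"
  have id: "(\<lambda>c. c) \<in> alg_hom ?C ?C" by (rule alg_homI) auto
  note tm = tensor_map_hom[OF P.kpair_axioms K.P.kpair_axioms BI.cls_hom id, folded pr_def]
  note prD = alg_homD[OF tm(1)]
  have pr_zero: "pr \<zero>\<^bsub>R\<^esub> = \<zero>\<^bsub>?T\<^esub>" by (rule alg_hom_zero[OF P.T.kalg_axioms K.P.T.kalg_axioms tm(1)])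
  have pr_minus: "pr (x \<ominus>\<^bsub>R\<^esub> y) = pr x \<ominus>\<^bsub>?T\<^esub> pr y" if "x \<in> carrier R" "y \<in> carrier R" for x y
  proof -
    have "x \<ominus>\<^bsub>R\<^esub> y = x \<oplus>\<^bsub>R\<^esub> (- 1) \<odot>\<^bsub>R\<^esub> y" using that by (simp add: P.T.smult_simps P.T.M.minus_eq)
    then have "pr (x \<ominus>\<^bsub>R\<^esub> y) = pr x \<oplus>\<^bsub>?T\<^esub> (- 1) \<odot>\<^bsub>?T\<^esub> pr y" using that by (simp add: prD)
    then show ?thesis using prD(1)[OF that(2)] by (simp add: K.P.T.smult_simps K.P.T.M.minus_eq)
  qed
  have pr_sum: "pr (\<Oplus>\<^bsub>R\<^esub>w\<in>A. f w) = \<zero>\<^bsub>?T\<^esub>"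
    if "finite A" "\<And>w. f w \<in> carrier R" "\<And>w. pr (f w) = \<zero>\<^bsub>?T\<^esub>" for A and f :: "nat list \<Rightarrow> _"
    using that by (induction A rule: finite_induct) (auto simp: pr_zero prD P.T.M.finsum_insert Pi_def)
  have all: "deg N f \<Longrightarrow> f \<in> J \<Longrightarrow> pr f = \<zero>\<^bsub>?T\<^esub>" for N f
  proof (induction N arbitrary: f)
    case f: 0
    show ?case
    proof -
      obtain b where b: "b \<in> carrier B" "f = io b" by (rule bexE[OF deg_0[OF f(1) refl]])
      have "b \<in> I" unfolding mem_I by (rule conjI[OF b(1) f(2)[unfolded b(2)]])
      then have "I +>\<^bsub>B\<^esub> b = \<zero>\<^bsub>gl_quot B I\<^esub>" using BI.cls_zero_iff[OF b(1)] by blast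
      then have "pr f = iota (gl_quot B I) (V_part lam) \<zero>\<^bsub>gl_quot B I\<^esub>"
        using b by (simp add: iota_def tm(2) del: gl_quot_simps)
      then show "pr f = \<zero>\<^bsub>?T\<^esub>" using K.iota_zero by simp
    qed
  next
    case (Suc N)
    note f = Suc.prems
    show ?case
    proof -
      have fc: "f \<in> carrier R" by (rule deg_closed[OF f(1)])
      obtain n g where g: "grad n f g" "\<And>w. lower (Suc N) (g w)" "lower (Suc N) (euler n g \<ominus>\<^bsub>R\<^esub> of_nat (Suc N) \<odot>\<^bsub>R\<^esub> f)"
        using euler_deg[OF f(1)] by (metis order_refl)
      have gc: "g w \<in> carrier R" "e (eps w) \<in> carrier R" for w using grad_closed[OF g(1)] e_simps(1)[OF eps_VV] by auto
      have gJ: "g w \<in> J" for w by (rule st[OF g(1) f(2)])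
      have "pr (g w) = \<zero>\<^bsub>?T\<^esub>" for w
        using Suc.IH[OF _ gJ[of w]] g(2)[of w] unfolding lower_def nat.case by blast
      then have "pr (g w \<otimes>\<^bsub>R\<^esub> e (eps w)) = \<zero>\<^bsub>?T\<^esub>" for w using gc prD(1)[OF gc(2)] by (simp add: prD)
      then have prE: "pr (euler n g) = \<zero>\<^bsub>?T\<^esub>" unfolding euler_def using gc by (intro pr_sum) auto
      have EJ: "euler n g \<in> J"
      proof -
        have term_J: "g w \<otimes>\<^bsub>R\<^esub> e (eps w) \<in> J" for w by (rule RJ.I.I_r_closed[OF gJ gc(2)])
        have "(\<Oplus>\<^bsub>R\<^esub>w\<in>A. g w \<otimes>\<^bsub>R\<^esub> e (eps w)) \<in> J" if "finite A" for A
          using that by (induction A rule: finite_induct) (simp_all add: P.T.M.finsum_insert Pi_def gc term_J Jsub(2,3))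
        then show ?thesis by (simp add: euler_def)
      qed
      have Ec: "euler n g \<in> carrier R" by (rule Jsub(1)[OF EJ])
      have "euler n g \<ominus>\<^bsub>R\<^esub> of_nat (Suc N) \<odot>\<^bsub>R\<^esub> f \<in> J" by (rule Jsub(6)[OF EJ Jsub(4)[OF f(2)]])
      then have "pr (euler n g \<ominus>\<^bsub>R\<^esub> of_nat (Suc N) \<odot>\<^bsub>R\<^esub> f) = \<zero>\<^bsub>?T\<^esub>"
        using Suc.IH g(3) unfolding lower_def nat.case by blast
      then have "\<zero>\<^bsub>?T\<^esub> \<ominus>\<^bsub>?T\<^esub> of_nat (Suc N) \<odot>\<^bsub>?T\<^esub> pr f = \<zero>\<^bsub>?T\<^esub>"
        by (simp only: pr_minus[OF Ec P.T.smult_c[OF fc]] prE prD(5)[OF fc])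
      then have "(- of_nat (Suc N)) \<odot>\<^bsub>?T\<^esub> pr f = \<zero>\<^bsub>?T\<^esub>"
        using prD(1)[OF fc] by (simp add: K.P.T.M.minus_eq K.P.T.smult_simps del: of_nat_Suc)
      moreover have "- of_nat (Suc N) \<noteq> (0::'k)" using of_nat_neq_0 by (simp del: of_nat_Suc)
      ultimately show "pr f = \<zero>\<^bsub>?T\<^esub>"
        using K.P.T.smult_cancel[OF prD(1)[OF fc], of "- of_nat (Suc N)"] by (simp del: of_nat_Suc)
    qed
  qed
  have sub: "pr f = \<zero>\<^bsub>?T\<^esub>" if "f \<in> J" for f
    by (rule exE[OF deg_exists[OF Jsub(1)[OF that]]], rule all[OF _ that])
  have ker: "f \<in> J" if f: "f \<in> carrier R" "pr f = \<zero>\<^bsub>?T\<^esub>" for f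
    by (rule tensor_kernel_le[OF P.kpair_axioms I ideal_J _ f(1) f(2)[unfolded pr_def]])
      (simp only: mem_I iota_def)
  have "f \<in> J \<longleftrightarrow> f \<in> carrier R \<and> pr f = \<zero>\<^bsub>?T\<^esub>" for f
    by (rule iffI, rule conjI, erule Jsub(1), erule sub, erule conjE, rule ker)
  then have "J = product_ideal B ?C I"
    unfolding product_ideal_def a_kernel_def' pr_def[symmetric] by (simp only: set_eq_iff mem_Collect_eq simp_thms)
  moreover have "closed_gl_subvariety B I"
    unfolding closed_gl_subvariety_def
  proof (intro conjI I)
    show "gl_stable B I"
      unfolding gl_stable_def
    proof (intro ballI)
      fix g :: "'k mat" and b assume g: "g \<in> GL" "b \<in> I"
      then have "act R g (io b) \<in> J" using stable_J mem_I by blast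
      then show "act B g b \<in> I"
        using g mem_I act_R(2)[OF g(1), of b] alg_homD(1)[OF act_B[OF g(1)], of b] by simp
    qed
    show "reduced (gl_quot B I)"
      unfolding reduced_def
    proof (intro ballI allI impI)
      fix z and n :: nat assume z: "z \<in> carrier (gl_quot B I)" "z [^]\<^bsub>gl_quot B I\<^esub> n = \<zero>\<^bsub>gl_quot B I\<^esub>"
      then obtain b where b: "b \<in> carrier B" "z = I +>\<^bsub>B\<^esub> b" using BI.quot_cases by blast
      have "I +>\<^bsub>B\<^esub> (b [^]\<^bsub>B\<^esub> n) = \<zero>\<^bsub>gl_quot B I\<^esub>"
        using z(2) alg_hom_pow[OF B.kalg_axioms QB.kalg_axioms BI.cls_hom b(1), of n] by (simp add: b(2) del: gl_quot_simps)
      then have "b [^]\<^bsub>B\<^esub> n \<in> I" using BI.cls_zero_iff[of "b [^]\<^bsub>B\<^esub> n"] b(1) by blast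
      then have "io b [^]\<^bsub>R\<^esub> n \<in> J"
        using alg_hom_pow[OF B.kalg_axioms P.T.kalg_axioms iota_hom b(1), of n] mem_I by simp
      moreover have ioc: "io b \<in> carrier R" using b by (simp add: iota_simps)
      ultimately have "J +>\<^bsub>R\<^esub> (io b [^]\<^bsub>R\<^esub> n) = \<zero>\<^bsub>gl_quot R J\<^esub>" using RJ.cls_zero_iff[of "io b [^]\<^bsub>R\<^esub> n"] by simp
      then have "(J +>\<^bsub>R\<^esub> io b) [^]\<^bsub>gl_quot R J\<^esub> n = \<zero>\<^bsub>gl_quot R J\<^esub>"
        using alg_hom_pow[OF P.T.kalg_axioms RJ.kalg_quot RJ.cls_hom ioc, of n] by (simp del: gl_quot_simps)
      then have "J +>\<^bsub>R\<^esub> io b = \<zero>\<^bsub>gl_quot R J\<^esub>"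
        using reduced_J RJ.cls_closed[OF ioc] unfolding reduced_def by blast
      then have "b \<in> I" using RJ.cls_zero_iff[OF ioc] b(1) mem_I by blast
      then show "z = \<zero>\<^bsub>gl_quot B I\<^esub>" using BI.cls_zero_iff[OF b(1)] b(2) by simp
    qed
  qed
  ultimately show ?thesis by blast
qed

end

section \<open>Localization and closed immersions\<close>

locale loc = cring R for R (structure) + fixes h assumes h [simp]: "h \<in> carrier R"
begin

lemma pow_pow: "r \<in> carrier R \<Longrightarrow> h [^] (a::nat) \<otimes> (h [^] (b::nat) \<otimes> r) = h [^] (a + b) \<otimes> r"
  by (simp add: m_assoc[symmetric] nat_pow_mult)

definition eqv :: "'a \<Rightarrow> nat \<Rightarrow> 'a \<Rightarrow> nat \<Rightarrow> bool" where
  "eqv r k s l \<longleftrightarrow> (\<exists>m. h [^] (m + l) \<otimes> r = h [^] (m + k) \<otimes> s)"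

lemma eqv_shift:
  assumes "h [^] (a::nat) \<otimes> r = h [^] (b::nat) \<otimes> s" "r \<in> carrier R" "s \<in> carrier R"
  shows "h [^] (c + a) \<otimes> r = h [^] (c + b) \<otimes> s"
  using arg_cong[OF assms(1), of "\<lambda>x. h [^] c \<otimes> x"] assms(2,3) by (simp add: pow_pow)

lemma mem_frac: "(s, l) \<in> loc_frac R h r k \<longleftrightarrow> r \<in> carrier R \<and> s \<in> carrier R \<and> eqv r k s l"
  by (auto simp: loc_frac_def loc_rel_def eqv_def pow_pow)

lemma eqv_refl: "eqv r k r k" by (auto simp: eqv_def)

lemma eqv_sym: "eqv r k s l \<Longrightarrow> eqv s l r k" unfolding eqv_def by metis

lemma eqv_trans:
  assumes c: "r \<in> carrier R" "s \<in> carrier R" "t \<in> carrier R" and e: "eqv r k s l" "eqv s l t j"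
  shows "eqv r k t j"
proof -
  obtain m m' where m: "h [^] (m + l) \<otimes> r = h [^] (m + k) \<otimes> s" "h [^] (m' + j) \<otimes> s = h [^] (m' + l) \<otimes> t"
    using e unfolding eqv_def by blast
  have "h [^] ((m' + j) + (m + l)) \<otimes> r = h [^] ((m' + j) + (m + k)) \<otimes> s" by (rule eqv_shift[OF m(1) c(1,2)])
  also have "\<dots> = h [^] ((m + k) + (m' + l)) \<otimes> t"
    using eqv_shift[OF m(2) c(2,3), of "m + k"] by (simp add: add.commute add.left_commute)
  finally have "h [^] ((m + m' + l) + j) \<otimes> r = h [^] ((m + m' + l) + k) \<otimes> t" by (simp add: ac_simps)
  then show ?thesis unfolding eqv_def by blast
qed

lemma frac_eq:
  assumes "r \<in> carrier R" "s \<in> carrier R" "eqv r k s l"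
  shows "loc_frac R h r k = loc_frac R h s l"
  using assms by (auto simp: mem_frac) (blast intro: eqv_trans eqv_sym)+

lemma frac_self: "r \<in> carrier R \<Longrightarrow> (r, k) \<in> loc_frac R h r k"
  by (simp add: mem_frac eqv_refl)

lemma eqv_mult:
  assumes c: "r \<in> carrier R" "r' \<in> carrier R" "s \<in> carrier R" "s' \<in> carrier R" and e: "eqv r k r' k'" "eqv s l s' l'"
  shows "eqv (r \<otimes> s) (k + l) (r' \<otimes> s') (k' + l')"
proof -
  obtain m m' where m: "h [^] (m + k') \<otimes> r = h [^] (m + k) \<otimes> r'" "h [^] (m' + l') \<otimes> s = h [^] (m' + l) \<otimes> s'"
    using e unfolding eqv_def by blast
  have prod: "h [^] (a + b) \<otimes> (x \<otimes> y) = (h [^] a \<otimes> x) \<otimes> (h [^] b \<otimes> y)"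
    if "x \<in> carrier R" "y \<in> carrier R" for a b :: nat and x y
    using that by (simp add: nat_pow_mult[symmetric] m_ac)
  have "h [^] ((m + k') + (m' + l')) \<otimes> (r \<otimes> s) = h [^] ((m + k) + (m' + l)) \<otimes> (r' \<otimes> s')"
    using c by (simp only: prod m)
  then have "h [^] ((m + m') + (k' + l')) \<otimes> (r \<otimes> s) = h [^] ((m + m') + (k + l)) \<otimes> (r' \<otimes> s')"
    by (simp add: ac_simps)
  then show ?thesis unfolding eqv_def by blast
qed

lemma eqv_add:
  assumes c: "r \<in> carrier R" "r' \<in> carrier R" "s \<in> carrier R" "s' \<in> carrier R" and e: "eqv r k r' k'" "eqv s l s' l'"
  shows "eqv (h [^] l \<otimes> r \<oplus> h [^] k \<otimes> s) (k + l) (h [^] l' \<otimes> r' \<oplus> h [^] k' \<otimes> s') (k' + l')"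
proof -
  obtain m m' where m: "h [^] (m + k') \<otimes> r = h [^] (m + k) \<otimes> r'" "h [^] (m' + l') \<otimes> s = h [^] (m' + l) \<otimes> s'"
    using e unfolding eqv_def by blast
  have "h [^] ((m + m') + (k' + l')) \<otimes> (h [^] l \<otimes> r) = h [^] ((m + m') + (k + l)) \<otimes> (h [^] l' \<otimes> r')"
    using eqv_shift[OF m(1) c(1,2), of "m' + l + l'"] c by (simp add: pow_pow ac_simps)
  moreover have "h [^] ((m + m') + (k' + l')) \<otimes> (h [^] k \<otimes> s) = h [^] ((m + m') + (k + l)) \<otimes> (h [^] k' \<otimes> s')"
    using eqv_shift[OF m(2) c(3,4), of "m + k + k'"] c by (simp add: pow_pow ac_simps)
  ultimately have "h [^] ((m + m') + (k' + l')) \<otimes> (h [^] l \<otimes> r \<oplus> h [^] k \<otimes> s) =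
      h [^] ((m + m') + (k + l)) \<otimes> (h [^] l' \<otimes> r' \<oplus> h [^] k' \<otimes> s')"
    using c by (simp add: r_distr)
  then show ?thesis unfolding eqv_def by blast
qed

lemma localization_simps:
  assumes "r \<in> carrier R" "s \<in> carrier R"
  shows "loc_frac R h r k \<otimes>\<^bsub>localization R h\<^esub> loc_frac R h s l = loc_frac R h (r \<otimes> s) (k + l)"
    "loc_frac R h r k \<oplus>\<^bsub>localization R h\<^esub> loc_frac R h s l = loc_frac R h (h [^] l \<otimes> r \<oplus> h [^] k \<otimes> s) (k + l)"
proof -
  have 1: "loc_frac R h (r' \<otimes> s') (k' + l') = loc_frac R h (r \<otimes> s) (k + l)"
    and 2: "loc_frac R h (h [^] l' \<otimes> r' \<oplus> h [^] k' \<otimes> s') (k' + l') = loc_frac R h (h [^] l \<otimes> r \<oplus> h [^] k \<otimes> s) (k + l)"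
    if "(r', k') \<in> loc_frac R h r k" "(s', l') \<in> loc_frac R h s l" for r' k' s' l'
  proof -
    have c: "r' \<in> carrier R" "s' \<in> carrier R" "eqv r' k' r k" "eqv s' l' s l"
      using that eqv_sym by (auto simp: mem_frac)
    show "loc_frac R h (r' \<otimes> s') (k' + l') = loc_frac R h (r \<otimes> s) (k + l)"
      using c assms by (intro frac_eq eqv_mult) auto
    show "loc_frac R h (h [^] l' \<otimes> r' \<oplus> h [^] k' \<otimes> s') (k' + l') = loc_frac R h (h [^] l \<otimes> r \<oplus> h [^] k \<otimes> s) (k + l)"
      using c assms by (intro frac_eq eqv_add) auto
  qed
  have "(\<Union>(r', k')\<in>loc_frac R h r k. \<Union>(s', l')\<in>loc_frac R h s l. loc_frac R h (r' \<otimes> s') (k' + l')) =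
      (\<Union>_\<in>loc_frac R h r k. \<Union>_\<in>loc_frac R h s l. loc_frac R h (r \<otimes> s) (k + l))"
    by (intro SUP_cong refl) (auto simp: 1)
  then show "loc_frac R h r k \<otimes>\<^bsub>localization R h\<^esub> loc_frac R h s l = loc_frac R h (r \<otimes> s) (k + l)"
    using frac_self[OF assms(1), of k] frac_self[OF assms(2), of l] by (auto simp: localization_def)
  have "(\<Union>(r', k')\<in>loc_frac R h r k. \<Union>(s', l')\<in>loc_frac R h s l. loc_frac R h (h [^] l' \<otimes> r' \<oplus> h [^] k' \<otimes> s') (k' + l')) =
      (\<Union>_\<in>loc_frac R h r k. \<Union>_\<in>loc_frac R h s l. loc_frac R h (h [^] l \<otimes> r \<oplus> h [^] k \<otimes> s) (k + l))"
    by (intro SUP_cong refl) (auto simp: 2)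
  then show "loc_frac R h r k \<oplus>\<^bsub>localization R h\<^esub> loc_frac R h s l = loc_frac R h (h [^] l \<otimes> r \<oplus> h [^] k \<otimes> s) (k + l)"
    using frac_self[OF assms(1), of k] frac_self[OF assms(2), of l] by (auto simp: localization_def)
qed

lemma localization_carrier: "x \<in> carrier (localization R h) \<longleftrightarrow> (\<exists>r\<in>carrier R. \<exists>k. x = loc_frac R h r k)"
  by (auto simp: localization_def)

end

text \<open>
  A homomorphism whose image contains a multiple of each element by a power of \<open>f h\<close> becomes surjective after
  inverting \<open>h\<close>.
\<close>

lemma closed_immersion_localization:
  fixes R :: "('a, 'm) ring_scheme" and S :: "('b, 'n) ring_scheme"
  assumes R: "cring R" and S: "cring S" and f: "f \<in> ring_hom R S" and h: "h \<in> carrier R"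
    and surj: "\<And>s. s \<in> carrier S \<Longrightarrow> \<exists>N::nat. \<exists>r\<in>carrier R. f h [^]\<^bsub>S\<^esub> N \<otimes>\<^bsub>S\<^esub> s = f r"
  shows "closed_immersion (localization R h) (localization S (f h)) (loc_map S (f h) f)"
proof -
  interpret R: cring R by (rule R)
  interpret S: cring S by (rule S)
  interpret fh: ring_hom_ring R S f by (intro ring_hom_ringI2 R.ring_axioms S.ring_axioms f)
  interpret L: loc R h by (intro loc.intro loc_axioms.intro R h)
  interpret M: loc S "f h" by (intro loc.intro loc_axioms.intro S) (use h in simp)
  have pow: "f (h [^]\<^bsub>R\<^esub> (k::nat)) = f h [^]\<^bsub>S\<^esub> k" for k using h by (induction k) auto
  have frac: "loc_map S (f h) f (loc_frac R h r k) = loc_frac S (f h) (f r) k" if r: "r \<in> carrier R" for r k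
  proof -
    have "loc_frac S (f h) (f r') k' = loc_frac S (f h) (f r) k" if "(r', k') \<in> loc_frac R h r k" for r' k'
    proof -
      have c: "r' \<in> carrier R" "L.eqv r' k' r k" using that L.eqv_sym by (auto simp: L.mem_frac)
      then obtain m where "h [^]\<^bsub>R\<^esub> (m + k) \<otimes>\<^bsub>R\<^esub> r' = h [^]\<^bsub>R\<^esub> (m + k') \<otimes>\<^bsub>R\<^esub> r" by (auto simp: L.eqv_def)
      from arg_cong[OF this, of f] have "f h [^]\<^bsub>S\<^esub> (m + k) \<otimes>\<^bsub>S\<^esub> f r' = f h [^]\<^bsub>S\<^esub> (m + k') \<otimes>\<^bsub>S\<^esub> f r"
        using c(1) r h by (simp add: pow)
      then show ?thesis using c(1) r by (intro M.frac_eq) (auto simp: M.eqv_def)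
    qed
    then have "loc_map S (f h) f (loc_frac R h r k) = (\<Union>_\<in>loc_frac R h r k. loc_frac S (f h) (f r) k)"
      unfolding loc_map_def by (intro SUP_cong refl) auto
    then show ?thesis using L.frac_self[OF r, of k] by auto
  qed
  have "loc_map S (f h) f \<in> ring_hom (localization R h) (localization S (f h))"
  proof (rule ring_hom_memI)
    fix x assume "x \<in> carrier (localization R h)"
    then show "loc_map S (f h) f x \<in> carrier (localization S (f h))"
      by (auto simp: L.localization_carrier M.localization_carrier frac) (use fh.hom_closed in blast)
  next
    fix x y assume "x \<in> carrier (localization R h)" "y \<in> carrier (localization R h)"
    then obtain r k s l where x: "r \<in> carrier R" "x = loc_frac R h r k" and y: "s \<in> carrier R" "y = loc_frac R h s l"
      by (auto simp: L.localization_carrier)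
    show "loc_map S (f h) f (x \<otimes>\<^bsub>localization R h\<^esub> y) = loc_map S (f h) f x \<otimes>\<^bsub>localization S (f h)\<^esub> loc_map S (f h) f y"
      using x(1) y(1) by (simp add: x(2) y(2) L.localization_simps M.localization_simps frac)
    show "loc_map S (f h) f (x \<oplus>\<^bsub>localization R h\<^esub> y) = loc_map S (f h) f x \<oplus>\<^bsub>localization S (f h)\<^esub> loc_map S (f h) f y"
      using x(1) y(1) h by (simp add: x(2) y(2) L.localization_simps M.localization_simps frac pow)
  next
    show "loc_map S (f h) f \<one>\<^bsub>localization R h\<^esub> = \<one>\<^bsub>localization S (f h)\<^esub>" by (simp add: localization_def frac)
  qed
  moreover have "x \<in> loc_map S (f h) f ` carrier (localization R h)" if x: "x \<in> carrier (localization S (f h))" for x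
  proof -
    obtain s k where s: "s \<in> carrier S" "x = loc_frac S (f h) s k" using x by (auto simp: M.localization_carrier)
    obtain N r where r: "r \<in> carrier R" "f h [^]\<^bsub>S\<^esub> (N::nat) \<otimes>\<^bsub>S\<^esub> s = f r" using surj[OF s(1)] by blast
    have "f h [^]\<^bsub>S\<^esub> (0 + k) \<otimes>\<^bsub>S\<^esub> f r = f h [^]\<^bsub>S\<^esub> (0 + (k + N)) \<otimes>\<^bsub>S\<^esub> s"
      using s(1) unfolding r(2)[symmetric] by (simp add: M.pow_pow)
    then have "M.eqv (f r) (k + N) s k" unfolding M.eqv_def by blast
    then have "loc_frac S (f h) (f r) (k + N) = x" using r(1) s by (simp add: M.frac_eq)
    then show ?thesis using frac[OF r(1), of "k + N"] r(1)
      by (intro image_eqI[of _ _ "loc_frac R h r (k + N)"]) (auto simp: L.localization_carrier)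
  qed
  moreover have "loc_map S (f h) f ` carrier (localization R h) \<subseteq> carrier (localization S (f h))"
    by (auto simp: L.localization_carrier M.localization_carrier frac) (use fh.hom_closed in blast)
  ultimately show ?thesis unfolding closed_immersion_def by blast
qed

section \<open>Unipotent derivations and the functions they reach\<close>

context kalg
begin

lemma lie_unique:
  assumes l: "lie M p i x a" "lie M p i x b"
  shows "a = b"
proof -
  obtain v where v: "x \<in> carrier M" "poly v" "v 0 = a" "\<And>s. act M (el p i s) x = x \<oplus> s \<odot> v s"
    using l(1) unfolding lie_def by blast
  obtain w where w: "poly w" "w 0 = b" "\<And>s. act M (el p i s) x = x \<oplus> s \<odot> w s"
    using l(2) unfolding lie_def by blast
  note c = v(1) poly_closed[OF v(2)] poly_closed[OF w(1)]
  have neg: "((- 1) \<odot> \<one>) \<otimes> y = (- 1) \<odot> y" if "y \<in> carrier M" for y using that by (simp add: smult_mult)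
  have "poly (\<lambda>s. v s \<oplus> ((- 1) \<odot> \<one>) \<otimes> w s)" by (intro poly_add v(2) poly_mult poly_const w(1)) simp
  then have p: "poly (\<lambda>s. v s \<oplus> (- 1) \<odot> w s)" using c by (simp add: neg)
  have "v 0 \<oplus> (- 1) \<odot> w 0 \<in> {\<zero>}"
  proof (rule poly_times_subspace[OF _ p])
    show "subspace {\<zero>}" by (simp add: subspace_def)
    fix s
    have "s \<odot> v s = s \<odot> w s" using v(4)[of s] w(3)[of s] c by simp
    then have "s \<odot> (v s \<oplus> (- 1) \<odot> w s) = s \<odot> w s \<oplus> (- s) \<odot> w s" using c by (simp add: smult_add_right smult_simps(2))
    then show "s \<odot> (v s \<oplus> (- 1) \<odot> w s) \<in> {\<zero>}" using c by (simp add: smult_simps M.r_neg)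
  qed
  then have "v 0 \<ominus> w 0 = \<zero>" using c by (simp add: smult_simps M.minus_eq)
  moreover have "v 0 = (v 0 \<ominus> w 0) \<oplus> w 0" using c by (simp add: M.minus_eq M.a_assoc M.l_neg)
  ultimately show ?thesis using c(3)[of 0] v(3) w(2) by simp
qed

end

context glv
begin

definition D where "D p i f = (THE f'. lie R p i f f')"

lemma D_eq: "lie R p i f f' \<Longrightarrow> D p i f = f'"
  unfolding D_def by (rule the_equality, assumption, erule P.T.lie_unique)

lemma act_el:
  assumes "p \<noteq> i"
  shows "act R (el p i s) \<in> alg_hom R R"
  by (rule act_R(1)[OF el_GL[OF assms]])

lemma lie_generators:
  assumes "p \<noteq> i"
  shows "b \<in> carrier B \<Longrightarrow> \<exists>b'\<in>carrier B. lie R p i (io b) (io b')" "x \<in> VV lam \<Longrightarrow> lie R p i (e x) (e (edge p i x))"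
proof -
  assume b: "b \<in> carrier B"
  obtain b' where b': "lie B p i b b'" using polynomial_rep_props(2)[OF poly_rep b assms] by blast
  have "lie R p i (io b) (io b')"
    by (rule lie_hom[OF B.kmod_axioms P.T.kmod_axioms iota_simps(1,2,5) _ b'])
      (use b in \<open>simp_all add: act_R(2)[OF el_GL[OF assms]]\<close>)
  then show "\<exists>b'\<in>carrier B. lie R p i (io b) (io b')" using B.lie_closed[OF b'] by blast
next
  assume x: "x \<in> VV lam"
  show "lie R p i (e x) (e (edge p i x))"
    by (rule lie_hom[OF kmod_V_part P.T.kmod_axioms _ _ _ _ lie_V_part[OF assms x]])
      (use x in \<open>simp_all add: e_simps act_R(3)[OF el_GL[OF assms]]\<close>)
qed

lemma lie_exists:
  assumes pi: "p \<noteq> i" and f: "f \<in> carrier R"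
  shows "lie R p i f (D p i f)"
proof -
  note aD = alg_homD[OF act_el[OF pi]]
  have "\<exists>f'. lie R p i f f'"
    using f
  proof (rule TS_induct)
    fix b assume "b \<in> carrier B"
    then show "\<exists>f'. lie R p i (io b) f'" using lie_generators(1)[OF pi] by blast
  next
    fix x :: "nat list \<Rightarrow>\<^sub>0 'k" assume "x \<in> VV lam"
    then show "\<exists>f'. lie R p i (e x) f'" using lie_generators(2)[OF pi] by blast
  next
    fix x y assume "\<exists>f'. lie R p i x f'" "\<exists>f'. lie R p i y f'"
    then obtain x' y' where l: "lie R p i x x'" "lie R p i y y'" by blast
    show "\<exists>f'. lie R p i (x \<oplus>\<^bsub>R\<^esub> y) f'" using P.T.lie_add[OF aD(2) l] by blast
    show "\<exists>f'. lie R p i (x \<otimes>\<^bsub>R\<^esub> y) f'" using P.T.lie_mult[OF aD(3) l] by blast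
  qed
  then show ?thesis using D_eq by auto
qed

lemma D_rules:
  assumes pi: "p \<noteq> i"
  shows "f \<in> carrier R \<Longrightarrow> D p i f \<in> carrier R"
    "f \<in> carrier R \<Longrightarrow> f' \<in> carrier R \<Longrightarrow> D p i (f \<oplus>\<^bsub>R\<^esub> f') = D p i f \<oplus>\<^bsub>R\<^esub> D p i f'"
    "f \<in> carrier R \<Longrightarrow> f' \<in> carrier R \<Longrightarrow> D p i (f \<otimes>\<^bsub>R\<^esub> f') = D p i f \<otimes>\<^bsub>R\<^esub> f' \<oplus>\<^bsub>R\<^esub> f \<otimes>\<^bsub>R\<^esub> D p i f'"
    "b \<in> carrier B \<Longrightarrow> \<exists>b'\<in>carrier B. D p i (io b) = io b'"
    "x \<in> VV lam \<Longrightarrow> D p i (e x) = e (edge p i x)"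
    "f \<in> J \<Longrightarrow> D p i f \<in> J"
proof -
  note aD = alg_homD[OF act_el[OF pi]] and ex = lie_exists[OF pi]
  show "D p i f \<in> carrier R" if "f \<in> carrier R" using P.T.lie_closed[OF ex[OF that]] by blast
  assume f: "f \<in> carrier R" "f' \<in> carrier R"
  show "D p i (f \<oplus>\<^bsub>R\<^esub> f') = D p i f \<oplus>\<^bsub>R\<^esub> D p i f'"
    by (rule D_eq[OF P.T.lie_add[OF aD(2) ex[OF f(1)] ex[OF f(2)]]])
  show "D p i (f \<otimes>\<^bsub>R\<^esub> f') = D p i f \<otimes>\<^bsub>R\<^esub> f' \<oplus>\<^bsub>R\<^esub> f \<otimes>\<^bsub>R\<^esub> D p i f'"
    by (rule D_eq[OF P.T.lie_mult[OF aD(3) ex[OF f(1)] ex[OF f(2)]]])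
next
  show "\<exists>b'\<in>carrier B. D p i (io b) = io b'" if "b \<in> carrier B"
  proof -
    obtain b' where "b' \<in> carrier B" "lie R p i (io b) (io b')" using lie_generators(1)[OF pi \<open>b \<in> carrier B\<close>] by blast
    then show ?thesis using D_eq by blast
  qed
  show "D p i (e x) = e (edge p i x)" if "x \<in> VV lam" by (rule D_eq[OF lie_generators(2)[OF pi that]])
  assume f: "f \<in> J"
  show "D p i f \<in> J"
    by (rule P.T.lie_subspace[OF P.T.ideal_subspace[OF ideal_J] f _ lie_exists[OF pi RJ.I.Icarr[OF f]]])
      (rule stable_J[OF el_GL[OF pi] f])
qed

text \<open>
  \<open>low n\<close> is the ring of functions on \<open>Sh\<^sub>n(Y) \<times> A\<^sup>\<mu>\<close>, realized inside the functions on \<open>Y \<times> A\<^sup>\<lambda>\<close>.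
\<close>

inductive low for n where
  low_io: "b \<in> carrier B \<Longrightarrow> low n (io b)"
| low_e: "x \<in> mixed n lam \<Longrightarrow> low n (e x)"
| low_add: "low n f \<Longrightarrow> low n f' \<Longrightarrow> low n (f \<oplus>\<^bsub>R\<^esub> f')"
| low_mult: "low n f \<Longrightarrow> low n f' \<Longrightarrow> low n (f \<otimes>\<^bsub>R\<^esub> f')"

lemma mixed_VV: "x \<in> mixed n lam \<Longrightarrow> x \<in> VV lam" by (simp add: mixed_def)

lemma low_closed: "low n f \<Longrightarrow> f \<in> carrier R"
  by (induction rule: low.induct) (simp_all add: iota_simps e_simps mixed_VV)

lemma low_smult: "low n f \<Longrightarrow> low n (c \<odot>\<^bsub>R\<^esub> f)"
  using low_mult[OF low_io[of "c \<odot>\<^bsub>B\<^esub> \<one>\<^bsub>B\<^esub>" n], of f] low_closed[of n f] by (simp add: iota_simps P.T.smult_mult)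

lemma low_zero: "low n \<zero>\<^bsub>R\<^esub>" and low_one: "low n \<one>\<^bsub>R\<^esub>"
  using low_io[of "\<zero>\<^bsub>B\<^esub>" n] low_io[of "\<one>\<^bsub>B\<^esub>" n] by (simp_all add: iota_zero iota_simps)

lemma low_minus: "low n f \<Longrightarrow> low n f' \<Longrightarrow> low n (f \<ominus>\<^bsub>R\<^esub> f')"
  using low_add[of n f "(- 1) \<odot>\<^bsub>R\<^esub> f'"] low_smult[of n f' "- 1"] low_closed[of n f']
  by (simp add: P.T.smult_simps P.T.M.minus_eq)

abbreviation "Ds \<equiv> foldr (\<lambda>(i, p). D p i)"

definition moves :: "nat \<Rightarrow> (nat \<times> nat) set" where "moves n = {(i, p). i < n \<and> n \<le> p}"

lemma Ds_rules:
  assumes "set zs \<subseteq> moves n"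
  shows "f \<in> carrier R \<Longrightarrow> Ds zs f \<in> carrier R"
    "f \<in> carrier R \<Longrightarrow> f' \<in> carrier R \<Longrightarrow> Ds zs (f \<oplus>\<^bsub>R\<^esub> f') = Ds zs f \<oplus>\<^bsub>R\<^esub> Ds zs f'"
    "b \<in> carrier B \<Longrightarrow> \<exists>b'\<in>carrier B. Ds zs (io b) = io b'"
    "x \<in> VV lam \<Longrightarrow> foldr (\<lambda>(i, p). edge p i) zs x \<in> VV lam \<and> Ds zs (e x) = e (foldr (\<lambda>(i, p). edge p i) zs x)"
    "f \<in> J \<Longrightarrow> Ds zs f \<in> J"
proof -
  have 1: "set zs \<subseteq> moves n \<Longrightarrow> f \<in> carrier R \<Longrightarrow> Ds zs f \<in> carrier R" for f zs
    by (induction zs) (auto simp: moves_def intro!: D_rules(1))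
  show "f \<in> carrier R \<Longrightarrow> Ds zs f \<in> carrier R" by (rule 1[OF assms])
  show "f \<in> carrier R \<Longrightarrow> f' \<in> carrier R \<Longrightarrow> Ds zs (f \<oplus>\<^bsub>R\<^esub> f') = Ds zs f \<oplus>\<^bsub>R\<^esub> Ds zs f'"
    using assms by (induction zs) (auto simp: moves_def D_rules(2) 1)
  show "\<exists>b'\<in>carrier B. Ds zs (io b) = io b'" if b: "b \<in> carrier B"
    using assms
  proof (induction zs)
    case (Cons z zs)
    then obtain i p b' where z: "z = (i, p)" "p \<noteq> i" "b' \<in> carrier B" "Ds zs (io b) = io b'"
      by (auto simp: moves_def)
    then show ?case using D_rules(4)[OF z(2,3)] by simp
  qed (use b in auto)
  show "foldr (\<lambda>(i, p). edge p i) zs x \<in> VV lam \<and> Ds zs (e x) = e (foldr (\<lambda>(i, p). edge p i) zs x)" if x: "x \<in> VV lam"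
    using assms x by (induction zs) (auto simp: moves_def D_rules(5) edge_VV)
  show "f \<in> J \<Longrightarrow> Ds zs f \<in> J"
    using assms by (induction zs) (auto simp: moves_def intro!: D_rules(6))
qed

text \<open>
  \<open>tame n k f\<close>: fewer than \<open>k + 1\<close> derivations that replace a letter below \<open>n\<close> by one above keep \<open>f\<close> in \<open>low n\<close>.  For
  functions of the first coordinates this holds if \<open>k < |\<lambda>|\<close>, because a letter below \<open>n\<close> remains in each word.
\<close>

definition tame where
  "tame n k f \<longleftrightarrow> f \<in> carrier R \<and> (\<forall>zs. set zs \<subseteq> moves n \<longrightarrow> length zs \<le> k \<longrightarrow> low n (Ds zs f))"

lemma tame_low: "tame n k f \<Longrightarrow> low n f"
  unfolding tame_def by (metis empty_set foldr.simps(1) id_apply empty_subsetI list.size(3) zero_le)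

lemma tame_mono: "tame n k f \<Longrightarrow> k' \<le> k \<Longrightarrow> tame n k' f"
  unfolding tame_def by (meson order_trans)

lemma tame_D: "tame n (Suc k) f \<Longrightarrow> (i, p) \<in> moves n \<Longrightarrow> tame n k (D p i f)"
  unfolding tame_def
proof (intro conjI allI impI, elim conjE)
  assume "(i, p) \<in> moves n" "f \<in> carrier R"
  then show "D p i f \<in> carrier R" by (intro D_rules(1)) (auto simp: moves_def)
next
  fix zs assume a: "f \<in> carrier R \<and> (\<forall>zs. set zs \<subseteq> moves n \<longrightarrow> length zs \<le> Suc k \<longrightarrow> low n (Ds zs f))"
    "(i, p) \<in> moves n" "set zs \<subseteq> moves n" "length zs \<le> k"
  then have "low n (Ds (zs @ [(i, p)]) f)" by (intro a(1)[THEN conjunct2, rule_format]) auto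
  then show "low n (Ds zs (D p i f))" by simp
qed

lemma tame_add: "tame n k f \<Longrightarrow> tame n k f' \<Longrightarrow> tame n k (f \<oplus>\<^bsub>R\<^esub> f')"
  unfolding tame_def by (auto simp: Ds_rules(2) intro: low_add)

lemma Ds_mult_snoc:
  assumes "f \<in> carrier R" "f' \<in> carrier R" "set zs \<subseteq> moves n" "(i, p) \<in> moves n"
  shows "Ds (zs @ [(i, p)]) (f \<otimes>\<^bsub>R\<^esub> f') = Ds zs (D p i f \<otimes>\<^bsub>R\<^esub> f') \<oplus>\<^bsub>R\<^esub> Ds zs (f \<otimes>\<^bsub>R\<^esub> D p i f')"
proof -
  have pi: "p \<noteq> i" using assms(4) by (auto simp: moves_def)
  show ?thesis using assms D_rules(1)[OF pi] by (simp add: D_rules(3)[OF pi] Ds_rules(2)[OF assms(3)])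
qed

lemma tame_mult: "tame n k f \<Longrightarrow> tame n k f' \<Longrightarrow> tame n k (f \<otimes>\<^bsub>R\<^esub> f')"
proof (induction k arbitrary: f f')
  case 0
  then show ?case using low_mult[OF tame_low[of n 0 f] tame_low[of n 0 f']] by (auto simp: tame_def)
next
  case (Suc k)
  have c: "f \<in> carrier R" "f' \<in> carrier R" using Suc.prems by (auto simp: tame_def)
  have "low n (Ds zs (f \<otimes>\<^bsub>R\<^esub> f'))" if zs: "set zs \<subseteq> moves n" "length zs \<le> Suc k" for zs
  proof (cases zs rule: rev_cases)
    case Nil
    then show ?thesis using low_mult[OF tame_low[OF Suc.prems(1)] tame_low[OF Suc.prems(2)]] by simp
  next
    case (snoc zs' z)
    obtain i p where z: "z = (i, p)" by (cases z)
    have m: "set zs' \<subseteq> moves n" "(i, p) \<in> moves n" "length zs' \<le> k" using zs by (auto simp: snoc z)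
    have t: "tame n k (D p i f \<otimes>\<^bsub>R\<^esub> f')" "tame n k (f \<otimes>\<^bsub>R\<^esub> D p i f')"
      using Suc.IH tame_D[OF Suc.prems(1) m(2)] tame_D[OF Suc.prems(2) m(2)] tame_mono[OF Suc.prems(1), of k]
        tame_mono[OF Suc.prems(2), of k] by auto
    then have "low n (Ds zs' (D p i f \<otimes>\<^bsub>R\<^esub> f'))" "low n (Ds zs' (f \<otimes>\<^bsub>R\<^esub> D p i f'))"
      using m unfolding tame_def by blast+
    then show ?thesis unfolding snoc z Ds_mult_snoc[OF c m(1,2)] by (rule low_add)
  qed
  then show ?case using c by (simp add: tame_def)
qed

text \<open>One derivation more, and the composite is a derivation modulo \<open>low n\<close>: the mixed terms of the Leibniz rule lie there.\<close>

lemma leibniz: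
  assumes "tame n k f" "tame n k f'" "set zs \<subseteq> moves n" "length zs = Suc k"
  shows "low n (Ds zs (f \<otimes>\<^bsub>R\<^esub> f') \<ominus>\<^bsub>R\<^esub> (f \<otimes>\<^bsub>R\<^esub> Ds zs f' \<oplus>\<^bsub>R\<^esub> f' \<otimes>\<^bsub>R\<^esub> Ds zs f))"
  using assms
proof (induction k arbitrary: f f' zs)
  case (0 f f' zs)
  obtain i p where z: "zs = [(i, p)]" using 0(4) by (cases zs) auto
  have pi: "p \<noteq> i" using 0(3) by (auto simp: z moves_def)
  have c: "f \<in> carrier R" "f' \<in> carrier R" using 0 by (auto simp: tame_def)
  have "Ds zs (f \<otimes>\<^bsub>R\<^esub> f') = f \<otimes>\<^bsub>R\<^esub> Ds zs f' \<oplus>\<^bsub>R\<^esub> f' \<otimes>\<^bsub>R\<^esub> Ds zs f"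
    using c D_rules(1)[OF pi] by (simp add: z D_rules(3)[OF pi] P.T.A.m_comm P.T.M.a_comm)
  then show ?case using c Ds_rules(1)[OF 0(3)] low_zero by (simp add: P.T.M.minus_eq P.T.M.r_neg)
next
  case (Suc k f f' zs)
  obtain zs' i p where z: "zs = zs' @ [(i, p)]" using Suc.prems(4) by (cases zs rule: rev_cases) auto
  have m: "set zs' \<subseteq> moves n" "(i, p) \<in> moves n" "length zs' = Suc k" using Suc.prems(3,4) by (auto simp: z)
  have pi: "p \<noteq> i" using m(2) by (auto simp: moves_def)
  have c: "f \<in> carrier R" "f' \<in> carrier R" using Suc.prems by (auto simp: tame_def)
  let ?E = "D p i f" and ?E' = "D p i f'"
  have Ec: "?E \<in> carrier R" "?E' \<in> carrier R" using D_rules(1)[OF pi] c by auto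
  note dc = Ds_rules(1)[OF m(1)]
  have t: "tame n k f" "tame n k f'" "tame n k ?E" "tame n k ?E'"
    using tame_mono[OF Suc.prems(1)] tame_mono[OF Suc.prems(2)] tame_D[OF Suc.prems(1) m(2)] tame_D[OF Suc.prems(2) m(2)] by auto
  have l: "low n (Ds zs' f)" "low n (Ds zs' f')" using Suc.prems(1,2) m unfolding tame_def by auto
  let ?A = "Ds zs' (?E \<otimes>\<^bsub>R\<^esub> f')" and ?B = "Ds zs' (f \<otimes>\<^bsub>R\<^esub> ?E')"
  let ?a = "?E \<otimes>\<^bsub>R\<^esub> Ds zs' f'" and ?b = "f' \<otimes>\<^bsub>R\<^esub> Ds zs' ?E" and ?x = "f \<otimes>\<^bsub>R\<^esub> Ds zs' ?E'" and ?y = "?E' \<otimes>\<^bsub>R\<^esub> Ds zs' f"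
  have AB: "low n (?A \<ominus>\<^bsub>R\<^esub> (?a \<oplus>\<^bsub>R\<^esub> ?b))" "low n (?B \<ominus>\<^bsub>R\<^esub> (?x \<oplus>\<^bsub>R\<^esub> ?y))"
    by (rule Suc.IH; fact t m)+
  have ay: "low n ?a" "low n ?y" using low_mult tame_low t(3,4) l by auto
  have cc: "?A \<in> carrier R" "?B \<in> carrier R" "?a \<in> carrier R" "?b \<in> carrier R" "?x \<in> carrier R" "?y \<in> carrier R"
    using c Ec dc by auto
  have "(?A \<ominus>\<^bsub>R\<^esub> (?a \<oplus>\<^bsub>R\<^esub> ?b)) \<oplus>\<^bsub>R\<^esub> ?a = ?A \<ominus>\<^bsub>R\<^esub> ?b"
    using cc(1,3,4) by (simp add: P.T.M.a_comm[of ?a ?b] P.T.M.minus_eq P.T.M.minus_add P.T.M.a_assoc P.T.M.l_neg)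
  then have A: "low n (?A \<ominus>\<^bsub>R\<^esub> ?b)" using low_add[OF AB(1) ay(1)] by simp
  have "(?B \<ominus>\<^bsub>R\<^esub> (?x \<oplus>\<^bsub>R\<^esub> ?y)) \<oplus>\<^bsub>R\<^esub> ?y = ?B \<ominus>\<^bsub>R\<^esub> ?x"
    using cc(2,5,6) by (simp add: P.T.M.minus_eq P.T.M.minus_add P.T.M.a_assoc P.T.M.l_neg)
  then have B: "low n (?B \<ominus>\<^bsub>R\<^esub> ?x)" using low_add[OF AB(2) ay(2)] by simp
  have "(?A \<ominus>\<^bsub>R\<^esub> ?b) \<oplus>\<^bsub>R\<^esub> (?B \<ominus>\<^bsub>R\<^esub> ?x) = (?A \<oplus>\<^bsub>R\<^esub> ?B) \<ominus>\<^bsub>R\<^esub> (?x \<oplus>\<^bsub>R\<^esub> ?b)"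
    using cc(1,2,4,5) by (simp add: P.T.M.minus_eq P.T.M.minus_add P.T.M.a_ac)
  moreover have "Ds zs (f \<otimes>\<^bsub>R\<^esub> f') = ?A \<oplus>\<^bsub>R\<^esub> ?B" unfolding z by (rule Ds_mult_snoc[OF c m(1,2)])
  ultimately show ?case using low_add[OF A B] by (simp add: z)
qed

lemma heavy_letters:
  fixes x :: "nat list \<Rightarrow>\<^sub>0 'k"
  assumes "set zs \<subseteq> moves n" "light n x" "w \<in> Poly_Mapping.keys (foldr (\<lambda>(i, p). edge p i) zs x)"
  shows "length (filter (\<lambda>l. n \<le> l) w) \<le> length zs"
  using assms(1,3)
proof (induction zs arbitrary: w)
  case Nil
  then show ?case using assms(2) by (auto simp: light_def not_le)
next
  case (Cons z zs)
  obtain i p where z: "z = (i, p)" by (cases z)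
  let ?y = "foldr (\<lambda>(i, p). edge p i) zs x"
  have "w \<in> Poly_Mapping.keys (lext (\<lambda>v. \<Sum>j | j < length v \<and> v ! j = i. sg (v[j := p])) ?y)"
    using Cons.prems(2) by (simp add: z edge_def)
  then obtain v where v: "v \<in> Poly_Mapping.keys ?y"
      "w \<in> Poly_Mapping.keys (\<Sum>j | j < length v \<and> v ! j = i. sg (v[j := p]) :: nat list \<Rightarrow>\<^sub>0 'k)"
    by (rule UN_E[OF subsetD[OF keys_lext]])
  obtain j where j: "j \<in> {j. j < length v \<and> v ! j = i}" "w \<in> Poly_Mapping.keys (sg (v[j := p]) :: nat list \<Rightarrow>\<^sub>0 'k)"
    by (rule UN_E[OF subsetD[OF keys_sum v(2)]])
  have w: "w = v[j := p]" using j(2) by (simp split: if_splits)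
  have upd: "length (filter P (us[j := p])) \<le> Suc (length (filter P us))" for P and us :: "nat list"
    by (induction us arbitrary: j) (auto split: nat.split)
  have "length (filter (\<lambda>l. n \<le> l) v) \<le> length zs" using Cons v(1) by simp
  then show ?case using upd[of "\<lambda>l. n \<le> l" v] by (simp add: w)
qed

lemma tame_grad: "grad n f g \<Longrightarrow> tame n (d - 1) f"
proof (induction rule: grad.induct)
  case (grad_io b)
  have "low n (Ds zs (io b))" if zs: "set zs \<subseteq> moves n" for zs
  proof -
    obtain b' where "b' \<in> carrier B" "Ds zs (io b) = io b'" by (rule bexE[OF Ds_rules(3)[OF zs grad_io(1)]])
    then show ?thesis using low_io by simp
  qed
  then show ?case using grad_io(1) by (simp add: tame_def iota_simps)
next
  case (grad_e x)
  have "low n (Ds zs (e x))" if zs: "set zs \<subseteq> moves n" "length zs \<le> d - 1" for zs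
  proof -
    let ?y = "foldr (\<lambda>(i, p). edge p i) zs x"
    have y: "?y \<in> VV lam" "Ds zs (e x) = e ?y" using Ds_rules(4)[OF zs(1) grad_e(1)] by auto
    have "\<exists>l\<in>set w. l < n" if w: "w \<in> Poly_Mapping.keys ?y" for w
    proof (rule ccontr)
      assume "\<not> (\<exists>l\<in>set w. l < n)"
      then have "filter (\<lambda>l. n \<le> l) w = w" by (auto simp: filter_id_conv not_less)
      moreover have "length w = d" using VV_tens[OF y(1)] w by (auto simp: tens_def)
      moreover have "d > 0" using lam by (cases lam) (auto simp: partition_def)
      ultimately show False using heavy_letters[OF zs(1) grad_e(2) w] zs(2) by simp
    qed
    then have "?y \<in> mixed n lam" using y(1) by (simp add: mixed_def)
    then show ?thesis unfolding y(2) by (rule low_e)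
  qed
  then show ?case using grad_e(1) by (simp add: tame_def e_simps)
qed (auto intro: tame_add tame_mult)

end

section \<open>Solving for the coordinates of the affine space\<close>

context glv
begin

definition cg where
  "cg n a b \<longleftrightarrow> a \<in> carrier R \<and> b \<in> carrier R \<and> low n (a \<ominus>\<^bsub>R\<^esub> b)"

lemma cg_refl: "a \<in> carrier R \<Longrightarrow> cg n a a"
  by (simp add: cg_def P.T.M.minus_eq P.T.M.r_neg low_zero)

lemma cg_trans: "cg n a b \<Longrightarrow> cg n b c \<Longrightarrow> cg n a c"
proof -
  assume ab: "cg n a b" and bc: "cg n b c"
  then have c: "a \<in> carrier R" "b \<in> carrier R" "c \<in> carrier R" by (auto simp: cg_def)
  have "(a \<ominus>\<^bsub>R\<^esub> b) \<oplus>\<^bsub>R\<^esub> (b \<ominus>\<^bsub>R\<^esub> c) = a \<ominus>\<^bsub>R\<^esub> c"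
    using c by (simp add: P.T.M.minus_eq P.T.M.a_assoc P.T.M.r_neg1)
  then show ?thesis using ab bc low_add[of n "a \<ominus>\<^bsub>R\<^esub> b" "b \<ominus>\<^bsub>R\<^esub> c"] by (simp add: cg_def)
qed

lemma cg_add: "cg n a b \<Longrightarrow> cg n a' b' \<Longrightarrow> cg n (a \<oplus>\<^bsub>R\<^esub> a') (b \<oplus>\<^bsub>R\<^esub> b')"
proof -
  assume ab: "cg n a b" "cg n a' b'"
  then have c: "a \<in> carrier R" "b \<in> carrier R" "a' \<in> carrier R" "b' \<in> carrier R" by (auto simp: cg_def)
  have "(a \<ominus>\<^bsub>R\<^esub> b) \<oplus>\<^bsub>R\<^esub> (a' \<ominus>\<^bsub>R\<^esub> b') = (a \<oplus>\<^bsub>R\<^esub> a') \<ominus>\<^bsub>R\<^esub> (b \<oplus>\<^bsub>R\<^esub> b')"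
    using c by (simp add: P.T.M.minus_eq P.T.M.minus_add P.T.M.a_ac)
  then show ?thesis using ab low_add[of n "a \<ominus>\<^bsub>R\<^esub> b" "a' \<ominus>\<^bsub>R\<^esub> b'"] by (simp add: cg_def)
qed

lemma cg_mult: "low n f \<Longrightarrow> cg n a b \<Longrightarrow> cg n (f \<otimes>\<^bsub>R\<^esub> a) (f \<otimes>\<^bsub>R\<^esub> b)"
proof -
  assume f: "low n f" and ab: "cg n a b"
  have c: "f \<in> carrier R" "a \<in> carrier R" "b \<in> carrier R" using low_closed[OF f] ab by (auto simp: cg_def)
  have "f \<otimes>\<^bsub>R\<^esub> (a \<ominus>\<^bsub>R\<^esub> b) = f \<otimes>\<^bsub>R\<^esub> a \<ominus>\<^bsub>R\<^esub> f \<otimes>\<^bsub>R\<^esub> b"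
    using c by (simp add: P.T.M.minus_eq P.T.A.r_distr P.T.A.r_minus)
  then show ?thesis using c low_mult[OF f, of "a \<ominus>\<^bsub>R\<^esub> b"] ab by (simp add: cg_def)
qed

lemma cg_smult: "cg n a b \<Longrightarrow> cg n (c \<odot>\<^bsub>R\<^esub> a) (c \<odot>\<^bsub>R\<^esub> b)"
proof -
  assume ab: "cg n a b"
  have "low n (c \<odot>\<^bsub>R\<^esub> \<one>\<^bsub>R\<^esub>)" by (rule low_smult[OF low_one])
  from cg_mult[OF this ab] show ?thesis using ab by (simp add: cg_def P.T.smult_mult)
qed

lemma cg_sum:
  "finite A \<Longrightarrow> (\<And>s. s \<in> A \<Longrightarrow> cg n (F s) (G s)) \<Longrightarrow> cg n (\<Oplus>\<^bsub>R\<^esub>s\<in>A. F s) (\<Oplus>\<^bsub>R\<^esub>s\<in>A. G s)"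
proof (induction A rule: finite_induct)
  case (insert s A)
  have c: "F t \<in> carrier R" "G t \<in> carrier R" if "t \<in> insert s A" for t using insert.prems[OF that] by (auto simp: cg_def)
  have "cg n (\<Oplus>\<^bsub>R\<^esub>s\<in>A. F s) (\<Oplus>\<^bsub>R\<^esub>s\<in>A. G s)" by (rule insert.IH) (rule insert.prems, simp)
  from cg_add[OF insert.prems[of s] this] show ?case
    using insert.hyps c by (simp add: P.T.M.finsum_insert Pi_def)
qed (simp add: cg_refl)

lemma ideal_sum:
  "finite A \<Longrightarrow> (\<And>s. s \<in> A \<Longrightarrow> F s \<in> J) \<Longrightarrow> (\<Oplus>\<^bsub>R\<^esub>s\<in>A. F s) \<in> J"
proof (induction A rule: finite_induct)
  case empty
  then show ?case using RJ.I.zero_closed by simp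
next
  case (insert s A)
  have c: "F t \<in> carrier R" if "t \<in> insert s A" for t using RJ.I.Icarr[OF insert.prems[OF that]] .
  have "(\<Oplus>\<^bsub>R\<^esub>s\<in>A. F s) \<in> J" by (rule insert.IH) (rule insert.prems, simp)
  from RJ.I.a_closed[OF insert.prems[of s] this] show ?case
    using insert.hyps c by (simp add: P.T.M.finsum_insert Pi_def)
qed

definition zs where
  "zs n u s = zip u (permute_list (papp s) [n..<n + d])"

lemma zs_moves:
  assumes "length u = d" "set u \<subseteq> {..<n}" "s \<in> Poly_Mapping.keys (young lam :: 'k galg)"
  shows "set (zs n u s) \<subseteq> moves n" "length (zs n u s) = Suc (d - 1)"
proof -
  have "papp s permutes {..<length [n..<n + d]}" using assms(3) keys_young[of lam] by (auto simp: SS_def)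
  then have "set (permute_list (papp s) [n..<n + d]) = {n..<n + d}" by (simp add: set_permute_list)
  then show "set (zs n u s) \<subseteq> moves n"
    using assms(2) unfolding zs_def moves_def by (auto dest: set_zip_leftD set_zip_rightD)
  have "d > 0" using lam by (cases lam) (auto simp: partition_def)
  then show "length (zs n u s) = Suc (d - 1)" using assms(1) by (simp add: zs_def)
qed

text \<open>
  The Young symmetrizer combination of the composites of derivations that replace the letters of the word \<open>u\<close> by
  \<open>n, \<dots>, n + d - 1\<close>, in all orders.
\<close>

definition Theta where
  "Theta n u f = (\<Oplus>\<^bsub>R\<^esub>s\<in>Poly_Mapping.keys (young lam :: 'k galg).
     Poly_Mapping.lookup (young lam) s \<odot>\<^bsub>R\<^esub> Ds (zs n u s) f)"

abbreviation "top_vec n \<equiv> ract (sg [n..<n + d]) (young lam) :: nat list \<Rightarrow>\<^sub>0 'k"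

lemma top_vec_VV: "top_vec n \<in> VV lam"
  by (intro VV_closed) (simp add: tens_def)

text \<open>
  Modulo \<open>low n\<close>, all derivatives of a function of the first coordinates that reach a new coordinate reach the same one
  \<open>e (top_vec n)\<close>, with the partial derivative in the direction of \<open>u\<close> as coefficient.
\<close>

lemma Theta_grad:
  assumes u: "length u = d" "set u \<subseteq> {..<n}" and g: "grad n f g"
  shows "cg n (Theta n u f) (hook lam \<odot>\<^bsub>R\<^esub> (g u \<otimes>\<^bsub>R\<^esub> e (top_vec n)))"
  using g
proof (induction rule: grad.induct)
  note m = zs_moves[OF u]
  note fin = finite_keys[of "young lam :: 'k galg"]
  note Ec = e_simps(1)[OF top_vec_VV, of n]
  {
    case (grad_io b)
    have t: "cg n (Poly_Mapping.lookup (young lam) s \<odot>\<^bsub>R\<^esub> Ds (zs n u s) (io b)) \<zero>\<^bsub>R\<^esub>"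
      if s: "s \<in> Poly_Mapping.keys (young lam :: 'k galg)" for s
    proof -
      obtain b' where "b' \<in> carrier B" "Ds (zs n u s) (io b) = io b'"
        by (rule bexE[OF Ds_rules(3)[OF m(1)[OF s] grad_io(1)]])
      then show ?thesis using low_smult[OF low_io[of b' n], of "Poly_Mapping.lookup (young lam) s"]
        by (simp add: cg_def iota_simps P.T.M.minus_eq)
    qed
    have "cg n (Theta n u (io b)) (\<Oplus>\<^bsub>R\<^esub>s\<in>Poly_Mapping.keys (young lam :: 'k galg). \<zero>\<^bsub>R\<^esub>)"
      unfolding Theta_def by (rule cg_sum[OF fin t])
    then show ?case using Ec by simp
  next
    case (grad_e x)
    let ?y = "\<lambda>s. foldr (\<lambda>(i, p). edge p i) (zs n u s) x"
    have y: "?y s \<in> VV lam" "Ds (zs n u s) (e x) = e (?y s)" if "s \<in> Poly_Mapping.keys (young lam :: 'k galg)" for s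
      using Ds_rules(4)[OF m(1)[OF that] grad_e(1)] by auto
    have "Theta n u (e x) = (\<Oplus>\<^bsub>R\<^esub>s\<in>Poly_Mapping.keys (young lam :: 'k galg). e (scale (Poly_Mapping.lookup (young lam) s) (?y s)))"
      unfolding Theta_def by (rule P.T.M.finsum_cong') (auto simp: y e_simps)
    also have "\<dots> = e (\<Sum>s\<in>Poly_Mapping.keys (young lam :: 'k galg). scale (Poly_Mapping.lookup (young lam) s) (?y s))"
      by (rule e_sum[symmetric, OF fin]) (intro VV_closed y)
    also have "(\<Sum>s\<in>Poly_Mapping.keys (young lam :: 'k galg). scale (Poly_Mapping.lookup (young lam) s) (?y s)) =
        probe lam u [n..<n + d] x"
      by (simp add: probe_def lext_def edges_def zs_def)
    also have "\<dots> = scale (hook lam * Poly_Mapping.lookup x u) (top_vec n)"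
      by (rule probe_coefficient[OF lam(1) grad_e(1) _ u(1)]) (use u(2) grad_e(2) in \<open>auto simp: light_def\<close>)
    finally have "Theta n u (e x) = hook lam \<odot>\<^bsub>R\<^esub> ((Poly_Mapping.lookup x u \<odot>\<^bsub>R\<^esub> \<one>\<^bsub>R\<^esub>) \<otimes>\<^bsub>R\<^esub> e (top_vec n))"
      using Ec top_vec_VV by (simp add: e_simps P.T.smult_mult P.T.smult_simps)
    then show ?case using Ec by (simp add: cg_refl)
  next
    case (grad_add f g f' g')
    have c: "f \<in> carrier R" "f' \<in> carrier R" "g u \<in> carrier R" "g' u \<in> carrier R"
      using grad_closed[OF grad_add(1)] grad_closed[OF grad_add(2)] by auto
    have "Theta n u (f \<oplus>\<^bsub>R\<^esub> f') = (\<Oplus>\<^bsub>R\<^esub>s\<in>Poly_Mapping.keys (young lam :: 'k galg).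
        Poly_Mapping.lookup (young lam) s \<odot>\<^bsub>R\<^esub> Ds (zs n u s) f \<oplus>\<^bsub>R\<^esub> Poly_Mapping.lookup (young lam) s \<odot>\<^bsub>R\<^esub> Ds (zs n u s) f')"
      unfolding Theta_def
      by (rule P.T.M.finsum_cong') (auto simp: Ds_rules(1,2)[OF m(1)] c P.T.smult_add_right)
    also have "\<dots> = Theta n u f \<oplus>\<^bsub>R\<^esub> Theta n u f'"
      unfolding Theta_def by (rule P.T.M.finsum_addf) (auto simp: Ds_rules(1)[OF m(1)] c)
    finally have T: "Theta n u (f \<oplus>\<^bsub>R\<^esub> f') = Theta n u f \<oplus>\<^bsub>R\<^esub> Theta n u f'" .
    have "hook lam \<odot>\<^bsub>R\<^esub> ((g u \<oplus>\<^bsub>R\<^esub> g' u) \<otimes>\<^bsub>R\<^esub> e (top_vec n)) =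
        hook lam \<odot>\<^bsub>R\<^esub> (g u \<otimes>\<^bsub>R\<^esub> e (top_vec n)) \<oplus>\<^bsub>R\<^esub> hook lam \<odot>\<^bsub>R\<^esub> (g' u \<otimes>\<^bsub>R\<^esub> e (top_vec n))"
      using c Ec by (simp add: P.T.A.l_distr P.T.smult_add_right)
    then show ?case unfolding T using cg_add[OF grad_add.IH] by simp
  next
    case (grad_mult f g f' g')
    have c: "f \<in> carrier R" "f' \<in> carrier R" "g u \<in> carrier R" "g' u \<in> carrier R"
      using grad_closed[OF grad_mult(1)] grad_closed[OF grad_mult(2)] by auto
    note t = tame_grad[OF grad_mult(1)] tame_grad[OF grad_mult(2)]
    let ?c = "\<lambda>s. Poly_Mapping.lookup (young lam :: 'k galg) s" and ?K = "Poly_Mapping.keys (young lam :: 'k galg)"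
    have Tc: "Theta n u f \<in> carrier R" "Theta n u f' \<in> carrier R"
      using grad_mult.IH by (auto simp: cg_def)
    have L: "cg n (?c s \<odot>\<^bsub>R\<^esub> Ds (zs n u s) (f \<otimes>\<^bsub>R\<^esub> f'))
        (f \<otimes>\<^bsub>R\<^esub> (?c s \<odot>\<^bsub>R\<^esub> Ds (zs n u s) f') \<oplus>\<^bsub>R\<^esub> f' \<otimes>\<^bsub>R\<^esub> (?c s \<odot>\<^bsub>R\<^esub> Ds (zs n u s) f))" if s: "s \<in> ?K" for s
    proof -
      note dc = Ds_rules(1)[OF m(1)[OF s]]
      have "cg n (Ds (zs n u s) (f \<otimes>\<^bsub>R\<^esub> f')) (f \<otimes>\<^bsub>R\<^esub> Ds (zs n u s) f' \<oplus>\<^bsub>R\<^esub> f' \<otimes>\<^bsub>R\<^esub> Ds (zs n u s) f)"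
        unfolding cg_def using leibniz[OF t m[OF s]] dc c by simp
      from cg_smult[OF this, of "?c s"] show ?thesis
        using dc c by (simp add: P.T.smult_add_right P.T.smult_mult)
    qed
    have "cg n (Theta n u (f \<otimes>\<^bsub>R\<^esub> f'))
        (\<Oplus>\<^bsub>R\<^esub>s\<in>?K. f \<otimes>\<^bsub>R\<^esub> (?c s \<odot>\<^bsub>R\<^esub> Ds (zs n u s) f') \<oplus>\<^bsub>R\<^esub> f' \<otimes>\<^bsub>R\<^esub> (?c s \<odot>\<^bsub>R\<^esub> Ds (zs n u s) f))"
      unfolding Theta_def by (rule cg_sum[OF fin L])
    also have "(\<Oplus>\<^bsub>R\<^esub>s\<in>?K. f \<otimes>\<^bsub>R\<^esub> (?c s \<odot>\<^bsub>R\<^esub> Ds (zs n u s) f') \<oplus>\<^bsub>R\<^esub> f' \<otimes>\<^bsub>R\<^esub> (?c s \<odot>\<^bsub>R\<^esub> Ds (zs n u s) f)) =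
        (\<Oplus>\<^bsub>R\<^esub>s\<in>?K. f \<otimes>\<^bsub>R\<^esub> (?c s \<odot>\<^bsub>R\<^esub> Ds (zs n u s) f')) \<oplus>\<^bsub>R\<^esub> (\<Oplus>\<^bsub>R\<^esub>s\<in>?K. f' \<otimes>\<^bsub>R\<^esub> (?c s \<odot>\<^bsub>R\<^esub> Ds (zs n u s) f))"
      by (rule P.T.M.finsum_addf) (auto simp: Ds_rules(1)[OF m(1)] c)
    also have "\<dots> = f \<otimes>\<^bsub>R\<^esub> Theta n u f' \<oplus>\<^bsub>R\<^esub> f' \<otimes>\<^bsub>R\<^esub> Theta n u f"
      unfolding Theta_def using fin c by (subst (1 2) P.T.A.finsum_rdistr) (auto simp: Ds_rules(1)[OF m(1)])
    finally have 1: "cg n (Theta n u (f \<otimes>\<^bsub>R\<^esub> f')) (f \<otimes>\<^bsub>R\<^esub> Theta n u f' \<oplus>\<^bsub>R\<^esub> f' \<otimes>\<^bsub>R\<^esub> Theta n u f)" .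
    have 2: "cg n (f \<otimes>\<^bsub>R\<^esub> Theta n u f' \<oplus>\<^bsub>R\<^esub> f' \<otimes>\<^bsub>R\<^esub> Theta n u f)
        (f \<otimes>\<^bsub>R\<^esub> (hook lam \<odot>\<^bsub>R\<^esub> (g' u \<otimes>\<^bsub>R\<^esub> e (top_vec n))) \<oplus>\<^bsub>R\<^esub> f' \<otimes>\<^bsub>R\<^esub> (hook lam \<odot>\<^bsub>R\<^esub> (g u \<otimes>\<^bsub>R\<^esub> e (top_vec n))))"
      by (rule cg_add[OF cg_mult[OF tame_low[OF t(1)] grad_mult.IH(2)] cg_mult[OF tame_low[OF t(2)] grad_mult.IH(1)]])
    have 3: "f \<otimes>\<^bsub>R\<^esub> (hook lam \<odot>\<^bsub>R\<^esub> (g' u \<otimes>\<^bsub>R\<^esub> e (top_vec n))) \<oplus>\<^bsub>R\<^esub> f' \<otimes>\<^bsub>R\<^esub> (hook lam \<odot>\<^bsub>R\<^esub> (g u \<otimes>\<^bsub>R\<^esub> e (top_vec n))) =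
        hook lam \<odot>\<^bsub>R\<^esub> ((f \<otimes>\<^bsub>R\<^esub> g' u \<oplus>\<^bsub>R\<^esub> f' \<otimes>\<^bsub>R\<^esub> g u) \<otimes>\<^bsub>R\<^esub> e (top_vec n))"
      using c Ec by (simp add: P.T.A.l_distr P.T.smult_add_right P.T.smult_mult P.T.A.m_assoc)
    show ?case using cg_trans[OF 1 2] unfolding 3 .
  }
qed

text \<open>The functions on \<open>Y \<times> A\<^sup>\<lambda>\<close> whose restriction to \<open>X\<close> comes from \<open>low n\<close>.\<close>

definition solved where
  "solved n f \<longleftrightarrow> (\<exists>j\<in>J. \<exists>r. low n r \<and> f = j \<oplus>\<^bsub>R\<^esub> r)"

lemma solved_closed: "solved n f \<Longrightarrow> f \<in> carrier R"
  unfolding solved_def using RJ.I.Icarr low_closed by auto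

lemma solved_J: "f \<in> J \<Longrightarrow> solved n f"
  unfolding solved_def using RJ.I.Icarr low_zero by (intro bexI[of _ f] exI[of _ "\<zero>\<^bsub>R\<^esub>"]) auto

lemma solved_low: "low n f \<Longrightarrow> solved n f"
  unfolding solved_def using RJ.I.zero_closed low_closed by (intro bexI[of _ "\<zero>\<^bsub>R\<^esub>"] exI[of _ f]) auto

lemma solved_add:
  assumes "solved n f" "solved n f'"
  shows "solved n (f \<oplus>\<^bsub>R\<^esub> f')"
proof -
  obtain j r j' r' where *: "j \<in> J" "low n r" "f = j \<oplus>\<^bsub>R\<^esub> r" "j' \<in> J" "low n r'" "f' = j' \<oplus>\<^bsub>R\<^esub> r'"
    using assms unfolding solved_def by blast
  have c: "j \<in> carrier R" "r \<in> carrier R" "j' \<in> carrier R" "r' \<in> carrier R" using * RJ.I.Icarr low_closed by auto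
  have "f \<oplus>\<^bsub>R\<^esub> f' = (j \<oplus>\<^bsub>R\<^esub> j') \<oplus>\<^bsub>R\<^esub> (r \<oplus>\<^bsub>R\<^esub> r')" unfolding * using c by (simp add: P.T.M.a_ac)
  then show ?thesis unfolding solved_def using RJ.I.a_closed[OF *(1,4)] low_add[OF *(2,5)] by blast
qed

lemma solved_mult:
  assumes "solved n f" "solved n f'"
  shows "solved n (f \<otimes>\<^bsub>R\<^esub> f')"
proof -
  obtain j r j' r' where *: "j \<in> J" "low n r" "f = j \<oplus>\<^bsub>R\<^esub> r" "j' \<in> J" "low n r'" "f' = j' \<oplus>\<^bsub>R\<^esub> r'"
    using assms unfolding solved_def by blast
  have c: "j \<in> carrier R" "r \<in> carrier R" "j' \<in> carrier R" "r' \<in> carrier R" using * RJ.I.Icarr low_closed by auto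
  have "f \<otimes>\<^bsub>R\<^esub> f' = (j \<otimes>\<^bsub>R\<^esub> (j' \<oplus>\<^bsub>R\<^esub> r') \<oplus>\<^bsub>R\<^esub> r \<otimes>\<^bsub>R\<^esub> j') \<oplus>\<^bsub>R\<^esub> r \<otimes>\<^bsub>R\<^esub> r'"
    unfolding * using c by (simp add: P.T.A.l_distr P.T.A.r_distr P.T.M.a_ac)
  moreover have "j \<otimes>\<^bsub>R\<^esub> (j' \<oplus>\<^bsub>R\<^esub> r') \<oplus>\<^bsub>R\<^esub> r \<otimes>\<^bsub>R\<^esub> j' \<in> J"
    using c by (intro RJ.I.a_closed RJ.I.I_r_closed[OF *(1)] RJ.I.I_l_closed[OF *(4)]) auto
  ultimately show ?thesis unfolding solved_def using low_mult[OF *(2,5)] by blast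
qed

lemma solved_smult: "solved n f \<Longrightarrow> solved n (c \<odot>\<^bsub>R\<^esub> f)"
  using solved_mult[OF solved_low[OF low_smult[OF low_one]], of n f c] solved_closed[of n f] by (simp add: P.T.smult_mult)

lemma solved_top_vec:
  assumes u: "length u = d" "set u \<subseteq> {..<n}" and g: "grad n f g" and f: "f \<in> J"
  shows "solved n (g u \<otimes>\<^bsub>R\<^esub> e (top_vec n))"
proof -
  let ?T = "Theta n u f" and ?z = "g u \<otimes>\<^bsub>R\<^esub> e (top_vec n)"
  have gc: "g u \<in> carrier R" using grad_closed[OF g] by blast
  then have z: "?z \<in> carrier R" using e_simps(1)[OF top_vec_VV] by simp
  have TJ: "?T \<in> J"
    unfolding Theta_def
    by (rule ideal_sum[OF finite_keys P.T.subspaceD(4)[OF P.T.ideal_subspace[OF ideal_J] Ds_rules(5)[OF zs_moves(1)[OF u] f]]])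
  note Tc = RJ.I.Icarr[OF TJ]
  have "low n (?T \<ominus>\<^bsub>R\<^esub> hook lam \<odot>\<^bsub>R\<^esub> ?z)" using Theta_grad[OF u g] by (simp add: cg_def)
  then have "solved n (?T \<oplus>\<^bsub>R\<^esub> (- 1) \<odot>\<^bsub>R\<^esub> (?T \<ominus>\<^bsub>R\<^esub> hook lam \<odot>\<^bsub>R\<^esub> ?z))"
    by (intro solved_add solved_smult solved_J[OF TJ] solved_low)
  moreover have "?T \<oplus>\<^bsub>R\<^esub> (- 1) \<odot>\<^bsub>R\<^esub> (?T \<ominus>\<^bsub>R\<^esub> hook lam \<odot>\<^bsub>R\<^esub> ?z) = hook lam \<odot>\<^bsub>R\<^esub> ?z"
    using Tc z by (simp add: P.T.smult_simps P.T.M.minus_eq P.T.M.minus_add P.T.M.r_neg1 P.T.M.r_neg2)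
  ultimately have "solved n (hook lam \<odot>\<^bsub>R\<^esub> ?z)" by simp
  from solved_smult[OF this, of "1 / hook lam"] show ?thesis
    using P.T.smult_cancel[OF z young_sq(2)[OF lam(1)]] by simp
qed

lemma grad_support:
  assumes "grad n f g" "w \<notin> W n"
  shows "g w = \<zero>\<^bsub>R\<^esub>"
  using assms(1)
proof (induction rule: grad.induct)
  case (grad_e x)
  have "w \<notin> Poly_Mapping.keys x"
    using assms(2) VV_tens[OF grad_e(1)] grad_e(2) by (auto simp: W_def tens_def light_def)
  then show ?case by (simp add: in_keys_iff P.T.smult_simps)
next
  case (grad_mult f g f' g')
  then show ?case using grad_closed by simp
qed simp_all

end

text \<open>The words with distinct letters are permuted freely, so that the coefficient of the identity can be read off.\<close>

lemma young_word_nonzero: "ract (sg [0..<sum_list lam]) (young lam) \<noteq> (0 :: nat list \<Rightarrow>\<^sub>0 'k::field_char_0)"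
proof -
  let ?d = "sum_list lam" and ?y = "young lam :: 'k galg"
  let ?w = "[0..<sum_list lam]"
  have fix_word: "permute_list (papp s) ?w = ?w \<longleftrightarrow> s = 0" if "s \<in> Poly_Mapping.keys ?y" for s
  proof
    have p: "papp s permutes {..<?d}" using that keys_young[of lam, where 'k='k] by (auto simp: SS_def)
    assume eq: "permute_list (papp s) ?w = ?w"
    have "papp s i = i" for i
    proof (cases "i < ?d")
      case True
      then have "papp s i < ?d" using permutes_in_image[OF p, of i] by simp
      then show ?thesis using arg_cong[OF eq, of "\<lambda>v. v ! i"] True p by (simp add: permute_list_nth)
    qed (use p in \<open>simp add: permutes_def\<close>)
    then have "papp s = papp 0" by (simp add: fun_eq_iff)
    then show "s = 0" using papp_inject[of s 0] by blast
  qed simp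
  have "Poly_Mapping.lookup (ract (sg ?w) ?y) ?w =
      (\<Sum>s\<in>Poly_Mapping.keys ?y. Poly_Mapping.lookup ?y s * (1 when permute_list (papp s) ?w = ?w))"
    by (simp add: ract_def lext_def lookup_sum lookup_scale push_single lookup_single)
  also have "\<dots> = (\<Sum>s\<in>Poly_Mapping.keys ?y. if s = 0 then Poly_Mapping.lookup ?y s else 0)"
    by (rule sum.cong) (auto simp: fix_word when_def)
  also have "\<dots> = tau ?y" by (simp add: tau_def in_keys_iff)
  also have "\<dots> = 1" by (rule tau_young)
  finally show ?thesis by auto
qed

section \<open>The projection from the shifted product\<close>

lemma Sh_algebra: "algebra KK (Sh n A) \<longleftrightarrow> algebra KK A"
  and Sh_module: "module KK (Sh n A) \<longleftrightarrow> module KK A"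
  unfolding algebra_def algebra_axioms_def module_def module_axioms_def cring_def ring_def ring_axioms_def
    comm_monoid_def monoid_def comm_monoid_axioms_def abelian_group_def abelian_monoid_def abelian_group_axioms_def Sh_simps
  by (rule refl)+

lemma kalg_Sh: "kalg A \<Longrightarrow> kalg (Sh n A)" and kmod_Sh: "kmod M \<Longrightarrow> kmod (Sh n M)"
  by (simp_all add: kalg_def kmod_def Sh_algebra Sh_module)

lemma alg_hom_Sh: "alg_hom A (Sh n A') = alg_hom A A'" "alg_hom (Sh n A) A' = alg_hom A A'"
  by (auto simp: alg_hom_def ring_hom_def)

lemma eta_Sh: "eta (Sh n M) = eta M"
proof -
  have 1: "free_sym (Sh n M) = Sh n (free_sym M)"
    by (simp add: free_sym_def Sh_def fun_eq_iff)
  have 2: "sym_ideal (Sh n M) = sym_ideal M"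
    unfolding sym_ideal_def genideal_def 1 sym_rels_def
    by (simp add: ideal_cong[of "Sh n (free_sym M)" "free_sym M"])
  show ?thesis unfolding eta_def 1 2 by (simp add: fun_eq_iff a_r_coset_def r_coset_def)
qed

lemma tns_Sh: "tns (Sh n A) (Sh n C) = tns A C"
proof -
  have 1: "free_pairs (Sh n A) (Sh n C) = Sh n (free_pairs A C)"
    by (simp add: free_pairs_def Sh_def fun_eq_iff)
  have 2: "tensor_ideal (Sh n A) (Sh n C) = tensor_ideal A C"
    unfolding tensor_ideal_def genideal_def 1 bilinear_rels_def
    by (simp add: ideal_cong[of "Sh n (free_pairs A C)" "free_pairs A C"])
  show ?thesis unfolding tns_def 1 2 by (simp add: fun_eq_iff a_r_coset_def r_coset_def)
qed

lemma kmod_V_tuple: "kmod (V_tuple mu :: ('k::field_char_0, _) gl_module)"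
proof (rule kmod.intro, rule moduleI[OF cring_KK])
  let ?V = "V_tuple mu :: ('k, _) gl_module"
  show "abelian_group ?V"
  proof (rule abelian_groupI)
    fix x assume "x \<in> carrier ?V"
    then show "\<exists>y\<in>carrier ?V. y \<oplus>\<^bsub>?V\<^esub> x = \<zero>\<^bsub>?V\<^esub>"
      by (intro bexI[of _ "\<lambda>i. scale (- 1) (x i)"])
        (auto simp: V_tuple_carrier scale_minus_left scale_1 scale_simps VV_closed intro: VV_closed(3)[where c = "- 1", simplified scale_minus_left scale_1])
  qed (auto simp: V_tuple_carrier add.assoc add.commute VV_closed)
qed (auto simp: V_tuple_carrier scale_simps VV_closed)

lemma pure_ract:
  assumes t: "t \<in> tens (sum_list lam)"
  shows "pure n (ract t (young lam)) = ract (push (map ((+) n)) t) (young lam)"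
  unfolding pure_def young_symmetrizer_ract[symmetric]
  by (rule push_young) (use t in \<open>simp add: tens_def\<close>)

locale glv_split = glv B lam J
  for B :: "('k::field_char_0, 'b) gl_module" and lam J +
  fixes n :: nat and mu :: "nat list list" and \<phi> :: "(nat \<Rightarrow> nat list \<Rightarrow>\<^sub>0 'k) \<Rightarrow> nat list \<Rightarrow>\<^sub>0 'k"
  assumes split: "shift_splitting n lam mu \<phi>"
    and mixed_image: "(\<lambda>y. \<phi> (case_nat 0 y)) ` carrier (V_tuple mu) = mixed n lam"
    and split_VV: "\<And>x :: nat list \<Rightarrow>\<^sub>0 'k. x \<in> VV lam \<Longrightarrow> \<exists>a\<in>VV lam. \<exists>b\<in>mixed n lam. x = pure n a + b"
begin

abbreviation "\<psi> y \<equiv> \<phi> (case_nat 0 y)"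

lemma extend_carrier: "y \<in> carrier (V_tuple mu) \<Longrightarrow> case_nat 0 y \<in> carrier (V_tuple (lam # mu))"
  unfolding V_tuple_carrier by (auto simp: VV_closed nth_Cons split: nat.splits)

lemma psi_rules:
  assumes y: "y \<in> carrier (V_tuple mu)"
  shows "\<psi> y \<in> mixed n lam" "y' \<in> carrier (V_tuple mu) \<Longrightarrow> \<psi> (\<lambda>i. y i + y' i) = \<psi> y + \<psi> y'"
    "\<psi> (\<lambda>i. scale c (y i)) = scale c (\<psi> y)"
    "g \<in> GL \<Longrightarrow> \<psi> (\<lambda>i. tensor_act g (y i)) = tensor_act (shift_mat n g) (\<psi> y)"
    "y' \<in> carrier (V_tuple mu) \<Longrightarrow> \<psi> y = \<psi> y' \<Longrightarrow> y = y'"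
proof -
  have iso: "\<phi> \<in> gl_hom (V_tuple (lam # mu)) (Sh n (V_part lam))" "inj_on \<phi> (carrier (V_tuple (lam # mu)))"
    using split by (auto simp: shift_splitting_def gl_iso_def bij_betw_def)
  note c = extend_carrier[OF y] extend_carrier
  show "\<psi> y \<in> mixed n lam" using mixed_image y by blast
  show "\<psi> (\<lambda>i. y i + y' i) = \<psi> y + \<psi> y'" if "y' \<in> carrier (V_tuple mu)"
  proof -
    have "case_nat 0 (\<lambda>i. y i + y' i) = (\<lambda>i. case_nat 0 y i + case_nat 0 y' i)" by (auto split: nat.splits)
    then show ?thesis using iso(1) c(1) c(2)[OF that] by (simp add: gl_hom_def)
  qed
  have "case_nat 0 (\<lambda>i. scale c (y i)) = (\<lambda>i. scale c (case_nat 0 y i))"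
    by (auto simp: scale_simps scale_sum split: nat.splits intro!: poly_mapping_eqI)
  then show "\<psi> (\<lambda>i. scale c (y i)) = scale c (\<psi> y)" using iso(1) c(1) by (simp add: gl_hom_def)
  show "\<psi> (\<lambda>i. tensor_act g (y i)) = tensor_act (shift_mat n g) (\<psi> y)" if g: "g \<in> GL"
  proof -
    have "case_nat 0 (\<lambda>i. tensor_act g (y i)) = (\<lambda>i. tensor_act g (case_nat 0 y i))"
      using linear_op_zero[OF linear_tensor_act[OF fincol_GL(1)[OF g]]] by (auto split: nat.splits)
    then show ?thesis using iso(1) c(1) g by (simp add: gl_hom_def)
  qed
  show "y = y'" if "y' \<in> carrier (V_tuple mu)" "\<psi> y = \<psi> y'"
  proof
    fix i
    have "case_nat 0 y = case_nat 0 y'" by (rule inj_onD[OF iso(2) that(2) c(1) c(2)[OF that(1)]])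
    from fun_cong[OF this, of "Suc i"] show "y i = y' i" by simp
  qed
qed

lemma V_tuple_act: "g \<in> GL \<Longrightarrow> y \<in> carrier (V_tuple mu) \<Longrightarrow> (\<lambda>i. tensor_act g (y i)) \<in> carrier (V_tuple mu)"
  using linear_op_zero[OF linear_tensor_act[OF fincol_GL(1)]] by (auto simp: V_tuple_carrier tensor_act_VV fincol_GL)

lemma mixed_stable:
  fixes x :: "nat list \<Rightarrow>\<^sub>0 'k"
  assumes g: "g \<in> GL" and x: "x \<in> mixed n lam"
  shows "tensor_act (shift_mat n g) x \<in> mixed n lam"
proof -
  obtain y where y: "y \<in> carrier (V_tuple mu)" "x = \<psi> y" using x mixed_image by blast
  show ?thesis using psi_rules(1)[OF V_tuple_act[OF g y(1)]] psi_rules(4)[OF y(1) g] y(2) by simp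
qed

lemma solved_act:
  assumes g: "g \<in> GL" and f: "solved n f"
  shows "solved n (act R (shift_mat n g) f)"
proof -
  note a = act_R[OF shift_mat_GL[OF g, of n]]
  note aD = alg_homD[OF a(1)]
  have low: "low n (act R (shift_mat n g) r)" if "low n r" for r
    using that
  proof (induction rule: low.induct)
    case (low_io b)
    then show ?case using a(2) low.low_io alg_homD(1)[OF act_B[OF shift_mat_GL[OF g]]] by simp
  next
    case (low_e x)
    then show ?case using a(3)[OF mixed_VV[OF low_e]] low.low_e[OF mixed_stable[OF g low_e]] by simp
  next
    case (low_add f f')
    then show ?case using aD(2) low_closed low.low_add by simp
  next
    case (low_mult f f')
    then show ?case using aD(3) low_closed low.low_mult by simp
  qed
  obtain j r where jr: "j \<in> J" "low n r" "f = j \<oplus>\<^bsub>R\<^esub> r" using f unfolding solved_def by blast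
  have "act R (shift_mat n g) f = act R (shift_mat n g) j \<oplus>\<^bsub>R\<^esub> act R (shift_mat n g) r"
    unfolding jr(3) by (rule aD(2)[OF RJ.I.Icarr[OF jr(1)] low_closed[OF jr(2)]])
  then show ?thesis unfolding solved_def using stable_J[OF shift_mat_GL[OF g] jr(1)] low[OF jr(2)] by blast
qed

lemma grad_fixed: "grad n f g \<Longrightarrow> a \<in> GL \<Longrightarrow> act R (shift_mat n a) f = f"
proof (induction rule: grad.induct)
  case (grad_io b)
  then show ?case using act_R(2)[OF shift_mat_GL[OF grad_io(3)]] by (simp add: fixed_def)
next
  case (grad_e x)
  then show ?case using act_R(3)[OF shift_mat_GL[OF grad_e(3)] grad_e(1), of n] tensor_act_light[OF grad_e(3,2)] by simp
next
  case (grad_add f g f' g')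
  then show ?case using alg_homD(2)[OF act_R(1)[OF shift_mat_GL[OF grad_add.prems]]] grad_closed by simp
next
  case (grad_mult f g f' g')
  then show ?case using alg_homD(3)[OF act_R(1)[OF shift_mat_GL[OF grad_mult.prems]]] grad_closed by simp
qed

text \<open>
  The vectors \<open>v\<close> whose coordinate can be solved for after inverting \<open>h\<close> form a subrepresentation of \<open>V\<^sub>\<lambda>\<close>, since \<open>h\<close> is
  invariant; it contains a nonzero vector and \<open>V\<^sub>\<lambda>\<close> is irreducible.
\<close>

lemma solved_pure:
  assumes u: "length u = d" "set u \<subseteq> {..<n}" and g: "grad n f g" and f: "f \<in> J" and v: "v \<in> VV lam"
  shows "solved n (g u \<otimes>\<^bsub>R\<^esub> e (pure n v))"
proof -
  define U where "U = {v \<in> VV lam. solved n (g u \<otimes>\<^bsub>R\<^esub> e (pure n v))}"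
  have hc: "g u \<in> carrier R" using grad_closed[OF g] by blast
  have pc: "e (pure n v) \<in> carrier R" if "v \<in> VV lam" for v by (rule e_simps(1)[OF pure_VV[OF that]])
  have padd: "pure n (x + y) = pure n x + pure n y" and psc: "pure n (scale c x) = scale c (pure n x)" for x y :: "nat list \<Rightarrow>\<^sub>0 'k" and c
    by (simp_all add: pure_def push_add push_scale)
  have "U = VV lam"
  proof (rule V_part_simple[OF lam(1), of U "ract (sg [0..<d]) (young lam)"])
    have "\<zero>\<^bsub>R\<^esub> = g u \<otimes>\<^bsub>R\<^esub> e (pure n 0)" using hc by (simp add: pure_def e_zero)
    then have "0 \<in> U" using solved_low[OF low_zero, of n] by (simp add: U_def VV_closed)
    moreover have "x + y \<in> U" if "x \<in> U" "y \<in> U" for x y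
      using that solved_add[of n "g u \<otimes>\<^bsub>R\<^esub> e (pure n x)" "g u \<otimes>\<^bsub>R\<^esub> e (pure n y)"] hc pc
      by (simp add: U_def VV_closed padd e_simps pure_VV P.T.A.r_distr)
    moreover have "scale c x \<in> U" if "x \<in> U" for c x
      using that solved_smult[of n "g u \<otimes>\<^bsub>R\<^esub> e (pure n x)" c] hc pc
      by (simp add: U_def VV_closed psc e_simps pure_VV P.T.smult_mult)
    ultimately show "M.subspace U" unfolding M.subspace_def by (auto simp: U_def)
    show "gl_stable (V_part lam) U"
      unfolding gl_stable_def
    proof (intro ballI)
      fix a :: "'k mat" and x assume a: "a \<in> GL" and x: "x \<in> U"
      have xV: "x \<in> VV lam" using x by (simp add: U_def)
      obtain g' where g': "grad n (g u) g'" using grad_repr[OF g] by blast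
      note act = act_R[OF shift_mat_GL[OF a, of n]]
      have "act R (shift_mat n a) (g u \<otimes>\<^bsub>R\<^esub> e (pure n x)) = g u \<otimes>\<^bsub>R\<^esub> e (pure n (tensor_act a x))"
        using alg_homD(3)[OF act(1) hc pc[OF xV]] grad_fixed[OF g' a] act(3)[OF pure_VV[OF xV]]
        by (simp add: pure_def tensor_act_shift_heavy[OF a])
      then have "solved n (g u \<otimes>\<^bsub>R\<^esub> e (pure n (tensor_act a x)))"
        using solved_act[OF a, of "g u \<otimes>\<^bsub>R\<^esub> e (pure n x)"] x by (simp add: U_def)
      then show "act (V_part lam) a x \<in> U"
        using tensor_act_VV[OF fincol_GL(1)[OF a] xV] by (simp add: U_def)
    qed
    have t: "(sg [0..<d] :: nat list \<Rightarrow>\<^sub>0 'k) \<in> tens d" by (simp add: tens_def)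
    have "map ((+) n) [0..<d] = [n..<n + d]" by (rule nth_equalityI) auto
    then have "pure n (ract (sg [0..<d]) (young lam)) = top_vec n" by (simp add: pure_ract[OF t] push_single)
    then show "ract (sg [0..<d]) (young lam) \<in> U"
      using solved_top_vec[OF u g f] VV_closed(4)[OF t] by (simp add: U_def)
    show "ract (sg [0..<d]) (young lam) \<noteq> (0 :: nat list \<Rightarrow>\<^sub>0 'k)" by (rule young_word_nonzero)
  qed
  then show ?thesis using v by (auto simp: U_def)
qed

text \<open>Hence every function becomes solvable after multiplication by a power of \<open>h\<close>.\<close>

lemma solved_power:
  assumes u: "length u = d" "set u \<subseteq> {..<n}" and g: "grad n f g" and f: "f \<in> J" and hl: "low n (g u)" and z: "z \<in> carrier R"
  shows "\<exists>N::nat. solved n (g u [^]\<^bsub>R\<^esub> N \<otimes>\<^bsub>R\<^esub> z)"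
  using z
proof (rule TS_induct)
  note h = low_closed[OF hl]
  have pw: "solved n (g u [^]\<^bsub>R\<^esub> (N::nat))" for N
    by (induction N) (auto intro: solved_low low_one solved_mult hl)
  have hc: "g u [^]\<^bsub>R\<^esub> (N::nat) \<in> carrier R" for N using h by simp
  {
    fix b assume "b \<in> carrier B"
    then show "\<exists>N::nat. solved n (g u [^]\<^bsub>R\<^esub> N \<otimes>\<^bsub>R\<^esub> io b)"
      using solved_low[OF low_io] by (intro exI[of _ 0]) (simp add: iota_simps)
  next
    fix x :: "nat list \<Rightarrow>\<^sub>0 'k" assume x: "x \<in> VV lam"
    from split_VV[OF x] obtain a where a: "a \<in> VV lam" "\<exists>b\<in>mixed n lam. x = pure n a + b" by (rule bexE)
    from a(2) obtain b where b: "b \<in> mixed n lam" "x = pure n a + b" by (rule bexE)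
    note ab = a(1) b
    have c: "e (pure n a) \<in> carrier R" "e b \<in> carrier R" using e_simps(1)[OF pure_VV[OF ab(1)]] e_simps(1)[OF mixed_VV[OF ab(2)]] by auto
    have "solved n (g u \<otimes>\<^bsub>R\<^esub> e (pure n a) \<oplus>\<^bsub>R\<^esub> g u \<otimes>\<^bsub>R\<^esub> e b)"
      by (intro solved_add solved_pure[OF u g f ab(1)] solved_mult solved_low[OF hl] solved_low[OF low_e[OF ab(2)]])
    then have "solved n (g u [^]\<^bsub>R\<^esub> (1::nat) \<otimes>\<^bsub>R\<^esub> e x)"
      using c h by (simp add: ab(3) e_simps pure_VV[OF ab(1)] mixed_VV[OF ab(2)] P.T.A.r_distr)
    then show "\<exists>N::nat. solved n (g u [^]\<^bsub>R\<^esub> N \<otimes>\<^bsub>R\<^esub> e x)" by (rule exI)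
  next
    fix x y assume c: "x \<in> carrier R" "y \<in> carrier R"
      and "\<exists>N::nat. solved n (g u [^]\<^bsub>R\<^esub> N \<otimes>\<^bsub>R\<^esub> x)" "\<exists>N::nat. solved n (g u [^]\<^bsub>R\<^esub> N \<otimes>\<^bsub>R\<^esub> y)"
    then obtain N N' :: nat where s: "solved n (g u [^]\<^bsub>R\<^esub> N \<otimes>\<^bsub>R\<^esub> x)" "solved n (g u [^]\<^bsub>R\<^esub> N' \<otimes>\<^bsub>R\<^esub> y)" by blast
    have "solved n (g u [^]\<^bsub>R\<^esub> N' \<otimes>\<^bsub>R\<^esub> (g u [^]\<^bsub>R\<^esub> N \<otimes>\<^bsub>R\<^esub> x) \<oplus>\<^bsub>R\<^esub> g u [^]\<^bsub>R\<^esub> N \<otimes>\<^bsub>R\<^esub> (g u [^]\<^bsub>R\<^esub> N' \<otimes>\<^bsub>R\<^esub> y))"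
      by (intro solved_add solved_mult pw s)
    moreover have "g u [^]\<^bsub>R\<^esub> N' \<otimes>\<^bsub>R\<^esub> (g u [^]\<^bsub>R\<^esub> N \<otimes>\<^bsub>R\<^esub> x) \<oplus>\<^bsub>R\<^esub> g u [^]\<^bsub>R\<^esub> N \<otimes>\<^bsub>R\<^esub> (g u [^]\<^bsub>R\<^esub> N' \<otimes>\<^bsub>R\<^esub> y) =
        g u [^]\<^bsub>R\<^esub> (N + N') \<otimes>\<^bsub>R\<^esub> (x \<oplus>\<^bsub>R\<^esub> y)"
      using c hc h by (simp add: P.T.A.nat_pow_mult[symmetric] P.T.A.r_distr P.T.A.l_distr P.T.A.m_ac)
    ultimately show "\<exists>N::nat. solved n (g u [^]\<^bsub>R\<^esub> N \<otimes>\<^bsub>R\<^esub> (x \<oplus>\<^bsub>R\<^esub> y))" by auto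
    have "solved n ((g u [^]\<^bsub>R\<^esub> N \<otimes>\<^bsub>R\<^esub> x) \<otimes>\<^bsub>R\<^esub> (g u [^]\<^bsub>R\<^esub> N' \<otimes>\<^bsub>R\<^esub> y))" by (rule solved_mult[OF s])
    moreover have "(g u [^]\<^bsub>R\<^esub> N \<otimes>\<^bsub>R\<^esub> x) \<otimes>\<^bsub>R\<^esub> (g u [^]\<^bsub>R\<^esub> N' \<otimes>\<^bsub>R\<^esub> y) = g u [^]\<^bsub>R\<^esub> (N + N') \<otimes>\<^bsub>R\<^esub> (x \<otimes>\<^bsub>R\<^esub> y)"
      using c hc h by (simp add: P.T.A.nat_pow_mult[symmetric] P.T.A.m_ac)
    ultimately show "\<exists>N::nat. solved n (g u [^]\<^bsub>R\<^esub> N \<otimes>\<^bsub>R\<^esub> (x \<otimes>\<^bsub>R\<^esub> y))" by auto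
  }
qed

sublocale K: kts "Sh n B" "V_tuple mu"
  by (intro kts.intro kalg_Sh B.kalg_axioms kmod_V_tuple)

abbreviation "\<pi> \<equiv> shift_proj n B lam \<phi>"

lemma proj_hom:
  shows "\<pi> \<in> alg_hom K.R R"
    "b \<in> carrier B \<Longrightarrow> \<pi> (iota (Sh n B) (V_tuple mu) b) = io b"
    "y \<in> carrier (V_tuple mu) \<Longrightarrow> \<pi> (et (Sh n B) (V_tuple mu) y) = e (\<psi> y)"
proof -
  let ?C = "Sym (Sh n (V_part lam)) :: ('k, _) gl_module"
  have lm: "lin_map (V_tuple mu) (Sh n (V_part lam)) \<psi>"
    unfolding lin_map_def by (auto simp: psi_rules(2,3) intro: mixed_VV[OF psi_rules(1)])
  note s = sym_map_hom[OF kmod_V_tuple kmod_Sh[OF kmod_V_part] lm]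
  have id: "(\<lambda>b. b) \<in> alg_hom (Sh n B) (Sh n B)" by (rule alg_homI) auto
  have p: "kpair (Sh n B) ?C"
    by (intro kpair.intro kalg_Sh B.kalg_axioms kalg_Sym kmod_Sh kmod_V_part)
  note t = tensor_map_hom[OF K.P.kpair_axioms p id s(1), folded shift_proj_def]
  show "\<pi> \<in> alg_hom K.R R" using t(1) by (simp only: Sh_Sym Sh_tensor alg_hom_Sh)
  show "\<pi> (iota (Sh n B) (V_tuple mu) b) = io b" if "b \<in> carrier B"
    using t(2)[of b "\<one>\<^bsub>Sym (V_tuple mu)\<^esub>"] that by (simp add: iota_def alg_homD(4)[OF s(1)]) (simp add: Sh_Sym tns_Sh)
  show "\<pi> (et (Sh n B) (V_tuple mu) y) = e (\<psi> y)" if "y \<in> carrier (V_tuple mu)"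
    using t(2)[of "\<one>\<^bsub>Sh n B\<^esub>" "eta (V_tuple mu) y"] that s(2)[OF that] eta_props(1)[OF kmod_V_tuple that]
    by (simp add: et_def) (simp add: Sh_Sym tns_Sh eta_Sh)
qed

lemma act_K:
  assumes g: "g \<in> GL"
  shows "act K.R g \<in> alg_hom K.R K.R"
    "b \<in> carrier B \<Longrightarrow> act K.R g (iota (Sh n B) (V_tuple mu) b) = iota (Sh n B) (V_tuple mu) (act B (shift_mat n g) b)"
    "y \<in> carrier (V_tuple mu) \<Longrightarrow> act K.R g (et (Sh n B) (V_tuple mu) y) = et (Sh n B) (V_tuple mu) (\<lambda>i. tensor_act g (y i))"
proof -
  have 1: "act (Sh n B) g \<in> alg_hom (Sh n B) (Sh n B)"
    using act_B[OF shift_mat_GL[OF g]] by (simp add: alg_hom_Sh)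
  have 2: "lin_map (V_tuple mu) (V_tuple mu) (act (V_tuple mu) g)"
    using V_tuple_act[OF g] linear_opD[OF linear_tensor_act[OF fincol_GL(1)[OF g]]] by (auto simp: lin_map_def)
  show "act K.R g \<in> alg_hom K.R K.R"
    "b \<in> carrier B \<Longrightarrow> act K.R g (iota (Sh n B) (V_tuple mu) b) = iota (Sh n B) (V_tuple mu) (act B (shift_mat n g) b)"
    "y \<in> carrier (V_tuple mu) \<Longrightarrow> act K.R g (et (Sh n B) (V_tuple mu) y) = et (Sh n B) (V_tuple mu) (\<lambda>i. tensor_act g (y i))"
    using K.TS_act[OF 1 2] by auto
qed

lemma low_lift: "low n f \<Longrightarrow> \<exists>r\<in>carrier K.R. \<pi> r = f"
proof (induction rule: low.induct)
  case (low_io b)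
  then show ?case using proj_hom(2) K.iota_simps(1) by force
next
  case (low_e x)
  then obtain y where y: "y \<in> carrier (V_tuple mu)" "x = \<psi> y" using mixed_image by blast
  then show ?case using proj_hom(3) K.et_simps(1) by force
next
  case (low_add f f')
  then obtain r r' where r: "r \<in> carrier K.R" "\<pi> r = f" "r' \<in> carrier K.R" "\<pi> r' = f'" by blast
  then show ?case using alg_homD(2)[OF proj_hom(1) r(1,3)] by (intro bexI[of _ "r \<oplus>\<^bsub>K.R\<^esub> r'"]) auto
next
  case (low_mult f f')
  then obtain r r' where r: "r \<in> carrier K.R" "\<pi> r = f" "r' \<in> carrier K.R" "\<pi> r' = f'" by blast
  then show ?case using alg_homD(3)[OF proj_hom(1) r(1,3)] by (intro bexI[of _ "r \<otimes>\<^bsub>K.R\<^esub> r'"]) auto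
qed

text \<open>A function of the first coordinates is the pullback of an invariant function, as \<open>\<phi>\<close> is injective and equivariant.\<close>

lemma grad_lift: "grad n f g \<Longrightarrow> \<exists>r\<in>carrier K.R. \<pi> r = f \<and> (\<forall>a\<in>GL. act K.R a r = r)"
proof (induction rule: grad.induct)
  case (grad_io b)
  then show ?case
    using proj_hom(2) K.iota_simps(1) act_K(2)
    by (intro bexI[of _ "iota (Sh n B) (V_tuple mu) b"]) (auto simp: fixed_def)
next
  case (grad_e x)
  have "\<exists>l\<in>set w. l < n" if w: "w \<in> Poly_Mapping.keys x" for w
  proof -
    have "length w = d" using VV_tens[OF grad_e(1)] w by (auto simp: tens_def)
    moreover have "d > 0" using lam by (cases lam) (auto simp: partition_def)
    ultimately have "0 < length w" by (simp only:)
    then have "hd w \<in> set w" by simp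
    then show ?thesis using grad_e(2) w by (auto simp: light_def)
  qed
  then have "x \<in> mixed n lam" using grad_e(1) by (simp add: mixed_def)
  then obtain y where y: "y \<in> carrier (V_tuple mu)" "x = \<psi> y" using mixed_image by blast
  have "(\<lambda>i. tensor_act a (y i)) = y" if a: "a \<in> GL" for a
  proof (rule psi_rules(5)[OF V_tuple_act[OF a y(1)] y(1)])
    show "\<psi> (\<lambda>i. tensor_act a (y i)) = \<psi> y"
      using psi_rules(4)[OF y(1) a] tensor_act_light[OF a grad_e(2)] y(2) by simp
  qed
  then show ?case using y proj_hom(3)[OF y(1)] K.et_simps(1)[OF y(1)] act_K(3)[OF _ y(1)]
    by (intro bexI[of _ "et (Sh n B) (V_tuple mu) y"]) auto
next
  case (grad_add f g f' g')
  then obtain r r' where r: "r \<in> carrier K.R" "\<pi> r = f" "\<forall>a\<in>GL. act K.R a r = r"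
    "r' \<in> carrier K.R" "\<pi> r' = f'" "\<forall>a\<in>GL. act K.R a r' = r'" by blast
  then show ?case using alg_homD(2)[OF proj_hom(1) r(1,4)] alg_homD(2)[OF act_K(1) r(1,4)]
    by (intro bexI[of _ "r \<oplus>\<^bsub>K.R\<^esub> r'"]) auto
next
  case (grad_mult f g f' g')
  then obtain r r' where r: "r \<in> carrier K.R" "\<pi> r = f" "\<forall>a\<in>GL. act K.R a r = r"
    "r' \<in> carrier K.R" "\<pi> r' = f'" "\<forall>a\<in>GL. act K.R a r' = r'" by blast
  then show ?case using alg_homD(3)[OF proj_hom(1) r(1,4)] alg_homD(3)[OF act_K(1) r(1,4)]
    by (intro bexI[of _ "r \<otimes>\<^bsub>K.R\<^esub> r'"]) auto
qed

lemma solution: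
  assumes g: "grad n f g" and f: "f \<in> J" and hJ: "g u \<notin> J"
  shows "\<exists>h. h \<in> carrier K.R \<and> (\<forall>a\<in>GL. act K.R a h = h) \<and> J +>\<^bsub>R\<^esub> \<pi> h \<noteq> \<zero>\<^bsub>gl_quot R J\<^esub> \<and>
    closed_immersion (localization K.R h) (localization (Sh n (gl_quot R J)) (J +>\<^bsub>R\<^esub> \<pi> h))
      (loc_map (Sh n (gl_quot R J)) (J +>\<^bsub>R\<^esub> \<pi> h) (\<lambda>f. J +>\<^bsub>R\<^esub> \<pi> f))"
proof -
  have "u \<in> W n"
  proof (rule ccontr)
    assume "u \<notin> W n"
    then have "g u = \<zero>\<^bsub>R\<^esub>" by (rule grad_support[OF g])
    then show False using hJ RJ.I.zero_closed by simp
  qed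
  then have u: "length u = d" "set u \<subseteq> {..<n}" by (auto simp: W_def)
  obtain g' where g': "grad n (g u) g'" using grad_repr[OF g] by blast
  obtain h where h: "h \<in> carrier K.R" "\<pi> h = g u" "\<forall>a\<in>GL. act K.R a h = h" using grad_lift[OF g'] by blast
  have hl: "low n (g u)" by (rule tame_low[OF tame_grad[OF g']])
  have hc: "g u \<in> carrier R" by (rule low_closed[OF hl])
  let ?S = "Sh n (gl_quot R J)"
  let ?q = "\<lambda>f. J +>\<^bsub>R\<^esub> \<pi> f"
  interpret QJ: kalg "gl_quot R J" by (rule RJ.kalg_quot)
  interpret SJ: kalg ?S by (rule kalg_Sh[OF RJ.kalg_quot])
  note pD = alg_homD[OF proj_hom(1)] and qD = alg_homD[OF RJ.cls_hom]
  have "?q \<in> alg_hom K.R (gl_quot R J)"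
    by (rule alg_homI) (simp_all add: pD qD del: gl_quot_simps)
  then have qS: "?q \<in> alg_hom K.R ?S" by (simp only: alg_hom_Sh)
  have pow: "(J +>\<^bsub>R\<^esub> g u) [^]\<^bsub>?S\<^esub> (N::nat) = J +>\<^bsub>R\<^esub> (g u [^]\<^bsub>R\<^esub> N)" for N
    by (rule alg_hom_pow[OF P.T.kalg_axioms SJ.kalg_axioms _ hc, symmetric]) (simp only: alg_hom_Sh RJ.cls_hom)
  have surj: "\<exists>N::nat. \<exists>r\<in>carrier K.R. ?q h [^]\<^bsub>?S\<^esub> N \<otimes>\<^bsub>?S\<^esub> s = ?q r" if s: "s \<in> carrier ?S" for s
  proof -
    have "s \<in> carrier (gl_quot R J)" using s by (simp only: Sh_simps)
    then obtain z where z: "z \<in> carrier R" "s = J +>\<^bsub>R\<^esub> z" by (rule RJ.quot_cases)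
    obtain N :: nat where N: "solved n (g u [^]\<^bsub>R\<^esub> N \<otimes>\<^bsub>R\<^esub> z)" using solved_power[OF u g f hl z(1)] by blast
    then obtain j r where jr: "j \<in> J" "low n r" "g u [^]\<^bsub>R\<^esub> N \<otimes>\<^bsub>R\<^esub> z = j \<oplus>\<^bsub>R\<^esub> r" unfolding solved_def by blast
    obtain r' where r': "r' \<in> carrier K.R" "\<pi> r' = r" using low_lift[OF jr(2)] by blast
    have jc: "j \<in> carrier R" "r \<in> carrier R" using RJ.I.Icarr[OF jr(1)] low_closed[OF jr(2)] by auto
    have "j \<oplus>\<^bsub>R\<^esub> r \<ominus>\<^bsub>R\<^esub> r = j" using jc by (simp add: P.T.M.minus_eq P.T.M.a_assoc P.T.M.r_neg)
    then have eq: "J +>\<^bsub>R\<^esub> (j \<oplus>\<^bsub>R\<^esub> r) = J +>\<^bsub>R\<^esub> r" using RJ.cls_eq[of "j \<oplus>\<^bsub>R\<^esub> r" r] jc jr(1) by simp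
    have "?q h [^]\<^bsub>?S\<^esub> N \<otimes>\<^bsub>?S\<^esub> s = (J +>\<^bsub>R\<^esub> (g u [^]\<^bsub>R\<^esub> N)) \<otimes>\<^bsub>?S\<^esub> (J +>\<^bsub>R\<^esub> z)"
      by (simp only: h(2) z(2) pow)
    also have "\<dots> = J +>\<^bsub>R\<^esub> (g u [^]\<^bsub>R\<^esub> N \<otimes>\<^bsub>R\<^esub> z)"
      using RJ.cls_mult[of "g u [^]\<^bsub>R\<^esub> N" z] hc z(1) by (simp del: gl_quot_simps)
    also have "\<dots> = ?q r'" by (simp only: jr(3) eq r'(2))
    finally show ?thesis using r'(1) by blast
  qed
  have "closed_immersion (localization K.R h) (localization ?S (?q h)) (loc_map ?S (?q h) ?q)"
    by (rule closed_immersion_localization[OF K.P.T.A.is_cring SJ.A.is_cring alg_homD(6)[OF qS] h(1) surj])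
  moreover have "?q h \<noteq> \<zero>\<^bsub>gl_quot R J\<^esub>" using RJ.cls_zero_iff[OF hc] hJ h(2) by simp
  ultimately show ?thesis using h(1,3) by blast
qed

end

theorem theorem4p2:
  fixes B :: "('k::field_char_0, 'b) gl_module"
    and lam :: "nat list"
  assumes Y: "affine_gl_variety B"
    and lam: "partition lam" "lam \<noteq> []"
    and X: "closed_gl_subvariety (tensor B (Sym (V_part lam))) J"
  shows
    "(\<exists>I. closed_gl_subvariety B I \<and> J = product_ideal B (Sym (V_part lam)) I) \<or>
     (\<exists>n mu \<phi> h.
        shift_splitting n lam mu \<phi> \<and>
        (let R = tensor (Sh n B) (Sym (V_tuple mu));
             S = Sh n (gl_quot (tensor B (Sym (V_part lam))) J);
             \<pi> = shift_proj n B lam \<phi>;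
             \<pi>\<^sub>X = (\<lambda>f. J +>\<^bsub>tensor B (Sym (V_part lam))\<^esub> \<pi> f)
         in h \<in> carrier R \<and> (\<forall>g\<in>GL. act R g h = h) \<and>
            \<pi>\<^sub>X h \<noteq> \<zero>\<^bsub>S\<^esub> \<and>
            closed_immersion (localization R h) (localization S (\<pi>\<^sub>X h))
              (loc_map S (\<pi>\<^sub>X h) \<pi>\<^sub>X)))"
proof -
  interpret glv B lam J by (intro glv.intro Y lam X)
  show ?thesis
  proof (cases "\<exists>n f g w. grad n f g \<and> f \<in> J \<and> g w \<notin> J")
    case False
    have st: "g w \<in> J" if "grad n f g" "f \<in> J" for n f g w
    proof (rule ccontr)
      assume "g w \<notin> J"
      then have "grad n f g \<and> f \<in> J \<and> g w \<notin> J" using that by simp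
      then have "\<exists>n f g w. grad n f g \<and> f \<in> J \<and> g w \<notin> J" by (intro exI)
      then show False using False by (rule notE[rotated])
    qed
    show ?thesis by (rule disjI1, rule derivative_stable, rule st)
  next
    case True
    then obtain n f g u where g: "grad n f g" "f \<in> J" "g u \<notin> J" by (elim exE conjE)
    obtain mu and \<phi> :: "(nat \<Rightarrow> nat list \<Rightarrow>\<^sub>0 'k) \<Rightarrow> (nat list \<Rightarrow>\<^sub>0 'k)" where
      s: "shift_splitting n lam mu \<phi>" "(\<lambda>y. \<phi> (case_nat 0 y)) ` carrier (V_tuple mu) = mixed n lam"
      "\<And>x :: nat list \<Rightarrow>\<^sub>0 'k. x \<in> VV lam \<Longrightarrow> \<exists>a\<in>VV lam. \<exists>b\<in>mixed n lam. x = pure n a + b"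
      by (rule shift_splitting_exists[OF lam(1), where n = n]) (rule that; (assumption | blast))
    interpret glv_split B lam J n mu \<phi>
      by (intro glv_split.intro glv_axioms glv_split_axioms.intro s)
    obtain h where "h \<in> carrier K.R" "\<forall>a\<in>GL. act K.R a h = h" "J +>\<^bsub>R\<^esub> \<pi> h \<noteq> \<zero>\<^bsub>gl_quot R J\<^esub>"
      "closed_immersion (localization K.R h) (localization (Sh n (gl_quot R J)) (J +>\<^bsub>R\<^esub> \<pi> h))
        (loc_map (Sh n (gl_quot R J)) (J +>\<^bsub>R\<^esub> \<pi> h) (\<lambda>f. J +>\<^bsub>R\<^esub> \<pi> f))"
      using solution[OF g] by blast
    then show ?thesis
      unfolding Let_def by (intro disjI2 exI[of _ n] exI[of _ mu] exI[of _ \<phi>] exI[of _ h] conjI s(1)) (simp_all only: Sh_simps simp_thms)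
  qed
qed

end
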